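(* A minimal self-consistent generating (up to the $G^\sim_{\mathcal P'}$-equivalence and the linear superposition of solutions) set $\mathcal B$ of admissible transformations for the class $\mathcal P'$ of heat equations with time-independent potentials, $u_t=u_{xx}+C(x)u$, is the union of the following families of admissible transformations $(C,\Phi,\tilde C)$, where $\mu$ runs through $\mathbb R$: \[ \mathcal T_{1\mu}:=\left(\frac{\mu}{x^2}+x^2,\ \Phi_1,\ \frac{\mu}{\tilde x^2}\right),\quad \Phi_1\colon\ \tilde t=\tfrac12\tan 2t,\ \ \tilde x=\frac{x}{\cos 2t},\ \ \tilde u=|\cos 2t|^{1/2}e^{-\tan(2t)x^2/2}u; \] \[ \mathcal T_{2\mu}:=\left(\frac{\mu}{x^2}-x^2,\ \Phi_2,\ \frac{\mu}{\tilde x^2}\right),\quad \Phi_2\colon\ \tilde t=\tfrac14e^{4t},\ \ \tilde x=e^{2t}x,\ \ \tilde u=e^{-x^2/2-t}u; \] \[ \mathcal T_3:=(x,\Phi_3,0),\quad \Phi_3\colon\ \tilde t=t,\ \ \tilde x=x+t^2,\ \ \tilde u=e^{-tx-t^3/3}u. \]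
   Context: Everything is real, smooth and local; point transformations are local diffeomorphisms of the space with coordinates $(t,x,u)$. The class $\mathcal P'$ consists of the equations $\mathcal P'_C$: $u_t=u_{xx}+C(x)u$, where the arbitrary element $C$ runs through the smooth functions of $x$ (on an interval). An admissible transformation of $\mathcal P'$ is a triple $\mathcal T=(C,\Phi,\tilde C)$, where $\Phi$ is a point transformation mapping $\mathcal P'_C$ to $\mathcal P'_{\tilde C}$; $C=\mathrm s(\mathcal T)$ is its source and $\tilde C=\mathrm t(\mathcal T)$ is its target. Two admissible transformations $\mathcal T=(C,\Phi,\tilde C)$ and $\mathcal T'=(C',\Phi',\tilde C')$ are composable if $\tilde C=C'$, and then $\mathcal T\star\mathcal T':=(C,\Phi'\circ\Phi,\tilde C')$. The inverse is $\mathcal T^{-1}=(\tilde C,\Phi^{-1},C)$. All admissible transformations constitute the equivalence groupoid $\mathcal G^\sim_{\mathcal P'}$. The equivalence group $G^\sim_{\mathcal P'}$ consists of the transformations $\tilde t=c_1^2t+c_2$, $\tilde x=c_1x+c_3$, $\tilde u=c_4e^{c_5t}u$, $\tilde C=c_1^{-2}(C+c_5)$, where $c_1,\dots,c_5$ are arbitrary constants with $c_1c_4\neq0$. Its action groupoid $\mathcal G^{G^\sim_{\mathcal P'}}$ consists of the triples $(C,\Phi,\tilde C)$, where $\Phi$ is the $(t,x,u)$-part of an element of $G^\sim_{\mathcal P'}$ and $\tilde C$ is the image of $C$ under this element. Let $\mathcal G^{\rm lin}$ be the groupoid of all triples $(C,\Phi,C)$ with $\Phi\colon\tilde t=t$,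 $\tilde x=x$, $\tilde u=u+f(t,x)$, where $f$ is an arbitrary solution of $\mathcal P'_C$. Let $\mathcal U$ be the subgroupoid of $\mathcal G^\sim_{\mathcal P'}$ consisting of all compositions of elements of $\mathcal G^{G^\sim_{\mathcal P'}}$ and $\mathcal G^{\rm lin}$ (a semidirect $\star$-product with $\mathcal G^{\rm lin}$ normal). "Up to the $G^\sim_{\mathcal P'}$-equivalence and the linear superposition of solutions" means up to $\mathcal U$-equivalence, where: - $\mathcal T,\tilde{\mathcal T}\in\mathcal G^\sim_{\mathcal P'}$ are $\mathcal U$-equivalent if $\tilde{\mathcal T}=\mathcal T_1\star\mathcal T\star\mathcal T_2$ for some $\mathcal T_1,\mathcal T_2\in\mathcal U$; - $\mathcal T$ is composable with $\mathcal T'$ up to the $\mathcal U$-equivalence if some admissible transformation $\mathcal U$-equivalent to $\mathcal T$ is composable with $\mathcal T'$; - $\mathcal B\subseteq\mathcal G^\sim_{\mathcal P'}$ is a generating set up to the $\mathcal U$-equivalence if every admissible transformation of the class is the composition of finitely many elements of $\mathcal B\cup\hat{\mathcal B}\cup\mathcal U$, where $\hat{\mathcal B}=\{\mathcal T^{-1}\mid\mathcal T\in\mathcal B\}$; - $\mathcal B$ is self-consistent if composability of elements of $\mathcal B\cup\hat{\mathcal B}$ up to the $\mathcal U$-equivalence implies their usual composability; - a generating set is minimal if no proper subset of it is generating (up to the $\mathcal U$-equivalence). Since point transformations are local, $\Phi_1$ is understood as restricted to $t$-intervals between consecutive zeros of $\cos 2t$ or to smaller intervals. *)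

theory Defs
  imports "HOL-Analysis.Analysis"
begin

section \<open>Smooth functions\<close>

primrec Ck_on :: "nat \<Rightarrow> ('a::euclidean_space \<Rightarrow> 'b::real_normed_vector) \<Rightarrow> 'a set \<Rightarrow> bool" where
  "Ck_on 0 f S \<longleftrightarrow> continuous_on S f"
| "Ck_on (Suc k) f S \<longleftrightarrow>
     (\<forall>p\<in>S. f differentiable (at p)) \<and> (\<forall>v. Ck_on k (\<lambda>p. frechet_derivative f (at p) v) S)"

text \<open>Only used for open \<open>S\<close>; all iterated directional derivatives exist and are continuous.\<close>

definition smooth_on :: "('a::euclidean_space \<Rightarrow> 'b::real_normed_vector) \<Rightarrow> 'a set \<Rightarrow> bool" where
  "smooth_on f S \<longleftrightarrow> (\<forall>k. Ck_on k f S)"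


section \<open>Equations and point transformations\<close>

text \<open>Local objects are partial functions, so that equality includes equality of domains.
  A potential \<open>C\<close> stands for the equation \<open>u\<^sub>t = u\<^sub>x\<^sub>x + C(x) u\<close> with \<open>x \<in> dom C\<close>.\<close>

type_synonym potential = "real \<rightharpoonup> real"
type_synonym pt = "real \<times> real \<times> real"
type_synonym ptrans = "pt \<rightharpoonup> pt"

definition potential :: "potential \<Rightarrow> bool" where
  "potential C \<longleftrightarrow> dom C \<noteq> {} \<and> open (dom C) \<and> is_interval (dom C) \<and> smooth_on (\<lambda>x. the (C x)) (dom C)"

definition potential_on :: "real set \<Rightarrow> (real \<Rightarrow> real) \<Rightarrow> potential" where
  "potential_on D c = (\<lambda>x. if x \<in> D then Some (c x) else None)"

definition satisfies_at :: "potential \<Rightarrow> (real \<times> real \<Rightarrow> real) \<Rightarrow> real \<Rightarrow> real \<Rightarrow> bool" where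
  "satisfies_at C w t x \<longleftrightarrow>
     x \<in> dom C \<and>
     deriv (\<lambda>s. w (s, x)) t = deriv (deriv (\<lambda>y. w (t, y))) x + the (C x) * w (t, x)"

definition solution_on :: "potential \<Rightarrow> (real \<times> real) set \<Rightarrow> (real \<times> real \<Rightarrow> real) \<Rightarrow> bool" where
  "solution_on C \<Omega> w \<longleftrightarrow> smooth_on w \<Omega> \<and> (\<forall>(t, x)\<in>\<Omega>. satisfies_at C w t x)"

definition inverse_map :: "('a \<rightharpoonup> 'b) \<Rightarrow> ('b \<rightharpoonup> 'a)" where
  "inverse_map \<Phi> = (\<lambda>q. if q \<in> ran \<Phi> then Some (THE p. \<Phi> p = Some q) else None)"

definition point_transformation :: "ptrans \<Rightarrow> bool" where
  "point_transformation \<Phi> \<longleftrightarrow>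
     dom \<Phi> \<noteq> {} \<and> open (dom \<Phi>) \<and> open (ran \<Phi>) \<and> inj_on \<Phi> (dom \<Phi>) \<and>
     smooth_on (\<lambda>p. the (\<Phi> p)) (dom \<Phi>) \<and>
     smooth_on (\<lambda>q. the (inverse_map \<Phi> q)) (ran \<Phi>)"

definition graph_over :: "(real \<times> real) set \<Rightarrow> (real \<times> real \<Rightarrow> real) \<Rightarrow> pt set" where
  "graph_over \<Omega> w = {(t, x, w (t, x)) | t x. (t, x) \<in> \<Omega>}"

text \<open>An equation is a submanifold of the second-order jet space, and a point transformation maps
  one equation to another if its second prolongation identifies the two submanifolds. Jets at a
  point are represented by smooth functions \<open>w\<close> (not necessarily solutions) defined near that point,
  and the prolongation by the transformation of their graphs.\<close>

definition maps_equation :: "potential \<Rightarrow> ptrans \<Rightarrow> potential \<Rightarrow> bool" where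
  "maps_equation C \<Phi> C' \<longleftrightarrow>
     (\<forall>\<Omega> \<Omega>' w w' t x t' x'.
        open \<Omega> \<and> open \<Omega>' \<and> smooth_on w \<Omega> \<and> smooth_on w' \<Omega>' \<and>
        (t, x) \<in> \<Omega> \<and> (t', x') \<in> \<Omega>' \<and>
        graph_over \<Omega> w \<subseteq> dom \<Phi> \<and>
        (\<lambda>p. the (\<Phi> p)) ` graph_over \<Omega> w = graph_over \<Omega>' w' \<and>
        \<Phi> (t, x, w (t, x)) = Some (t', x', w' (t', x'))
        \<longrightarrow> (satisfies_at C w t x \<longleftrightarrow> satisfies_at C' w' t' x'))"


section \<open>Admissible transformations\<close>

type_synonym triple = "potential \<times> ptrans \<times> potential"

definition source :: "triple \<Rightarrow> potential" where "source T = fst T"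
definition trans_part :: "triple \<Rightarrow> ptrans" where "trans_part T = fst (snd T)"
definition target :: "triple \<Rightarrow> potential" where "target T = snd (snd T)"

definition admissible :: "triple set" where
  "admissible =
     {(C, \<Phi>, C'). potential C \<and> potential C' \<and> point_transformation \<Phi> \<and>
        (\<forall>(t, x, u)\<in>dom \<Phi>. x \<in> dom C) \<and> (\<forall>(t, x, u)\<in>ran \<Phi>. x \<in> dom C') \<and>
        maps_equation C \<Phi> C'}"

definition composable :: "triple \<Rightarrow> triple \<Rightarrow> bool" where
  "composable T T' \<longleftrightarrow> target T = source T'"

definition compose :: "triple \<Rightarrow> triple \<Rightarrow> triple" (infixl "\<star>" 70) where
  "T \<star> T' = (source T, trans_part T' \<circ>\<^sub>m trans_part T, target T')"

definition inverse_of :: "triple \<Rightarrow> triple" where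
  "inverse_of T = (target T, inverse_map (trans_part T), source T)"

inductive_set compositions :: "triple set \<Rightarrow> triple set" for S where
  single: "T \<in> S \<Longrightarrow> T \<in> compositions S"
| step: "T \<in> S \<Longrightarrow> T' \<in> compositions S \<Longrightarrow> composable T T' \<Longrightarrow> T \<star> T' \<in> compositions S"


section \<open>Equivalence group and linear superposition\<close>

definition group_trans :: "real \<Rightarrow> real \<Rightarrow> real \<Rightarrow> real \<Rightarrow> real \<Rightarrow> pt \<Rightarrow> pt" where
  "group_trans c1 c2 c3 c4 c5 = (\<lambda>(t, x, u). (c1\<^sup>2 * t + c2, c1 * x + c3, c4 * exp (c5 * t) * u))"

definition group_potential :: "real \<Rightarrow> real \<Rightarrow> real \<Rightarrow> potential \<Rightarrow> potential" where
  "group_potential c1 c3 c5 C = (\<lambda>x'. map_option (\<lambda>c. (c + c5) / c1\<^sup>2) (C ((x' - c3) / c1)))"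

definition action_groupoid :: "triple set" where
  "action_groupoid =
     {(C, \<Phi>, C'). potential C \<and>
        (\<exists>c1 c2 c3 c4 c5. c1 * c4 \<noteq> 0 \<and>
           \<Phi> = (\<lambda>(t, x, u). if x \<in> dom C then Some (group_trans c1 c2 c3 c4 c5 (t, x, u)) else None) \<and>
           C' = group_potential c1 c3 c5 C)}"

definition lin_groupoid :: "triple set" where
  "lin_groupoid =
     {(C, \<Phi>, C') | C \<Phi> C'. potential C \<and> C' = C \<and>
        (\<exists>\<Omega> f. open \<Omega> \<and> \<Omega> \<noteq> {} \<and> solution_on C \<Omega> f \<and>
           \<Phi> = (\<lambda>(t, x, u). if (t, x) \<in> \<Omega> then Some (t, x, u + f (t, x)) else None))}"

text \<open>Intersecting with \<open>admissible\<close> only discards compositions with empty domain.\<close>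

definition \<U> :: "triple set" where
  "\<U> = compositions (action_groupoid \<union> lin_groupoid) \<inter> admissible"

definition U_equivalent :: "triple \<Rightarrow> triple \<Rightarrow> bool" where
  "U_equivalent T T' \<longleftrightarrow>
     T \<in> admissible \<and> T' \<in> admissible \<and>
     (\<exists>T1\<in>\<U>. \<exists>T2\<in>\<U>. composable T1 T \<and> composable T T2 \<and> T' = T1 \<star> T \<star> T2)"


section \<open>Generating sets\<close>

text \<open>The theory is local: an admissible transformation may be replaced by its restrictions (of
  the potentials to smaller intervals and of the point transformation to smaller open sets), and
  two admissible transformations are compared near a given point. Literal equality of domains would
  be too much: for the potential \<open>x\<^sup>2\<close> there are admissible transformations to itself defined for all
  \<open>t \<in> \<real>\<close>, while any decomposition through \<open>\<Phi>\<^sub>1\<close> has a bounded \<open>t\<close>-domain.\<close>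

definition restriction_of :: "triple \<Rightarrow> triple \<Rightarrow> bool" (infix "\<sqsubseteq>\<^sub>r" 50) where
  "T0 \<sqsubseteq>\<^sub>r T \<longleftrightarrow>
     source T0 \<subseteq>\<^sub>m source T \<and> trans_part T0 \<subseteq>\<^sub>m trans_part T \<and> target T0 \<subseteq>\<^sub>m target T"

definition restrictions :: "triple set \<Rightarrow> triple set" where
  "restrictions S = {T0 \<in> admissible. \<exists>T\<in>S. T0 \<sqsubseteq>\<^sub>r T}"

definition generating :: "triple set \<Rightarrow> bool" where
  "generating B \<longleftrightarrow>
     B \<subseteq> admissible \<and>
     (\<forall>T\<in>admissible. \<forall>p\<in>dom (trans_part T).
        \<exists>T0\<in>compositions (restrictions (B \<union> inverse_of ` B \<union> \<U>)).
          T0 \<sqsubseteq>\<^sub>r T \<and> p \<in> dom (trans_part T0))"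

definition composable_up_to_U :: "triple \<Rightarrow> triple \<Rightarrow> bool" where
  "composable_up_to_U T T' \<longleftrightarrow>
     (\<exists>T0\<in>restrictions {T}. \<exists>T0'\<in>restrictions {T'}.
        \<exists>T1. U_equivalent T0 T1 \<and> composable T1 T0')"

definition self_consistent :: "triple set \<Rightarrow> bool" where
  "self_consistent B \<longleftrightarrow>
     (\<forall>T\<in>B \<union> inverse_of ` B. \<forall>T'\<in>B \<union> inverse_of ` B.
        composable_up_to_U T T' \<longrightarrow> composable T T')"

definition minimal_generating :: "triple set \<Rightarrow> bool" where
  "minimal_generating B \<longleftrightarrow> generating B \<and> (\<forall>B'. B' \<subset> B \<longrightarrow> \<not> generating B')"


section \<open>The three families\<close>

definition \<Phi>1 :: "pt \<Rightarrow> pt" where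
  "\<Phi>1 = (\<lambda>(t, x, u). (tan (2 * t) / 2, x / cos (2 * t),
           sqrt \<bar>cos (2 * t)\<bar> * exp (- (tan (2 * t) * x\<^sup>2 / 2)) * u))"

definition \<Phi>2 :: "pt \<Rightarrow> pt" where
  "\<Phi>2 = (\<lambda>(t, x, u). (exp (4 * t) / 4, exp (2 * t) * x, exp (- x\<^sup>2 / 2 - t) * u))"

definition \<Phi>3 :: "pt \<Rightarrow> pt" where
  "\<Phi>3 = (\<lambda>(t, x, u). (t, x + t\<^sup>2, exp (- t * x - t ^ 3 / 3) * u))"

text \<open>The potential \<open>\<mu> / x\<^sup>2\<close> lives on the whole line if \<open>\<mu> = 0\<close> and on a half-line \<open>H\<close> otherwise.
  (For \<open>\<mu> = 0\<close> the quotient is \<open>0\<close> also at \<open>x = 0\<close>.)\<close>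

definition axis :: "real set \<Rightarrow> real \<Rightarrow> real set" where
  "axis H \<mu> = (if \<mu> = 0 then UNIV else H)"

text \<open>\<open>J\<close> is the \<open>t\<close>-interval to which \<open>\<Phi>1\<close> is restricted. On it the sign of \<open>cos (2 * t)\<close> is constant;
  if this sign is negative, \<open>\<Phi>1\<close> swaps the half-lines.\<close>

definition T1 :: "real set \<Rightarrow> real set \<Rightarrow> real \<Rightarrow> triple" where
  "T1 J H \<mu> =
     (let D = {x. \<forall>t\<in>J. x / cos (2 * t) \<in> axis H \<mu>}
      in (potential_on D (\<lambda>x. \<mu> / x\<^sup>2 + x\<^sup>2),
          (\<lambda>(t, x, u). if t \<in> J \<and> x \<in> D then Some (\<Phi>1 (t, x, u)) else None),
          potential_on (axis H \<mu>) (\<lambda>x. \<mu> / x\<^sup>2)))"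

definition T2 :: "real set \<Rightarrow> real \<Rightarrow> triple" where
  "T2 H \<mu> =
     (potential_on (axis H \<mu>) (\<lambda>x. \<mu> / x\<^sup>2 - x\<^sup>2),
      (\<lambda>(t, x, u). if x \<in> axis H \<mu> then Some (\<Phi>2 (t, x, u)) else None),
      potential_on (axis H \<mu>) (\<lambda>x. \<mu> / x\<^sup>2))"

definition T3 :: triple where
  "T3 = (potential_on UNIV (\<lambda>x. x), (\<lambda>p. Some (\<Phi>3 p)), potential_on UNIV (\<lambda>x. 0))"

definition \<B> :: "real set \<Rightarrow> real set \<Rightarrow> triple set" where
  "\<B> J H = range (T1 J H) \<union> range (T2 H) \<union> {T3}"

end

theory Submission
  imports Defs
begin

text \<open>An admissible transformation is locally linear up to a superposition of solutions: prolonging it,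
  \<open>u\<^sub>t\<^sub>t\<close> is unconstrained and forces \<open>t'\<close> to depend on \<open>t\<close> only, and then \<open>u\<^sub>t\<close>, \<open>u\<^sub>x\<close> and \<open>u\<close> force
  \<open>x' = \<theta>(t) x + \<beta>(t)\<close> with \<open>\<theta>\<^sup>2 = dt'/dt\<close> and \<open>u' = A(t, x) (u + f(t, x))\<close>, where \<open>f\<close> solves the source
  equation and both first derivatives of \<open>ln A\<close> are explicit. Their compatibility says that
  \<open>C(x) - \<theta>\<^sup>2 C'(\<theta> x + \<beta>)\<close> is quadratic in \<open>x\<close> with coefficients determined by \<open>\<theta>\<close> and \<open>\<beta>\<close>.
  If \<open>\<theta>\<close> and \<open>\<beta>\<close> are constant, the transformation comes from the equivalence group. Otherwise, differentiating
  in \<open>t\<close> shows that \<open>C\<close> and \<open>C'\<close> are \<open>\<mu> / (x - a)\<^sup>2\<close> plus a quadratic polynomial, with the same \<open>\<mu>\<close>, so the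
  three families connect both to \<open>\<mu> / x\<^sup>2\<close>. The symmetries of \<open>\<mu> / x\<^sup>2\<close> are generated by conjugates of time
  shifts under \<open>\<Phi>1\<close> and \<open>\<Phi>3\<close>.

  Minimality and self-consistency rest on an invariant of potentials of this form that does not change under
  \<open>\<U>\<close>, takes different values on all sources of the families and on \<open>\<mu> / x\<^sup>2\<close>, and determines \<open>\<mu>\<close>.\<close>

subsection \<open>Calculus of smooth functions\<close>

text \<open>\<open>maps_equation\<close> tests arbitrary smooth functions, so every 2-jet is
  available through an explicit quadratic polynomial; this is what leaves \<open>u_tt\<close> free.
  The main obstacle is domains: potentials and transformations are partial functions, and
  composability is literal equality. Arguments are therefore made near one point with total
  representatives (\<open>reachable\<close>), and factors are cut down until neighbouring potentials
  coincide. Generators are carried together with their inverses (\<open>link\<close>), so a germ may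
  be composed with them until it becomes trivial, and they are cancelled afterwards. For a loop at
  \<open>\<mu> / x\<^sup>2\<close>, uniqueness of rational forms yields
  \<open>G' = - 4 G\<^sup>2\<close> and \<open>K' = - 4 G K\<close> for the coefficients of
  \<open>slope = 2 G x + K\<close>. Hence a loop comes from the equivalence group as soon as
  \<open>sc1\<close> and \<open>sh1\<close> vanish at one instant, and only two numbers have to be
  removed: \<open>sc1\<close> by a projective loop, \<open>sh1\<close> by a boost. For
  \<open>\<mu> \<noteq> 0\<close> the pole cannot move and \<open>sh1\<close> vanishes by itself.
  The invariant survives \<open>\<U>\<close> because the group acts on potentials by affine
  substitutions, scalings and added constants, and superposition leaves them unchanged.\<close>

abbreviation dd :: "('a::euclidean_space \<Rightarrow> 'b::real_normed_vector) \<Rightarrow> 'a \<Rightarrow> 'a \<Rightarrow> 'b" where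
  "dd f v \<equiv> \<lambda>p. frechet_derivative f (at p) v"

lemma Ck_on_cong:
  assumes "open S" "\<And>x. x \<in> S \<Longrightarrow> f x = g x"
  shows "Ck_on k f S \<longleftrightarrow> Ck_on k g S"
  using assms(2)
proof (induction k arbitrary: f g)
  case 0
  then show ?case by (simp cong: continuous_on_cong)
next
  case (Suc k)
  have d: "(f has_derivative D) (at p) \<longleftrightarrow> (g has_derivative D) (at p)" if "p \<in> S" for D p
    using has_derivative_transform_within_open[OF _ \<open>open S\<close> that] Suc.prems by metis
  then have "f differentiable (at p) \<longleftrightarrow> g differentiable (at p)" if "p \<in> S" for p
    using that by (simp add: differentiable_def)
  moreover have "dd f v p = dd g v p" if "p \<in> S" for p v
    using d[OF that] by (simp add: frechet_derivative_def)
  then have "Ck_on k (dd f v) S = Ck_on k (dd g v) S" for v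
    by (rule Suc.IH)
  ultimately show ?case by simp
qed

lemma Ck_on_subset: "Ck_on k f S \<Longrightarrow> T \<subseteq> S \<Longrightarrow> Ck_on k f T"
  by (induction k arbitrary: f) (auto intro: continuous_on_subset)

lemma Ck_on_imp_continuous: "Ck_on k f S \<Longrightarrow> continuous_on S f"
  by (cases k) (simp_all add: continuous_at_imp_continuous_on differentiable_imp_continuous_within)

lemma Ck_on_SucD: "Ck_on (Suc k) f S \<Longrightarrow> Ck_on k f S"
proof (induction k arbitrary: f)
  case 0
  then show ?case using Ck_on_imp_continuous[OF 0] by simp
qed auto

lemma Ck_on_SucI:
  assumes "open S" "\<And>p. p \<in> S \<Longrightarrow> (f has_derivative D p) (at p)" "\<And>v. Ck_on k (\<lambda>p. D p v) S"
  shows "Ck_on (Suc k) f S"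
proof -
  have "dd f v p = D p v" if "p \<in> S" for p v
    using frechet_derivative_at[OF assms(2)[OF that]] by simp
  then have "Ck_on k (dd f v) S" for v
    using Ck_on_cong[OF assms(1), of "dd f v" "\<lambda>p. D p v"] assms(3) by blast
  then show ?thesis using assms(2) by (auto simp: differentiable_def)
qed

lemma Ck_on_const: "Ck_on k (\<lambda>_. c) S"
proof (induction k arbitrary: c)
  case (Suc k)
  have "dd (\<lambda>_::'a. c) v = (\<lambda>p. 0)" for v
    by (auto simp: fun_eq_iff frechet_derivative_const)
  then show ?case using Suc by simp
qed simp

lemma Ck_on_linear_comp:
  assumes "open S" "bounded_linear L" "Ck_on k f S"
  shows "Ck_on k (\<lambda>p. L (f p)) S"
  using assms(3)
proof (induction k arbitrary: f)
  case 0
  then show ?case by (auto intro: bounded_linear.continuous_on[OF assms(2)])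
next
  case (Suc k)
  show ?case
  proof (rule Ck_on_SucI[OF assms(1)])
    show "((\<lambda>p. L (f p)) has_derivative (\<lambda>v. L (dd f v p))) (at p)" if "p \<in> S" for p
      using Suc.prems that
      by (intro bounded_linear.has_derivative[OF assms(2)]) (simp add: frechet_derivative_works)
  qed (use Suc in auto)
qed

lemma Ck_on_id: "open S \<Longrightarrow> Ck_on k (\<lambda>x. x) S"
  by (cases k) (auto intro!: Ck_on_SucI Ck_on_const)

lemma Ck_on_add:
  assumes "open S" "Ck_on k f S" "Ck_on k g S"
  shows "Ck_on k (\<lambda>p. f p + g p) S"
  using assms(2,3)
proof (induction k arbitrary: f g)
  case 0
  then show ?case by (auto intro: continuous_intros)
next
  case (Suc k)
  show ?case
  proof (rule Ck_on_SucI[OF assms(1)])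
    show "((\<lambda>p. f p + g p) has_derivative (\<lambda>v. dd f v p + dd g v p)) (at p)" if "p \<in> S" for p
      using Suc.prems that by (intro has_derivative_add) (simp_all add: frechet_derivative_works)
  qed (use Suc in auto)
qed

lemma Ck_on_sum:
  assumes "open S" "\<And>i. i \<in> I \<Longrightarrow> Ck_on k (f i) S"
  shows "Ck_on k (\<lambda>p. \<Sum>i\<in>I. f i p) S"
  using assms(2) by (induction I rule: infinite_finite_induct) (auto intro!: Ck_on_const Ck_on_add assms(1))

lemma Ck_on_bilinear:
  assumes "open S" "bounded_bilinear B" "Ck_on k f S" "Ck_on k g S"
  shows "Ck_on k (\<lambda>p. B (f p) (g p)) S"
  using assms(3,4)
proof (induction k arbitrary: f g)
  case 0
  then show ?case by (auto intro: bounded_bilinear.continuous_on[OF assms(2)])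
next
  case (Suc k)
  show ?case
  proof (rule Ck_on_SucI[OF assms(1)])
    show "((\<lambda>p. B (f p) (g p)) has_derivative (\<lambda>v. B (f p) (dd g v p) + B (dd f v p) (g p))) (at p)"
      if "p \<in> S" for p
      using Suc.prems that
      by (intro bounded_bilinear.FDERIV[OF assms(2)]) (simp_all add: frechet_derivative_works)
    show "Ck_on k (\<lambda>p. B (f p) (dd g v p) + B (dd f v p) (g p)) S" for v
      by (intro Ck_on_add[OF assms(1)] Suc.IH) (use Suc.prems Ck_on_SucD in auto)
  qed
qed

lemma Ck_on_compose:
  fixes f :: "'b::euclidean_space \<Rightarrow> 'c::real_normed_vector" and g :: "'a::euclidean_space \<Rightarrow> 'b"
  assumes "open S" "open T" "g ` S \<subseteq> T" "Ck_on k f T" "Ck_on k g S"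
  shows "Ck_on k (\<lambda>p. f (g p)) S"
  using assms(4,5)
proof (induction k arbitrary: f)
  case 0
  then show ?case using assms(3) by (auto intro: continuous_on_compose2)
next
  case (Suc k)
  have fT: "f differentiable (at (g p))" if "p \<in> S" for p
    using Suc.prems(1) that assms(3) by auto
  \<comment> \<open>The direction \<open>dd g v p\<close> moves with \<open>p\<close>, whereas the
    induction hypothesis concerns fixed directions. Expanding along \<open>Basis\<close> turns the
    derivative into a sum of products of components of \<open>dd g v\<close> with
    \<open>dd f b\<close> composed with \<open>g\<close>.\<close>
  have *: "frechet_derivative f (at (g p)) (dd g v p) = (\<Sum>b\<in>Basis. (dd g v p \<bullet> b) *\<^sub>R dd f b (g p))"
    if "p \<in> S" for p v
  proof -
    have "linear (frechet_derivative f (at (g p)))"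
      using fT[OF that] linear_frechet_derivative by blast
    then have "frechet_derivative f (at (g p)) (\<Sum>b\<in>Basis. (dd g v p \<bullet> b) *\<^sub>R b)
       = (\<Sum>b\<in>Basis. (dd g v p \<bullet> b) *\<^sub>R dd f b (g p))"
      by (simp add: linear_sum linear_scale)
    then show ?thesis by (simp add: euclidean_representation)
  qed
  show ?case
  proof (rule Ck_on_SucI[OF assms(1)])
    show "((\<lambda>p. f (g p)) has_derivative (\<lambda>v. \<Sum>b\<in>Basis. (dd g v p \<bullet> b) *\<^sub>R dd f b (g p))) (at p)"
      if "p \<in> S" for p
    proof -
      have "((\<lambda>p. f (g p)) has_derivative (\<lambda>v. frechet_derivative f (at (g p)) (dd g v p))) (at p)"
        using Suc.prems that fT[OF that]
        by (intro has_derivative_compose[of g _ p UNIV f]) (simp_all add: frechet_derivative_works)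
      then show ?thesis using *[OF that] by simp
    qed
    show "Ck_on k (\<lambda>p. \<Sum>b\<in>Basis. (dd g v p \<bullet> b) *\<^sub>R dd f b (g p)) S" for v
    proof (intro Ck_on_sum[OF assms(1)] Ck_on_bilinear[OF assms(1) bounded_bilinear_scaleR])
      show "Ck_on k (\<lambda>p. dd g v p \<bullet> b) S" for b
        using Suc.prems by (intro Ck_on_linear_comp[OF assms(1) bounded_linear_inner_left]) simp
      show "Ck_on k (\<lambda>p. dd f b (g p)) S" for b
        using Suc.prems Ck_on_SucD[OF Suc.prems(2)] by (intro Suc.IH) auto
    qed
  qed
qed

lemma smooth_on_cong: "open S \<Longrightarrow> (\<And>x. x \<in> S \<Longrightarrow> f x = g x) \<Longrightarrow> smooth_on f S \<longleftrightarrow> smooth_on g S"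
  unfolding smooth_on_def using Ck_on_cong[of S f g] by blast

lemma smooth_on_subset: "smooth_on f S \<Longrightarrow> T \<subseteq> S \<Longrightarrow> smooth_on f T"
  unfolding smooth_on_def using Ck_on_subset by blast

lemma smooth_on_continuous: "smooth_on f S \<Longrightarrow> continuous_on S f"
  unfolding smooth_on_def using Ck_on_imp_continuous by blast

lemma smooth_on_differentiable: "smooth_on f S \<Longrightarrow> p \<in> S \<Longrightarrow> f differentiable (at p)"
  unfolding smooth_on_def using Ck_on.simps(2)[of 0 f S] by blast

lemma smooth_on_has_derivative:
  "smooth_on f S \<Longrightarrow> p \<in> S \<Longrightarrow> (f has_derivative (\<lambda>v. dd f v p)) (at p)"
  using smooth_on_differentiable frechet_derivative_works by blast

lemma smooth_on_dd:
  assumes "smooth_on f S"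
  shows "smooth_on (dd f v) S"
  unfolding smooth_on_def
proof
  fix k
  have "Ck_on (Suc k) f S" using assms by (simp only: smooth_on_def)
  then show "Ck_on k (dd f v) S" by simp
qed

lemma smooth_on_const: "smooth_on (\<lambda>_. c) S"
  by (simp add: smooth_on_def Ck_on_const)

lemma smooth_on_id: "open S \<Longrightarrow> smooth_on (\<lambda>x. x) S"
  by (simp add: smooth_on_def Ck_on_id)

lemma smooth_on_linear_comp:
  "open S \<Longrightarrow> bounded_linear L \<Longrightarrow> smooth_on f S \<Longrightarrow> smooth_on (\<lambda>p. L (f p)) S"
  by (simp add: smooth_on_def Ck_on_linear_comp)

lemma smooth_on_add: "open S \<Longrightarrow> smooth_on f S \<Longrightarrow> smooth_on g S \<Longrightarrow> smooth_on (\<lambda>p. f p + g p) S"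
  by (simp add: smooth_on_def Ck_on_add)

lemma smooth_on_minus: "open S \<Longrightarrow> smooth_on f S \<Longrightarrow> smooth_on (\<lambda>p. - f p) S"
  by (rule smooth_on_linear_comp[where L = uminus]) (auto intro: bounded_linear_minus bounded_linear_ident)

lemma smooth_on_diff: "open S \<Longrightarrow> smooth_on f S \<Longrightarrow> smooth_on g S \<Longrightarrow> smooth_on (\<lambda>p. f p - g p) S"
  using smooth_on_add[of S f "\<lambda>p. - g p"] smooth_on_minus[of S g] by simp

lemma smooth_on_mult:
  fixes f g :: "'a::euclidean_space \<Rightarrow> real"
  shows "open S \<Longrightarrow> smooth_on f S \<Longrightarrow> smooth_on g S \<Longrightarrow> smooth_on (\<lambda>p. f p * g p) S"
  by (simp add: smooth_on_def Ck_on_bilinear bounded_bilinear_mult)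

lemma smooth_on_power:
  fixes f :: "'a::euclidean_space \<Rightarrow> real"
  shows "open S \<Longrightarrow> smooth_on f S \<Longrightarrow> smooth_on (\<lambda>p. f p ^ n) S"
  by (induction n) (simp_all add: smooth_on_const smooth_on_mult)

lemma smooth_on_fst:
  fixes f :: "'a::euclidean_space \<Rightarrow> 'b::euclidean_space \<times> 'c::euclidean_space"
  shows "open S \<Longrightarrow> smooth_on f S \<Longrightarrow> smooth_on (\<lambda>p. fst (f p)) S"
  by (rule smooth_on_linear_comp[OF _ bounded_linear_fst])

lemma smooth_on_snd:
  fixes f :: "'a::euclidean_space \<Rightarrow> 'b::euclidean_space \<times> 'c::euclidean_space"
  shows "open S \<Longrightarrow> smooth_on f S \<Longrightarrow> smooth_on (\<lambda>p. snd (f p)) S"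
  by (rule smooth_on_linear_comp[OF _ bounded_linear_snd])

lemma smooth_on_Pair:
  fixes f :: "'a::euclidean_space \<Rightarrow> 'b::euclidean_space" and g :: "'a \<Rightarrow> 'c::euclidean_space"
  assumes "open S" "smooth_on f S" "smooth_on g S"
  shows "smooth_on (\<lambda>p. (f p, g p)) S"
proof -
  have "smooth_on (\<lambda>p. (f p, 0) + (0, g p)) S"
    by (intro smooth_on_add assms smooth_on_linear_comp[OF assms(1) _ assms(2), of "\<lambda>x. (x, 0)"]
        smooth_on_linear_comp[OF assms(1) _ assms(3), of "\<lambda>x. (0, x)"]
        bounded_linear_Pair bounded_linear_ident bounded_linear_zero)
  then show ?thesis by simp
qed

lemma smooth_on_compose:
  fixes f :: "'b::euclidean_space \<Rightarrow> 'c::real_normed_vector" and g :: "'a::euclidean_space \<Rightarrow> 'b"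
  assumes "smooth_on f T" "open S" "open T" "smooth_on g S" "\<And>x. x \<in> S \<Longrightarrow> g x \<in> T"
  shows "smooth_on (\<lambda>p. f (g p)) S"
  unfolding smooth_on_def
proof
  show "Ck_on k (\<lambda>p. f (g p)) S" for k
  proof (rule Ck_on_compose[OF assms(2,3)])
    show "Ck_on k f T" "Ck_on k g S" using assms(1,4) by (simp_all only: smooth_on_def)
  qed (use assms(5) in blast)
qed

lemma smooth_on_real_primitive:
  fixes f :: "real \<Rightarrow> real"
  assumes "open S" "\<And>x. x \<in> S \<Longrightarrow> (f has_real_derivative f' x) (at x)" "smooth_on f' S"
  shows "smooth_on f S"
proof -
  have "Ck_on k f S" for k
  proof (rule Ck_on_SucD, rule Ck_on_SucI[OF assms(1)])
    show "(f has_derivative (\<lambda>v. f' p * v)) (at p)" if "p \<in> S" for p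
      using assms(2)[OF that] by (simp add: has_field_derivative_def)
    have "smooth_on (\<lambda>p. f' p * v) S" for v
      by (intro smooth_on_mult assms smooth_on_const)
    then show "Ck_on k (\<lambda>p. f' p * v) S" for v by (simp add: smooth_on_def)
  qed
  then show ?thesis by (simp add: smooth_on_def)
qed

lemma smooth_on_has_real_derivative:
  fixes f :: "real \<Rightarrow> real"
  assumes "smooth_on f S" "x \<in> S"
  shows "(f has_real_derivative dd f 1 x) (at x)"
proof -
  have "linear (\<lambda>v. dd f v x)"
    using smooth_on_differentiable[OF assms] linear_frechet_derivative by blast
  then have "dd f v x = dd f 1 x * v" for v
    by (metis linear_scale mult.commute mult.right_neutral real_scaleR_def)
  then have "(\<lambda>v. dd f v x) = (*) (dd f 1 x)" by (rule ext)
  from has_derivative_eq_rhs[OF smooth_on_has_derivative[OF assms] this]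
  show ?thesis unfolding has_field_derivative_def .
qed

text \<open>A function is as smooth as its derivative, so a function solving \<open>f' = F \<circ> f\<close> gains one
  derivative after another.\<close>

lemma smooth_on_ode:
  fixes f F :: "real \<Rightarrow> real"
  assumes "open S" "open T" "\<And>x. x \<in> S \<Longrightarrow> f x \<in> T"
    "\<And>x. x \<in> S \<Longrightarrow> (f has_real_derivative F (f x)) (at x)" "smooth_on F T"
  shows "smooth_on f S"
proof -
  have "Ck_on k f S" for k
  proof (induction k)
    case 0
    have "isCont f x" if "x \<in> S" for x
      using DERIV_isCont[OF assms(4)[OF that]] .
    then show ?case by (simp add: continuous_at_imp_continuous_on)
  next
    case (Suc k)
    have "Ck_on k (\<lambda>x. F (f x)) S"
    proof (rule Ck_on_compose[OF assms(1,2) _ _ Suc])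
      show "Ck_on k F T" using assms(5) by (simp add: smooth_on_def)
    qed (use assms(3) in blast)
    then have "Ck_on k (\<lambda>x. F (f x) * v) S" for v
      by (rule Ck_on_bilinear[OF assms(1) bounded_bilinear_mult _ Ck_on_const])
    moreover have "(f has_derivative (\<lambda>v. F (f x) * v)) (at x)" if "x \<in> S" for x
      using assms(4)[OF that] by (simp add: has_field_derivative_def)
    ultimately show ?case
      by (intro Ck_on_SucI[OF assms(1), where D = "\<lambda>x v. F (f x) * v"])
  qed
  then show ?thesis by (simp add: smooth_on_def)
qed

section \<open>Smoothness of elementary functions and of inverse maps\<close>

lemma smooth_on_inverse_real: "smooth_on (inverse :: real \<Rightarrow> real) (- {0})"
proof (rule smooth_on_ode[of "- {0}" UNIV _ "\<lambda>y. - (y * y)"])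
  show "(inverse has_real_derivative - (inverse x * inverse x)) (at x)" if "x \<in> - {0}" for x :: real
    using that DERIV_inverse[of x UNIV] by (simp add: power2_eq_square)
qed (auto intro!: smooth_on_minus smooth_on_mult smooth_on_id)

lemma smooth_on_exp_real: "smooth_on (exp :: real \<Rightarrow> real) UNIV"
  by (rule smooth_on_ode[of UNIV UNIV _ "\<lambda>y. y"]) (auto intro!: smooth_on_id DERIV_exp)

lemma smooth_on_inverse:
  fixes f :: "'a::euclidean_space \<Rightarrow> real"
  assumes "open S" "smooth_on f S" "\<And>x. x \<in> S \<Longrightarrow> f x \<noteq> 0"
  shows "smooth_on (\<lambda>x. inverse (f x)) S"
  using assms by (intro smooth_on_compose[OF smooth_on_inverse_real]) auto

lemma smooth_on_divide:
  fixes f :: "'a::euclidean_space \<Rightarrow> real"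
  assumes "open S" "smooth_on f S" "smooth_on g S" "\<And>x. x \<in> S \<Longrightarrow> g x \<noteq> 0"
  shows "smooth_on (\<lambda>x. f x / g x) S"
  using assms by (simp add: divide_inverse smooth_on_mult smooth_on_inverse)

lemma smooth_on_exp:
  fixes f :: "'a::euclidean_space \<Rightarrow> real"
  assumes "open S" "smooth_on f S"
  shows "smooth_on (\<lambda>x. exp (f x)) S"
  using assms by (intro smooth_on_compose[OF smooth_on_exp_real]) auto

text \<open>Each derivative is the other function up to sign, so one induction must carry
  both.\<close>

lemma smooth_on_sin_cos: "smooth_on (sin :: real \<Rightarrow> real) UNIV" "smooth_on (cos :: real \<Rightarrow> real) UNIV"
proof -
  have "Ck_on k (sin :: real \<Rightarrow> real) UNIV \<and> Ck_on k (cos :: real \<Rightarrow> real) UNIV" for k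
  proof (induction k)
    case 0
    show ?case by (auto intro!: continuous_intros)
  next
    case (Suc k)
    have "Ck_on (Suc k) (sin :: real \<Rightarrow> real) UNIV"
      using Suc by (intro Ck_on_SucI[where D = "\<lambda>x v. cos x * v"])
        (auto intro!: Ck_on_bilinear[OF _ bounded_bilinear_mult] Ck_on_const
          simp flip: has_field_derivative_def)
    moreover have "Ck_on (Suc k) (cos :: real \<Rightarrow> real) UNIV"
      using Suc by (intro Ck_on_SucI[where D = "\<lambda>x v. - sin x * v"])
        (auto intro!: Ck_on_bilinear[OF _ bounded_bilinear_mult] Ck_on_const
          Ck_on_linear_comp[of UNIV uminus] bounded_linear_minus bounded_linear_ident derivative_eq_intros
          simp flip: has_field_derivative_def)
    ultimately show ?case by blast
  qed
  then show "smooth_on (sin :: real \<Rightarrow> real) UNIV" "smooth_on (cos :: real \<Rightarrow> real) UNIV"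
    by (auto simp: smooth_on_def)
qed

lemma smooth_on_sin: "open S \<Longrightarrow> smooth_on f S \<Longrightarrow> smooth_on (\<lambda>x. sin (f x :: real)) S"
  by (rule smooth_on_compose[OF smooth_on_sin_cos(1)]) auto

lemma smooth_on_cos: "open S \<Longrightarrow> smooth_on f S \<Longrightarrow> smooth_on (\<lambda>x. cos (f x :: real)) S"
  by (rule smooth_on_compose[OF smooth_on_sin_cos(2)]) auto

lemmas smooth_intros = smooth_on_const smooth_on_id smooth_on_add smooth_on_minus smooth_on_diff
  smooth_on_mult smooth_on_power smooth_on_fst smooth_on_snd smooth_on_Pair smooth_on_inverse
  smooth_on_divide smooth_on_exp smooth_on_sin smooth_on_cos

text \<open>The derivative of \<open>g\<close> at \<open>y\<close> is \<open>N (g y)\<close>, so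
  \<open>g\<close> gains one derivative after another, just as a solution of an autonomous
  differential equation does. The pointwise inverse \<open>N\<close> of the derivative is supplied
  by the caller together with its smoothness.\<close>

lemma smooth_on_inverse_map:
  fixes f :: "'a::euclidean_space \<Rightarrow> 'a"
  assumes "open U" "open V" "smooth_on f U"
    "\<And>y. y \<in> V \<Longrightarrow> g y \<in> U" "\<And>y. y \<in> V \<Longrightarrow> f (g y) = y" "\<And>x. x \<in> U \<Longrightarrow> g (f x) = x"
    "\<And>x v. x \<in> U \<Longrightarrow> dd f (N x v) x = v" "\<And>v. smooth_on (\<lambda>x. N x v) U"
  shows "smooth_on g V"
proof -
  have D: "(g has_derivative N (g y)) (at y)" if y: "y \<in> V" for y
  proof (rule has_derivative_inverse_strong_x[OF assms(1) _ smooth_on_continuous[OF assms(3)]])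
    show gU: "g y \<in> U" by (rule assms(4)[OF y])
    show "(f has_derivative (\<lambda>v. dd f v (g y))) (at (g y))"
      by (rule smooth_on_has_derivative[OF assms(3) gU])
    show "(\<lambda>v. dd f v (g y)) \<circ> N (g y) = id"
      unfolding fun_eq_iff comp_def id_def using assms(7)[OF gU] by blast
    show "f (g y) = y" by (rule assms(5)[OF y])
    show "g (f x) = x" if "x \<in> U" for x by (rule assms(6)[OF that])
  qed
  have "Ck_on k g V" for k
  proof (induction k)
    case 0
    have "isCont g y" if "y \<in> V" for y
      using has_derivative_continuous[OF D[OF that]] .
    then show ?case by (simp add: continuous_at_imp_continuous_on)
  next
    case (Suc k)
    have "Ck_on k (\<lambda>y. N (g y) v) V" for v
    proof (rule Ck_on_compose[OF assms(2,1) _ _ Suc])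
      show "Ck_on k (\<lambda>x. N x v) U" using assms(8) by (simp only: smooth_on_def)
    qed (use assms(4) in blast)
    from Ck_on_SucI[OF assms(2) D this] show ?case .
  qed
  then show ?thesis by (simp add: smooth_on_def)
qed

subsection \<open>Prolongation of point transformations\<close>

lemma dd_linear: "f differentiable (at p) \<Longrightarrow> linear (\<lambda>v. dd f v p)"
  by (rule linear_frechet_derivative)

lemma dd_pair:
  fixes g :: "real \<times> real \<Rightarrow> 'b::real_normed_vector"
  assumes "g differentiable (at p)"
  shows "dd g (a, b) p = a *\<^sub>R dd g (1, 0) p + b *\<^sub>R dd g (0, 1) p"
proof -
  have "(a, b) = a *\<^sub>R (1, 0) + b *\<^sub>R (0, 1)" by simp
  then have "dd g (a, b) p = dd g (a *\<^sub>R (1, 0) + b *\<^sub>R (0, 1)) p" by (rule arg_cong)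
  also have "\<dots> = a *\<^sub>R dd g (1, 0) p + b *\<^sub>R dd g (0, 1) p"
    by (simp only: linear_add[OF dd_linear[OF assms]] linear_scale[OF dd_linear[OF assms]])
  finally show ?thesis .
qed

lemma dd_curve:
  fixes F :: "'a::euclidean_space \<Rightarrow> real"
  assumes "F differentiable (at (\<gamma> s))" "(\<gamma> has_vector_derivative v) (at s)"
  shows "((\<lambda>s. F (\<gamma> s)) has_real_derivative dd F v (\<gamma> s)) (at s)"
proof -
  have F: "(F has_derivative (\<lambda>v. dd F v (\<gamma> s))) (at (\<gamma> s))"
    using assms(1) by (simp add: frechet_derivative_works)
  have "((\<lambda>s. F (\<gamma> s)) has_derivative (\<lambda>h. dd F (h *\<^sub>R v) (\<gamma> s))) (at s)"
    by (rule has_derivative_compose[OF assms(2)[unfolded has_vector_derivative_def] F])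
  moreover have "dd F (h *\<^sub>R v) (\<gamma> s) = dd F v (\<gamma> s) * h" for h
    using linear_scale[OF dd_linear[OF assms(1)]] by simp
  ultimately show ?thesis by (simp add: has_field_derivative_def)
qed

text \<open>\<open>satisfies_at\<close> differentiates along coordinate lines; this is the bridge to
  the directional derivatives used elsewhere. The inner \<open>deriv\<close> has to be identified on
  a neighbourhood of \<open>x\<close> before the outer one can be taken.\<close>

lemma satisfies_at_dd:
  assumes "open \<Omega>" "smooth_on w \<Omega>" "(t, x) \<in> \<Omega>"
  shows "satisfies_at C w t x \<longleftrightarrow>
    x \<in> dom C \<and> dd w (1, 0) (t, x) = dd (dd w (0, 1)) (0, 1) (t, x) + the (C x) * w (t, x)"
proof -
  have px: "((\<lambda>y. f (t, y)) has_real_derivative dd f (0, 1) (t, y)) (at y)"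
    if "smooth_on f \<Omega>" "(t, y) \<in> \<Omega>" for y and f :: "real \<times> real \<Rightarrow> real"
    by (rule dd_curve[where \<gamma> = "\<lambda>y. (t, y)"])
      (auto intro!: smooth_on_differentiable that derivative_eq_intros)
  have pt: "((\<lambda>s. w (s, x)) has_real_derivative dd w (1, 0) (t, x)) (at t)"
    by (rule dd_curve[where \<gamma> = "\<lambda>s. (s, x)"])
      (auto intro!: smooth_on_differentiable assms derivative_eq_intros)
  have "open ((\<lambda>y. (t, y)) -` \<Omega>)"
    by (intro open_vimage assms continuous_intros)
  then have "eventually (\<lambda>y. y \<in> (\<lambda>y. (t, y)) -` \<Omega>) (nhds x)"
    by (rule eventually_nhds_in_open) (simp add: assms(3))
  then have "eventually (\<lambda>y. deriv (\<lambda>y. w (t, y)) y = dd w (0, 1) (t, y)) (nhds x)"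
  proof (rule eventually_mono)
    fix y assume "y \<in> (\<lambda>y. (t, y)) -` \<Omega>"
    then have "(t, y) \<in> \<Omega>" by simp
    from px[OF assms(2) this] show "deriv (\<lambda>y. w (t, y)) y = dd w (0, 1) (t, y)"
      by (rule DERIV_imp_deriv)
  qed
  then have "deriv (deriv (\<lambda>y. w (t, y))) x = deriv (\<lambda>y. dd w (0, 1) (t, y)) x"
    by (rule deriv_cong_ev) simp
  also have "\<dots> = dd (dd w (0, 1)) (0, 1) (t, x)"
    by (rule DERIV_imp_deriv[OF px[OF smooth_on_dd[OF assms(2)] assms(3)]])
  finally show ?thesis
    using DERIV_imp_deriv[OF pt] by (simp add: satisfies_at_def)
qed

text \<open>For a curve whose first component is stationary at 0, the terms with \<open>w_tt\<close>
  and \<open>w_tx\<close> drop out of the second derivative. What remains is \<open>w_xx\<close>,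
  \<open>w_t\<close> and \<open>w_x\<close>, the derivatives from which the transformed equation is
  read off.\<close>

lemma second_derivative_along_curve:
  fixes w :: "real \<times> real \<Rightarrow> real"
  assumes "open \<Omega>" "smooth_on w \<Omega>" "(a 0, b 0) \<in> \<Omega>"
    and a: "\<forall>\<^sub>F s in nhds 0. (a has_real_derivative a' s) (at s)" "(a' has_real_derivative a2) (at 0)"
    and b: "\<forall>\<^sub>F s in nhds 0. (b has_real_derivative b' s) (at s)" "(b' has_real_derivative b2) (at 0)"
    and V: "\<forall>\<^sub>F s in nhds 0. (V has_real_derivative V' s) (at s)" "(V' has_real_derivative V2) (at 0)"
    and eq: "\<forall>\<^sub>F s in nhds 0. w (a s, b s) = V s"
    and a0: "a' 0 = 0"
  shows "V2 = dd (dd w (0, 1)) (0, 1) (a 0, b 0) * (b' 0)\<^sup>2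
    + dd w (1, 0) (a 0, b 0) * a2 + dd w (0, 1) (a 0, b 0) * b2"
proof -
  have vd: "((\<lambda>s. (a s, b s)) has_vector_derivative (a' s, b' s)) (at s)"
    if "(a has_real_derivative a' s) (at s)" "(b has_real_derivative b' s) (at s)" for s
    using that by (intro has_vector_derivative_Pair) (simp_all add: has_real_derivative_iff_has_vector_derivative)
  have chain: "((\<lambda>s. f (a s, b s)) has_real_derivative
      a' s * dd f (1, 0) (a s, b s) + b' s * dd f (0, 1) (a s, b s)) (at s)"
    if "(a has_real_derivative a' s) (at s)" "(b has_real_derivative b' s) (at s)"
      "smooth_on f \<Omega>" "(a s, b s) \<in> \<Omega>" for s and f :: "real \<times> real \<Rightarrow> real"
    using dd_curve[OF smooth_on_differentiable[OF that(3,4)] vd[OF that(1,2)]]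
      dd_pair[OF smooth_on_differentiable[OF that(3,4)], of "a' s" "b' s"] by simp
  have a00: "(a has_real_derivative a' 0) (at 0)" and b00: "(b has_real_derivative b' 0) (at 0)"
    using a(1) b(1) eventually_nhds_x_imp_x by blast+
  have "isCont (\<lambda>s. (a s, b s)) 0"
    using DERIV_isCont[OF a00] DERIV_isCont[OF b00] by (intro continuous_intros)
  then have inO: "\<forall>\<^sub>F s in nhds 0. (a s, b s) \<in> \<Omega>"
    using topological_tendstoD[OF _ assms(1,3)] unfolding isCont_def tendsto_nhds_iff[symmetric]
    by (simp add: eventually_nhds_conv_at assms(3))
  have "\<forall>\<^sub>F s in nhds 0. \<forall>\<^sub>F r in nhds s. w (a r, b r) = V r"
    using eq by (simp add: eventually_eventually)
  with a(1) b(1) V(1) inO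
  have ev: "\<forall>\<^sub>F s in nhds 0. a' s * dd w (1, 0) (a s, b s) + b' s * dd w (0, 1) (a s, b s) = V' s"
  proof eventually_elim
    case (elim s)
    have "((\<lambda>s. w (a s, b s)) has_real_derivative V' s) (at s)"
      using elim(3) DERIV_cong_ev[OF refl elim(5) refl] by simp
    then show ?case using chain[OF elim(1,2) assms(2) elim(4)] DERIV_unique by blast
  qed
  have "((\<lambda>s. a' s * dd w (1, 0) (a s, b s) + b' s * dd w (0, 1) (a s, b s)) has_real_derivative V2) (at 0)"
    using V(2) DERIV_cong_ev[OF refl ev refl] by simp
  moreover have "((\<lambda>s. a' s * dd w (1, 0) (a s, b s) + b' s * dd w (0, 1) (a s, b s)) has_real_derivative
     (a2 * dd w (1, 0) (a 0, b 0) + a' 0 * (a' 0 * dd (dd w (1, 0)) (1, 0) (a 0, b 0) + b' 0 * dd (dd w (1, 0)) (0, 1) (a 0, b 0)))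
     + (b2 * dd w (0, 1) (a 0, b 0) + b' 0 * (a' 0 * dd (dd w (0, 1)) (1, 0) (a 0, b 0) + b' 0 * dd (dd w (0, 1)) (0, 1) (a 0, b 0)))) (at 0)"
    by (intro DERIV_add) (rule DERIV_cong[OF DERIV_mult[OF a(2) chain[OF a00 b00 smooth_on_dd[OF assms(2)] assms(3)]]]
        DERIV_cong[OF DERIV_mult[OF b(2) chain[OF a00 b00 smooth_on_dd[OF assms(2)] assms(3)]]]; simp)+
  ultimately have "V2 = (a2 * dd w (1, 0) (a 0, b 0) + a' 0 * (a' 0 * dd (dd w (1, 0)) (1, 0) (a 0, b 0) + b' 0 * dd (dd w (1, 0)) (0, 1) (a 0, b 0)))
     + (b2 * dd w (0, 1) (a 0, b 0) + b' 0 * (a' 0 * dd (dd w (0, 1)) (1, 0) (a 0, b 0) + b' 0 * dd (dd w (0, 1)) (0, 1) (a 0, b 0)))"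
    by (rule DERIV_unique)
  then show ?thesis using a0 by (simp add: power2_eq_square algebra_simps)
qed

text \<open>The inverse function theorem gives a local homeomorphism; smoothness of its inverse then
  follows by \<open>smooth_on_inverse_map\<close>.\<close>

lemma local_inverse_2D:
  fixes g :: "real \<times> real \<Rightarrow> real \<times> real"
  assumes S: "open S" "smooth_on g S" "p \<in> S"
    and det: "fst (dd g (1, 0) p) * snd (dd g (0, 1) p) - fst (dd g (0, 1) p) * snd (dd g (1, 0) p) \<noteq> 0"
  obtains U V h where "open U" "U \<subseteq> S" "p \<in> U" "open V" "smooth_on h V"
    "g ` U = V" "h ` V = U" "\<And>x. x \<in> U \<Longrightarrow> h (g x) = x" "\<And>y. y \<in> V \<Longrightarrow> g (h y) = y"
proof -
  define a where "a x = fst (dd g (1, 0) x)" for x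
  define b where "b x = fst (dd g (0, 1) x)" for x
  define c where "c x = snd (dd g (1, 0) x)" for x
  define d where "d x = snd (dd g (0, 1) x)" for x
  define \<Delta> where "\<Delta> x = a x * d x - b x * c x" for x
  have sm: "smooth_on a S" "smooth_on b S" "smooth_on c S" "smooth_on d S"
    unfolding a_def b_def c_def d_def using S by (auto intro!: smooth_intros smooth_on_dd)
  then have sD: "smooth_on \<Delta> S" unfolding \<Delta>_def using S by (auto intro!: smooth_intros)
  define S' where "S' = S \<inter> \<Delta> -` (- {0})"
  have S': "open S'" unfolding S'_def
    by (intro continuous_open_preimage smooth_on_continuous[OF sD] S(1)) auto
  have sub: "S' \<subseteq> S" by (auto simp: S'_def)
  have pS: "p \<in> S'" using S(3) det by (simp add: S'_def \<Delta>_def a_def b_def c_def d_def)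
  \<comment> \<open>Cramer's rule for the 2 by 2 derivative of \<open>g\<close>: smooth in
    \<open>x\<close> wherever the determinant \<open>\<Delta>\<close> does not vanish.\<close>
  define N where "N x v = ((d x * fst v - b x * snd v) / \<Delta> x, (a x * snd v - c x * fst v) / \<Delta> x)" for x v
  have ddg: "dd g v x = (fst v * a x + snd v * b x, fst v * c x + snd v * d x)" if "x \<in> S" for x v
    using dd_pair[OF smooth_on_differentiable[OF S(2) that], of "fst v" "snd v"]
    by (simp add: a_def b_def c_def d_def prod_eq_iff)
  have N: "dd g (N x v) x = v" "N x (dd g v x) = v" if "x \<in> S'" for x v
  proof -
    have "x \<in> S" and nz: "\<Delta> x \<noteq> 0" using that by (auto simp: S'_def)
    then show "dd g (N x v) x = v"
      by (auto simp: ddg N_def prod_eq_iff field_simps) (auto simp: \<Delta>_def algebra_simps)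
    show "N x (dd g v x) = v" using nz
      by (auto simp: ddg[OF \<open>x \<in> S\<close>] N_def prod_eq_iff field_simps) (auto simp: \<Delta>_def algebra_simps)
  qed
  have bl: "bounded_linear (\<lambda>v. dd g v x)" if "x \<in> S" for x
    using smooth_on_has_derivative[OF S(2) that] by (rule has_derivative_bounded_linear)
  have blN: "bounded_linear (N p)"
    unfolding linear_conv_bounded_linear[symmetric]
    by (rule linearI) (auto simp: N_def add_divide_distrib[symmetric] diff_divide_distrib[symmetric] algebra_simps)
  define f' where "f' x = Blinfun (\<lambda>v. dd g v x)" for x
  have f': "blinfun_apply (f' x) = (\<lambda>v. dd g v x)" if "x \<in> S" for x
    unfolding f'_def by (rule bounded_linear_Blinfun_apply[OF bl[OF that]])
  have der: "(g has_derivative blinfun_apply (f' x)) (at x)" if "x \<in> S'" for x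
    using smooth_on_has_derivative[OF S(2) subsetD[OF sub that]] f'[OF subsetD[OF sub that]] by simp
  have cont: "continuous_on S' f'"
  proof (rule continuous_on_blinfun_componentwise)
    fix i :: "real \<times> real"
    have "continuous_on S' (dd g i)"
      by (rule continuous_on_subset[OF smooth_on_continuous[OF smooth_on_dd[OF S(2)]] sub])
    then show "continuous_on S' (\<lambda>x. blinfun_apply (f' x) i)"
      by (rule continuous_on_eq) (use f' sub in auto)
  qed
  have inv: "Blinfun (N p) o\<^sub>L f' p = id_blinfun"
    by (rule blinfun_eqI) (simp add: bounded_linear_Blinfun_apply[OF blN] f'[OF subsetD[OF sub pS]] N(2)[OF pS])
  obtain U V h where U: "open U" "U \<subseteq> S'" "p \<in> U" "open V" "homeomorphism U V g h"
    by (rule inverse_function_theorem[OF S' der cont pS inv]) (assumption, rule that)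
  have hom: "g ` U = V" "h ` V = U" "\<And>x. x \<in> U \<Longrightarrow> h (g x) = x" "\<And>y. y \<in> V \<Longrightarrow> g (h y) = y"
    using U(5) by (auto simp: homeomorphism_def)
  have "smooth_on h V"
  proof (rule smooth_on_inverse_map[OF U(1,4), where f = g and N = N])
    show "smooth_on g U" using smooth_on_subset[OF S(2)] U(2) sub by blast
    show "h y \<in> U" if "y \<in> V" for y using hom(2) that by blast
    show "dd g (N x v) x = v" if "x \<in> U" for x v using N(1) that U(2) by blast
    show "smooth_on (\<lambda>x. N x v) U" for v
    proof -
      have "smooth_on (\<lambda>x. N x v) S'" unfolding N_def
        by (intro smooth_intros S' smooth_on_subset[OF sD sub] smooth_on_subset[OF sm(1) sub] smooth_on_subset[OF sm(2) sub]
            smooth_on_subset[OF sm(3) sub] smooth_on_subset[OF sm(4) sub]) (auto simp: S'_def)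
      then show ?thesis using smooth_on_subset U(2) by blast
    qed
  qed (use hom in auto)
  then show thesis using that[of U V h] U hom sub by blast
qed

text \<open>The parabola has velocity \<open>E\<close> and acceleration
  \<open>\<eta> *\<^sub>R Z\<close> at \<open>P\<close>. With \<open>Z\<close> the
  \<open>u\<close>-direction it is the lift of a straight line in the base to the graph of a
  quadratic polynomial.\<close>

lemma second_order_curve:
  fixes F :: "'a::euclidean_space \<Rightarrow> real" and E Z :: 'a and \<eta> :: real
  assumes "open S" "smooth_on F S" "P \<in> S"
  defines "\<gamma> \<equiv> \<lambda>s::real. P + s *\<^sub>R E + (s\<^sup>2 * \<eta> / 2) *\<^sub>R Z"
  defines "F' \<equiv> \<lambda>s. dd F E (\<gamma> s) + s * \<eta> * dd F Z (\<gamma> s)"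
  shows "\<forall>\<^sub>F s in nhds 0. ((\<lambda>s. F (\<gamma> s)) has_real_derivative F' s) (at s)"
    and "(F' has_real_derivative dd (dd F E) E P + \<eta> * dd F Z P) (at 0)"
    and "\<forall>\<^sub>F s in nhds 0. \<gamma> s \<in> S"
proof -
  have g: "(\<gamma> has_vector_derivative (E + (s * \<eta>) *\<^sub>R Z)) (at s)" for s
    unfolding \<gamma>_def by (auto intro!: derivative_eq_intros simp: has_vector_derivative_def algebra_simps scaleR_add_right scaleR_add_left)
  have "open (\<gamma> -` S)"
    unfolding \<gamma>_def by (intro open_vimage assms continuous_intros) simp_all
  then have "\<forall>\<^sub>F s in nhds 0. s \<in> \<gamma> -` S"
    by (rule eventually_nhds_in_open) (simp add: assms(3) \<gamma>_def)
  then show ev: "\<forall>\<^sub>F s in nhds 0. \<gamma> s \<in> S" by simp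
  show "\<forall>\<^sub>F s in nhds 0. ((\<lambda>s. F (\<gamma> s)) has_real_derivative F' s) (at s)"
    using ev
  proof (rule eventually_mono)
    fix s assume s: "\<gamma> s \<in> S"
    have d: "F differentiable (at (\<gamma> s))" by (rule smooth_on_differentiable[OF assms(2) s])
    have "dd F (E + (s * \<eta>) *\<^sub>R Z) (\<gamma> s) = F' s"
      using linear_add[OF dd_linear[OF d]] linear_scale[OF dd_linear[OF d]] by (simp add: F'_def)
    with dd_curve[OF d g] show "((\<lambda>s. F (\<gamma> s)) has_real_derivative F' s) (at s)" by simp
  qed
  have g0: "\<gamma> 0 = P" by (simp add: \<gamma>_def)
  have d: "((\<lambda>s. dd F v (\<gamma> s)) has_real_derivative dd (dd F v) E P) (at 0)" for v
    using dd_curve[OF smooth_on_differentiable[OF smooth_on_dd[OF assms(2)]] g, of 0 v] g0 assms(3) by simp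
  have d2: "((\<lambda>s. s * \<eta>) has_real_derivative \<eta>) (at 0)" by (auto intro!: derivative_eq_intros)
  show "(F' has_real_derivative dd (dd F E) E P + \<eta> * dd F Z P) (at 0)"
    unfolding F'_def using DERIV_add[OF d[of E] DERIV_mult[OF d2 d[of Z]]] by (simp add: g0)
qed

lemma graph_over_image: "graph_over \<Omega> w = (\<lambda>q. (fst q, snd q, w q)) ` \<Omega>"
  by (force simp: graph_over_def)

lemma inverse_map_apply:
  assumes "inj_on \<Phi> (dom \<Phi>)" "\<Phi> p = Some q"
  shows "inverse_map \<Phi> q = Some p"
proof -
  have "(THE p. \<Phi> p = Some q) = p"
    using assms by (intro the_equality) (auto simp: inj_on_def dom_def)
  then show ?thesis using assms(2) by (auto simp: inverse_map_def ran_def)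
qed

section \<open>Constraints on an admissible transformation from its prolongation\<close>

locale admissible_transformation =
  fixes C :: potential and \<Phi> :: ptrans and C' :: potential
  assumes admissible: "(C, \<Phi>, C') \<in> admissible"
begin

definition T :: "pt \<Rightarrow> real" where "T p = fst (the (\<Phi> p))"
definition X :: "pt \<Rightarrow> real" where "X p = fst (snd (the (\<Phi> p)))"
definition U :: "pt \<Rightarrow> real" where "U p = snd (snd (the (\<Phi> p)))"

lemma apply_eq: "p \<in> dom \<Phi> \<Longrightarrow> \<Phi> p = Some (T p, X p, U p)"
  by (auto simp: T_def X_def U_def)

lemma point_transformation: "point_transformation \<Phi>"
  and maps: "maps_equation C \<Phi> C'"
  and potentials: "potential C" "potential C'"
  using admissible by (auto simp: admissible_def)

lemma open_dom: "open (dom \<Phi>)"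
  and smooth: "smooth_on (\<lambda>p. the (\<Phi> p)) (dom \<Phi>)"
  using point_transformation by (auto simp: point_transformation_def)

lemma smooth_T: "smooth_on T (dom \<Phi>)" and smooth_X: "smooth_on X (dom \<Phi>)" and smooth_U: "smooth_on U (dom \<Phi>)"
  unfolding T_def[abs_def] X_def[abs_def] U_def[abs_def]
  by (intro smooth_on_fst smooth_on_snd open_dom smooth)+

lemma source_dom:
  assumes "(t, x, u) \<in> dom \<Phi>"
  shows "x \<in> dom C"
proof -
  have "\<forall>(t, x, u)\<in>dom \<Phi>. x \<in> dom C" using admissible by (simp add: admissible_def)
  from bspec[OF this assms] show ?thesis by simp
qed

lemma target_dom:
  assumes "p \<in> dom \<Phi>"
  shows "X p \<in> dom C'"
proof -
  have "\<forall>(t, x, u)\<in>ran \<Phi>. x \<in> dom C'" using admissible by (simp add: admissible_def)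
  from bspec[OF this ranI[of \<Phi>, OF apply_eq[OF assms]]] show ?thesis by simp
qed

text \<open>By the chain rule, the derivative of the smooth inverse is a left inverse of the
  derivative of \<open>\<Phi>\<close>.\<close>

lemma derivative_injective:
  assumes P: "P \<in> dom \<Phi>" and "dd T v P = 0" "dd X v P = 0" "dd U v P = 0"
  shows "v = 0"
proof -
  let ?F = "\<lambda>p. the (\<Phi> p)" and ?G = "\<lambda>q. the (inverse_map \<Phi> q)"
  have G: "?G differentiable (at (?F P))"
  proof (rule smooth_on_differentiable)
    show "smooth_on ?G (ran \<Phi>)" using point_transformation by (simp add: point_transformation_def)
    show "?F P \<in> ran \<Phi>" using ranI[of \<Phi>, OF apply_eq[OF P]] apply_eq[OF P] by simp
  qed
  have F: "(?F has_derivative (\<lambda>v. (dd T v P, dd X v P, dd U v P))) (at P)"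
  proof -
    have "((\<lambda>p. (T p, X p, U p)) has_derivative (\<lambda>v. (dd T v P, dd X v P, dd U v P))) (at P)"
      using P by (intro has_derivative_Pair smooth_on_has_derivative[OF smooth_T]
          smooth_on_has_derivative[OF smooth_X] smooth_on_has_derivative[OF smooth_U])
    then show ?thesis by (simp add: T_def X_def U_def)
  qed
  have id: "((\<lambda>p. ?G (?F p)) has_derivative (\<lambda>v. dd ?G (dd T v P, dd X v P, dd U v P) (?F P))) (at P)"
    by (rule has_derivative_compose[OF F]) (use G in \<open>simp add: frechet_derivative_works\<close>)
  have "?G (?F p) = p" if "p \<in> dom \<Phi>" for p
    using inverse_map_apply[of \<Phi> p] apply_eq[OF that] point_transformation
    by (simp add: point_transformation_def)
  then have "((\<lambda>p. p) has_derivative (\<lambda>v. dd ?G (dd T v P, dd X v P, dd U v P) (?F P))) (at P)"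
    using has_derivative_transform_within_open[OF id open_dom P] by simp
  then have "v = dd ?G (dd T v P, dd X v P, dd U v P) (?F P)"
    by (rule fun_cong[OF has_derivative_unique[OF has_derivative_ident]])
  also have "\<dots> = dd ?G 0 (?F P)" using assms by (simp add: zero_prod_def)
  also have "\<dots> = 0" using linear_0[OF dd_linear[OF G]] .
  finally show ?thesis .
qed

text \<open>The numbers \<open>p\<close>, \<open>q\<close>, \<open>r\<close> are the derivatives
  \<open>w'_t\<close>, \<open>w'_x\<close>, \<open>w'_xx\<close> of the transformed function. The
  source jet has value \<open>u0\<close>, first derivatives \<open>vt\<close>, \<open>vx\<close> and
  second derivatives \<open>\<alpha>\<close>, \<open>b\<close>, \<open>\<gamma>\<close> in the order
  \<open>tt\<close>, \<open>tx\<close>, \<open>xx\<close>. The last clause computes \<open>r\<close>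
  along base directions in which the transformed time is stationary.\<close>

lemma prolongation_aux:
  fixes t0 x0 u0 vt vx \<alpha> b \<gamma> :: real
  defines "P \<equiv> (t0, x0, u0)"
  assumes P: "P \<in> dom \<Phi>"
    and det: "dd T (1, 0, vt) P * dd X (0, 1, vx) P - dd T (0, 1, vx) P * dd X (1, 0, vt) P \<noteq> 0"
  shows "\<exists>p q r. (vt = \<gamma> + the (C x0) * u0 \<longleftrightarrow> p = r + the (C' (X P)) * U P) \<and>
     (\<forall>a c. p * dd T (a, c, a * vt + c * vx) P + q * dd X (a, c, a * vt + c * vx) P = dd U (a, c, a * vt + c * vx) P) \<and>
     (\<forall>a c. let E = (a, c, a * vt + c * vx); \<eta> = \<alpha> * a\<^sup>2 + 2 * b * a * c + \<gamma> * c\<^sup>2 in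
        dd T E P = 0 \<longrightarrow>
        dd (dd U E) E P + \<eta> * dd U (0, 0, 1) P = r * (dd X E P)\<^sup>2
          + p * (dd (dd T E) E P + \<eta> * dd T (0, 0, 1) P)
          + q * (dd (dd X E) E P + \<eta> * dd X (0, 0, 1) P))"
proof -
  \<comment> \<open>The quadratic polynomial with the prescribed 2-jet at
    \<open>(t0, x0)\<close>.\<close>
  define w where "w = (\<lambda>(t, x). u0 + vt * (t - t0) + vx * (x - x0) + \<alpha> / 2 * (t - t0)\<^sup>2
     + b * (t - t0) * (x - x0) + \<gamma> / 2 * (x - x0)\<^sup>2)"
  define j where "j q = (fst q, snd q, w q)" for q :: "real \<times> real"
  define p0 where "p0 = (t0, x0)"
  have jp: "j p0 = P" by (simp add: j_def w_def p0_def P_def)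
  have smw: "smooth_on w UNIV"
    unfolding w_def case_prod_beta by (intro smooth_intros) auto
  have smj: "smooth_on j UNIV"
    unfolding j_def[abs_def] by (intro smooth_intros smw) auto
  define S where "S = j -` dom \<Phi>"
  have S: "open S" unfolding S_def
    by (intro open_vimage open_dom) (use smooth_on_continuous[OF smj] in simp)
  have smF: "smooth_on (\<lambda>q. F (j q)) S" if "smooth_on F (dom \<Phi>)" for F :: "pt \<Rightarrow> real"
    by (rule smooth_on_compose[OF that S open_dom smooth_on_subset[OF smj]]) (auto simp: S_def)
  define g where "g q = (T (j q), X (j q))" for q
  have smg: "smooth_on g S" unfolding g_def[abs_def]
    by (intro smooth_on_Pair S smF smooth_T smooth_X)
  have p0S: "p0 \<in> S" by (simp add: S_def jp P)
  have dw: "(w has_derivative (\<lambda>(a, c). a * (vt + \<alpha> * (t - t0) + b * (x - x0)) + c * (vx + b * (t - t0) + \<gamma> * (x - x0)))) (at (t, x))" for t x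
    unfolding w_def case_prod_beta
    by (auto intro!: derivative_eq_intros simp: fun_eq_iff algebra_simps power2_eq_square)
  have ddw: "dd w v (t, x) = fst v * (vt + \<alpha> * (t - t0) + b * (x - x0)) + snd v * (vx + b * (t - t0) + \<gamma> * (x - x0))" for v t x
    using fun_cong[OF frechet_derivative_at[OF dw[of t x]], of v] by (simp add: case_prod_beta)
  have dw1: "dd w (1, 0) p0 = vt" by (simp add: p0_def ddw)
  have dw2: "dd (dd w (0, 1)) (0, 1) p0 = \<gamma>"
  proof -
    have "dd w (0, 1) = (\<lambda>q. vx + b * (fst q - t0) + \<gamma> * (snd q - x0))"
      by (auto simp: fun_eq_iff ddw)
    moreover have "((\<lambda>q. vx + b * (fst q - t0) + \<gamma> * (snd q - x0)) has_derivative (\<lambda>v. b * fst v + \<gamma> * snd v)) (at p0)"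
      by (auto intro!: derivative_eq_intros)
    from frechet_derivative_at[OF this] have "frechet_derivative (\<lambda>q. vx + b * (fst q - t0) + \<gamma> * (snd q - x0)) (at p0) = (\<lambda>v. b * fst v + \<gamma> * snd v)" by simp
    ultimately show ?thesis by simp
  qed
  have dj: "(j has_derivative (\<lambda>(a, c). (a, c, a * vt + c * vx))) (at p0)"
    unfolding j_def[abs_def] p0_def using dw[of t0 x0]
    by (auto intro!: derivative_eq_intros simp: case_prod_beta)
  have dF: "dd (\<lambda>q. F (j q)) (a, c) p0 = dd F (a, c, a * vt + c * vx) P" if "smooth_on F (dom \<Phi>)" for F :: "pt \<Rightarrow> real" and a c
  proof -
    have "(F has_derivative (\<lambda>v. dd F v P)) (at (j p0))"
      using smooth_on_has_derivative[OF that] P jp by simp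
    from has_derivative_compose[OF dj this]
    have "((\<lambda>q. F (j q)) has_derivative (\<lambda>v. dd F (case v of (a, c) \<Rightarrow> (a, c, a * vt + c * vx)) P)) (at p0)" .
    from frechet_derivative_at[OF this]
    have "(\<lambda>v. dd F (case v of (a, c) \<Rightarrow> (a, c, a * vt + c * vx)) P) = (\<lambda>v. dd (\<lambda>q. F (j q)) v p0)" .
    from fun_cong[OF this, of "(a, c)"] show ?thesis by simp
  qed
  have dg: "dd g v p0 = (dd (\<lambda>q. T (j q)) v p0, dd (\<lambda>q. X (j q)) v p0)" for v
  proof -
    have "(g has_derivative (\<lambda>v. (dd (\<lambda>q. T (j q)) v p0, dd (\<lambda>q. X (j q)) v p0))) (at p0)"
      unfolding g_def[abs_def]
      by (intro has_derivative_Pair smooth_on_has_derivative[OF _ p0S] smF smooth_T smooth_X)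
    from fun_cong[OF frechet_derivative_at[OF this], of v] show ?thesis by simp
  qed
  \<comment> \<open>By \<open>det\<close> the induced map of the base is locally invertible, so the
    image of the graph of \<open>w\<close> is again a graph, that of \<open>w'\<close>.\<close>
  have "fst (dd g (1, 0) p0) * snd (dd g (0, 1) p0) - fst (dd g (0, 1) p0) * snd (dd g (1, 0) p0) \<noteq> 0"
    using det by (simp add: dg dF[OF smooth_T] dF[OF smooth_X])
  from local_inverse_2D[OF S smg p0S this]
  obtain W V h where W: "open W" "W \<subseteq> S" "p0 \<in> W" "open V" "smooth_on h V"
    "g ` W = V" "h ` V = W" "\<And>x. x \<in> W \<Longrightarrow> h (g x) = x" "\<And>y. y \<in> V \<Longrightarrow> g (h y) = y" by blast
  define w' where "w' q = U (j (h q))" for q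
  have smw': "smooth_on w' V"
    unfolding w'_def[abs_def]
    by (rule smooth_on_compose[OF smF[OF smooth_U] W(4) S W(5)]) (use W(2,7) in blast)
  have w'g: "w' (g q) = U (j q)" if "q \<in> W" for q using W(8)[OF that] by (simp add: w'_def)
  have jdom: "j q \<in> dom \<Phi>" if "q \<in> W" for q using that W(2) by (auto simp: S_def)
  have gr: "graph_over W w = j ` W" by (simp add: graph_over_image j_def[abs_def])
  have gsub: "graph_over W w \<subseteq> dom \<Phi>" unfolding gr using jdom by blast
  have Phij: "the (\<Phi> (j q)) = (fst (g q), snd (g q), w' (g q))" if "q \<in> W" for q
    using apply_eq[OF jdom[OF that]] w'g[OF that] by (simp add: g_def)
  have img: "(\<lambda>p. the (\<Phi> p)) ` graph_over W w = graph_over V w'"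
  proof -
    have "(\<lambda>p. the (\<Phi> p)) ` graph_over W w = (\<lambda>q. (fst (g q), snd (g q), w' (g q))) ` W"
      unfolding gr image_image using Phij by (rule image_cong[OF refl])
    also have "\<dots> = (\<lambda>q. (fst q, snd q, w' q)) ` V"
      unfolding W(6)[symmetric] image_image ..
    also have "\<dots> = graph_over V w'" by (simp add: graph_over_image)
    finally show ?thesis .
  qed
  have gp: "g p0 = (T P, X P)" by (simp add: g_def jp)
  have gV: "(T P, X P) \<in> V" using W(3,6) gp by force
  have w'p: "w' (T P, X P) = U P" using w'g[OF W(3)] gp jp by simp
  have wp: "w (t0, x0) = u0" by (simp add: w_def)
  have "satisfies_at C w t0 x0 \<longleftrightarrow> satisfies_at C' w' (T P) (X P)"
  proof (rule maps[unfolded maps_equation_def, rule_format])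
    show "open W \<and> open V \<and> smooth_on w W \<and> smooth_on w' V \<and> (t0, x0) \<in> W \<and> (T P, X P) \<in> V \<and>
      graph_over W w \<subseteq> dom \<Phi> \<and> (\<lambda>p. the (\<Phi> p)) ` graph_over W w = graph_over V w' \<and>
      \<Phi> (t0, x0, w (t0, x0)) = Some (T P, X P, w' (T P, X P))"
      using W(1,3,4) smw' smooth_on_subset[OF smw] gV img gsub apply_eq[OF P] w'p wp
      by (simp add: p0_def P_def)
  qed
  then have main: "vt = \<gamma> + the (C x0) * u0 \<longleftrightarrow>
     dd w' (1, 0) (T P, X P) = dd (dd w' (0, 1)) (0, 1) (T P, X P) + the (C' (X P)) * U P"
    using satisfies_at_dd[OF W(1) smooth_on_subset[OF smw], of t0 x0 C] satisfies_at_dd[OF W(4) smw' gV, of C']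
      source_dom[OF P[unfolded P_def]] target_dom[OF P] W(3) dw1 dw2 wp w'p
    by (simp add: p0_def)
  have first: "dd w' (1, 0) (T P, X P) * dd T (a, c, a * vt + c * vx) P + dd w' (0, 1) (T P, X P) * dd X (a, c, a * vt + c * vx) P
      = dd U (a, c, a * vt + c * vx) P" for a c
  proof -
    have "(w' has_derivative (\<lambda>v. dd w' v (T P, X P))) (at (g p0))"
      using smooth_on_has_derivative[OF smw' gV] gp by simp
    from has_derivative_compose[OF smooth_on_has_derivative[OF smg p0S] this]
    have "((\<lambda>q. w' (g q)) has_derivative (\<lambda>v. dd w' (dd g v p0) (T P, X P))) (at p0)" .
    from has_derivative_transform_within_open[OF this W(1,3) w'g]
    have "((\<lambda>q. U (j q)) has_derivative (\<lambda>v. dd w' (dd g v p0) (T P, X P))) (at p0)" .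
    from fun_cong[OF frechet_derivative_at[OF this], of "(a, c)"]
    have "dd w' (dd T (a, c, a * vt + c * vx) P, dd X (a, c, a * vt + c * vx) P) (T P, X P) = dd U (a, c, a * vt + c * vx) P"
      by (simp add: dg dF smooth_T smooth_X smooth_U)
    with dd_pair[OF smooth_on_differentiable[OF smw' gV],
        of "dd T (a, c, a * vt + c * vx) P" "dd X (a, c, a * vt + c * vx) P"]
    show ?thesis by (simp add: mult.commute)
  qed
  have second: "dd (dd U E) E P + \<eta> * dd U (0, 0, 1) P = dd (dd w' (0, 1)) (0, 1) (T P, X P) * (dd X E P)\<^sup>2
          + dd w' (1, 0) (T P, X P) * (dd (dd T E) E P + \<eta> * dd T (0, 0, 1) P)
          + dd w' (0, 1) (T P, X P) * (dd (dd X E) E P + \<eta> * dd X (0, 0, 1) P)"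
    if E: "E = (a, c, a * vt + c * vx)" and \<eta>: "\<eta> = \<alpha> * a\<^sup>2 + 2 * b * a * c + \<gamma> * c\<^sup>2" and T0: "dd T E P = 0" for E \<eta> a c
  proof -
    let ?\<gamma> = "\<lambda>s. P + s *\<^sub>R E + (s\<^sup>2 * \<eta> / 2) *\<^sub>R (0, 0, 1)"
    \<comment> \<open>Since \<open>w\<close> is a polynomial of degree two, the lift of a straight
      line to its graph is exactly this parabola, without remainder.\<close>
    have g: "?\<gamma> s = j (t0 + s * a, x0 + s * c)" for s
      by (simp add: P_def E \<eta> j_def w_def power2_eq_square) (simp add: field_simps)
    note curve = second_order_curve[OF open_dom _ P, where E = E and Z = "(0, 0, 1)" and \<eta> = \<eta>]
    have "open ((\<lambda>s. (t0 + s * a, x0 + s * c)) -` W)"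
      by (intro open_vimage W(1) continuous_intros)
    then have "\<forall>\<^sub>F s in nhds 0. s \<in> ((\<lambda>s. (t0 + s * a, x0 + s * c)) -` W)"
      by (rule eventually_nhds_in_open) (use W(3) in \<open>simp add: p0_def\<close>)
    then have eq: "\<forall>\<^sub>F s in nhds 0. w' (T (?\<gamma> s), X (?\<gamma> s)) = U (?\<gamma> s)"
    proof (rule eventually_mono)
      fix s assume "s \<in> ((\<lambda>s. (t0 + s * a, x0 + s * c)) -` W)"
      then have "(t0 + s * a, x0 + s * c) \<in> W" by simp
      from w'g[OF this] show "w' (T (?\<gamma> s), X (?\<gamma> s)) = U (?\<gamma> s)" by (simp only: g g_def)
    qed
    have g0: "?\<gamma> 0 = P" by (simp flip: zero_prod_def)
    show ?thesis
      using second_derivative_along_curve[OF W(4) smw' _ curve(1,2)[OF smooth_T] curve(1,2)[OF smooth_X]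
          curve(1,2)[OF smooth_U] eq] gV T0 by (simp flip: zero_prod_def)
  qed
  show ?thesis
    by (rule exI[of _ "dd w' (1, 0) (T P, X P)"], rule exI[of _ "dd w' (0, 1) (T P, X P)"],
        rule exI[of _ "dd (dd w' (0, 1)) (0, 1) (T P, X P)"])
      (use main first second in \<open>auto simp: Let_def\<close>)
qed

text \<open>The jet now lies on the source equation, so its image lies on the target equation. The
  mixed derivative is set to zero, while \<open>\<alpha>\<close>, on which the equation imposes
  nothing, stays a parameter.\<close>

lemma prolongation:
  fixes t0 x0 u0 vt vx \<alpha> \<gamma> :: real
  assumes P: "P = (t0, x0, u0)" "P \<in> dom \<Phi>"
    and det: "dd T (1, 0, vt) P * dd X (0, 1, vx) P - dd T (0, 1, vx) P * dd X (1, 0, vt) P \<noteq> 0"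
    and eq: "vt = \<gamma> + the (C x0) * u0"
  obtains p r q where "p = r + the (C' (X P)) * U P"
    "\<And>a c. p * dd T (a, c, a * vt + c * vx) P + q * dd X (a, c, a * vt + c * vx) P = dd U (a, c, a * vt + c * vx) P"
    "\<And>a c E \<eta>. E = (a, c, a * vt + c * vx) \<Longrightarrow> \<eta> = \<alpha> * a\<^sup>2 + \<gamma> * c\<^sup>2 \<Longrightarrow> dd T E P = 0 \<Longrightarrow>
       dd (dd U E) E P + \<eta> * dd U (0, 0, 1) P = r * (dd X E P)\<^sup>2
          + p * (dd (dd T E) E P + \<eta> * dd T (0, 0, 1) P)
          + q * (dd (dd X E) E P + \<eta> * dd X (0, 0, 1) P)"
proof -
  from prolongation_aux[of t0 x0 u0 vt vx \<gamma> \<alpha> 0, folded P(1), OF P(2) det]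
  obtain p q r where pqr: "vt = \<gamma> + the (C x0) * u0 \<longleftrightarrow> p = r + the (C' (X P)) * U P"
    "\<forall>a c. p * dd T (a, c, a * vt + c * vx) P + q * dd X (a, c, a * vt + c * vx) P = dd U (a, c, a * vt + c * vx) P"
    and second: "\<forall>a c. let E = (a, c, a * vt + c * vx); \<eta> = \<alpha> * a\<^sup>2 + 2 * 0 * a * c + \<gamma> * c\<^sup>2 in
        dd T E P = 0 \<longrightarrow>
        dd (dd U E) E P + \<eta> * dd U (0, 0, 1) P = r * (dd X E P)\<^sup>2
          + p * (dd (dd T E) E P + \<eta> * dd T (0, 0, 1) P)
          + q * (dd (dd X E) E P + \<eta> * dd X (0, 0, 1) P)"
    by (elim exE conjE)
  show thesis
  proof (rule that[of p r q])
    show "p = r + the (C' (X P)) * U P" using pqr(1) eq by blast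
    show "p * dd T (a, c, a * vt + c * vx) P + q * dd X (a, c, a * vt + c * vx) P = dd U (a, c, a * vt + c * vx) P" for a c
      using pqr(2) by blast
    show "dd (dd U E) E P + \<eta> * dd U (0, 0, 1) P = r * (dd X E P)\<^sup>2
          + p * (dd (dd T E) E P + \<eta> * dd T (0, 0, 1) P)
          + q * (dd (dd X E) E P + \<eta> * dd X (0, 0, 1) P)"
      if "E = (a, c, a * vt + c * vx)" "\<eta> = \<alpha> * a\<^sup>2 + \<gamma> * c\<^sup>2" "dd T E P = 0" for a c E \<eta>
      using second[rule_format, of a c] that unfolding Let_def by simp
  qed
qed

lemma derivative_surjective:
  assumes P: "P \<in> dom \<Phi>"
  obtains v where "dd T v P = y1" "dd X v P = y2" "dd U v P = y3"
proof -
  note lin = dd_linear[OF smooth_on_differentiable[OF smooth_T P]]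
    dd_linear[OF smooth_on_differentiable[OF smooth_X P]]
    dd_linear[OF smooth_on_differentiable[OF smooth_U P]]
  let ?L = "\<lambda>v. (dd T v P, dd X v P, dd U v P)"
  have L: "linear ?L"
    by (rule linearI) (simp_all add: linear_add[OF lin(1)] linear_add[OF lin(2)] linear_add[OF lin(3)]
      linear_scale[OF lin(1)] linear_scale[OF lin(2)] linear_scale[OF lin(3)])
  have "inj ?L" unfolding linear_injective_0[OF L]
    using derivative_injective[OF P] by (simp add: zero_prod_def)
  then have "surj ?L" by (rule linear_injective_imp_surjective[OF L]) simp
  then obtain v where "(y1, y2, y3) = ?L v" by (rule surjE)
  then show thesis using that by simp
qed

lemma dd_triple:
  fixes F :: "pt \<Rightarrow> real"
  assumes "F differentiable (at P)"
  shows "dd F (a, b, c) P = a * dd F (1, 0, 0) P + b * dd F (0, 1, 0) P + c * dd F (0, 0, 1) P"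
proof -
  have "(a, b, c) = a *\<^sub>R (1, 0, 0) + b *\<^sub>R (0, 1, 0) + c *\<^sub>R (0, 0, 1)" by simp
  then have "dd F (a, b, c) P = dd F (a *\<^sub>R (1, 0, 0) + b *\<^sub>R (0, 1, 0) + c *\<^sub>R (0, 0, 1)) P" by (rule arg_cong)
  also have "\<dots> = a * dd F (1, 0, 0) P + b * dd F (0, 1, 0) P + c * dd F (0, 0, 1) P"
    by (simp only: linear_add[OF dd_linear[OF assms]] linear_scale[OF dd_linear[OF assms]] real_scaleR_def)
  finally show ?thesis .
qed

lemma dd_T: "P \<in> dom \<Phi> \<Longrightarrow> dd T (a, b, c) P = a * dd T (1, 0, 0) P + b * dd T (0, 1, 0) P + c * dd T (0, 0, 1) P"
  and dd_X: "P \<in> dom \<Phi> \<Longrightarrow> dd X (a, b, c) P = a * dd X (1, 0, 0) P + b * dd X (0, 1, 0) P + c * dd X (0, 0, 1) P"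
  and dd_U: "P \<in> dom \<Phi> \<Longrightarrow> dd U (a, b, c) P = a * dd U (1, 0, 0) P + b * dd U (0, 1, 0) P + c * dd U (0, 0, 1) P"
  by (rule dd_triple, rule smooth_on_differentiable, rule smooth_T smooth_X smooth_U, assumption)+

text \<open>The equation does not restrict \<open>u\<^sub>t\<^sub>t\<close>. Varying it while the first jet is fixed shows
  \<open>D\<^sub>x T = 0\<close> for every first jet at which the transformed variables are admissible coordinates.\<close>

lemma time_depends_on_time_only:
  assumes P: "P \<in> dom \<Phi>"
  shows "dd T (0, 1, 0) P = 0" "dd T (0, 0, 1) P = 0"
proof -
  obtain t0 x0 u0 where P_eq: "P = (t0, x0, u0)" by (cases P)
  define Tt Tx Tu where "Tt = dd T (1, 0, 0) P" and "Tx = dd T (0, 1, 0) P" and "Tu = dd T (0, 0, 1) P"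
  define Xt Xx Xu where "Xt = dd X (1, 0, 0) P" and "Xx = dd X (0, 1, 0) P" and "Xu = dd X (0, 0, 1) P"
  have T: "dd T (a, b, c) P = a * Tt + b * Tx + c * Tu" for a b c
    using dd_T[OF P, of a b c] by (simp only: Tt_def Tx_def Tu_def)
  have X: "dd X (a, b, c) P = a * Xt + b * Xx + c * Xu" for a b c
    using dd_X[OF P, of a b c] by (simp only: Xt_def Xx_def Xu_def)
  define Ut Ux Uu where "Ut = dd U (1, 0, 0) P" and "Ux = dd U (0, 1, 0) P" and "Uu = dd U (0, 0, 1) P"
  have U: "dd U (a, b, c) P = a * Ut + b * Ux + c * Uu" for a b c
    using dd_U[OF P, of a b c] by (simp only: Ut_def Ux_def Uu_def)
  have key: "Tx + Tu * vx = 0"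
    if det: "(Tt + Tu * vt) * (Xx + Xu * vx) - (Tx + Tu * vx) * (Xt + Xu * vt) \<noteq> 0" for vt vx
  proof -
    have det': "dd T (1, 0, vt) P * dd X (0, 1, vx) P - dd T (0, 1, vx) P * dd X (1, 0, vt) P \<noteq> 0"
      using det by (simp add: T X mult.commute)
    define \<gamma> where "\<gamma> = vt - the (C x0) * u0"
    then have eq: "vt = \<gamma> + the (C x0) * u0" by simp
    \<comment> \<open>The base direction, unique up to scaling, along which the total derivative of
      \<open>T\<close> vanishes: \<open>a\<close> is minus the total \<open>x\<close>-derivative and
      \<open>c\<close> the total \<open>t\<close>-derivative.\<close>
    define a c where "a = - (Tx + Tu * vx)" and "c = Tt + Tu * vt"
    define E where "E = (a, c, a * vt + c * vx)"
    have TE: "dd T E P = 0" by (simp add: E_def T a_def c_def algebra_simps)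
    obtain p r q where 1: "p = r + the (C' (X P)) * U P"
      "\<And>a c. p * dd T (a, c, a * vt + c * vx) P + q * dd X (a, c, a * vt + c * vx) P = dd U (a, c, a * vt + c * vx) P"
      "\<And>a c E \<eta>. E = (a, c, a * vt + c * vx) \<Longrightarrow> \<eta> = 0 * a\<^sup>2 + \<gamma> * c\<^sup>2 \<Longrightarrow> dd T E P = 0 \<Longrightarrow>
       dd (dd U E) E P + \<eta> * dd U (0, 0, 1) P = r * (dd X E P)\<^sup>2
          + p * (dd (dd T E) E P + \<eta> * dd T (0, 0, 1) P)
          + q * (dd (dd X E) E P + \<eta> * dd X (0, 0, 1) P)"
      by (rule prolongation[where \<alpha> = 0, OF P_eq P det' eq]) (rule that; assumption)
    obtain p' r' q' where 2: "p' = r' + the (C' (X P)) * U P"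
      "\<And>a c. p' * dd T (a, c, a * vt + c * vx) P + q' * dd X (a, c, a * vt + c * vx) P = dd U (a, c, a * vt + c * vx) P"
      "\<And>a c E \<eta>. E = (a, c, a * vt + c * vx) \<Longrightarrow> \<eta> = 1 * a\<^sup>2 + \<gamma> * c\<^sup>2 \<Longrightarrow> dd T E P = 0 \<Longrightarrow>
       dd (dd U E) E P + \<eta> * dd U (0, 0, 1) P = r' * (dd X E P)\<^sup>2
          + p' * (dd (dd T E) E P + \<eta> * dd T (0, 0, 1) P)
          + q' * (dd (dd X E) E P + \<eta> * dd X (0, 0, 1) P)"
      by (rule prolongation[where \<alpha> = 1, OF P_eq P det' eq]) (rule that; assumption)
    note second = 1(3)[OF E_def refl TE] 2(3)[OF E_def refl TE]
    have e1: "(p - p') * (Tt + Tu * vt) + (q - q') * (Xt + Xu * vt) = 0"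
      using 1(2)[of 1 0] 2(2)[of 1 0] by (simp add: T X algebra_simps)
    have e2: "(p - p') * (Tx + Tu * vx) + (q - q') * (Xx + Xu * vx) = 0"
      using 1(2)[of 0 1] 2(2)[of 0 1] by (simp add: T X algebra_simps)
    have "(p - p') * ((Tt + Tu * vt) * (Xx + Xu * vx) - (Tx + Tu * vx) * (Xt + Xu * vt)) = 0"
      "(q - q') * ((Tt + Tu * vt) * (Xx + Xu * vx) - (Tx + Tu * vx) * (Xt + Xu * vt)) = 0"
      using e1 e2 by algebra+
    then have pq: "p' = p" "q' = q" using det by auto
    then have "r' = r" using 1(1) 2(1) by simp
    then have "a\<^sup>2 * (dd U (0, 0, 1) P - p * dd T (0, 0, 1) P - q * dd X (0, 0, 1) P) = 0"
      using second pq by (simp add: algebra_simps)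
    \<comment> \<open>Otherwise the differential of \<open>U\<close> would be a linear combination
      of those of \<open>T\<close> and \<open>X\<close>, contradicting surjectivity of the
      derivative of \<open>\<Phi>\<close>.\<close>
    moreover have "dd U (0, 0, 1) P - p * dd T (0, 0, 1) P - q * dd X (0, 0, 1) P \<noteq> 0"
    proof
      assume K: "dd U (0, 0, 1) P - p * dd T (0, 0, 1) P - q * dd X (0, 0, 1) P = 0"
      obtain v where v: "dd T v P = 0" "dd X v P = 0" "dd U v P = 1"
        using derivative_surjective[OF P, of 0 0 1] by blast
      obtain a b c where veq: "v = (a, b, c)" by (cases v)
      have "dd U v P = p * dd T v P + q * dd X v P"
        using 1(2)[of 1 0] 1(2)[of 0 1] K unfolding veq T X U by algebra
      then show False using v by simp
    qed
    ultimately show ?thesis by (simp add: a_def)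
  qed
  have "Tx = 0 \<and> Tu = 0"
  proof (rule ccontr)
    assume neg: "\<not> (Tx = 0 \<and> Tu = 0)"
    \<comment> \<open>Wherever the determinant is nonzero, \<open>key\<close> applies, so the
      product vanishes for all \<open>vt\<close> and \<open>vx\<close>. The bilinear terms of the
      determinant cancel: it is affine in \<open>vt\<close>, \<open>vx\<close>, and its coefficients
      are the 2 by 2 minors of the differentials of \<open>T\<close> and \<open>X\<close>, up to
      sign.\<close>
    have z: "(Tx + Tu * vx) * ((Tt * Xx - Tx * Xt) + vx * (Tt * Xu - Tu * Xt) + vt * (Tu * Xx - Tx * Xu)) = 0" for vt vx
    proof (cases "Tx + Tu * vx = 0")
      case False
      then have "(Tt + Tu * vt) * (Xx + Xu * vx) - (Tx + Tu * vx) * (Xt + Xu * vt) = 0" using key by blast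
      then show ?thesis by algebra
    qed simp
    \<comment> \<open>If \<open>Tx\<close> and \<open>Tu\<close> are not both zero, two values of
      \<open>vx\<close> keep the first factor nonzero. This is enough to annihilate all minors,
      which the independence of the differentials of \<open>T\<close> and \<open>X\<close>
      forbids.\<close>
    have M: "Tu * Xx - Tx * Xu = 0 \<and> Tt * Xx - Tx * Xt = 0 \<and> Tt * Xu - Tu * Xt = 0"
    proof -
      obtain k1 k2 where k: "k1 \<noteq> k2" "Tx + Tu * k1 \<noteq> 0" "Tx + Tu * k2 \<noteq> 0"
      proof (cases "Tu = 0")
        case True
        then show ?thesis using neg that[of 0 1] by auto
      next
        case False
        then show ?thesis using that[of "(1 - Tx) / Tu" "(2 - Tx) / Tu"] by (auto simp: field_simps)
      qed
      have "(Tt * Xx - Tx * Xt) + k * (Tt * Xu - Tu * Xt) + vt * (Tu * Xx - Tx * Xu) = 0" if "k = k1 \<or> k = k2" for k vt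
        using z[of k vt] k that by auto
      from this[of k1 0] this[of k1 1] this[of k2 0]
      have "Tu * Xx - Tx * Xu = 0" "(k1 - k2) * (Tt * Xu - Tu * Xt) = 0"
        "(Tt * Xx - Tx * Xt) + k1 * (Tt * Xu - Tu * Xt) = 0" by (simp_all add: algebra_simps)
      then show ?thesis using k(1) by auto
    qed
    obtain v where v: "dd T v P = 1" "dd X v P = 0"
      using derivative_surjective[OF P, of 1 0 0] by blast
    obtain w where w: "dd T w P = 0" "dd X w P = 1"
      using derivative_surjective[OF P, of 0 1 0] by blast
    obtain a1 b1 c1 a2 b2 c2 where vw: "v = (a1, b1, c1)" "w = (a2, b2, c2)" by (cases v, cases w)
    have "dd T v P * dd X w P - dd T w P * dd X v P = 0"
      using M unfolding vw T X by algebra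
    then show False using v w by simp
  qed
  then show "dd T (0, 1, 0) P = 0" "dd T (0, 0, 1) P = 0" by (simp_all add: Tx_def Tu_def)
qed

end

subsection \<open>Linear germs\<close>

text \<open>The germ stands for \<open>t' = tm t\<close>, \<open>x' = sc t * x + sh t\<close>, \<open>u' = fa (t, x) * u\<close>; \<open>sc1\<close> and \<open>sh1\<close> are
  the derivatives of \<open>sc\<close> and \<open>sh\<close>.\<close>

datatype germ = Germ (tm: "real \<Rightarrow> real") (sc: "real \<Rightarrow> real") (sc1: "real \<Rightarrow> real")
  (sh: "real \<Rightarrow> real") (sh1: "real \<Rightarrow> real") (fa: "real \<times> real \<Rightarrow> real")

definition gmap :: "germ \<Rightarrow> pt \<Rightarrow> pt" where
  "gmap d = (\<lambda>(t, x, u). (tm d t, sc d t * x + sh d t, fa d (t, x) * u))"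

definition slope :: "germ \<Rightarrow> real \<Rightarrow> real \<Rightarrow> real" where
  "slope d t x = - (sc1 d t * x + sh1 d t) / (2 * sc d t)"

definition rate :: "(real \<Rightarrow> real) \<Rightarrow> germ \<Rightarrow> (real \<Rightarrow> real) \<Rightarrow> real \<Rightarrow> real \<Rightarrow> real" where
  "rate c d c' t x = (sc d t)\<^sup>2 * c' (sc d t * x + sh d t) - c x - (slope d t x)\<^sup>2 - sc1 d t / (2 * sc d t)"

text \<open>These first-order conditions say that \<open>gmap d\<close> intertwines the operators
  \<open>\<partial>\<^sub>t - \<partial>\<^sub>x\<partial>\<^sub>x - c\<close> and \<open>\<partial>\<^sub>t - \<partial>\<^sub>x\<partial>\<^sub>x - c'\<close>.\<close>

definition germ_at :: "(real \<Rightarrow> real) \<Rightarrow> germ \<Rightarrow> (real \<Rightarrow> real) \<Rightarrow> real \<Rightarrow> real \<Rightarrow> bool" where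
  "germ_at c d c' t x \<longleftrightarrow>
     (tm d has_real_derivative (sc d t)\<^sup>2) (at t) \<and> sc d t \<noteq> 0 \<and>
     (sc d has_real_derivative sc1 d t) (at t) \<and> (sh d has_real_derivative sh1 d t) (at t) \<and>
     sc1 d differentiable (at t) \<and> sh1 d differentiable (at t) \<and> fa d (t, x) \<noteq> 0 \<and>
     (fa d has_derivative (\<lambda>(a, b). fa d (t, x) * (a * rate c d c' t x + b * slope d t x))) (at (t, x))"

lemma dd_cong:
  assumes "open S" "P \<in> S" "\<And>p. p \<in> S \<Longrightarrow> f p = g p"
  shows "dd f v P = dd g v P"
proof -
  have "(f has_derivative D) (at P) \<longleftrightarrow> (g has_derivative D) (at P)" for D
    using has_derivative_transform_within_open[OF _ assms(1,2), of f D UNIV g]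
      has_derivative_transform_within_open[OF _ assms(1,2), of g D UNIV f] assms(3) by auto
  then show ?thesis by (simp add: frechet_derivative_def)
qed

lemma dd_add:
  fixes f g :: "'a::euclidean_space \<Rightarrow> real"
  assumes "f differentiable (at P)" "g differentiable (at P)"
  shows "dd (\<lambda>p. f p + g p) v P = dd f v P + dd g v P"
  using fun_cong[OF frechet_derivative_at[OF has_derivative_add[OF
      frechet_derivative_works[THEN iffD1, OF assms(1)] frechet_derivative_works[THEN iffD1, OF assms(2)]]], of v]
  by simp

lemma dd_mult:
  fixes f g :: "'a::euclidean_space \<Rightarrow> real"
  assumes "f differentiable (at P)" "g differentiable (at P)"
  shows "dd (\<lambda>p. f p * g p) v P = dd f v P * g P + f P * dd g v P"
  using fun_cong[OF frechet_derivative_at[OF has_derivative_mult[OF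
      frechet_derivative_works[THEN iffD1, OF assms(1)] frechet_derivative_works[THEN iffD1, OF assms(2)]]], of v]
  by (simp add: algebra_simps)

lemma dd_affine:
  fixes A B :: "real \<times> real \<Rightarrow> real"
  assumes S: "open S" "(t, x, u) \<in> S"
    and A: "A differentiable (at (t, x))" and B: "B differentiable (at (t, x))"
    and F: "\<And>t x u. (t, x, u) \<in> S \<Longrightarrow> F (t, x, u) = A (t, x) * u + B (t, x)"
  shows "dd F (a, b, c) (t, x, u) = dd A (a, b) (t, x) * u + dd B (a, b) (t, x) + A (t, x) * c"
proof -
  let ?\<pi> = "\<lambda>p::pt. (fst p, fst (snd p))"
  have pi: "(?\<pi> has_derivative (\<lambda>v. (fst v, fst (snd v)))) (at (t, x, u))"
    by (auto intro!: derivative_eq_intros)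
  have dA: "((\<lambda>p. A (?\<pi> p)) has_derivative (\<lambda>v. dd A (fst v, fst (snd v)) (t, x))) (at (t, x, u))"
    by (rule has_derivative_compose[OF pi]) (use A in \<open>simp add: frechet_derivative_works\<close>)
  have dB: "((\<lambda>p. B (?\<pi> p)) has_derivative (\<lambda>v. dd B (fst v, fst (snd v)) (t, x))) (at (t, x, u))"
    by (rule has_derivative_compose[OF pi]) (use B in \<open>simp add: frechet_derivative_works\<close>)
  have d3: "((\<lambda>p::pt. snd (snd p)) has_derivative (\<lambda>v. snd (snd v))) (at (t, x, u))"
    by (auto intro!: derivative_eq_intros)
  have "dd F (a, b, c) (t, x, u) = dd (\<lambda>p. A (?\<pi> p) * snd (snd p) + B (?\<pi> p)) (a, b, c) (t, x, u)"
    by (rule dd_cong[OF S]) (use F in auto)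
  also have "\<dots> = dd A (a, b) (t, x) * u + dd B (a, b) (t, x) + A (t, x) * c"
    using fun_cong[OF frechet_derivative_at[OF has_derivative_add[OF has_derivative_mult[OF dA d3] dB]], of "(a, b, c)"]
    by simp
  finally show ?thesis .
qed

lemma open_box:
  fixes t0 x0 u0 :: real
  assumes "open S" "(t0, x0, u0) \<in> S"
  obtains e where "e > 0" "{t0 - e<..<t0 + e} \<times> {x0 - e<..<x0 + e} \<times> {u0 - e<..<u0 + e} \<subseteq> S"
proof -
  obtain A B where AB: "open A" "open B" "(t0, x0, u0) \<in> A \<times> B" "A \<times> B \<subseteq> S"
    by (rule open_prod_elim[OF assms])
  then have A: "open A" "t0 \<in> A" and B: "open B" "(x0, u0) \<in> B" "A \<times> B \<subseteq> S" by simp_all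
  obtain D E where DE: "open D" "open E" "(x0, u0) \<in> D \<times> E" "D \<times> E \<subseteq> B"
    by (rule open_prod_elim[OF B(1,2)])
  then have D: "open D" "x0 \<in> D" and E: "open E" "u0 \<in> E" "D \<times> E \<subseteq> B" by simp_all
  obtain e1 where e1: "e1 > 0" "ball t0 e1 \<subseteq> A" by (rule openE[OF A])
  obtain e2 where e2: "e2 > 0" "ball x0 e2 \<subseteq> D" by (rule openE[OF D])
  obtain e3 where e3: "e3 > 0" "ball u0 e3 \<subseteq> E" by (rule openE[OF E(1,2)])
  note e = e1 e2 e3
  define e where "e = min e1 (min e2 e3)"
  have "{t0 - e<..<t0 + e} \<times> {x0 - e<..<x0 + e} \<times> {u0 - e<..<u0 + e} \<subseteq> A \<times> D \<times> E"
  proof (intro Sigma_mono)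
    show "{t0 - e<..<t0 + e} \<subseteq> A"
      by (rule subset_trans[OF _ e(2)]) (auto simp: ball_eq_greaterThanLessThan e_def)
    show "{x0 - e<..<x0 + e} \<subseteq> D"
      by (rule subset_trans[OF _ e(4)]) (auto simp: ball_eq_greaterThanLessThan e_def)
    show "{u0 - e<..<u0 + e} \<subseteq> E"
      by (rule subset_trans[OF _ e(6)]) (auto simp: ball_eq_greaterThanLessThan e_def)
  qed
  also have "\<dots> \<subseteq> A \<times> B" by (rule Sigma_mono[OF subset_refl E(3)])
  also have "\<dots> \<subseteq> S" by (rule B(3))
  finally show thesis using that[of e] e by (simp add: e_def)
qed

context admissible_transformation
begin

lemma dd_T_time_nonzero:
  assumes P: "P \<in> dom \<Phi>"
  shows "dd T (1, 0, 0) P \<noteq> 0"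
proof
  assume z: "dd T (1, 0, 0) P = 0"
  obtain v where v: "dd T v P = 1" using derivative_surjective[OF P, of 1 0 0] by blast
  obtain a b c where "v = (a, b, c)" by (cases v)
  then show False using v dd_T[OF P, of a b c] z time_depends_on_time_only[OF P] by simp
qed

lemma time_second: "P \<in> dom \<Phi> \<Longrightarrow> dd (dd T (0, b, c)) v P = 0"
proof -
  assume P: "P \<in> dom \<Phi>"
  have "dd (dd T (0, b, c)) v P = dd (\<lambda>_. 0 :: real) v P"
  proof (rule dd_cong[OF open_dom P])
    show "dd T (0, b, c) p = 0" if "p \<in> dom \<Phi>" for p
      using dd_T[OF that, of 0 b c] time_depends_on_time_only[OF that] by simp
  qed
  then show ?thesis by (simp add: frechet_derivative_const)
qed

text \<open>Since \<open>T\<close> depends on \<open>t\<close> only, the direction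
  \<open>(0, 1, vx)\<close> is stationary for it. The derivative \<open>vt\<close> is free once
  \<open>\<gamma>\<close> is adjusted to the equation, so the prolonged equation is affine in
  \<open>vt\<close> and splits into its slope, the first conclusion, and its value at 0, the
  second.\<close>

lemma second_stage:
  assumes P_eq: "P = (t0, x0, u0)" and P: "P \<in> dom \<Phi>"
    and Y: "dd X (0, 1, 0) P + dd X (0, 0, 1) P * vx \<noteq> 0"
  defines "q \<equiv> (dd U (0, 1, 0) P + dd U (0, 0, 1) P * vx) / (dd X (0, 1, 0) P + dd X (0, 0, 1) P * vx)"
  shows "(dd X (0, 1, 0) P + dd X (0, 0, 1) P * vx)\<^sup>2 = dd T (1, 0, 0) P"
    and "dd (dd U (0, 1, vx)) (0, 1, vx) P - the (C x0) * u0 * (dd U (0, 0, 1) P - q * dd X (0, 0, 1) P) =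
      dd U (1, 0, 0) P - q * dd X (1, 0, 0) P - dd T (1, 0, 0) P * the (C' (X P)) * U P
      + q * dd (dd X (0, 1, vx)) (0, 1, vx) P"
proof -
  define Tt where "Tt = dd T (1, 0, 0) P"
  define Xt Xx Xu where "Xt = dd X (1, 0, 0) P" and "Xx = dd X (0, 1, 0) P" and "Xu = dd X (0, 0, 1) P"
  define Ut Ux Uu where "Ut = dd U (1, 0, 0) P" and "Ux = dd U (0, 1, 0) P" and "Uu = dd U (0, 0, 1) P"
  define U2 X2 where "U2 = dd (dd U (0, 1, vx)) (0, 1, vx) P" and "X2 = dd (dd X (0, 1, vx)) (0, 1, vx) P"
  have T: "dd T (a, b, c) P = a * Tt" for a b c
    using dd_T[OF P, of a b c] time_depends_on_time_only[OF P] by (simp add: Tt_def)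
  have X: "dd X (a, b, c) P = a * Xt + b * Xx + c * Xu" for a b c
    using dd_X[OF P, of a b c] by (simp only: Xt_def Xx_def Xu_def)
  have U: "dd U (a, b, c) P = a * Ut + b * Ux + c * Uu" for a b c
    using dd_U[OF P, of a b c] by (simp only: Ut_def Ux_def Uu_def)
  have Tt: "Tt \<noteq> 0" using dd_T_time_nonzero[OF P] by (simp add: Tt_def)
  define Y where "Y = Xx + Xu * vx"
  have Y0: "Y \<noteq> 0" using assms(3) by (simp add: Y_def Xx_def Xu_def)
  have q: "q = (Ux + Uu * vx) / Y" by (simp add: q_def Y_def Xx_def Xu_def Ux_def Uu_def)
  \<comment> \<open>The prolonged equation with \<open>p\<close> and \<open>r\<close> eliminated; it
    holds for every \<open>vt\<close>.\<close>
  have main: "(U2 + (vt - the (C x0) * u0) * (Uu - q * Xu)) * Tt =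
      (Ut + Uu * vt - q * (Xt + Xu * vt) - Tt * the (C' (X P)) * U P) * Y\<^sup>2 + q * X2 * Tt" for vt
  proof -
    have det: "dd T (1, 0, vt) P * dd X (0, 1, vx) P - dd T (0, 1, vx) P * dd X (1, 0, vt) P \<noteq> 0"
      using Tt Y0 by (simp add: T X Y_def mult.commute)
    have eq: "vt = (vt - the (C x0) * u0) + the (C x0) * u0" by simp
    obtain p r q' where pr: "p = r + the (C' (X P)) * U P"
      "\<And>a c. p * dd T (a, c, a * vt + c * vx) P + q' * dd X (a, c, a * vt + c * vx) P = dd U (a, c, a * vt + c * vx) P"
      "\<And>a c E \<eta>. E = (a, c, a * vt + c * vx) \<Longrightarrow> \<eta> = 0 * a\<^sup>2 + (vt - the (C x0) * u0) * c\<^sup>2 \<Longrightarrow> dd T E P = 0 \<Longrightarrow>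
       dd (dd U E) E P + \<eta> * dd U (0, 0, 1) P = r * (dd X E P)\<^sup>2
          + p * (dd (dd T E) E P + \<eta> * dd T (0, 0, 1) P)
          + q' * (dd (dd X E) E P + \<eta> * dd X (0, 0, 1) P)"
      by (rule prolongation[where \<alpha> = 0, OF P_eq P det eq]) (rule that; assumption)
    have "q' * Y = Ux + Uu * vx" using pr(2)[of 0 1] by (simp add: T X U Y_def mult.commute)
    then have q': "q' = q" using Y0 by (simp add: q field_simps)
    have pt: "p * Tt + q * (Xt + Xu * vt) = Ut + Uu * vt"
      using pr(2)[of 1 0] by (simp add: T X U q' mult.commute)
    have "U2 + (vt - the (C x0) * u0) * Uu = r * Y\<^sup>2 + q * (X2 + (vt - the (C x0) * u0) * Xu)"
      using pr(3)[of "(0, 1, vx)" 0 1 "vt - the (C x0) * u0"] time_second[OF P]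
      by (simp add: T X U q' U2_def X2_def Y_def mult.commute[of Xu])
    with pr(1) pt show ?thesis by algebra
  qed
  \<comment> \<open>Along directions with zero \<open>T\<close>-component, \<open>dd U\<close> would
    otherwise be \<open>q\<close> times \<open>dd X\<close>, although some such direction has
    \<open>X\<close>-component 0 and \<open>U\<close>-component 1.\<close>
  have K: "Uu - q * Xu \<noteq> 0"
  proof
    assume K: "Uu - q * Xu = 0"
    obtain v where v: "dd T v P = 0" "dd X v P = 0" "dd U v P = 1"
      using derivative_surjective[OF P, of 0 0 1] by blast
    obtain a b c where veq: "v = (a, b, c)" by (cases v)
    have a0: "a = 0" using v(1) Tt unfolding veq T by simp
    have "q * Y = Ux + Uu * vx" using Y0 by (simp add: q)
    then have "b * Ux + c * Uu = q * (b * Xx + c * Xu)" using K unfolding Y_def by algebra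
    then show False using v(2,3) unfolding veq X U a0 by simp
  qed
  have "(Uu - q * Xu) * (Tt - Y\<^sup>2) = 0"
    using main[of 0] main[of 1] by (simp add: algebra_simps)
  then have YT: "Y\<^sup>2 = Tt" using K by simp
  then show "(dd X (0, 1, 0) P + dd X (0, 0, 1) P * vx)\<^sup>2 = dd T (1, 0, 0) P"
    by (simp add: Y_def Xx_def Xu_def Tt_def)
  have "(U2 - the (C x0) * u0 * (Uu - q * Xu)) * Tt = (Ut - q * Xt - Tt * the (C' (X P)) * U P + q * X2) * Tt"
    using main[of 0] by (simp add: YT algebra_simps)
  then have "U2 - the (C x0) * u0 * (Uu - q * Xu) = Ut - q * Xt - Tt * the (C' (X P)) * U P + q * X2"
    using Tt by simp
  then show "dd (dd U (0, 1, vx)) (0, 1, vx) P - the (C x0) * u0 * (dd U (0, 0, 1) P - q * dd X (0, 0, 1) P) =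
      dd U (1, 0, 0) P - q * dd X (1, 0, 0) P - dd T (1, 0, 0) P * the (C' (X P)) * U P
      + q * dd (dd X (0, 1, vx)) (0, 1, vx) P"
    by (simp add: U2_def X2_def Tt_def Ut_def Uu_def Xt_def Xu_def)
qed

text \<open>If \<open>X\<close> depended on \<open>u\<close>, its total \<open>x\<close>-derivative
  would be a nonconstant affine function of \<open>vx\<close>, while its square is fixed wherever it
  is nonzero. The values 1 and 2 already give a contradiction.\<close>

lemma space_independent_of_u:
  assumes P: "P \<in> dom \<Phi>"
  shows "dd X (0, 0, 1) P = 0" "dd X (0, 1, 0) P \<noteq> 0" "(dd X (0, 1, 0) P)\<^sup>2 = dd T (1, 0, 0) P"
proof -
  obtain t0 x0 u0 where P_eq: "P = (t0, x0, u0)" by (cases P)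
  note st = second_stage(1)[OF P_eq P]
  show Xu: "dd X (0, 0, 1) P = 0"
  proof (rule ccontr)
    assume n: "dd X (0, 0, 1) P \<noteq> 0"
    have "dd X (0, 1, 0) P + dd X (0, 0, 1) P * ((k - dd X (0, 1, 0) P) / dd X (0, 0, 1) P) = k" for k
      using n by simp
    with st[of "(1 - dd X (0, 1, 0) P) / dd X (0, 0, 1) P"] st[of "(2 - dd X (0, 1, 0) P) / dd X (0, 0, 1) P"]
    show False by simp
  qed
  show nz: "dd X (0, 1, 0) P \<noteq> 0"
  proof
    assume z: "dd X (0, 1, 0) P = 0"
    obtain v where v: "dd T v P = 0" "dd X v P = 1" using derivative_surjective[OF P, of 0 1 0] by blast
    obtain a b c where veq: "v = (a, b, c)" by (cases v)
    have "a * dd T (1, 0, 0) P = 0" using v(1) dd_T[OF P, of a b c] time_depends_on_time_only[OF P] by (simp add: veq)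
    then have "a = 0" using dd_T_time_nonzero[OF P] by simp
    then show False using v(2) dd_X[OF P, of a b c] Xu z by (simp add: veq)
  qed
  show "(dd X (0, 1, 0) P)\<^sup>2 = dd T (1, 0, 0) P" using st[of 0] nz by simp
qed

lemma dd_U_nonzero:
  assumes P: "P \<in> dom \<Phi>"
  shows "dd U (0, 0, 1) P \<noteq> 0"
  using derivative_injective[OF P, of "(0, 0, 1)"] time_depends_on_time_only[OF P] space_independent_of_u[OF P]
  by (auto simp: zero_prod_def)

lemma dd2_expand:
  fixes F :: "pt \<Rightarrow> real"
  assumes F: "smooth_on F (dom \<Phi>)" and P: "P \<in> dom \<Phi>"
  shows "dd (dd F (0, 1, v)) (0, 1, v) P = dd (dd F (0, 1, 0)) (0, 1, 0) P
    + v * (dd (dd F (0, 1, 0)) (0, 0, 1) P + dd (dd F (0, 0, 1)) (0, 1, 0) P) + v\<^sup>2 * dd (dd F (0, 0, 1)) (0, 0, 1) P"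
proof -
  have d: "dd F e differentiable (at P)" for e
    by (rule smooth_on_differentiable[OF smooth_on_dd[OF F] P])
  have "dd (dd F (0, 1, v)) (0, 1, v) P = dd (\<lambda>p. dd F (0, 1, 0) p + v * dd F (0, 0, 1) p) (0, 1, v) P"
    by (rule dd_cong[OF open_dom P]) (use dd_triple[OF smooth_on_differentiable[OF F], of _ 0 1 v] in simp)
  also have "\<dots> = dd (dd F (0, 1, 0)) (0, 1, v) P + v * dd (dd F (0, 0, 1)) (0, 1, v) P"
    using d by (simp add: dd_add dd_mult frechet_derivative_const differentiable_mult)
  also have "\<dots> = dd (dd F (0, 1, 0)) (0, 1, 0) P
    + v * (dd (dd F (0, 1, 0)) (0, 0, 1) P + dd (dd F (0, 0, 1)) (0, 1, 0) P) + v\<^sup>2 * dd (dd F (0, 0, 1)) (0, 0, 1) P"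
    using dd_triple[OF d, of _ 0 1 v] by (simp add: power2_eq_square algebra_simps)
  finally show ?thesis .
qed

end

lemma DERIV_imp_differentiable: "(f has_real_derivative D) (at x) \<Longrightarrow> f differentiable (at x)"
  unfolding real_differentiable_def by (rule exI)

context admissible_transformation
begin

text \<open>The pointwise constraints are integrated on a box. The prolonged equation is polynomial
  in the first derivative \<open>v\<close> and, once \<open>U\<close> is known to be affine, in
  \<open>u\<close>; comparing coefficients produces the differential equations for the factor
  \<open>A\<close> and for the summand \<open>B\<close> of \<open>U = A u + B\<close>, and
  \<open>f\<close> is \<open>B / A\<close>.\<close>

lemma local_form:
  assumes P0: "(t0, x0, u0) \<in> dom \<Phi>"
  obtains d f W e where "open W" "(t0, x0) \<in> W" "e > 0"
    "\<And>t x. (t, x) \<in> W \<Longrightarrow> germ_at (\<lambda>x. the (C x)) d (\<lambda>x. the (C' x)) t x"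
    "solution_on C W f"
    "\<And>t x u. (t, x) \<in> W \<Longrightarrow> \<bar>u - u0\<bar> < e \<Longrightarrow> \<Phi> (t, x, u) = Some (gmap d (t, x, u + f (t, x)))"
proof -
  define c where "c x = the (C x)" for x
  define c' where "c' x = the (C' x)" for x
  \<comment> \<open>On a product of intervals every slice is an interval, so a vanishing partial
    derivative means independence of that variable.\<close>
  obtain e where e: "e > 0" "{t0 - e<..<t0 + e} \<times> {x0 - e<..<x0 + e} \<times> {u0 - e<..<u0 + e} \<subseteq> dom \<Phi>"
    by (rule open_box[OF open_dom P0])
  define I where "I = {t0 - e<..<t0 + e}"
  define K where "K = {x0 - e<..<x0 + e}"
  define L where "L = {u0 - e<..<u0 + e}"
  have box: "(t, x, u) \<in> dom \<Phi>" if "t \<in> I" "x \<in> K" "u \<in> L" for t x u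
    by (rule subsetD[OF e(2)]) (use that in \<open>simp add: I_def K_def L_def\<close>)
  have opn: "open I" "open K" "open L" by (auto simp: I_def K_def L_def)
  have ctr: "t0 \<in> I" "x0 \<in> K" "u0 \<in> L" using e(1) by (auto simp: I_def K_def L_def)
  have Dt: "((\<lambda>s. F (s, x, u)) has_real_derivative dd F (1, 0, 0) (t, x, u)) (at t)"
    if "smooth_on F (dom \<Phi>)" "t \<in> I" "x \<in> K" "u \<in> L" for F :: "pt \<Rightarrow> real" and t x u
    by (rule dd_curve[where \<gamma> = "\<lambda>s. (s, x, u)"], rule smooth_on_differentiable[OF that(1) box[OF that(2,3,4)]])
      (auto intro!: derivative_eq_intros simp: zero_prod_def)
  have Dx: "((\<lambda>y. F (t, y, u)) has_real_derivative dd F (0, 1, 0) (t, x, u)) (at x)"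
    if "smooth_on F (dom \<Phi>)" "t \<in> I" "x \<in> K" "u \<in> L" for F :: "pt \<Rightarrow> real" and t x u
    by (rule dd_curve[where \<gamma> = "\<lambda>y. (t, y, u)"], rule smooth_on_differentiable[OF that(1) box[OF that(2,3,4)]])
      (auto intro!: derivative_eq_intros simp: zero_prod_def)
  have Du: "((\<lambda>v. F (t, x, v)) has_real_derivative dd F (0, 0, 1) (t, x, u)) (at u)"
    if "smooth_on F (dom \<Phi>)" "t \<in> I" "x \<in> K" "u \<in> L" for F :: "pt \<Rightarrow> real" and t x u
    by (rule dd_curve[where \<gamma> = "\<lambda>v. (t, x, v)"], rule smooth_on_differentiable[OF that(1) box[OF that(2,3,4)]])
      (auto intro!: derivative_eq_intros simp: zero_prod_def)
  have const_x: "F (t, x, u) = F (t, x0, u)"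
    if "smooth_on F (dom \<Phi>)" "t \<in> I" "x \<in> K" "u \<in> L"
      "\<And>y. y \<in> K \<Longrightarrow> dd F (0, 1, 0) (t, y, u) = 0" for F :: "pt \<Rightarrow> real" and t x u
  proof -
    have "((\<lambda>y. F (t, y, u)) has_real_derivative 0) (at y)" if "y \<in> K" for y
      using Dx[OF \<open>smooth_on F (dom \<Phi>)\<close> \<open>t \<in> I\<close> that \<open>u \<in> L\<close>] \<open>y \<in> K \<Longrightarrow> dd F (0, 1, 0) (t, y, u) = 0\<close> that by simp
    then show ?thesis
      using DERIV_isconst3[of "x0 - e" "x0 + e" x x0 "\<lambda>y. F (t, y, u)"] e(1) that(3) ctr(2) by (simp add: K_def)
  qed
  have const_u: "F (t, x, u) = F (t, x, u0)"
    if "smooth_on F (dom \<Phi>)" "t \<in> I" "x \<in> K" "u \<in> L"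
      "\<And>y. y \<in> L \<Longrightarrow> dd F (0, 0, 1) (t, x, y) = 0" for F :: "pt \<Rightarrow> real" and t x u
  proof -
    have "((\<lambda>y. F (t, x, y)) has_real_derivative 0) (at y)" if "y \<in> L" for y
      using Du[OF \<open>smooth_on F (dom \<Phi>)\<close> \<open>t \<in> I\<close> \<open>x \<in> K\<close> that] \<open>y \<in> L \<Longrightarrow> dd F (0, 0, 1) (t, x, y) = 0\<close> that by simp
    then show ?thesis
      using DERIV_isconst3[of "u0 - e" "u0 + e" u u0 "\<lambda>y. F (t, x, y)"] e(1) that(4) ctr(3) by (simp add: L_def)
  qed
  have uniq: "D = D'"
    if "(f has_real_derivative D) (at a)" "(g has_real_derivative D') (at a)" "open S" "a \<in> S"
      "\<And>s. s \<in> S \<Longrightarrow> f s = g s" for f g :: "real \<Rightarrow> real" and D D' a S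
    using DERIV_unique[OF has_field_derivative_transform_within_open[OF that(1,3,4,5)] that(2)] .
  note sT = smooth_T and sX = smooth_X and sU = smooth_U
  note sTt = smooth_on_dd[OF sT, of "(1, 0, 0)"] and sXx = smooth_on_dd[OF sX, of "(0, 1, 0)"]
    and sXt = smooth_on_dd[OF sX, of "(1, 0, 0)"] and sUu = smooth_on_dd[OF sU, of "(0, 0, 1)"]
    and sUx = smooth_on_dd[OF sU, of "(0, 1, 0)"]
  have T_eq: "T (t, x, u) = T (t, x0, u0)" if "t \<in> I" "x \<in> K" "u \<in> L" for t x u
    using const_u[OF sT that] const_x[OF sT that(1,2) ctr(3)] time_depends_on_time_only box that ctr by simp
  have Tt_eq: "dd T (1, 0, 0) (t, x, u) = dd T (1, 0, 0) (t, x0, u0)" if "t \<in> I" "x \<in> K" "u \<in> L" for t x u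
    by (rule uniq[OF Dt[OF sT that] Dt[OF sT that(1) ctr(2,3)] opn(1) that(1)]) (rule T_eq[OF _ that(2,3)])
  have X_u: "X (t, x, u) = X (t, x, u0)" if "t \<in> I" "x \<in> K" "u \<in> L" for t x u
    using const_u[OF sX that] space_independent_of_u(1) box that by simp
  have Xx_u: "dd X (0, 1, 0) (t, x, u) = dd X (0, 1, 0) (t, x, u0)" if "t \<in> I" "x \<in> K" "u \<in> L" for t x u
    by (rule uniq[OF Dx[OF sX that] Dx[OF sX that(1,2) ctr(3)] opn(2) that(2)]) (rule X_u[OF that(1) _ that(3)])
  \<comment> \<open>The square of \<open>dd X (0, 1, 0)\<close> equals
    \<open>dd T (1, 0, 0)\<close>, which does not depend on \<open>x\<close>; differentiate this in
    \<open>x\<close>.\<close>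
  have Xxx: "dd (dd X (0, 1, 0)) (0, 1, 0) (t, x, u) = 0" if "t \<in> I" "x \<in> K" "u \<in> L" for t x u
  proof -
    have "((\<lambda>y. (dd X (0, 1, 0) (t, y, u))\<^sup>2) has_real_derivative
        2 * dd X (0, 1, 0) (t, x, u) * dd (dd X (0, 1, 0)) (0, 1, 0) (t, x, u)) (at x)"
      using DERIV_power[OF Dx[OF sXx that], of 2] by (simp add: mult_ac)
    from uniq[OF this DERIV_const[of "dd T (1, 0, 0) (t, x0, u0)"] opn(2) that(2)]
    have "2 * dd X (0, 1, 0) (t, x, u) * dd (dd X (0, 1, 0)) (0, 1, 0) (t, x, u) = 0"
      using space_independent_of_u(3)[OF box] Tt_eq that by simp
    then show ?thesis using space_independent_of_u(2)[OF box[OF that]] by simp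
  qed
  define \<theta> where "\<theta> t = dd X (0, 1, 0) (t, x0, u0)" for t
  define \<xi> where "\<xi> t = X (t, x0, u0)" for t
  define \<theta>1 where "\<theta>1 t = dd (dd X (0, 1, 0)) (1, 0, 0) (t, x0, u0)" for t
  define \<xi>1 where "\<xi>1 t = dd X (1, 0, 0) (t, x0, u0)" for t
  have Xx: "dd X (0, 1, 0) (t, x, u) = \<theta> t" if "t \<in> I" "x \<in> K" "u \<in> L" for t x u
    using Xx_u[OF that] const_x[OF sXx that(1,2) ctr(3)] Xxx[OF that(1) _ ctr(3)] by (simp add: \<theta>_def)
  have \<theta>_nz: "\<theta> t \<noteq> 0" and \<theta>_sq: "(\<theta> t)\<^sup>2 = dd T (1, 0, 0) (t, x0, u0)" if "t \<in> I" for t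
    using space_independent_of_u(2,3)[OF box[OF that ctr(2,3)]] by (simp_all add: \<theta>_def)
  have X_eq: "X (t, x, u) = \<theta> t * (x - x0) + \<xi> t" if "t \<in> I" "x \<in> K" "u \<in> L" for t x u
  proof -
    have "((\<lambda>y. X (t, y, u0) - \<theta> t * y) has_real_derivative 0) (at y)" if "y \<in> K" for y
      using Dx[OF sX \<open>t \<in> I\<close> that ctr(3)] Xx[OF \<open>t \<in> I\<close> that ctr(3)] by (auto intro!: derivative_eq_intros)
    then have "X (t, x, u0) - \<theta> t * x = X (t, x0, u0) - \<theta> t * x0"
      using DERIV_isconst3[of "x0 - e" "x0 + e" x x0 "\<lambda>y. X (t, y, u0) - \<theta> t * y"] e(1) that(2) ctr(2) by (simp add: K_def)
    then show ?thesis using X_u[OF that] by (simp add: \<xi>_def algebra_simps)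
  qed
  have D\<theta>: "(\<theta> has_real_derivative \<theta>1 t) (at t)" and D\<xi>: "(\<xi> has_real_derivative \<xi>1 t) (at t)"
    and D\<theta>1: "\<theta>1 differentiable (at t)" and D\<xi>1: "\<xi>1 differentiable (at t)" if "t \<in> I" for t
  proof -
    show "(\<theta> has_real_derivative \<theta>1 t) (at t)"
      unfolding \<theta>_def[abs_def] \<theta>1_def by (rule Dt[OF sXx that ctr(2,3)])
    show "(\<xi> has_real_derivative \<xi>1 t) (at t)"
      unfolding \<xi>_def[abs_def] \<xi>1_def by (rule Dt[OF sX that ctr(2,3)])
    show "\<theta>1 differentiable (at t)"
      unfolding \<theta>1_def[abs_def] by (rule DERIV_imp_differentiable[OF Dt[OF smooth_on_dd[OF sXx] that ctr(2,3)]])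
    show "\<xi>1 differentiable (at t)"
      unfolding \<xi>1_def[abs_def] by (rule DERIV_imp_differentiable[OF Dt[OF sXt that ctr(2,3)]])
  qed
  have Xt: "dd X (1, 0, 0) (t, x, u) = \<theta>1 t * (x - x0) + \<xi>1 t" if "t \<in> I" "x \<in> K" "u \<in> L" for t x u
  proof (rule uniq[OF Dt[OF sX that] _ opn(1) that(1)])
    show "((\<lambda>s. \<theta> s * (x - x0) + \<xi> s) has_real_derivative \<theta>1 t * (x - x0) + \<xi>1 t) (at t)"
      using D\<theta>[OF that(1)] D\<xi>[OF that(1)] by (auto intro!: derivative_eq_intros)
  qed (rule X_eq[OF _ that(2,3)])
  have Xxu: "dd (dd X (0, 1, 0)) (0, 0, 1) (t, x, u) = 0" if "t \<in> I" "x \<in> K" "u \<in> L" for t x u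
    by (rule uniq[OF Du[OF sXx that] DERIV_const[of "\<theta> t"] opn(3) that(3)]) (rule Xx[OF that(1,2)])
  have Xu0: "dd (dd X (0, 0, 1)) v P = 0" if "P \<in> dom \<Phi>" for v P
  proof -
    have "dd (dd X (0, 0, 1)) v P = dd (\<lambda>_. 0 :: real) v P"
      by (rule dd_cong[OF open_dom that space_independent_of_u(1)])
    then show ?thesis by (simp add: frechet_derivative_const)
  qed
  \<comment> \<open>This will turn out to be the logarithmic \<open>x\<close>-derivative of the
    factor \<open>A\<close>; it is the \<open>slope\<close> of the germ.\<close>
  define a where "a t x = - (\<theta>1 t * (x - x0) + \<xi>1 t) / (2 * \<theta> t)" for t x
  have pde: "dd (dd U (0, 0, 1)) (0, 0, 1) (t, x, u) = 0 \<and>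
      dd (dd U (0, 1, 0)) (0, 0, 1) (t, x, u) + dd (dd U (0, 0, 1)) (0, 1, 0) (t, x, u) = 2 * a t x * dd U (0, 0, 1) (t, x, u) \<and>
      dd (dd U (0, 1, 0)) (0, 1, 0) (t, x, u) - c x * u * dd U (0, 0, 1) (t, x, u) =
        dd U (1, 0, 0) (t, x, u) + 2 * a t x * dd U (0, 1, 0) (t, x, u) - (\<theta> t)\<^sup>2 * c' (\<theta> t * (x - x0) + \<xi> t) * U (t, x, u)"
    if "t \<in> I" "x \<in> K" "u \<in> L" for t x u
  proof -
    let ?P = "(t, x, u)"
    have P: "?P \<in> dom \<Phi>" by (rule box[OF that])
    define Uxx Uxu Uuu where "Uxx = dd (dd U (0, 1, 0)) (0, 1, 0) ?P"
      and "Uxu = dd (dd U (0, 1, 0)) (0, 0, 1) ?P + dd (dd U (0, 0, 1)) (0, 1, 0) ?P"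
      and "Uuu = dd (dd U (0, 0, 1)) (0, 0, 1) ?P"
    define Ut Ux Uu where "Ut = dd U (1, 0, 0) ?P" and "Ux = dd U (0, 1, 0) ?P" and "Uu = dd U (0, 0, 1) ?P"
    define R where "R = (\<theta> t)\<^sup>2 * c' (\<theta> t * (x - x0) + \<xi> t) * U ?P"
    define ca where "ca = a t x"
    have th: "\<theta> t \<noteq> 0" by (rule \<theta>_nz[OF that(1)])
    have *: "Uxx + v * Uxu + v\<^sup>2 * Uuu - c x * u * Uu = Ut + 2 * ca * (Ux + Uu * v) - R" for v
    proof -
      have nz: "dd X (0, 1, 0) ?P + dd X (0, 0, 1) ?P * v \<noteq> 0"
        using Xx[OF that] th space_independent_of_u(1)[OF P] by simp
      have Ex: "dd (dd X (0, 1, v)) (0, 1, v) ?P = 0"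
        unfolding dd2_expand[OF sX P, of v] using Xxx[OF that] Xxu[OF that] Xu0[OF P] by simp
      have EU: "dd (dd U (0, 1, v)) (0, 1, v) ?P = Uxx + v * Uxu + v\<^sup>2 * Uuu"
        unfolding dd2_expand[OF sU P, of v] by (simp add: Uxx_def Uxu_def Uuu_def)
      have T1: "dd T (1, 0, 0) ?P = (\<theta> t)\<^sup>2" using Tt_eq[OF that] \<theta>_sq[OF that(1)] by simp
      have "(Ux + Uu * v) / \<theta> t * (\<theta>1 t * (x - x0) + \<xi>1 t) = - (2 * ca * (Ux + Uu * v))"
        using th by (simp add: a_def ca_def field_simps)
      with second_stage(2)[OF refl P nz] show ?thesis
        unfolding Ex EU T1 space_independent_of_u(1)[OF P] Xx[OF that] Xt[OF that] X_eq[OF that]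
        by (simp add: c_def c'_def R_def Ut_def Ux_def Uu_def)
    qed
    \<comment> \<open>A quadratic identity in \<open>v\<close> is determined by its values at 0, 1
      and -1.\<close>
    have "Uuu = 0" "Uxu = 2 * ca * Uu" "Uxx - c x * u * Uu = Ut + 2 * ca * Ux - R"
      using *[of 0] *[of 1] *[of "-1"] by (simp_all add: algebra_simps)
    then show ?thesis by (simp add: Uuu_def Uxu_def Uxx_def Ut_def Ux_def Uu_def R_def ca_def)
  qed
  define W where "W = I \<times> K"
  have W: "open W" "(t0, x0) \<in> W" using opn ctr by (auto simp: W_def open_Times)
  have smW: "smooth_on (\<lambda>q. F (fst q, snd q, u0)) W" if "smooth_on F (dom \<Phi>)" for F :: "pt \<Rightarrow> real"
  proof (rule smooth_on_compose[OF that W(1) open_dom])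
    show "smooth_on (\<lambda>q::real \<times> real. (fst q, snd q, u0)) W" by (intro smooth_intros W)
    show "(fst q, snd q, u0) \<in> dom \<Phi>" if "q \<in> W" for q
      by (rule box[OF _ _ ctr(3)]) (use that in \<open>simp_all add: W_def mem_Times_iff\<close>)
  qed
  define A where "A q = dd U (0, 0, 1) (fst q, snd q, u0)" for q
  define B where "B q = U (fst q, snd q, u0) - A q * u0" for q
  have smA: "smooth_on A W" unfolding A_def[abs_def] by (rule smW[OF sUu])
  have smB: "smooth_on B W" unfolding B_def[abs_def] by (intro smooth_on_diff smooth_on_mult W smA smW[OF sU] smooth_on_const)
  have Uu: "dd U (0, 0, 1) (t, x, u) = A (t, x)" if "t \<in> I" "x \<in> K" "u \<in> L" for t x u
    using const_u[OF sUu that] pde[OF that(1,2)] by (simp add: A_def)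
  have U_eq: "U (t, x, u) = A (t, x) * u + B (t, x)" if "t \<in> I" "x \<in> K" "u \<in> L" for t x u
  proof -
    have "((\<lambda>y. U (t, x, y) - A (t, x) * y) has_real_derivative 0) (at y)" if "y \<in> L" for y
      using Du[OF sU \<open>t \<in> I\<close> \<open>x \<in> K\<close> that] Uu[OF \<open>t \<in> I\<close> \<open>x \<in> K\<close> that] by (auto intro!: derivative_eq_intros)
    then have "U (t, x, u) - A (t, x) * u = U (t, x, u0) - A (t, x) * u0"
      using DERIV_isconst3[of "u0 - e" "u0 + e" u u0 "\<lambda>y. U (t, x, y) - A (t, x) * y"] e(1) that(3) ctr(3) by (simp add: L_def)
    then show ?thesis by (simp add: B_def)
  qed
  define S where "S = I \<times> K \<times> L"
  have S: "open S" using opn by (auto simp: S_def open_Times)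
  have dif: "F differentiable (at (t, x))" if "smooth_on F W" "t \<in> I" "x \<in> K" for F :: "real \<times> real \<Rightarrow> real" and t x
    by (rule smooth_on_differentiable[OF that(1)]) (simp add: W_def that)
  have aff: "dd F (i, j, k) (t, x, u) = dd M (i, j) (t, x) * u + dd N (i, j) (t, x) + M (t, x) * k"
    if "smooth_on M W" "smooth_on N W" "t \<in> I" "x \<in> K" "u \<in> L"
      "\<And>t x u. t \<in> I \<Longrightarrow> x \<in> K \<Longrightarrow> u \<in> L \<Longrightarrow> F (t, x, u) = M (t, x) * u + N (t, x)" for F M N i j k t x u
    by (rule dd_affine[OF S _ dif[OF that(1,3,4)] dif[OF that(2,3,4)]]) (use that in \<open>auto simp: S_def\<close>)
  have U_t: "dd U (1, 0, 0) (t, x, u) = dd A (1, 0) (t, x) * u + dd B (1, 0) (t, x)"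
    and U_x: "dd U (0, 1, 0) (t, x, u) = dd A (0, 1) (t, x) * u + dd B (0, 1) (t, x)"
    if "t \<in> I" "x \<in> K" "u \<in> L" for t x u
    using aff[OF smA smB that U_eq] by simp_all
  have U_xx: "dd (dd U (0, 1, 0)) (0, 1, 0) (t, x, u) = dd (dd A (0, 1)) (0, 1) (t, x) * u + dd (dd B (0, 1)) (0, 1) (t, x)"
    and U_xu: "dd (dd U (0, 1, 0)) (0, 0, 1) (t, x, u) = dd A (0, 1) (t, x)"
    if "t \<in> I" "x \<in> K" "u \<in> L" for t x u
  proof -
    note * = aff[OF smooth_on_dd[OF smA] smooth_on_dd[OF smB] that U_x]
    show "dd (dd U (0, 1, 0)) (0, 1, 0) (t, x, u) = dd (dd A (0, 1)) (0, 1) (t, x) * u + dd (dd B (0, 1)) (0, 1) (t, x)"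
      using * by simp
    have z: "dd F (0, 0) (t, x) = 0" if "smooth_on F W" for F :: "real \<times> real \<Rightarrow> real"
      using linear_0[OF dd_linear[OF dif[OF that \<open>t \<in> I\<close> \<open>x \<in> K\<close>]]] by (simp add: zero_prod_def)
    show "dd (dd U (0, 1, 0)) (0, 0, 1) (t, x, u) = dd A (0, 1) (t, x)"
      using * z[OF smooth_on_dd[OF smA]] z[OF smooth_on_dd[OF smB]] by simp
  qed
  have U_ux: "dd (dd U (0, 0, 1)) (0, 1, 0) (t, x, u) = dd A (0, 1) (t, x)" if "t \<in> I" "x \<in> K" "u \<in> L" for t x u
    using aff[OF smooth_on_const[of 0] smA that, of "dd U (0, 0, 1)" 0 1 0] Uu by (simp add: frechet_derivative_const)
  have A_nz: "A (t, x) \<noteq> 0" if "t \<in> I" "x \<in> K" for t x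
    using dd_U_nonzero[OF box[OF that ctr(3)]] by (simp add: A_def)
  have A_x: "dd A (0, 1) (t, x) = a t x * A (t, x)" if "t \<in> I" "x \<in> K" for t x
    using pde[OF that ctr(3)] U_xu[OF that ctr(3)] U_ux[OF that ctr(3)] Uu[OF that ctr(3)] by simp
  have AB: "dd (dd A (0, 1)) (0, 1) (t, x) - c x * A (t, x) = dd A (1, 0) (t, x) + 2 * a t x * dd A (0, 1) (t, x)
        - (\<theta> t)\<^sup>2 * c' (\<theta> t * (x - x0) + \<xi> t) * A (t, x)
    \<and> dd (dd B (0, 1)) (0, 1) (t, x) = dd B (1, 0) (t, x) + 2 * a t x * dd B (0, 1) (t, x)
        - (\<theta> t)\<^sup>2 * c' (\<theta> t * (x - x0) + \<xi> t) * B (t, x)"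
    if "t \<in> I" "x \<in> K" for t x
  proof -
    define k where "k = (\<theta> t)\<^sup>2 * c' (\<theta> t * (x - x0) + \<xi> t)"
    define m where "m = dd (dd A (0, 1)) (0, 1) (t, x) - c x * A (t, x) - dd A (1, 0) (t, x) - 2 * a t x * dd A (0, 1) (t, x) + k * A (t, x)"
    define n where "n = dd (dd B (0, 1)) (0, 1) (t, x) - dd B (1, 0) (t, x) - 2 * a t x * dd B (0, 1) (t, x) + k * B (t, x)"
    \<comment> \<open>The remaining equation is affine in \<open>u\<close>; its two coefficients are
      the equations for \<open>A\<close> and for \<open>B\<close>.\<close>
    have "m * u + n = 0" if "u \<in> L" for u
      using pde[OF \<open>t \<in> I\<close> \<open>x \<in> K\<close> that]
      unfolding U_xx[OF \<open>t \<in> I\<close> \<open>x \<in> K\<close> that] U_t[OF \<open>t \<in> I\<close> \<open>x \<in> K\<close> that] U_x[OF \<open>t \<in> I\<close> \<open>x \<in> K\<close> that]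
        U_eq[OF \<open>t \<in> I\<close> \<open>x \<in> K\<close> that] Uu[OF \<open>t \<in> I\<close> \<open>x \<in> K\<close> that] k_def[symmetric]
      by (simp add: m_def n_def algebra_simps)
    from this[of u0] this[of "u0 + e / 2"] have "m * u0 + n = 0" "m * (u0 + e / 2) + n = 0"
      using e(1) by (simp_all add: L_def)
    then have "m * e = 0" "n = - (m * u0)" by algebra+
    then have "m = 0" "n = 0" using e(1) by auto
    then show ?thesis unfolding k_def[symmetric] by (simp add: m_def n_def)
  qed
  \<comment> \<open>The shift is referred to the origin, whereas \<open>\<xi>\<close> is the image
    of the centre \<open>x0\<close>.\<close>
  define \<beta> where "\<beta> t = \<xi> t - \<theta> t * x0" for t
  define \<beta>1 where "\<beta>1 t = \<xi>1 t - \<theta>1 t * x0" for t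
  define d where "d = Germ (\<lambda>t. T (t, x0, u0)) \<theta> \<theta>1 \<beta> \<beta>1 A"
  have sl: "slope d t x = a t x" for t x
    by (simp add: slope_def d_def a_def \<beta>1_def algebra_simps)
  have arg: "\<theta> t * x + \<beta> t = \<theta> t * (x - x0) + \<xi> t" for t x by (simp add: \<beta>_def algebra_simps)
  \<comment> \<open>Differentiate \<open>A_x = a A\<close> once more; \<open>a\<close> is affine in
    \<open>x\<close>.\<close>
  have A_xx: "dd (dd A (0, 1)) (0, 1) (t, x) = - \<theta>1 t / (2 * \<theta> t) * A (t, x) + (a t x)\<^sup>2 * A (t, x)" if "t \<in> I" "x \<in> K" for t x
  proof -
    have g: "((\<lambda>y. A (t, y)) has_real_derivative dd A (0, 1) (t, x)) (at x)"
      by (rule dd_curve[where \<gamma> = "\<lambda>y. (t, y)", OF dif[OF smA that]]) (auto intro!: derivative_eq_intros simp: zero_prod_def)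
    have h: "((\<lambda>y. dd A (0, 1) (t, y)) has_real_derivative dd (dd A (0, 1)) (0, 1) (t, x)) (at x)"
      by (rule dd_curve[where \<gamma> = "\<lambda>y. (t, y)", OF dif[OF smooth_on_dd[OF smA] that]]) (auto intro!: derivative_eq_intros simp: zero_prod_def)
    have k: "((\<lambda>y. a t y) has_real_derivative - \<theta>1 t / (2 * \<theta> t)) (at x)"
      unfolding a_def using \<theta>_nz[OF that(1)] by (auto intro!: derivative_eq_intros)
    from uniq[OF h DERIV_mult[OF k g] opn(2) that(2)] A_x[OF that(1)] A_x[OF that]
    show ?thesis by (simp add: power2_eq_square algebra_simps)
  qed
  have A_t: "dd A (1, 0) (t, x) = A (t, x) * rate c d c' t x" if "t \<in> I" "x \<in> K" for t x
  proof -
    define Q where "Q = (\<theta> t)\<^sup>2 * c' (\<theta> t * (x - x0) + \<xi> t)"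
    define z where "z = \<theta>1 t / (2 * \<theta> t)"
    have r: "rate c d c' t x = Q - c x - (a t x)\<^sup>2 - z"
      unfolding rate_def sl Q_def z_def by (simp add: d_def arg)
    have 1: "dd (dd A (0, 1)) (0, 1) (t, x) = - z * A (t, x) + (a t x)\<^sup>2 * A (t, x)"
      using A_xx[OF that] by (simp add: z_def)
    show ?thesis
      using AB[OF that, THEN conjunct1, folded Q_def] unfolding r A_x[OF that] 1 by algebra
  qed
  have germ: "germ_at c d c' t x" if "(t, x) \<in> W" for t x
  proof -
    have tI: "t \<in> I" and xK: "x \<in> K" using that by (auto simp: W_def)
    have "(A has_derivative (\<lambda>(i, j). A (t, x) * (i * rate c d c' t x + j * slope d t x))) (at (t, x))"
    proof (rule has_derivative_eq_rhs[OF smooth_on_has_derivative[OF smA that]])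
      show "(\<lambda>v. dd A v (t, x)) = (\<lambda>(i, j). A (t, x) * (i * rate c d c' t x + j * slope d t x))"
      proof
        fix v :: "real \<times> real"
        obtain i j where v: "v = (i, j)" by (cases v)
        show "dd A v (t, x) = (case v of (i, j) \<Rightarrow> A (t, x) * (i * rate c d c' t x + j * slope d t x))"
          unfolding v dd_pair[OF dif[OF smA tI xK], of i j] A_t[OF tI xK] A_x[OF tI xK] sl by (simp add: algebra_simps)
      qed
    qed
    moreover have "((\<lambda>t. T (t, x0, u0)) has_real_derivative (\<theta> t)\<^sup>2) (at t)"
      using Dt[OF sT tI ctr(2,3)] \<theta>_sq[OF tI] by simp
    moreover have "(\<beta> has_real_derivative \<beta>1 t) (at t)" "\<beta>1 differentiable (at t)"
      unfolding \<beta>_def[abs_def] \<beta>1_def[abs_def] using D\<theta>[OF tI] D\<xi>[OF tI] D\<theta>1[OF tI] D\<xi>1[OF tI]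
      by (auto intro!: derivative_eq_intros derivative_intros)
    ultimately show ?thesis
      using A_nz[OF tI xK] \<theta>_nz[OF tI] D\<theta>[OF tI] D\<theta>1[OF tI] by (simp add: germ_at_def d_def)
  qed
  define f where "f q = B q / A q" for q
  have smf: "smooth_on f W" unfolding f_def[abs_def]
    by (intro smooth_on_divide W smA smB) (use A_nz in \<open>auto simp: W_def\<close>)
  have B_Af: "B q = A q * f q" if "q \<in> W" for q
    using that A_nz by (auto simp: f_def W_def)
  have dB: "dd B v q = dd A v q * f q + A q * dd f v q" if "q \<in> W" for v q
    using dd_cong[OF W(1) that B_Af] dd_mult[OF smooth_on_differentiable[OF smA that] smooth_on_differentiable[OF smf that]] by simp
  have sol: "solution_on C W f"
    unfolding solution_on_def
  proof (intro conjI smf ballI)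
    fix q assume q: "q \<in> W"
    then obtain t x where tx: "q = (t, x)" "t \<in> I" "x \<in> K" by (auto simp: W_def)
    have qW: "(t, x) \<in> W" using q tx(1) by simp
    define At Ax Axx ft fx fxx where "At = dd A (1, 0) (t, x)" and "Ax = dd A (0, 1) (t, x)" and "Axx = dd (dd A (0, 1)) (0, 1) (t, x)"
      and "ft = dd f (1, 0) (t, x)" and "fx = dd f (0, 1) (t, x)" and "fxx = dd (dd f (0, 1)) (0, 1) (t, x)"
    have Bxx: "dd (dd B (0, 1)) (0, 1) (t, x) = Axx * f (t, x) + 2 * Ax * fx + A (t, x) * fxx"
    proof -
      note df = smooth_on_differentiable[OF smooth_on_dd[OF smA] qW] smooth_on_differentiable[OF smooth_on_dd[OF smf] qW]
         smooth_on_differentiable[OF smA qW] smooth_on_differentiable[OF smf qW]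
      have "dd (dd B (0, 1)) (0, 1) (t, x) = dd (\<lambda>q. dd A (0, 1) q * f q + A q * dd f (0, 1) q) (0, 1) (t, x)"
        by (rule dd_cong[OF W(1) qW dB])
      also have "\<dots> = dd (\<lambda>q. dd A (0, 1) q * f q) (0, 1) (t, x) + dd (\<lambda>q. A q * dd f (0, 1) q) (0, 1) (t, x)"
        by (intro dd_add differentiable_mult df)
      also have "\<dots> = Axx * f (t, x) + 2 * Ax * fx + A (t, x) * fxx"
        unfolding dd_mult[OF df(1,4)] dd_mult[OF df(3,2)] by (simp add: Axx_def Ax_def fx_def fxx_def)
      finally show ?thesis .
    qed
    define Q where "Q = (\<theta> t)\<^sup>2 * c' (\<theta> t * (x - x0) + \<xi> t)"
    have 1: "Axx - c x * A (t, x) = At + 2 * a t x * Ax - Q * A (t, x)"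
      and 2: "Axx * f (t, x) + 2 * Ax * fx + A (t, x) * fxx = At * f (t, x) + A (t, x) * ft + 2 * a t x * (Ax * f (t, x) + A (t, x) * fx)
        - Q * (A (t, x) * f (t, x))"
      and 3: "Ax = a t x * A (t, x)"
      using AB[OF tx(2,3)] A_x[OF tx(2,3)] unfolding Bxx dB[OF qW] B_Af[OF qW]
      by (simp_all add: Axx_def At_def Ax_def ft_def fx_def Q_def)
    \<comment> \<open>From the equation for \<open>B = A f\<close> subtract \<open>f\<close> times
      the equation for \<open>A\<close>. The terms with \<open>fx\<close> cancel because
      \<open>Ax = a A\<close>, so precisely the source equation for \<open>f\<close> is
      left.\<close>
    have "A (t, x) * (ft - (fxx + c x * f (t, x))) = 0" using 1 2 3 by algebra
    then have "ft = fxx + c x * f (t, x)" using A_nz[OF tx(2,3)] by simp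
    then show "case q of (t, x) \<Rightarrow> satisfies_at C f t x"
      using satisfies_at_dd[OF W(1) smf qW, of C] source_dom[OF box[OF tx(2,3) ctr(3)]]
      by (simp add: tx(1) ft_def fxx_def c_def)
  qed
  show thesis
  proof (rule that[of W e d f])
    show "germ_at (\<lambda>x. the (C x)) d (\<lambda>x. the (C' x)) t x" if "(t, x) \<in> W" for t x
      using germ[OF that] by (simp add: c_def[abs_def] c'_def[abs_def])
    show "\<Phi> (t, x, u) = Some (gmap d (t, x, u + f (t, x)))" if q: "(t, x) \<in> W" and "\<bar>u - u0\<bar> < e" for t x u
    proof -
      have tx: "t \<in> I" "x \<in> K" "u \<in> L" using that by (auto simp: W_def L_def)
      show ?thesis
        using apply_eq[OF box[OF tx]] T_eq[OF tx] X_eq[OF tx] U_eq[OF tx] B_Af[OF q] arg[of t x]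
        by (simp add: gmap_def d_def algebra_simps)
    qed
  qed (use W e(1) sol in auto)
qed

end

subsection \<open>Composition and inversion of germs\<close>

definition bmap :: "germ \<Rightarrow> real \<times> real \<Rightarrow> real \<times> real" where
  "bmap d = (\<lambda>(t, x). (tm d t, sc d t * x + sh d t))"

text \<open>The powers of \<open>sc d\<close> in \<open>sc1\<close> and \<open>sh1\<close> come from
  the chain rule, since the derivative of \<open>tm d\<close> is
  \<open>(sc d)\<^sup>2\<close>.\<close>

definition germ_comp :: "germ \<Rightarrow> germ \<Rightarrow> germ" where
  "germ_comp e d = Germ (\<lambda>t. tm e (tm d t)) (\<lambda>t. sc e (tm d t) * sc d t)
     (\<lambda>t. sc1 e (tm d t) * (sc d t) ^ 3 + sc e (tm d t) * sc1 d t)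
     (\<lambda>t. sc e (tm d t) * sh d t + sh e (tm d t))
     (\<lambda>t. sc1 e (tm d t) * (sc d t)\<^sup>2 * sh d t + sc e (tm d t) * sh1 d t + sh1 e (tm d t) * (sc d t)\<^sup>2)
     (\<lambda>p. fa e (bmap d p) * fa d p)"

text \<open>Here \<open>\<sigma>\<close> is meant to be a local inverse of \<open>tm d\<close>, with
  derivative \<open>1 / (sc d)\<^sup>2\<close>; this accounts for the fourth powers.\<close>

definition germ_inv :: "(real \<Rightarrow> real) \<Rightarrow> germ \<Rightarrow> germ" where
  "germ_inv \<sigma> d = Germ \<sigma> (\<lambda>s. 1 / sc d (\<sigma> s)) (\<lambda>s. - sc1 d (\<sigma> s) / (sc d (\<sigma> s)) ^ 4)
     (\<lambda>s. - sh d (\<sigma> s) / sc d (\<sigma> s))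
     (\<lambda>s. (sh d (\<sigma> s) * sc1 d (\<sigma> s) - sh1 d (\<sigma> s) * sc d (\<sigma> s)) / (sc d (\<sigma> s)) ^ 4)
     (\<lambda>(s, y). 1 / fa d (\<sigma> s, (y - sh d (\<sigma> s)) / sc d (\<sigma> s)))"

lemma gmap_comp: "gmap (germ_comp e d) p = gmap e (gmap d p)"
  by (cases p) (simp add: gmap_def germ_comp_def bmap_def algebra_simps)

lemma bmap_comp: "bmap (germ_comp e d) p = bmap e (bmap d p)"
  by (cases p) (simp add: germ_comp_def bmap_def algebra_simps)

lemma bmap_has_derivative:
  assumes "germ_at c d c' t x"
  shows "(bmap d has_derivative (\<lambda>(a, b). ((sc d t)\<^sup>2 * a, (sc1 d t * x + sh1 d t) * a + sc d t * b))) (at (t, x))"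
proof -
  have D: "((\<lambda>p::real \<times> real. f (fst p)) has_derivative (\<lambda>v. f' * fst v)) (at (t, x))"
    if "(f has_real_derivative f') (at t)" for f f'
    by (rule has_derivative_compose[where g = f and f = fst])
      (use that in \<open>auto intro!: derivative_eq_intros simp: has_field_derivative_def\<close>)
  note d = D[of "tm d" "(sc d t)\<^sup>2"] D[of "sc d" "sc1 d t"] D[of "sh d" "sh1 d t"]
  have "((\<lambda>p. (tm d (fst p), sc d (fst p) * snd p + sh d (fst p))) has_derivative
      (\<lambda>v. ((sc d t)\<^sup>2 * fst v, (sc d t * snd v + (sc1 d t * fst v) * x) + sh1 d t * fst v))) (at (t, x))"
    using has_derivative_Pair[OF d(1) has_derivative_add[OF has_derivative_mult[OF d(2) has_derivative_snd[OF has_derivative_ident]] d(3)]] assms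
    by (simp add: germ_at_def)
  moreover have "bmap d = (\<lambda>p. (tm d (fst p), sc d (fst p) * snd p + sh d (fst p)))"
    by (auto simp: bmap_def fun_eq_iff)
  ultimately show ?thesis
    by (simp only:) (rule has_derivative_eq_rhs, assumption, auto simp: fun_eq_iff algebra_simps)
qed

text \<open>\<open>slope\<close> and \<open>rate\<close> are the logarithmic derivatives of the
  multiplier. For a product of multipliers they add up after pulling the outer ones back along
  \<open>bmap d\<close>, which is the content of \<open>sl\<close> and \<open>ra\<close>.\<close>

lemma germ_at_comp:
  assumes d: "germ_at c d c1 t x" and e: "germ_at c1 e c' (tm d t) (sc d t * x + sh d t)"
  shows "germ_at c (germ_comp e d) c' t x"
proof -
  let ?t = "tm d t" and ?x = "sc d t * x + sh d t"
  have dd: "(tm d has_real_derivative (sc d t)\<^sup>2) (at t)" "sc d t \<noteq> 0"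
     "(sc d has_real_derivative sc1 d t) (at t)" "(sh d has_real_derivative sh1 d t) (at t)"
     "sc1 d differentiable (at t)" "sh1 d differentiable (at t)" "fa d (t, x) \<noteq> 0"
     "(fa d has_derivative (\<lambda>(a, b). fa d (t, x) * (a * rate c d c1 t x + b * slope d t x))) (at (t, x))"
    using d by (simp_all add: germ_at_def)
  have de: "(tm e has_real_derivative (sc e ?t)\<^sup>2) (at ?t)" "sc e ?t \<noteq> 0"
     "(sc e has_real_derivative sc1 e ?t) (at ?t)" "(sh e has_real_derivative sh1 e ?t) (at ?t)"
     "sc1 e differentiable (at ?t)" "sh1 e differentiable (at ?t)" "fa e (?t, ?x) \<noteq> 0"
     "(fa e has_derivative (\<lambda>(a, b). fa e (?t, ?x) * (a * rate c1 e c' ?t ?x + b * slope e ?t ?x))) (at (?t, ?x))"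
    using e by (simp_all add: germ_at_def)
  have chain: "((\<lambda>s. f (tm d s)) has_real_derivative f' * (sc d t)\<^sup>2) (at t)"
    if "(f has_real_derivative f') (at ?t)" for f f'
    using DERIV_chain2[OF that dd(1)] .
  note ch = chain[OF de(1)] chain[OF de(3)] chain[OF de(4)]
  have difc: "(\<lambda>s. f (tm d s)) differentiable (at t)" if "f differentiable (at ?t)" for f :: "real \<Rightarrow> real"
    using that chain DERIV_imp_differentiable unfolding real_differentiable_def by blast
  have dt: "tm d differentiable (at t)" "sc d differentiable (at t)" "sh d differentiable (at t)"
    "(\<lambda>s. sc e (tm d s)) differentiable (at t)"
    using dd(1,3,4) ch(2) DERIV_imp_differentiable by blast+
  have sl: "slope (germ_comp e d) t x = sc d t * slope e ?t ?x + slope d t x"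
    using dd(2) de(2) by (simp add: slope_def germ_comp_def field_simps power2_eq_square power3_eq_cube)
  have ra: "rate c (germ_comp e d) c' t x = (sc d t)\<^sup>2 * rate c1 e c' ?t ?x + (sc1 d t * x + sh1 d t) * slope e ?t ?x + rate c d c1 t x"
  proof -
    define S where "S = slope e ?t ?x"
    define R where "R = slope d t x"
    have R: "sc1 d t * x + sh1 d t = - 2 * sc d t * R" using dd(2) by (simp add: R_def slope_def field_simps)
    have z: "sc1 (germ_comp e d) t / (2 * sc (germ_comp e d) t) = (sc d t)\<^sup>2 * (sc1 e ?t / (2 * sc e ?t)) + sc1 d t / (2 * sc d t)"
      using dd(2) de(2) by (simp add: germ_comp_def field_simps power2_eq_square power3_eq_cube)
    have s: "sc (germ_comp e d) t = sc e ?t * sc d t" by (simp add: germ_comp_def)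
    have a: "sc (germ_comp e d) t * x + sh (germ_comp e d) t = sc e ?t * ?x + sh e ?t" by (simp add: germ_comp_def algebra_simps)
    show ?thesis
      unfolding rate_def z sl a unfolding s R S_def[symmetric] R_def[symmetric]
      by (simp add: power2_eq_square algebra_simps)
  qed
  have "(fa (germ_comp e d) has_derivative (\<lambda>v. fa e (bmap d (t, x)) * (case v of (a, b) \<Rightarrow> fa d (t, x) * (a * rate c d c1 t x + b * slope d t x))
     + (case (case v of (a, b) \<Rightarrow> ((sc d t)\<^sup>2 * a, (sc1 d t * x + sh1 d t) * a + sc d t * b)) of (a, b) \<Rightarrow> fa e (?t, ?x) * (a * rate c1 e c' ?t ?x + b * slope e ?t ?x)) * fa d (t, x))) (at (t, x))"
    unfolding germ_comp_def germ.sel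
    by (rule has_derivative_mult[OF has_derivative_compose[OF bmap_has_derivative[OF d]] dd(8)])
      (use de(8) in \<open>simp add: bmap_def\<close>)
  then have "(fa (germ_comp e d) has_derivative (\<lambda>(a, b). fa (germ_comp e d) (t, x) * (a * rate c (germ_comp e d) c' t x + b * slope (germ_comp e d) t x))) (at (t, x))"
    unfolding sl ra by (rule has_derivative_eq_rhs) (auto simp: fun_eq_iff germ_comp_def bmap_def algebra_simps)
  moreover have "(tm (germ_comp e d) has_real_derivative (sc (germ_comp e d) t)\<^sup>2) (at t)"
    using ch(1) by (simp add: germ_comp_def power_mult_distrib)
  moreover have "(sc (germ_comp e d) has_real_derivative sc1 (germ_comp e d) t) (at t)"
    unfolding germ_comp_def germ.sel
    by (rule DERIV_cong[OF DERIV_mult[OF ch(2) dd(3)]]) (simp add: power2_eq_square power3_eq_cube)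
  moreover have "(sh (germ_comp e d) has_real_derivative sh1 (germ_comp e d) t) (at t)"
    unfolding germ_comp_def germ.sel
    by (rule DERIV_cong[OF DERIV_add[OF DERIV_mult[OF ch(2) dd(4)] ch(3)]]) (simp add: power2_eq_square)
  moreover have "sc1 (germ_comp e d) differentiable (at t)" "sh1 (germ_comp e d) differentiable (at t)"
    unfolding germ_comp_def germ.sel
    by (intro differentiable_add differentiable_mult differentiable_power difc[OF de(5)] difc[OF de(6)] dt dd(5,6))+
  ultimately show ?thesis
    using dd(2,7) de(2,7) by (simp add: germ_at_def germ_comp_def bmap_def)
qed

lemma germ_at_inv:
  assumes d: "germ_at c d c' t x" and \<sigma>: "\<sigma> (tm d t) = t" "(\<sigma> has_real_derivative 1 / (sc d t)\<^sup>2) (at (tm d t))"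
  shows "germ_at c' (germ_inv \<sigma> d) c (tm d t) (sc d t * x + sh d t)"
proof -
  let ?t = "tm d t" and ?x = "sc d t * x + sh d t" and ?e = "germ_inv \<sigma> d"
  have dd: "sc d t \<noteq> 0"
     "(sc d has_real_derivative sc1 d t) (at t)" "(sh d has_real_derivative sh1 d t) (at t)"
     "sc1 d differentiable (at t)" "sh1 d differentiable (at t)" "fa d (t, x) \<noteq> 0"
     "(fa d has_derivative (\<lambda>(a, b). fa d (t, x) * (a * rate c d c' t x + b * slope d t x))) (at (t, x))"
    using d by (simp_all add: germ_at_def)
  have chain: "((\<lambda>s. f (\<sigma> s)) has_real_derivative f' / (sc d t)\<^sup>2) (at ?t)"
    if "(f has_real_derivative f') (at t)" for f f'
    using DERIV_chain2[OF _ \<sigma>(2), of f f'] that by (simp add: \<sigma>(1))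
  have difc: "(\<lambda>s. f (\<sigma> s)) differentiable (at ?t)" if "f differentiable (at t)" for f :: "real \<Rightarrow> real"
    using that chain DERIV_imp_differentiable unfolding real_differentiable_def by blast
  note ch = chain[OF dd(2)] chain[OF dd(3)]
  have dt: "(\<lambda>s. sc d (\<sigma> s)) differentiable (at ?t)" "(\<lambda>s. sh d (\<sigma> s)) differentiable (at ?t)"
    using ch DERIV_imp_differentiable by blast+
  define g where "g = (\<lambda>p. (\<sigma> (fst p), (snd p - sh d (\<sigma> (fst p))) / sc d (\<sigma> (fst p))))"
  have g0: "g (?t, ?x) = (t, x)" using dd(1) by (simp add: g_def \<sigma>(1))
  have D: "((\<lambda>p::real \<times> real. f (fst p)) has_derivative (\<lambda>v. f' * fst v)) (at (?t, ?x))"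
    if "(f has_real_derivative f') (at ?t)" for f f'
    by (rule has_derivative_compose[where g = f and f = fst])
      (use that in \<open>auto intro!: derivative_eq_intros simp: has_field_derivative_def\<close>)
  have sc0: "sc d (\<sigma> (fst (?t, ?x))) \<noteq> 0" using dd(1) \<sigma>(1) by simp
  have dg: "(g has_derivative (\<lambda>v. (fst v / (sc d t)\<^sup>2, (snd v - (sc1 d t * x + sh1 d t) / (sc d t)\<^sup>2 * fst v) / sc d t))) (at (?t, ?x))"
    unfolding g_def
    by (rule has_derivative_eq_rhs[OF has_derivative_Pair[OF D[OF \<sigma>(2)]
          has_derivative_divide'[OF has_derivative_diff[OF has_derivative_snd[OF has_derivative_ident] D[OF ch(2)]] D[OF ch(1)] sc0]]])
      (use dd(1) \<sigma>(1) in \<open>auto simp: fun_eq_iff field_simps power2_eq_square\<close>)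
  have fa_e: "fa ?e = (\<lambda>p. inverse (fa d (g p)))"
    by (auto simp: germ_inv_def g_def fun_eq_iff divide_inverse)
  have dfa: "((\<lambda>p. fa d (g p)) has_derivative (\<lambda>v. case (fst v / (sc d t)\<^sup>2, (snd v - (sc1 d t * x + sh1 d t) / (sc d t)\<^sup>2 * fst v) / sc d t) of
      (a, b) \<Rightarrow> fa d (t, x) * (a * rate c d c' t x + b * slope d t x))) (at (?t, ?x))"
    by (rule has_derivative_compose[OF dg]) (use dd(7) g0 in simp)
  have sl: "slope ?e ?t ?x = - slope d t x / sc d t"
    using dd(1) by (simp add: slope_def germ_inv_def \<sigma>(1) field_simps power4_eq_xxxx)
  have ra: "rate c' ?e c ?t ?x = - (rate c d c' t x + 2 * (slope d t x)\<^sup>2) / (sc d t)\<^sup>2"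
  proof -
    have z: "sc1 ?e ?t / (2 * sc ?e ?t) = - (sc1 d t / (2 * sc d t)) / (sc d t)\<^sup>2"
      using dd(1) by (simp add: germ_inv_def \<sigma>(1) field_simps power2_eq_square power4_eq_xxxx)
    have a: "sc ?e ?t * ?x + sh ?e ?t = x" using dd(1) by (simp add: germ_inv_def \<sigma>(1) field_simps)
    have s: "sc ?e ?t = 1 / sc d t" by (simp add: germ_inv_def \<sigma>(1))
    show ?thesis
      unfolding rate_def z sl a unfolding s using dd(1) by (simp add: field_simps power2_eq_square)
  qed
  \<comment> \<open>The velocity of the image point expressed through \<open>slope\<close>. It is
    responsible for the extra term with the squared slope in \<open>ra\<close>.\<close>
  have R: "(sc1 d t * x + sh1 d t) = - 2 * sc d t * slope d t x"
    using dd(1) by (simp add: slope_def)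
  have "(fa ?e has_derivative (\<lambda>(a, b). fa ?e (?t, ?x) * (a * rate c' ?e c ?t ?x + b * slope ?e ?t ?x))) (at (?t, ?x))"
    unfolding fa_e sl ra g0
    by (rule has_derivative_eq_rhs[OF Deriv.has_derivative_inverse[OF _ dfa[unfolded R]]])
      (use dd(1,6) in \<open>auto simp: fun_eq_iff g0 divide_simps power2_eq_square, auto simp: algebra_simps\<close>)
  moreover have "(tm ?e has_real_derivative (sc ?e ?t)\<^sup>2) (at ?t)"
    using \<sigma> by (simp add: germ_inv_def power_one_over)
  moreover have "(sc ?e has_real_derivative sc1 ?e ?t) (at ?t)"
    unfolding germ_inv_def germ.sel
    by (rule DERIV_cong[OF DERIV_divide[OF DERIV_const ch(1)]]) (use dd(1) \<sigma>(1) in \<open>auto simp: field_simps power2_eq_square power4_eq_xxxx\<close>)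
  moreover have "(sh ?e has_real_derivative sh1 ?e ?t) (at ?t)"
    unfolding germ_inv_def germ.sel
    by (rule DERIV_cong[OF DERIV_divide[OF DERIV_minus[OF ch(2)] ch(1)]]) (use dd(1) \<sigma>(1) in \<open>auto simp: field_simps power2_eq_square power4_eq_xxxx\<close>)
  moreover have "sc1 ?e differentiable (at ?t)" "sh1 ?e differentiable (at ?t)"
    unfolding germ_inv_def germ.sel
    by (intro differentiable_divide differentiable_minus differentiable_diff differentiable_mult differentiable_power difc[OF dd(4)] difc[OF dd(5)] dt;
        use dd(1) \<sigma>(1) in simp)+
  ultimately show ?thesis
    using dd(1,6) g0 by (simp add: germ_at_def fa_e) (simp add: germ_inv_def \<sigma>(1))
qed

section \<open>From germs to admissible transformations\<close>

lemma potential_open: "potential C \<Longrightarrow> open (dom C)"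
  by (simp add: potential_def)

text \<open>\<open>germ_at\<close> is a pointwise condition involving few derivatives. To obtain a
  member of \<open>admissible\<close> it is required on a whole strip
  \<open>I \<times> dom C\<close>, together with smoothness of scale, shift and multiplier;
  \<open>tm d\<close> is then smooth as a primitive of \<open>(sc d)\<^sup>2\<close>.\<close>

locale smooth_germ =
  fixes I :: "real set" and C C' :: potential and d :: germ
  assumes I: "open I" "is_interval I" "I \<noteq> {}"
    and C: "potential C" and C': "potential C'"
    and germ: "\<And>t x. t \<in> I \<Longrightarrow> x \<in> dom C \<Longrightarrow> germ_at (\<lambda>x. the (C x)) d (\<lambda>x. the (C' x)) t x"
    and range: "\<And>t x. t \<in> I \<Longrightarrow> x \<in> dom C \<Longrightarrow> sc d t * x + sh d t \<in> dom C'"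
    and smooth: "smooth_on (sc d) I" "smooth_on (sh d) I" "smooth_on (fa d) (I \<times> dom C)"
begin

definition \<Phi> :: ptrans where
  "\<Phi> = (\<lambda>(t, x, u). if t \<in> I \<and> x \<in> dom C then Some (gmap d (t, x, u)) else None)"

lemma dom_\<Phi>: "dom \<Phi> = I \<times> dom C \<times> UNIV"
proof (rule set_eqI)
  show "p \<in> dom \<Phi> \<longleftrightarrow> p \<in> I \<times> dom C \<times> UNIV" for p
    by (cases p) (simp add: \<Phi>_def gmap_def domIff)
qed

lemma \<Phi>_in: "p \<in> dom \<Phi> \<Longrightarrow> \<Phi> p = Some (gmap d p)"
  unfolding dom_\<Phi> by (auto simp: \<Phi>_def)

lemma ex_dom: "\<exists>x. x \<in> dom C" using C by (auto simp: potential_def)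

lemma tm_deriv: "t \<in> I \<Longrightarrow> (tm d has_real_derivative (sc d t)\<^sup>2) (at t)"
  and sc_nz: "t \<in> I \<Longrightarrow> sc d t \<noteq> 0"
  using germ ex_dom by (auto simp: germ_at_def)

lemma fa_nz: "t \<in> I \<Longrightarrow> x \<in> dom C \<Longrightarrow> fa d (t, x) \<noteq> 0"
  using germ by (simp add: germ_at_def)

lemma smooth_tm: "smooth_on (tm d) I"
  by (rule smooth_on_real_primitive[OF I(1) tm_deriv]) (auto intro!: smooth_on_power I smooth)

lemma tm_strict:
  assumes "s \<in> I" "t \<in> I" "s < t"
  shows "tm d s < tm d t"
proof (rule DERIV_pos_imp_increasing[OF assms(3)])
  fix r assume "s \<le> r" "r \<le> t"
  then have "r \<in> I" using assms I(2) unfolding is_interval_1 by blast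
  then show "\<exists>y. (tm d has_real_derivative y) (at r) \<and> 0 < y"
    using tm_deriv sc_nz by (intro exI[of _ "(sc d r)\<^sup>2"]) simp
qed

lemma tm_inj: "inj_on (tm d) I"
  by (rule inj_onI) (metis tm_strict less_irrefl linorder_neqE_linordered_idom)

definition \<sigma> :: "real \<Rightarrow> real" where "\<sigma> = the_inv_into I (tm d)"

lemma \<sigma>_tm: "t \<in> I \<Longrightarrow> \<sigma> (tm d t) = t"
  unfolding \<sigma>_def by (rule the_inv_into_f_f[OF tm_inj])

lemma open_tm: "open (tm d ` I)"
  by (rule invariance_of_domain[OF smooth_on_continuous[OF smooth_tm] I(1) tm_inj])

lemma \<sigma>_deriv:
  assumes "t \<in> I"
  shows "(\<sigma> has_real_derivative 1 / (sc d t)\<^sup>2) (at (tm d t))"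
  unfolding has_field_derivative_def
proof (rule has_derivative_inverse_strong[OF I(1) assms smooth_on_continuous[OF smooth_tm] \<sigma>_tm])
  show "(tm d has_derivative (*) ((sc d t)\<^sup>2)) (at t)"
    using tm_deriv[OF assms] by (simp add: has_field_derivative_def)
  show "(*) ((sc d t)\<^sup>2) \<circ> (*) (1 / (sc d t)\<^sup>2) = id"
    using sc_nz[OF assms] by (auto simp: fun_eq_iff)
qed

text \<open>The inverse time solves the autonomous equation with right-hand side
  \<open>1 / (sc d)\<^sup>2\<close>.\<close>

lemma smooth_\<sigma>: "smooth_on \<sigma> (tm d ` I)"
proof (rule smooth_on_ode[OF open_tm I(1)])
  show "\<sigma> s \<in> I" if "s \<in> tm d ` I" for s using that \<sigma>_tm by auto
  show "(\<sigma> has_real_derivative 1 / (sc d (\<sigma> s))\<^sup>2) (at s)" if "s \<in> tm d ` I" for s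
    using that \<sigma>_deriv \<sigma>_tm by auto
  show "smooth_on (\<lambda>t. 1 / (sc d t)\<^sup>2) I"
    by (intro smooth_on_divide smooth_on_power smooth_on_const I smooth) (simp add: sc_nz)
qed

definition dinv :: germ where "dinv = germ_inv \<sigma> d"

lemma gmap_dinv:
  assumes "t \<in> I" "x \<in> dom C"
  shows "gmap dinv (gmap d (t, x, u)) = (t, x, u)"
  using sc_nz[OF assms(1)] fa_nz[OF assms] by (simp add: gmap_def dinv_def germ_inv_def \<sigma>_tm[OF assms(1)] add_divide_distrib)

lemma germ_dinv:
  assumes "t \<in> I" "x \<in> dom C"
  shows "germ_at (\<lambda>x. the (C' x)) dinv (\<lambda>x. the (C x)) (tm d t) (sc d t * x + sh d t)"
  unfolding dinv_def by (rule germ_at_inv[OF germ[OF assms] \<sigma>_tm[OF assms(1)] \<sigma>_deriv[OF assms(1)]])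

lemma ran_\<Phi>: "ran \<Phi> = gmap d ` dom \<Phi>"
proof -
  have "ran \<Phi> = (\<lambda>p. the (\<Phi> p)) ` dom \<Phi>" by (force simp: ran_def dom_def image_def)
  also have "\<dots> = gmap d ` dom \<Phi>" using \<Phi>_in by (intro image_cong) auto
  finally show ?thesis .
qed

lemma inj_\<Phi>: "inj_on \<Phi> (dom \<Phi>)"
proof (rule inj_onI)
  fix p q assume pq: "p \<in> dom \<Phi>" "q \<in> dom \<Phi>" "\<Phi> p = \<Phi> q"
  then have "gmap dinv (gmap d p) = gmap dinv (gmap d q)" by (simp add: \<Phi>_in)
  moreover have "gmap dinv (gmap d r) = r" if "r \<in> dom \<Phi>" for r
    using that gmap_dinv unfolding dom_\<Phi> by (cases r) auto
  ultimately show "p = q" using pq(1,2) by simp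
qed

lemma inverse_\<Phi>:
  assumes "q \<in> ran \<Phi>"
  shows "inverse_map \<Phi> q = Some (gmap dinv q)"
proof -
  obtain p where p: "p \<in> dom \<Phi>" "q = gmap d p" using assms unfolding ran_\<Phi> by blast
  have "gmap dinv q = p" using p gmap_dinv unfolding dom_\<Phi> by (cases p) auto
  then show ?thesis using inverse_map_apply[OF inj_\<Phi>, of p q] \<Phi>_in[OF p(1)] p(2) by simp
qed

lemma smooth_gmap: "smooth_on (gmap d) (dom \<Phi>)"
proof -
  have o: "open (dom \<Phi>)" unfolding dom_\<Phi> by (intro open_Times I potential_open[OF C] open_UNIV)
  have f: "smooth_on (\<lambda>p::pt. f (fst p)) (dom \<Phi>)" if "smooth_on f I" for f :: "real \<Rightarrow> real"
    by (rule smooth_on_compose[OF that o I(1) smooth_on_fst[OF o smooth_on_id[OF o]]]) (auto simp: dom_\<Phi>)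
  have g: "smooth_on (\<lambda>p::pt. fa d (fst p, fst (snd p))) (dom \<Phi>)"
    by (rule smooth_on_compose[OF smooth(3) o open_Times[OF I(1) potential_open[OF C]]
          smooth_on_Pair[OF o smooth_on_fst[OF o smooth_on_id[OF o]] smooth_on_fst[OF o smooth_on_snd[OF o smooth_on_id[OF o]]]]])
      (auto simp: dom_\<Phi>)
  have "smooth_on (\<lambda>p. (tm d (fst p), sc d (fst p) * fst (snd p) + sh d (fst p), fa d (fst p, fst (snd p)) * snd (snd p))) (dom \<Phi>)"
    by (intro smooth_on_Pair smooth_on_add smooth_on_mult o f g smooth_tm smooth smooth_on_fst smooth_on_snd smooth_on_id)
  moreover have "gmap d = (\<lambda>p. (tm d (fst p), sc d (fst p) * fst (snd p) + sh d (fst p), fa d (fst p, fst (snd p)) * snd (snd p)))"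
    by (auto simp: gmap_def fun_eq_iff)
  ultimately show ?thesis by (simp only:)
qed

lemma point_transformation: "point_transformation \<Phi>"
proof -
  have o: "open (dom \<Phi>)" unfolding dom_\<Phi> by (intro open_Times I potential_open[OF C] open_UNIV)
  have inj: "inj_on (gmap d) (dom \<Phi>)"
    using inj_\<Phi> \<Phi>_in unfolding inj_on_def by simp
  have r: "open (ran \<Phi>)" unfolding ran_\<Phi>
    by (rule invariance_of_domain[OF smooth_on_continuous[OF smooth_gmap] o inj])
  have rI: "fst q \<in> tm d ` I" if "q \<in> ran \<Phi>" for q
    using that unfolding ran_\<Phi> dom_\<Phi> by (auto simp: gmap_def)
  have sI: "\<sigma> s \<in> I" if "s \<in> tm d ` I" for s using that \<sigma>_tm by auto
  have f: "smooth_on (\<lambda>q::pt. f (\<sigma> (fst q))) (ran \<Phi>)" if "smooth_on f I" for f :: "real \<Rightarrow> real"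
  proof (rule smooth_on_compose[OF that r I(1)])
    show "smooth_on (\<lambda>q::pt. \<sigma> (fst q)) (ran \<Phi>)"
      by (rule smooth_on_compose[OF smooth_\<sigma> r open_tm]) (auto intro!: smooth_intros r rI)
  qed (use rI sI in auto)
  have x: "smooth_on (\<lambda>q::pt. (fst (snd q) - sh d (\<sigma> (fst q))) / sc d (\<sigma> (fst q))) (ran \<Phi>)"
    by (intro smooth_on_divide smooth_on_diff f smooth smooth_on_fst smooth_on_snd smooth_on_id r) (use rI sI sc_nz in auto)
  have dom: "(\<sigma> (fst q), (fst (snd q) - sh d (\<sigma> (fst q))) / sc d (\<sigma> (fst q))) \<in> I \<times> dom C" if "q \<in> ran \<Phi>" for q
    using that sc_nz \<sigma>_tm unfolding ran_\<Phi> dom_\<Phi> by (auto simp: gmap_def)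
  have g: "smooth_on (\<lambda>q::pt. fa d (\<sigma> (fst q), (fst (snd q) - sh d (\<sigma> (fst q))) / sc d (\<sigma> (fst q)))) (ran \<Phi>)"
    by (rule smooth_on_compose[OF smooth(3) r open_Times[OF I(1) potential_open[OF C]] smooth_on_Pair[OF r f[OF smooth_on_id[OF I(1)]] x] dom])
  have "smooth_on (\<lambda>q. (\<sigma> (fst q), 1 / sc d (\<sigma> (fst q)) * fst (snd q) + - sh d (\<sigma> (fst q)) / sc d (\<sigma> (fst q)),
      1 / fa d (\<sigma> (fst q), (fst (snd q) - sh d (\<sigma> (fst q))) / sc d (\<sigma> (fst q))) * snd (snd q))) (ran \<Phi>)"
    by (intro smooth_on_Pair smooth_on_add smooth_on_mult smooth_on_divide smooth_on_minus smooth_on_const r f g smooth smooth_on_id I smooth_on_fst smooth_on_snd)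
      (use rI sI sc_nz dom fa_nz in auto)
  moreover have "gmap dinv = (\<lambda>q. (\<sigma> (fst q), 1 / sc d (\<sigma> (fst q)) * fst (snd q) + - sh d (\<sigma> (fst q)) / sc d (\<sigma> (fst q)),
      1 / fa d (\<sigma> (fst q), (fst (snd q) - sh d (\<sigma> (fst q))) / sc d (\<sigma> (fst q))) * snd (snd q)))"
    by (auto simp: gmap_def dinv_def germ_inv_def fun_eq_iff)
  ultimately have "smooth_on (gmap dinv) (ran \<Phi>)" by (simp only:)
  then have "smooth_on (\<lambda>q. the (inverse_map \<Phi> q)) (ran \<Phi>)"
    by (subst smooth_on_cong[OF r, of _ "gmap dinv"]) (simp_all add: inverse_\<Phi>)
  moreover have "smooth_on (\<lambda>p. the (\<Phi> p)) (dom \<Phi>)"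
    by (subst smooth_on_cong[OF o, of _ "gmap d"]) (simp_all add: \<Phi>_in smooth_gmap)
  moreover have "dom \<Phi> \<noteq> {}" unfolding dom_\<Phi> using I(3) ex_dom by auto
  ultimately show ?thesis using o r inj_\<Phi> by (simp add: point_transformation_def)
qed

text \<open>The defects of the two equations, left minus right side, differ only by the nonvanishing
  factors \<open>A\<close> and \<open>(sc d t)\<^sup>2\<close>; so one vanishes exactly when the
  other does.\<close>

lemma maps_equation: "maps_equation C \<Phi> C'"
  unfolding maps_equation_def
proof (intro allI impI, elim conjE)
  fix \<Omega> \<Omega>' :: "(real \<times> real) set" and w w' :: "real \<times> real \<Rightarrow> real" and t x t' x' :: real
  assume O: "open \<Omega>" "open \<Omega>'" and sm: "smooth_on w \<Omega>" "smooth_on w' \<Omega>'"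
    and tx: "(t, x) \<in> \<Omega>" "(t', x') \<in> \<Omega>'" and gr: "graph_over \<Omega> w \<subseteq> dom \<Phi>"
    and img: "(\<lambda>p. the (\<Phi> p)) ` graph_over \<Omega> w = graph_over \<Omega>' w'"
    and Phi: "\<Phi> (t, x, w (t, x)) = Some (t', x', w' (t', x'))"
  have IC: "s \<in> I \<and> y \<in> dom C" if "(s, y) \<in> \<Omega>" for s y
  proof -
    have "(s, y, w (s, y)) \<in> graph_over \<Omega> w" using that by (auto simp: graph_over_def)
    then show ?thesis using gr dom_\<Phi> by auto
  qed
  have w': "bmap d (s, y) \<in> \<Omega>' \<and> w' (bmap d (s, y)) = fa d (s, y) * w (s, y)" if "(s, y) \<in> \<Omega>" for s y
  proof -
    have "(s, y, w (s, y)) \<in> graph_over \<Omega> w" using that by (auto simp: graph_over_def)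
    then have "the (\<Phi> (s, y, w (s, y))) \<in> graph_over \<Omega>' w'" using img by blast
    then have "gmap d (s, y, w (s, y)) \<in> graph_over \<Omega>' w'" using IC[OF that] by (simp add: \<Phi>_def)
    then show ?thesis by (auto simp: graph_over_def gmap_def bmap_def)
  qed
  have tI: "t \<in> I" and xC: "x \<in> dom C" using IC[OF tx(1)] by auto
  have b0: "bmap d (t, x) = (t', x')" and t': "t' = tm d t" and x': "x' = sc d t * x + sh d t"
    using Phi tI xC by (auto simp: \<Phi>_def gmap_def bmap_def)
  let ?c = "\<lambda>x. the (C x)" and ?c' = "\<lambda>x. the (C' x)"
  define A where "A = fa d (t, x)"
  define a where "a = slope d t x"
  define k where "k = rate ?c d ?c' t x"
  define th where "th = sc d t"
  define X1 where "X1 = sc1 d t * x + sh1 d t"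
  define p q r where "p = dd w' (1, 0) (t', x')" and "q = dd w' (0, 1) (t', x')" and "r = dd (dd w' (0, 1)) (0, 1) (t', x')"
  define wt wx wxx where "wt = dd w (1, 0) (t, x)" and "wx = dd w (0, 1) (t, x)" and "wxx = dd (dd w (0, 1)) (0, 1) (t, x)"
  have g: "germ_at ?c d ?c' t y" if "y \<in> dom C" for y by (rule germ[OF tI that])
  have dfa: "(fa d has_derivative (\<lambda>(i, j). fa d (t, y) * (i * rate ?c d ?c' t y + j * slope d t y))) (at (t, y))"
    if "y \<in> dom C" for y using g[OF that] by (simp add: germ_at_def)
  have dw': "w' differentiable (at (t', x'))" and dw: "w differentiable (at (t, x))"
    by (rule smooth_on_differentiable[OF sm(2) tx(2)], rule smooth_on_differentiable[OF sm(1) tx(1)])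
  have first: "i * (th\<^sup>2 * p + X1 * q) + j * (th * q) = A * (i * k + j * a) * w (t, x) + A * (i * wt + j * wx)" for i j
  proof -
    have "(w' has_derivative (\<lambda>v. dd w' v (t', x'))) (at (bmap d (t, x)))"
      using dw' b0 by (simp add: frechet_derivative_works)
    from has_derivative_compose[OF bmap_has_derivative[OF g[OF xC]] this]
    have 1: "((\<lambda>z. w' (bmap d z)) has_derivative (\<lambda>v. dd w' (case v of (i, j) \<Rightarrow> ((sc d t)\<^sup>2 * i, (sc1 d t * x + sh1 d t) * i + sc d t * j)) (t', x'))) (at (t, x))" .
    have 2: "((\<lambda>z. w' (bmap d z)) has_derivative
       (\<lambda>v. fa d (t, x) * dd w v (t, x) + (case v of (i, j) \<Rightarrow> fa d (t, x) * (i * rate ?c d ?c' t x + j * slope d t x)) * w (t, x))) (at (t, x))"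
    proof (rule has_derivative_transform_within_open[OF has_derivative_mult[OF dfa[OF xC]] O(1) tx(1)])
      show "(w has_derivative (\<lambda>v. dd w v (t, x))) (at (t, x))" using dw by (simp add: frechet_derivative_works)
      show "fa d z * w z = w' (bmap d z)" if "z \<in> \<Omega>" for z using w' that by (cases z) simp
    qed
    from fun_cong[OF has_derivative_unique[OF 1 2], of "(i, j)"]
    have "dd w' (th\<^sup>2 * i, X1 * i + th * j) (t', x') = A * dd w (i, j) (t, x) + A * (i * k + j * a) * w (t, x)"
      by (simp add: A_def a_def k_def th_def X1_def)
    then show ?thesis
      unfolding dd_pair[OF dw', of "th\<^sup>2 * i" "X1 * i + th * j"] dd_pair[OF dw, of i j]
      by (simp add: p_def q_def wt_def wx_def algebra_simps)
  qed
  \<comment> \<open>The transformed function along the image of a line of constant \<open>t\<close>.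
    The transformed time is constant there, so the second derivative along this line yields
    \<open>r\<close>.\<close>
  define V where "V s = fa d (t, x + s) * w (t, x + s)" for s
  define V' where "V' s = fa d (t, x + s) * (slope d t (x + s) * w (t, x + s) + dd w (0, 1) (t, x + s))" for s
  have sl: "((\<lambda>s. slope d t (x + s)) has_real_derivative - sc1 d t / (2 * th)) (at 0)"
    unfolding slope_def th_def by (auto intro!: derivative_eq_intros simp: sc_nz[OF tI])
  have dfx: "((\<lambda>s. fa d (t, x + s)) has_real_derivative fa d (t, x + s) * slope d t (x + s)) (at s)" if "x + s \<in> dom C" for s
  proof -
    have v: "((\<lambda>s. (t, x + s)) has_vector_derivative (0, 1)) (at s)"
      by (auto intro!: derivative_eq_intros simp: zero_prod_def)
    have "fa d differentiable (at (t, x + s))" using dfa[OF that] by (auto simp: differentiable_def)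
    from dd_curve[where \<gamma> = "\<lambda>s. (t, x + s)", OF this v] show ?thesis
      using fun_cong[OF frechet_derivative_at[OF dfa[OF that]], of "(0, 1)"] by simp
  qed
  have dwx: "((\<lambda>s. f (t, x + s)) has_real_derivative dd f (0, 1) (t, x + s)) (at s)"
    if "smooth_on f \<Omega>" "(t, x + s) \<in> \<Omega>" for f :: "real \<times> real \<Rightarrow> real" and s
    by (rule dd_curve[where \<gamma> = "\<lambda>s. (t, x + s)", OF smooth_on_differentiable[OF that]])
      (auto intro!: derivative_eq_intros simp: zero_prod_def)
  have dV: "(V has_real_derivative V' s) (at s)" if "(t, x + s) \<in> \<Omega>" for s
    unfolding V_def V'_def using IC[OF that]
    by (intro DERIV_cong[OF DERIV_mult[OF dfx dwx[OF sm(1) that]]]) (auto simp: algebra_simps)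
  have inO: "\<forall>\<^sub>F s in nhds 0. (t, x + s) \<in> \<Omega>"
  proof -
    have "open ((\<lambda>s. (t, x + s)) -` \<Omega>)" by (intro open_vimage O continuous_intros)
    then have "\<forall>\<^sub>F s in nhds 0. s \<in> (\<lambda>s. (t, x + s)) -` \<Omega>"
      by (rule eventually_nhds_in_open) (simp add: tx)
    then show ?thesis by simp
  qed
  have evV: "\<forall>\<^sub>F s in nhds 0. (V has_real_derivative V' s) (at s)"
    using inO by (rule eventually_mono) (rule dV)
  have evw: "\<forall>\<^sub>F s in nhds 0. w' (tm d t, sc d t * (x + s) + sh d t) = V s"
    using inO by (rule eventually_mono) (use w' in \<open>simp add: V_def bmap_def\<close>)
  have evb: "\<forall>\<^sub>F s in nhds 0. ((\<lambda>s. sc d t * (x + s) + sh d t) has_real_derivative th) (at s)"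
    by (intro always_eventually allI) (auto intro!: derivative_eq_intros simp: th_def)
  have V2: "(V' has_real_derivative A * a * (a * w (t, x) + wx) + A * ((- sc1 d t / (2 * th)) * w (t, x) + a * wx + wxx)) (at 0)"
  proof -
    have 0: "x + 0 \<in> dom C" "(t, x + 0) \<in> \<Omega>" using xC tx by auto
    show ?thesis unfolding V'_def
      by (rule DERIV_cong[OF DERIV_mult[OF dfx[OF 0(1)] DERIV_add[OF DERIV_mult[OF sl dwx[OF sm(1) 0(2)]] dwx[OF smooth_on_dd[OF sm(1)] 0(2)]]]])
        (simp add: A_def a_def wx_def wxx_def algebra_simps)
  qed
  have second: "A * a * (a * w (t, x) + wx) + A * ((- sc1 d t / (2 * th)) * w (t, x) + a * wx + wxx) = r * th\<^sup>2"
    using second_derivative_along_curve[OF O(2) sm(2) _ _ _ evb _ evV V2 evw, of "\<lambda>_. 0" 0 0] tx(2)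
    by (auto simp: t' x' th_def r_def intro!: always_eventually derivative_eq_intros)
  have kk: "k = th\<^sup>2 * ?c' x' - ?c x - a\<^sup>2 + (- sc1 d t / (2 * th))"
    by (simp add: k_def rate_def th_def x' a_def)
  have Xa: "X1 = - 2 * a * th"
    using sc_nz[OF tI] by (simp add: X1_def a_def slope_def th_def)
  have e1: "th\<^sup>2 * p + X1 * q = A * k * w (t, x) + A * wt" and e2: "th * q = A * a * w (t, x) + A * wx"
    using first[of 1 0] first[of 0 1] by simp_all
  have w'0: "w' (t', x') = A * w (t, x)" using w'[OF tx(1)] b0 by (simp add: A_def)
  \<comment> \<open>The intertwining relation. The conditions on \<open>rate\<close> and
    \<open>slope\<close> are exactly what makes all terms with \<open>w\<close> and
    \<open>wx\<close> cancel.\<close>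
  have id: "th\<^sup>2 * (p - (r + ?c' x' * (A * w (t, x)))) = A * (wt - (wxx + ?c x * w (t, x)))"
    using e1 e2 second kk Xa by algebra
  have "A \<noteq> 0" "th \<noteq> 0" using fa_nz[OF tI xC] sc_nz[OF tI] by (simp_all add: A_def th_def)
  then have "wt = wxx + ?c x * w (t, x) \<longleftrightarrow> p = r + ?c' x' * (A * w (t, x))"
    using id by auto
  then show "satisfies_at C w t x \<longleftrightarrow> satisfies_at C' w' t' x'"
    using satisfies_at_dd[OF O(1) sm(1) tx(1), of C] satisfies_at_dd[OF O(2) sm(2) tx(2), of C'] xC range[OF tI xC] w'0
    by (simp add: wt_def wxx_def p_def r_def x' t')
qed

lemma admissible: "(C, \<Phi>, C') \<in> admissible"
proof -
  have "x \<in> dom C" if "(t, x, u) \<in> dom \<Phi>" for t x u using that by (simp add: dom_\<Phi>)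
  moreover have "x \<in> dom C'" if "(t, x, u) \<in> ran \<Phi>" for t x u
    using that range unfolding ran_\<Phi> dom_\<Phi> by (auto simp: gmap_def)
  ultimately show ?thesis
    using C C' point_transformation maps_equation by (fastforce simp: admissible_def)
qed

end

subsection \<open>Restrictions, inverses and compositions of admissible transformations\<close>

abbreviation xpart :: "pt \<Rightarrow> real" where "xpart p \<equiv> fst (snd p)"

lemma potential_restrict:
  assumes "potential C" "open D" "is_interval D" "x \<in> D" "x \<in> dom C"
  shows "potential (C |` D)"
proof -
  have o: "open (dom C)" and i: "is_interval (dom C)" and s: "smooth_on (\<lambda>x. the (C x)) (dom C)"
    using assms(1) by (auto simp: potential_def)
  have d: "dom (C |` D) = dom C \<inter> D" by simp
  have "smooth_on (\<lambda>x. the ((C |` D) x)) (dom C \<inter> D)"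
    by (subst smooth_on_cong[OF open_Int[OF o assms(2)], of _ "\<lambda>x. the (C x)"])
      (auto intro: smooth_on_subset[OF s])
  then show ?thesis
    unfolding potential_def d using assms o i by (auto intro!: is_interval_Int)
qed

lemma map_leD:
  assumes "m \<subseteq>\<^sub>m m'" "m x = Some y"
  shows "m' x = Some y"
proof -
  have "m x = m' x" using assms(1) domI[of m, OF assms(2)] unfolding map_le_def by (rule bspec)
  then show ?thesis using assms(2) by simp
qed

lemma map_le_SomeI:
  assumes "\<And>x y. m x = Some y \<Longrightarrow> y = f x"
  shows "m \<subseteq>\<^sub>m (\<lambda>x. Some (f x))"
  unfolding map_le_def
proof
  fix x assume "x \<in> dom m"
  then obtain y where y: "m x = Some y" unfolding domIff by (cases "m x") auto
  show "m x = Some (f x)" using assms[OF y] unfolding y by (rule arg_cong)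
qed

lemma restrict_map_Some: "(m |` A) x = Some y \<longleftrightarrow> x \<in> A \<and> m x = Some y"
  by (simp add: restrict_map_def)

lemma the_dom: "p \<in> dom \<Phi> \<Longrightarrow> \<Phi> p = Some (the (\<Phi> p))"
  by auto

lemma ran_image: "ran \<Phi> = (\<lambda>p. the (\<Phi> p)) ` dom \<Phi>"
  by (force simp: ran_def dom_def image_def)

lemma inverse_map_props:
  assumes "inj_on \<Phi> (dom \<Phi>)"
  shows "dom (inverse_map \<Phi>) = ran \<Phi>" "ran (inverse_map \<Phi>) = dom \<Phi>"
    "inverse_map (inverse_map \<Phi>) = \<Phi>" "inj_on (inverse_map \<Phi>) (dom (inverse_map \<Phi>))"
    "\<And>p q. inverse_map \<Phi> q = Some p \<longleftrightarrow> \<Phi> p = Some q"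
proof -
  show iff: "inverse_map \<Phi> q = Some p \<longleftrightarrow> \<Phi> p = Some q" for p q
  proof
    assume "inverse_map \<Phi> q = Some p"
    then have "q \<in> ran \<Phi>" by (auto simp: inverse_map_def split: if_splits)
    then obtain p' where p': "\<Phi> p' = Some q" by (auto simp: ran_def)
    then show "\<Phi> p = Some q" using inverse_map_apply[OF assms p'] \<open>inverse_map \<Phi> q = Some p\<close> by simp
  qed (rule inverse_map_apply[OF assms])
  show d: "dom (inverse_map \<Phi>) = ran \<Phi>" by (auto simp: inverse_map_def dom_def)
  show r: "ran (inverse_map \<Phi>) = dom \<Phi>" unfolding ran_def dom_def iff by blast
  show inj: "inj_on (inverse_map \<Phi>) (dom (inverse_map \<Phi>))"
  proof (rule inj_onI)
    fix q q' assume q: "q \<in> dom (inverse_map \<Phi>)" "inverse_map \<Phi> q = inverse_map \<Phi> q'"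
    then obtain p where "inverse_map \<Phi> q = Some p" by blast
    then have "\<Phi> p = Some q" "\<Phi> p = Some q'" using q(2) iff by metis+
    then show "q = q'" by simp
  qed
  show "inverse_map (inverse_map \<Phi>) = \<Phi>"
  proof
    fix p
    show "inverse_map (inverse_map \<Phi>) p = \<Phi> p"
    proof (cases "\<Phi> p")
      case None
      then have "p \<notin> ran (inverse_map \<Phi>)" unfolding r by (simp add: domIff)
      then show ?thesis using None by (simp add: inverse_map_def)
    next
      case (Some q)
      then show ?thesis using inverse_map_apply[OF inj, of q p] iff by simp
    qed
  qed
qed

text \<open>A smaller transformation has fewer test graphs. The last hypothesis is there because
  \<open>satisfies_at\<close> also demands that the point lie in the domain of the
  potential.\<close>

lemma maps_equation_mono:
  assumes "maps_equation C \<Phi> C'" "\<Phi>0 \<subseteq>\<^sub>m \<Phi>" "C0 \<subseteq>\<^sub>m C" "C0' \<subseteq>\<^sub>m C'"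
    "\<And>p q. \<Phi>0 p = Some q \<Longrightarrow> xpart p \<in> dom C0 \<and> xpart q \<in> dom C0'"
  shows "maps_equation C0 \<Phi>0 C0'"
  unfolding maps_equation_def
proof (intro allI impI, elim conjE)
  fix \<Omega> \<Omega>' :: "(real \<times> real) set" and w w' :: "real \<times> real \<Rightarrow> real" and t x t' x' :: real
  assume a: "open \<Omega>" "open \<Omega>'" "smooth_on w \<Omega>" "smooth_on w' \<Omega>'" "(t, x) \<in> \<Omega>" "(t', x') \<in> \<Omega>'"
    and gr: "graph_over \<Omega> w \<subseteq> dom \<Phi>0"
    and img: "(\<lambda>p. the (\<Phi>0 p)) ` graph_over \<Omega> w = graph_over \<Omega>' w'"
    and P: "\<Phi>0 (t, x, w (t, x)) = Some (t', x', w' (t', x'))"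
  have sub: "\<Phi>0 p = \<Phi> p" if "p \<in> dom \<Phi>0" for p
    using assms(2) that by (simp add: map_le_def)
  have gr': "graph_over \<Omega> w \<subseteq> dom \<Phi>"
    using gr map_le_implies_dom_le[OF assms(2)] by (rule subset_trans)
  have img': "(\<lambda>p. the (\<Phi> p)) ` graph_over \<Omega> w = graph_over \<Omega>' w'"
    unfolding img[symmetric]
  proof (rule image_cong[OF refl])
    fix p assume "p \<in> graph_over \<Omega> w"
    then have "p \<in> dom \<Phi>0" using gr by blast
    from sub[OF this] show "the (\<Phi> p) = the (\<Phi>0 p)" by simp
  qed
  have "\<Phi> (t, x, w (t, x)) = Some (t', x', w' (t', x'))"
    by (rule map_leD[OF assms(2) P])
  with assms(1) a gr' img' have *: "satisfies_at C w t x \<longleftrightarrow> satisfies_at C' w' t' x'"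
    unfolding maps_equation_def by blast
  have d: "x \<in> dom C0" "x' \<in> dom C0'" using assms(5)[OF P] by simp_all
  have c: "C0 x = C x" "C0' x' = C' x'" using assms(3,4) d by (simp_all add: map_le_def)
  have d': "x \<in> dom C" "x' \<in> dom C'"
    using d map_le_implies_dom_le[OF assms(3)] map_le_implies_dom_le[OF assms(4)] by auto
  show "satisfies_at C0 w t x \<longleftrightarrow> satisfies_at C0' w' t' x'"
    using * d d' unfolding satisfies_at_def c by simp
qed

lemma maps_equation_inverse:
  assumes "maps_equation C \<Phi> C'" "inj_on \<Phi> (dom \<Phi>)"
  shows "maps_equation C' (inverse_map \<Phi>) C"
  unfolding maps_equation_def
proof (intro allI impI, elim conjE)
  fix \<Omega> \<Omega>' :: "(real \<times> real) set" and w w' :: "real \<times> real \<Rightarrow> real" and t x t' x' :: real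
  assume a: "open \<Omega>" "open \<Omega>'" "smooth_on w \<Omega>" "smooth_on w' \<Omega>'" "(t, x) \<in> \<Omega>" "(t', x') \<in> \<Omega>'"
    and gr: "graph_over \<Omega> w \<subseteq> dom (inverse_map \<Phi>)"
    and img: "(\<lambda>p. the (inverse_map \<Phi> p)) ` graph_over \<Omega> w = graph_over \<Omega>' w'"
    and P: "inverse_map \<Phi> (t, x, w (t, x)) = Some (t', x', w' (t', x'))"
  note iff = inverse_map_props(5)[OF assms(2)]
  have pq: "\<Phi> (the (inverse_map \<Phi> q)) = Some q" if "q \<in> graph_over \<Omega> w" for q
    using gr that iff the_dom[of q "inverse_map \<Phi>"] by blast
  have gr': "graph_over \<Omega>' w' \<subseteq> dom \<Phi>"
    unfolding img[symmetric] using pq by (auto simp: dom_def)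
  have img': "(\<lambda>p. the (\<Phi> p)) ` graph_over \<Omega>' w' = graph_over \<Omega> w"
    unfolding img[symmetric] image_image using pq by (simp cong: image_cong)
  have "\<Phi> (t', x', w' (t', x')) = Some (t, x, w (t, x))" using P iff by simp
  with assms(1) a gr' img' show "satisfies_at C' w t x \<longleftrightarrow> satisfies_at C w' t' x'"
    unfolding maps_equation_def by blast
qed

lemma admissible_inverse:
  assumes "T \<in> admissible"
  shows "inverse_of T \<in> admissible"
proof -
  obtain C \<Phi> C' where T: "T = (C, \<Phi>, C')" by (cases T)
  have a: "potential C" "potential C'" "point_transformation \<Phi>" "\<forall>(t, x, u)\<in>dom \<Phi>. x \<in> dom C"
    "\<forall>(t, x, u)\<in>ran \<Phi>. x \<in> dom C'" "maps_equation C \<Phi> C'"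
    using assms unfolding T by (simp_all add: admissible_def)
  have inj: "inj_on \<Phi> (dom \<Phi>)" using a(3) by (simp add: point_transformation_def)
  note i = inverse_map_props[OF inj]
  have "ran \<Phi> \<noteq> {}" using a(3) unfolding ran_image by (simp add: point_transformation_def)
  then have "point_transformation (inverse_map \<Phi>)"
    using a(3) unfolding point_transformation_def i(1,2,3) using i(4) i(1) by simp
  then show ?thesis
    using a maps_equation_inverse[OF a(6) inj] unfolding T
    by (simp add: admissible_def inverse_of_def source_def target_def trans_part_def i)
qed

text \<open>Admissibility ties the \<open>x\<close>-coordinates of domain and range to the domains
  of the potentials, so shrinking a potential forces the point transformation to shrink with
  it.\<close>

definition cut :: "pt set \<Rightarrow> real set \<Rightarrow> real set \<Rightarrow> triple \<Rightarrow> triple" where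
  "cut W D D' T = (source T |` D,
     trans_part T |` {p \<in> W. xpart p \<in> D \<and> xpart (the (trans_part T p)) \<in> D'}, target T |` D')"

lemma cut_admissible:
  assumes T: "T \<in> admissible" and p: "trans_part T p = Some q"
    and W: "open W" "p \<in> W" and D: "open D" "is_interval D" "xpart p \<in> D"
    and D': "open D'" "is_interval D'" "xpart q \<in> D'"
  shows "cut W D D' T \<in> admissible"
proof -
  obtain C \<Phi> C' where TT: "T = (C, \<Phi>, C')" by (cases T)
  interpret admissible_transformation C \<Phi> C' using T by (simp add: admissible_transformation_def TT)
  have pq: "\<Phi> p = Some q" using p by (simp add: TT trans_part_def)
  have pd: "p \<in> dom \<Phi>" using pq by (simp add: domIff)
  define V where "V = {p \<in> dom \<Phi>. p \<in> W \<and> xpart p \<in> D \<and> X p \<in> D'}"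
  have V_eq: "V = dom \<Phi> \<inter> (W \<inter> (\<lambda>p. xpart p) -` D) \<inter> (dom \<Phi> \<inter> X -` D')" by (auto simp: V_def)
  have oV: "open V" unfolding V_eq
    by (intro open_Int open_dom W open_vimage D continuous_intros continuous_open_preimage smooth_on_continuous[OF smooth_X] D')
  have sub: "V \<subseteq> dom \<Phi>" by (auto simp: V_def)
  have pV: "p \<in> V" using pd W D D' apply_eq[OF pd] pq by (simp add: V_def)
  have R_eq: "\<Phi> |` {p \<in> W. xpart p \<in> D \<and> xpart (the (\<Phi> p)) \<in> D'} = \<Phi> |` V"
  proof
    fix r
    show "(\<Phi> |` {p \<in> W. xpart p \<in> D \<and> xpart (the (\<Phi> p)) \<in> D'}) r = (\<Phi> |` V) r"
    proof (cases "r \<in> dom \<Phi>")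
      case True
      then show ?thesis unfolding restrict_map_def V_def X_def by (simp only: mem_Collect_eq simp_thms)
    next
      case False
      then have "\<Phi> r = None" by (simp only: domIff not_not)
      then show ?thesis by (simp add: restrict_map_def)
    qed
  qed
  have d0: "dom (\<Phi> |` V) = V" using sub by auto
  have inj: "inj_on \<Phi> (dom \<Phi>)" using point_transformation by (simp add: point_transformation_def)
  have inj0: "inj_on (\<Phi> |` V) (dom (\<Phi> |` V))"
    unfolding d0 using inj_on_subset[OF inj sub] by (simp add: inj_on_def)
  have r0: "ran (\<Phi> |` V) = ran \<Phi> \<inter> (\<lambda>q. the (inverse_map \<Phi> q)) -` V"
  proof (rule set_eqI)
    fix r
    have "r \<in> ran (\<Phi> |` V) \<longleftrightarrow> (\<exists>p. p \<in> V \<and> \<Phi> p = Some r)"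
      by (auto simp: ran_def restrict_map_def split: if_splits)
    also have "\<dots> \<longleftrightarrow> r \<in> ran \<Phi> \<inter> (\<lambda>q. the (inverse_map \<Phi> q)) -` V"
    proof
      assume "\<exists>p. p \<in> V \<and> \<Phi> p = Some r"
      then obtain s where s: "s \<in> V" "\<Phi> s = Some r" by blast
      from ranI[of \<Phi>, OF s(2)] s(1) inverse_map_apply[OF inj s(2)]
      show "r \<in> ran \<Phi> \<inter> (\<lambda>q. the (inverse_map \<Phi> q)) -` V" by simp
    next
      assume r: "r \<in> ran \<Phi> \<inter> (\<lambda>q. the (inverse_map \<Phi> q)) -` V"
      then obtain s where s: "\<Phi> s = Some r" unfolding ran_def by blast
      then have "s \<in> V" using r inverse_map_apply[OF inj s] by simp
      then show "\<exists>p. p \<in> V \<and> \<Phi> p = Some r" using s by blast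
    qed
    finally show "r \<in> ran (\<Phi> |` V) \<longleftrightarrow> r \<in> ran \<Phi> \<inter> (\<lambda>q. the (inverse_map \<Phi> q)) -` V" .
  qed
  have orr: "open (ran \<Phi>)" and smi: "smooth_on (\<lambda>q. the (inverse_map \<Phi> q)) (ran \<Phi>)"
    using point_transformation by (auto simp: point_transformation_def)
  have or0: "open (ran (\<Phi> |` V))" unfolding r0
    by (rule continuous_open_preimage[OF smooth_on_continuous[OF smi] orr oV])
  have sm0: "smooth_on (\<lambda>p. the ((\<Phi> |` V) p)) V"
    by (subst smooth_on_cong[OF oV, of _ "\<lambda>p. the (\<Phi> p)"]) (auto intro: smooth_on_subset[OF smooth sub])
  have inv0: "inverse_map (\<Phi> |` V) r = inverse_map \<Phi> r" if r: "r \<in> ran (\<Phi> |` V)" for r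
  proof -
    obtain s where s: "(\<Phi> |` V) s = Some r" using r unfolding ran_def by blast
    then have "\<Phi> s = Some r" unfolding restrict_map_def by (simp split: if_splits)
    then show ?thesis using inverse_map_apply[OF inj] inverse_map_apply[OF inj0 s] by simp
  qed
  have smi0: "smooth_on (\<lambda>q. the (inverse_map (\<Phi> |` V) q)) (ran (\<Phi> |` V))"
    by (subst smooth_on_cong[OF or0, of _ "\<lambda>q. the (inverse_map \<Phi> q)"])
      (auto simp: inv0 intro: smooth_on_subset[OF smi] simp: r0)
  have pt: "point_transformation (\<Phi> |` V)"
    unfolding point_transformation_def using inj0 or0 smi0 pV oV sm0 unfolding d0 by auto
  have xs: "xpart s \<in> dom (C |` D) \<and> xpart r \<in> dom (C' |` D')" if "(\<Phi> |` V) s = Some r" for s r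
  proof -
    have s: "s \<in> V" "\<Phi> s = Some r" using that by (auto simp: restrict_map_def split: if_splits)
    have "s \<in> dom \<Phi>" using s sub by blast
    then have "xpart s \<in> dom C" "X s \<in> dom C'" using source_dom[of "fst s" "xpart s" "snd (snd s)"] target_dom by simp_all
    then show ?thesis using s by (auto simp: V_def X_def)
  qed
  have mp: "maps_equation (C |` D) (\<Phi> |` V) (C' |` D')"
    by (rule maps_equation_mono[OF maps _ _ _ xs]) (auto simp: map_le_def)
  have a1: "x \<in> dom (C |` D)" if m: "(t, x, u) \<in> dom (\<Phi> |` V)" for t x u
  proof -
    obtain r where "(\<Phi> |` V) (t, x, u) = Some r" using m by blast
    from xs[OF this] show ?thesis by simp
  qed
  have a2: "x \<in> dom (C' |` D')" if m: "(t, x, u) \<in> ran (\<Phi> |` V)" for t x u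
  proof -
    obtain s where "(\<Phi> |` V) s = Some (t, x, u)" using m unfolding ran_def by blast
    from xs[OF this] show ?thesis by simp
  qed
  have "\<forall>z\<in>dom (\<Phi> |` V). case z of (t, x, u) \<Rightarrow> x \<in> dom (C |` D)"
  proof
    fix z assume z: "z \<in> dom (\<Phi> |` V)"
    obtain t x u where eq: "z = (t, x, u)" by (cases z)
    show "case z of (t, x, u) \<Rightarrow> x \<in> dom (C |` D)" using a1[OF z[unfolded eq]] by (simp only: eq prod.case)
  qed
  moreover have "\<forall>z\<in>ran (\<Phi> |` V). case z of (t, x, u) \<Rightarrow> x \<in> dom (C' |` D')"
  proof
    fix z assume z: "z \<in> ran (\<Phi> |` V)"
    obtain t x u where eq: "z = (t, x, u)" by (cases z)
    show "case z of (t, x, u) \<Rightarrow> x \<in> dom (C' |` D')" using a2[OF z[unfolded eq]] by (simp only: eq prod.case)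
  qed
  moreover have "potential (C |` D)" "potential (C' |` D')"
  proof -
    have "p \<in> dom (\<Phi> |` V)" using pV d0 by simp
    then obtain r where "(\<Phi> |` V) p = Some r" by blast
    then have "r = q" using pq by (auto simp: restrict_map_def split: if_splits)
    then have "xpart p \<in> dom (C |` D)" "xpart q \<in> dom (C' |` D')" using xs \<open>(\<Phi> |` V) p = Some r\<close> by blast+
    then show "potential (C |` D)" "potential (C' |` D')"
      using potential_restrict[OF potentials(1) D] potential_restrict[OF potentials(2) D'] by auto
  qed
  ultimately show ?thesis
    using pt mp unfolding cut_def TT source_def trans_part_def target_def fst_conv snd_conv R_eq admissible_def
      mem_Collect_eq prod.case by (intro conjI)
qed

lemma restriction_refl: "T \<sqsubseteq>\<^sub>r T"
  by (simp add: restriction_of_def)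

lemma restriction_trans:
  assumes "T \<sqsubseteq>\<^sub>r T'" "T' \<sqsubseteq>\<^sub>r T''"
  shows "T \<sqsubseteq>\<^sub>r T''"
  using assms map_le_trans[of "source T" "source T'" "source T''"]
    map_le_trans[of "trans_part T" "trans_part T'" "trans_part T''"]
    map_le_trans[of "target T" "target T'" "target T''"]
  unfolding restriction_of_def by iprover

lemma cut_restriction: "cut W D D' T \<sqsubseteq>\<^sub>r T"
  by (simp add: restriction_of_def cut_def source_def trans_part_def target_def map_le_def)

lemma cut_in_restrictions:
  assumes "T \<in> restrictions S" "trans_part T p = Some q" "open W" "p \<in> W" "open D" "is_interval D" "xpart p \<in> D"
    "open D'" "is_interval D'" "xpart q \<in> D'"
  shows "cut W D D' T \<in> restrictions S"
proof -
  obtain T' where T: "T \<in> admissible" "T' \<in> S" "T \<sqsubseteq>\<^sub>r T'"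
    using assms(1) unfolding restrictions_def by blast
  have "cut W D D' T \<in> admissible" by (rule cut_admissible[OF T(1) assms(2-)])
  moreover have "cut W D D' T \<sqsubseteq>\<^sub>r T'" by (rule restriction_trans[OF cut_restriction T(3)])
  ultimately show ?thesis unfolding restrictions_def using T(2) by blast
qed

lemma compositions_append:
  assumes "A \<in> compositions S" "B \<in> compositions S" "composable A B"
  shows "A \<star> B \<in> compositions S"
  using assms(1,3)
proof (induction rule: compositions.induct)
  case (single T)
  then show ?case using assms(2) compositions.step by blast
next
  case (step T T')
  have "composable T' B" using step by (simp add: composable_def compose_def target_def)
  then have "T' \<star> B \<in> compositions S" using step by blast
  moreover have "composable T (T' \<star> B)" using step by (simp add: composable_def compose_def source_def)
  ultimately have "T \<star> (T' \<star> B) \<in> compositions S" using step compositions.step by blast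
  moreover have "T \<star> (T' \<star> B) = T \<star> T' \<star> B"
    by (auto simp: compose_def source_def trans_part_def target_def map_comp_def fun_eq_iff split: option.splits)
  ultimately show ?case by simp
qed

lemma admissible_points:
  assumes "T \<in> admissible" "trans_part T p = Some q"
  shows "potential (source T)" "potential (target T)" "xpart p \<in> dom (source T)" "xpart q \<in> dom (target T)"
proof -
  obtain C \<Phi> C' where T: "T = (C, \<Phi>, C')" by (cases T)
  interpret admissible_transformation C \<Phi> C' using assms by (simp add: admissible_transformation_def T)
  have pd: "\<Phi> p = Some q" using assms by (simp add: T trans_part_def)
  then have "p \<in> dom \<Phi>" by (simp add: domIff)
  then show "potential (source T)" "potential (target T)" "xpart p \<in> dom (source T)" "xpart q \<in> dom (target T)"
    using potentials source_dom[of "fst p" "xpart p" "snd (snd p)"] target_dom[of p] pd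
    by (simp_all add: T source_def target_def X_def)
qed

lemma compose_apply: "trans_part (T \<star> T') p = Some q \<longleftrightarrow> (\<exists>r. trans_part T p = Some r \<and> trans_part T' r = Some q)"
  by (simp add: compose_def trans_part_def map_comp_Some_iff)

lemma compositions_points:
  assumes "T \<in> compositions (restrictions S)" "trans_part T p = Some q"
  shows "potential (source T) \<and> potential (target T) \<and> xpart p \<in> dom (source T) \<and> xpart q \<in> dom (target T)"
  using assms
proof (induction arbitrary: p rule: compositions.induct)
  case (single T)
  then show ?case using admissible_points unfolding restrictions_def by blast
next
  case (step T T')
  from step.prems obtain r where r: "trans_part T p = Some r" "trans_part T' r = Some q"
    unfolding compose_apply by blast
  have "T \<in> admissible" using step.hyps(1) by (simp add: restrictions_def)
  from admissible_points[OF this r(1)] step.IH[OF r(2)]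
  show ?case by (simp add: compose_def source_def target_def)
qed

text \<open>Only the two ends shrink: the first factor is cut at its source and the last one at its
  target. The potentials in between stay the same, so the factors remain composable.\<close>

lemma compositions_cut:
  assumes "T \<in> compositions (restrictions S)" "trans_part T p = Some q" "open W" "p \<in> W"
    "open D" "is_interval D" "xpart p \<in> D" "open D'" "is_interval D'" "xpart q \<in> D'"
  shows "\<exists>T1\<in>compositions (restrictions S). source T1 = source T |` D \<and> target T1 = target T |` D' \<and>
    trans_part T1 \<subseteq>\<^sub>m trans_part T |` W \<and> p \<in> dom (trans_part T1)"
  using assms(1,2) assms(3-)
proof (induction arbitrary: p W D rule: compositions.induct)
  case (single T)
  have "cut W D D' T \<in> compositions (restrictions S)"
    by (rule compositions.single, rule cut_in_restrictions) (use single in auto)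
  then show ?case
    by (rule rev_bexI) (use single in \<open>auto simp: cut_def source_def target_def trans_part_def map_le_def restrict_map_def split: if_splits\<close>)
next
  case (step T T')
  from step.prems(1) obtain r where r: "trans_part T p = Some r" "trans_part T' r = Some q"
    unfolding compose_apply by blast
  from step.IH[OF r(2), of UNIV UNIV] step.prems
  obtain T1 where T1: "T1 \<in> compositions (restrictions S)" "source T1 = source T'" "target T1 = target T' |` D'"
    "trans_part T1 \<subseteq>\<^sub>m trans_part T'" "r \<in> dom (trans_part T1)"
    by (auto simp: is_interval_univ restrict_map_def[of _ UNIV])
  let ?T = "cut W D UNIV T"
  have c: "?T \<in> restrictions S"
    by (rule cut_in_restrictions[OF step.hyps(1) r(1)]) (use step.prems in \<open>auto simp: is_interval_univ\<close>)
  have comp: "composable ?T T1"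
    using step.hyps(3) T1(2) by (simp add: composable_def cut_def target_def restrict_map_def[of _ UNIV])
  have "?T \<star> T1 \<in> compositions (restrictions S)" by (rule compositions.step[OF c T1(1) comp])
  moreover have "source (?T \<star> T1) = source (T \<star> T') |` D" by (simp add: compose_def cut_def source_def)
  moreover have "target (?T \<star> T1) = target (T \<star> T') |` D'" using T1(3) by (simp add: compose_def target_def)
  moreover have "trans_part (?T \<star> T1) \<subseteq>\<^sub>m trans_part (T \<star> T') |` W"
    unfolding map_le_def
  proof
    fix s assume "s \<in> dom (trans_part (?T \<star> T1))"
    then obtain y where y: "trans_part (?T \<star> T1) s = Some y" by blast
    then obtain z where z: "trans_part ?T s = Some z" "trans_part T1 z = Some y" unfolding compose_apply by blast
    have "s \<in> W" "trans_part T s = Some z"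
      using z(1) by (auto simp: cut_def trans_part_def restrict_map_def split: if_splits)
    moreover have "trans_part T' z = Some y"
      by (rule map_leD[OF T1(4) z(2)])
    ultimately show "trans_part (?T \<star> T1) s = (trans_part (T \<star> T') |` W) s"
      using y compose_apply[of T T' s y] by auto
  qed
  moreover have "p \<in> dom (trans_part (?T \<star> T1))"
  proof -
    obtain y where "trans_part T1 r = Some y" using T1(5) by blast
    moreover have "trans_part ?T p = Some r" using r(1) step.prems by (simp add: cut_def trans_part_def)
    ultimately show ?thesis unfolding domIff using compose_apply[of ?T T1 p y] by auto
  qed
  ultimately show ?case by blast
qed

text \<open>Reachability only depends on the germs of \<open>c\<close>, \<open>F\<close> and \<open>c'\<close>, which may therefore be taken total.\<close>

definition reachable :: "triple set \<Rightarrow> (real \<Rightarrow> real) \<Rightarrow> (pt \<Rightarrow> pt) \<Rightarrow> (real \<Rightarrow> real) \<Rightarrow> pt \<Rightarrow> bool" where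
  "reachable S c F c' p \<longleftrightarrow> (\<exists>T\<in>compositions (restrictions S). p \<in> dom (trans_part T) \<and>
     trans_part T \<subseteq>\<^sub>m (\<lambda>q. Some (F q)) \<and> source T \<subseteq>\<^sub>m (\<lambda>x. Some (c x)) \<and> target T \<subseteq>\<^sub>m (\<lambda>x. Some (c' x)))"

lemma reachableI:
  assumes "T \<in> S" "T \<in> admissible" "p \<in> dom (trans_part T)"
    "\<And>q r. trans_part T q = Some r \<Longrightarrow> r = F q"
    "\<And>x y. source T x = Some y \<Longrightarrow> y = c x" "\<And>x y. target T x = Some y \<Longrightarrow> y = c' x"
  shows "reachable S c F c' p"
proof -
  have "T \<in> compositions (restrictions S)"
    by (rule compositions.single) (use assms(1,2) restriction_refl[of T] in \<open>unfold restrictions_def, blast\<close>)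
  moreover have "trans_part T \<subseteq>\<^sub>m (\<lambda>q. Some (F q))" by (rule map_le_SomeI[OF assms(4)])
  moreover have "source T \<subseteq>\<^sub>m (\<lambda>x. Some (c x))" by (rule map_le_SomeI[OF assms(5)])
  moreover have "target T \<subseteq>\<^sub>m (\<lambda>x. Some (c' x))" by (rule map_le_SomeI[OF assms(6)])
  ultimately show ?thesis unfolding reachable_def using assms(3) by blast
qed

lemma open_interval_around:
  fixes x :: real
  assumes "\<forall>\<^sub>F y in nhds x. P y"
  obtains D where "open D" "is_interval D" "x \<in> D" "\<And>y. y \<in> D \<Longrightarrow> P y"
proof -
  obtain e where "e > 0" "\<And>y. dist y x < e \<Longrightarrow> P y"
    using assms unfolding eventually_nhds_metric by blast
  then show thesis using that[of "ball x e"] by (simp add: is_interval_ball_real dist_commute)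
qed

text \<open>A witness is cut to neighbourhoods on which the old and new data agree.\<close>

lemma reachable_cong:
  assumes "reachable S c F c' p"
    and F: "\<forall>\<^sub>F q in nhds p. F q = G q" and c: "\<forall>\<^sub>F x in nhds (xpart p). c x = e x"
    and c': "\<forall>\<^sub>F x in nhds (xpart (F p)). c' x = e' x"
  shows "reachable S e G e' p"
proof -
  obtain T where T: "T \<in> compositions (restrictions S)" "p \<in> dom (trans_part T)"
    "trans_part T \<subseteq>\<^sub>m (\<lambda>q. Some (F q))" "source T \<subseteq>\<^sub>m (\<lambda>x. Some (c x))" "target T \<subseteq>\<^sub>m (\<lambda>x. Some (c' x))"
    using assms(1) unfolding reachable_def by blast
  obtain W where W: "open W" "p \<in> W" "\<And>q. q \<in> W \<Longrightarrow> F q = G q"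
    using F unfolding eventually_nhds by blast
  obtain D where D: "open D" "is_interval D" "xpart p \<in> D" "\<And>x. x \<in> D \<Longrightarrow> c x = e x"
    by (rule open_interval_around[OF c]) (rule that)
  obtain D' where D': "open D'" "is_interval D'" "xpart (F p) \<in> D'" "\<And>x. x \<in> D' \<Longrightarrow> c' x = e' x"
    by (rule open_interval_around[OF c']) (rule that)
  have Tp: "trans_part T p = Some (F p)"
    using T(2) map_leD[OF T(3)] by blast
  from compositions_cut[OF T(1) Tp W(1,2) D(1,2,3) D'(1,2,3)]
  obtain T1 where T1: "T1 \<in> compositions (restrictions S)" "source T1 = source T |` D" "target T1 = target T |` D'"
    "trans_part T1 \<subseteq>\<^sub>m trans_part T |` W" "p \<in> dom (trans_part T1)" by blast
  have le: "m |` A \<subseteq>\<^sub>m (\<lambda>q. Some (g q))" if "m \<subseteq>\<^sub>m (\<lambda>q. Some (f q))" "\<And>q. q \<in> A \<Longrightarrow> f q = g q"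
    for m :: "'a \<rightharpoonup> 'b" and f g A
  proof (rule map_le_SomeI)
    fix q r assume "(m |` A) q = Some r"
    then have "q \<in> A" "m q = Some r" unfolding restrict_map_Some by blast+
    then show "r = g q" using map_leD[OF that(1), of q r] that(2)[of q] by simp
  qed
  have "trans_part T1 \<subseteq>\<^sub>m (\<lambda>q. Some (G q))"
    by (rule map_le_trans[OF T1(4) le[OF T(3) W(3)]])
  moreover have "source T1 \<subseteq>\<^sub>m (\<lambda>x. Some (e x))" unfolding T1(2) by (rule le[OF T(4) D(4)])
  moreover have "target T1 \<subseteq>\<^sub>m (\<lambda>x. Some (e' x))" unfolding T1(3) by (rule le[OF T(5) D'(4)])
  ultimately show ?thesis unfolding reachable_def using T1(1,5) by blast
qed

text \<open>The inner potentials of the two witnesses both restrict \<open>c1\<close>, but their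
  domains may differ, whereas composability asks for equality. Both are cut to the common domain
  first.\<close>

lemma reachable_comp:
  assumes "reachable S c F c1 p" "reachable S c1 G c' (F p)"
  shows "reachable S c (\<lambda>q. G (F q)) c' p"
proof -
  obtain T where T: "T \<in> compositions (restrictions S)" "p \<in> dom (trans_part T)"
    "trans_part T \<subseteq>\<^sub>m (\<lambda>q. Some (F q))" "source T \<subseteq>\<^sub>m (\<lambda>x. Some (c x))" "target T \<subseteq>\<^sub>m (\<lambda>x. Some (c1 x))"
    using assms(1) unfolding reachable_def by blast
  obtain T' where T': "T' \<in> compositions (restrictions S)" "F p \<in> dom (trans_part T')"
    "trans_part T' \<subseteq>\<^sub>m (\<lambda>q. Some (G q))" "source T' \<subseteq>\<^sub>m (\<lambda>x. Some (c1 x))" "target T' \<subseteq>\<^sub>m (\<lambda>x. Some (c' x))"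
    using assms(2) unfolding reachable_def by blast
  have Tp: "trans_part T p = Some (F p)" using T(2) map_leD[OF T(3)] by blast
  have Tp': "trans_part T' (F p) = Some (G (F p))" using T'(2) map_leD[OF T'(3)] by blast
  have pt: "potential (target T)" "xpart (F p) \<in> dom (target T)" and ps: "potential (source T')" "xpart (F p) \<in> dom (source T')"
    using compositions_points[OF T(1) Tp] compositions_points[OF T'(1) Tp'] by blast+
  define E where "E = dom (target T) \<inter> dom (source T')"
  have E: "open E" "is_interval E" "xpart (F p) \<in> E"
    using pt ps unfolding E_def by (auto simp: potential_def intro!: is_interval_Int)
  from compositions_cut[OF T(1) Tp open_UNIV UNIV_I open_UNIV _ UNIV_I E]
  obtain T1 where T1: "T1 \<in> compositions (restrictions S)" "source T1 = source T" "target T1 = target T |` E"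
    "trans_part T1 \<subseteq>\<^sub>m trans_part T" "p \<in> dom (trans_part T1)"
    by (auto simp: is_interval_univ restrict_map_def[of _ UNIV])
  from compositions_cut[OF T'(1) Tp' open_UNIV UNIV_I E open_UNIV _ UNIV_I]
  obtain T1' where T1': "T1' \<in> compositions (restrictions S)" "source T1' = source T' |` E" "target T1' = target T'"
    "trans_part T1' \<subseteq>\<^sub>m trans_part T'" "F p \<in> dom (trans_part T1')"
    by (auto simp: is_interval_univ restrict_map_def[of _ UNIV])
  have "target T |` E = source T' |` E"
  proof
    fix x
    show "(target T |` E) x = (source T' |` E) x"
    proof (cases "x \<in> E")
      case True
      then obtain y z where "target T x = Some y" "source T' x = Some z" unfolding E_def by blast
      then show ?thesis using map_leD[OF T(5)] map_leD[OF T'(4)] True by (metis restrict_in)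
    qed simp
  qed
  then have comp: "composable T1 T1'" by (simp add: composable_def T1 T1')
  have "T1 \<star> T1' \<in> compositions (restrictions S)" by (rule compositions_append[OF T1(1) T1'(1) comp])
  moreover have "p \<in> dom (trans_part (T1 \<star> T1'))"
  proof -
    obtain r where r: "trans_part T1 p = Some r" using T1(5) by blast
    then have "r = F p" using map_leD[OF T1(4) r] Tp by simp
    moreover obtain y where "trans_part T1' (F p) = Some y" using T1'(5) by blast
    ultimately have "trans_part (T1 \<star> T1') p = Some y" unfolding compose_apply using r by blast
    then show ?thesis by (rule domI)
  qed
  moreover have "trans_part (T1 \<star> T1') \<subseteq>\<^sub>m (\<lambda>q. Some (G (F q)))"
    unfolding map_le_def
  proof
    fix s assume "s \<in> dom (trans_part (T1 \<star> T1'))"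
    then obtain y where y: "trans_part (T1 \<star> T1') s = Some y" by blast
    then obtain z where z: "trans_part T1 s = Some z" "trans_part T1' z = Some y" unfolding compose_apply by blast
    have "F s = z" using map_leD[OF T(3) map_leD[OF T1(4) z(1)]] by simp
    moreover have "G z = y" using map_leD[OF T'(3) map_leD[OF T1'(4) z(2)]] by simp
    ultimately show "trans_part (T1 \<star> T1') s = Some (G (F s))" using y by simp
  qed
  moreover have "source (T1 \<star> T1') \<subseteq>\<^sub>m (\<lambda>x. Some (c x))" "target (T1 \<star> T1') \<subseteq>\<^sub>m (\<lambda>x. Some (c' x))"
    using T(4) T'(5) T1(2) T1'(3) by (simp_all add: compose_def source_def target_def)
  ultimately show ?thesis unfolding reachable_def by blast
qed

lemma generating_if_reachable:
  assumes B: "B \<subseteq> admissible"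
    and R: "\<And>C \<Phi> C' p. (C, \<Phi>, C') \<in> admissible \<Longrightarrow> p \<in> dom \<Phi> \<Longrightarrow>
      reachable (B \<union> inverse_of ` B \<union> \<U>) (\<lambda>x. the (C x)) (\<lambda>p. the (\<Phi> p)) (\<lambda>x. the (C' x)) p"
  shows "generating B"
  unfolding generating_def
proof (intro conjI B ballI)
  fix T p assume T: "T \<in> admissible" "p \<in> dom (trans_part T)"
  obtain C \<Phi> C' where TT: "T = (C, \<Phi>, C')" by (cases T)
  have pd: "p \<in> dom \<Phi>" using T(2) by (simp add: TT trans_part_def)
  let ?S = "B \<union> inverse_of ` B \<union> \<U>"
  from R[OF T(1)[unfolded TT] pd] obtain T0 where T0: "T0 \<in> compositions (restrictions ?S)" "p \<in> dom (trans_part T0)"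
    "trans_part T0 \<subseteq>\<^sub>m (\<lambda>q. Some (the (\<Phi> q)))" "source T0 \<subseteq>\<^sub>m (\<lambda>x. Some (the (C x)))" "target T0 \<subseteq>\<^sub>m (\<lambda>x. Some (the (C' x)))"
    unfolding reachable_def by blast
  interpret admissible_transformation C \<Phi> C' using T by (simp add: admissible_transformation_def TT)
  define q where "q = the (\<Phi> p)"
  have q: "\<Phi> p = Some q" unfolding q_def by (rule the_dom[OF pd])
  have T0p: "trans_part T0 p = Some q" using T0(2) map_leD[OF T0(3)] q_def by blast
  have xs: "xpart p \<in> dom C" "xpart q \<in> dom C'"
    using admissible_points[OF T(1), of p q] q by (simp_all add: TT source_def target_def trans_part_def)
  have oi: "open (dom C)" "is_interval (dom C)" "open (dom C')" "is_interval (dom C')"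
    using potentials by (simp_all add: potential_def)
  \<comment> \<open>The witness is only known to restrict total extensions; cutting it to the
    original domains makes it a restriction of \<open>T\<close>.\<close>
  from compositions_cut[OF T0(1) T0p open_dom pd oi(1,2) xs(1) oi(3,4) xs(2)]
  obtain T1 where T1: "T1 \<in> compositions (restrictions ?S)" "source T1 = source T0 |` dom C" "target T1 = target T0 |` dom C'"
    "trans_part T1 \<subseteq>\<^sub>m trans_part T0 |` dom \<Phi>" "p \<in> dom (trans_part T1)" by blast
  have le: "m |` dom f \<subseteq>\<^sub>m f" if "m \<subseteq>\<^sub>m (\<lambda>q. Some (the (f q)))" for m f :: "'a \<rightharpoonup> 'b"
    unfolding map_le_def
  proof
    fix x assume "x \<in> dom (m |` dom f)"
    then obtain y where y: "(m |` dom f) x = Some y" by blast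
    then have "x \<in> dom f" "m x = Some y" unfolding restrict_map_Some by blast+
    then show "(m |` dom f) x = f x" using map_leD[OF that] the_dom[of x f] y by simp
  qed
  have "T1 \<sqsubseteq>\<^sub>r T"
    unfolding restriction_of_def TT T1(2,3) source_def[of "(C, \<Phi>, C')"] target_def[of "(C, \<Phi>, C')"] trans_part_def[of "(C, \<Phi>, C')"] fst_conv snd_conv
    using le[OF T0(4)] le[OF T0(5)] map_le_trans[OF T1(4) le[OF T0(3)]] by blast
  then show "\<exists>T0\<in>compositions (restrictions ?S). T0 \<sqsubseteq>\<^sub>r T \<and> p \<in> dom (trans_part T0)"
    using T1(1,5) by blast
qed

subsection \<open>Generators as germs\<close>

abbreviation ext :: "real \<times> real \<Rightarrow> real \<Rightarrow> pt" where "ext q u \<equiv> (fst q, snd q, u)"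

definition germ_near :: "(real \<Rightarrow> real) \<Rightarrow> germ \<Rightarrow> (real \<Rightarrow> real) \<Rightarrow> real \<times> real \<Rightarrow> bool" where
  "germ_near c d c' p \<longleftrightarrow> (\<forall>\<^sub>F q in nhds p. germ_at c d c' (fst q) (snd q))"

text \<open>\<open>e\<close> is the germ inverse to \<open>d\<close>, and both are generated by \<open>S\<close>.\<close>

definition link :: "triple set \<Rightarrow> (real \<Rightarrow> real) \<Rightarrow> germ \<Rightarrow> germ \<Rightarrow> (real \<Rightarrow> real) \<Rightarrow> real \<times> real \<Rightarrow> bool" where
  "link S c d e c' p \<longleftrightarrow> germ_near c d c' p \<and> germ_near c' e c (bmap d p) \<and> bmap e (bmap d p) = p \<and>
     (\<forall>\<^sub>F q in nhds p. \<forall>u. gmap e (gmap d (ext q u)) = ext q u) \<and>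
     (\<forall>\<^sub>F q in nhds (bmap d p). \<forall>u. gmap d (gmap e (ext q u)) = ext q u) \<and>
     (\<forall>u. reachable S c (gmap d) c' (ext p u)) \<and> (\<forall>u. reachable S c' (gmap e) c (ext (bmap d p) u))"

lemma gmap_ext: "gmap d (ext q u) = ext (bmap d q) (fa d q * u)"
  by (cases q) (simp add: gmap_def bmap_def)

lemma germ_nearD: "germ_near c d c' p \<Longrightarrow> germ_at c d c' (fst p) (snd p)"
  unfolding germ_near_def by (rule eventually_nhds_x_imp_x)

lemma germ_near_tendsto:
  assumes "germ_near c d c' p"
  shows "filterlim (bmap d) (nhds (bmap d p)) (nhds p)"
proof -
  have "isCont (bmap d) p"
    using has_derivative_continuous[OF bmap_has_derivative[OF germ_nearD[OF assms]]] by simp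
  then show ?thesis unfolding isCont_def by (simp add: tendsto_at_iff_tendsto_nhds)
qed

lemma eventually_bmap:
  assumes "germ_near c d c' p" "\<forall>\<^sub>F q in nhds (bmap d p). P q"
  shows "\<forall>\<^sub>F q in nhds p. P (bmap d q)"
  using germ_near_tendsto[OF assms(1)] assms(2) unfolding filterlim_iff by blast

lemma germ_near_comp:
  assumes d: "germ_near c d c1 p" and e: "germ_near c1 e c' (bmap d p)"
  shows "germ_near c (germ_comp e d) c' p"
  unfolding germ_near_def
  using d[unfolded germ_near_def] eventually_bmap[OF d e[unfolded germ_near_def]]
proof eventually_elim
  case (elim q)
  have "bmap d q = (tm d (fst q), sc d (fst q) * snd q + sh d (fst q))" by (simp add: bmap_def case_prod_beta)
  then show ?case using germ_at_comp[OF elim(1)] elim(2) by simp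
qed

lemma link_sym: "link S c d e c' p \<Longrightarrow> link S c' e d c (bmap d p)"
  unfolding link_def by simp

lemma link_comp:
  assumes 1: "link S c d e c1 p" and 2: "link S c1 d' e' c' (bmap d p)"
  shows "link S c (germ_comp d' d) (germ_comp e e') c' p"
proof -
  note l1 = 1[unfolded link_def] and l2 = 2[unfolded link_def]
  have bk: "bmap e' (bmap d' (bmap d p)) = bmap d p" using l2 by blast
  have g1: "germ_near c d c1 p" "germ_near c1 e c (bmap d p)" and g2: "germ_near c1 d' c' (bmap d p)" "germ_near c' e' c1 (bmap d' (bmap d p))"
    using l1 l2 by blast+
  have ev1: "\<forall>\<^sub>F q in nhds p. \<forall>u. gmap e' (gmap d' (ext (bmap d q) u)) = ext (bmap d q) u"
    by (rule eventually_bmap[OF g1(1)]) (use l2 in blast)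
  have "\<forall>\<^sub>F q in nhds p. \<forall>u. gmap e (gmap d (ext q u)) = ext q u" using l1 by blast
  with ev1 have c1: "\<forall>\<^sub>F q in nhds p. \<forall>u. gmap (germ_comp e e') (gmap (germ_comp d' d) (ext q u)) = ext q u"
  proof eventually_elim
    case (elim q)
    show ?case
    proof
      fix u
      have "gmap (germ_comp e e') (gmap (germ_comp d' d) (ext q u)) = gmap e (gmap e' (gmap d' (ext (bmap d q) (fa d q * u))))"
        by (simp only: gmap_comp gmap_ext[of d q])
      also have "\<dots> = gmap e (ext (bmap d q) (fa d q * u))" by (simp only: elim(1)[rule_format])
      also have "\<dots> = gmap e (gmap d (ext q u))" by (simp only: gmap_ext[of d q])
      also have "\<dots> = ext q u" using elim(2) by (rule spec)
      finally show "gmap (germ_comp e e') (gmap (germ_comp d' d) (ext q u)) = ext q u" .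
    qed
  qed
  have ev2: "\<forall>\<^sub>F q in nhds (bmap d' (bmap d p)). \<forall>u. gmap d (gmap e (ext (bmap e' q) u)) = ext (bmap e' q) u"
    by (rule eventually_bmap[OF g2(2)], unfold bk) (use l1 in blast)
  have "\<forall>\<^sub>F q in nhds (bmap d' (bmap d p)). \<forall>u. gmap d' (gmap e' (ext q u)) = ext q u" using l2 by blast
  with ev2 have c2: "\<forall>\<^sub>F q in nhds (bmap d' (bmap d p)). \<forall>u. gmap (germ_comp d' d) (gmap (germ_comp e e') (ext q u)) = ext q u"
  proof eventually_elim
    case (elim q)
    show ?case
    proof
      fix u
      have "gmap (germ_comp d' d) (gmap (germ_comp e e') (ext q u)) = gmap d' (gmap d (gmap e (ext (bmap e' q) (fa e' q * u))))"
        by (simp only: gmap_comp gmap_ext[of e' q])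
      also have "\<dots> = gmap d' (ext (bmap e' q) (fa e' q * u))" by (simp only: elim(1)[rule_format])
      also have "\<dots> = gmap d' (gmap e' (ext q u))" by (simp only: gmap_ext[of e' q])
      also have "\<dots> = ext q u" using elim(2) by (rule spec)
      finally show "gmap (germ_comp d' d) (gmap (germ_comp e e') (ext q u)) = ext q u" .
    qed
  qed
  have gm: "gmap (germ_comp a b) = (\<lambda>q. gmap a (gmap b q))" for a b by (rule ext) (rule gmap_comp)
  have r1: "reachable S c (gmap (germ_comp d' d)) c' (ext p u)" for u
    unfolding gm by (rule reachable_comp[of _ _ _ c1]) (use l1 l2 in \<open>simp_all add: gmap_ext\<close>)
  have r2: "reachable S c' (gmap (germ_comp e e')) c (ext (bmap d' (bmap d p)) u)" for u
    unfolding gm by (rule reachable_comp[of _ _ _ c1]) (use l1 l2 bk in \<open>simp_all add: gmap_ext\<close>)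
  have "germ_near c (germ_comp d' d) c' p" by (rule germ_near_comp[OF g1(1) g2(1)])
  moreover have "germ_near c' (germ_comp e e') c (bmap d' (bmap d p))"
    by (rule germ_near_comp[OF g2(2)]) (use g1(2) bk in simp)
  moreover have "bmap e (bmap e' (bmap d' (bmap d p))) = p" using l1 bk by simp
  ultimately show ?thesis
    unfolding link_def bmap_comp using c1 c2 r1 r2 by blast
qed

lemma eventually_base:
  assumes "\<forall>\<^sub>F q in nhds p. P q"
  shows "\<forall>\<^sub>F z in nhds (ext p u). P (fst z, xpart z)"
proof -
  define g where "g = (\<lambda>z::pt. (fst z, xpart z))"
  have "isCont g (ext p u)" unfolding g_def by (intro continuous_intros)
  then have "filterlim g (nhds (g (ext p u))) (nhds (ext p u))"
    unfolding isCont_def tendsto_at_iff_tendsto_nhds .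
  moreover have "g (ext p u) = p" by (simp add: g_def)
  ultimately have "\<forall>\<^sub>F z in nhds (ext p u). P (g z)" using assms unfolding filterlim_iff by simp
  then show ?thesis by (simp only: g_def)
qed

text \<open>Near \<open>ext p u\<close> the map \<open>gmap m\<close> factors through
  \<open>gmap d\<close>, because \<open>e\<close> undoes \<open>d\<close>. Hence a germ may be
  precomposed with an inverse generator without loss.\<close>

lemma link_cancel_source:
  assumes L: "link S c d e c1 p" and R: "\<And>u. reachable S c1 (gmap (germ_comp m e)) c' (ext (bmap d p) u)"
  shows "reachable S c (gmap m) c' (ext p u)"
proof (rule reachable_cong)
  show "reachable S c (\<lambda>q. gmap (germ_comp m e) (gmap d q)) c' (ext p u)"
    by (rule reachable_comp[of _ _ _ c1]) (use L R in \<open>simp_all add: link_def gmap_ext\<close>)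
  have ev: "\<forall>\<^sub>F q in nhds p. \<forall>u. gmap e (gmap d (ext q u)) = ext q u" using L by (simp add: link_def)
  have "\<forall>\<^sub>F z in nhds (ext p u). \<forall>u. gmap e (gmap d (ext (fst z, xpart z) u)) = ext (fst z, xpart z) u"
    by (rule eventually_base[OF ev])
  then have "\<forall>\<^sub>F z in nhds (ext p u). \<forall>u. gmap e (gmap d (fst z, xpart z, u)) = (fst z, xpart z, u)"
    by simp
  then show "\<forall>\<^sub>F z in nhds (ext p u). gmap (germ_comp m e) (gmap d z) = gmap m z"
  proof eventually_elim
    case (elim z)
    have "z = (fst z, xpart z, snd (snd z))" by simp
    then show ?case using elim unfolding gmap_comp by metis
  qed
qed simp_all

text \<open>The counterpart at the target: after \<open>germ_comp d m\<close> the inverse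
  \<open>e\<close> leads back to \<open>gmap m\<close>.\<close>

lemma link_cancel_target:
  assumes m: "germ_near c m c' p" and L: "link S c' d e c1 (bmap m p)"
    and R: "\<And>u. reachable S c (gmap (germ_comp d m)) c1 (ext p u)"
  shows "reachable S c (gmap m) c' (ext p u)"
proof (rule reachable_cong)
  show "reachable S c (\<lambda>q. gmap e (gmap (germ_comp d m) q)) c' (ext p u)"
    by (rule reachable_comp[OF R]) (use L in \<open>simp add: link_def gmap_ext bmap_comp\<close>)
  have "\<forall>\<^sub>F q in nhds p. \<forall>u. gmap e (gmap d (ext (bmap m q) u)) = ext (bmap m q) u"
    by (rule eventually_bmap[OF m]) (use L in \<open>simp add: link_def\<close>)
  from eventually_base[OF this] have "\<forall>\<^sub>F z in nhds (ext p u). \<forall>u. gmap e (gmap d (ext (bmap m (fst z, xpart z)) u)) = ext (bmap m (fst z, xpart z)) u" .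
  then show "\<forall>\<^sub>F z in nhds (ext p u). gmap e (gmap (germ_comp d m) z) = gmap m z"
  proof eventually_elim
    case (elim z)
    have "gmap m z = ext (bmap m (fst z, xpart z)) (fa m (fst z, xpart z) * snd (snd z))"
      using gmap_ext[of m "(fst z, xpart z)" "snd (snd z)"] by simp
    then show ?case using elim unfolding gmap_comp by simp
  qed
  show "\<forall>\<^sub>F x in nhds (xpart (gmap e (gmap (germ_comp d m) (ext p u)))). c' x = c' x" by simp
qed simp

lemma (in smooth_germ) link:
  assumes "(C, \<Phi>, C') \<in> S" "inverse_of (C, \<Phi>, C') \<in> S" "t \<in> I" "x \<in> dom C"
  shows "link S (\<lambda>x. the (C x)) d dinv (\<lambda>x. the (C' x)) (t, x)"
proof -
  have nd: "\<forall>\<^sub>F q in nhds (t, x). q \<in> I \<times> dom C"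
    by (rule eventually_nhds_in_open) (use assms I potential_open[OF C] in \<open>auto intro: open_Times\<close>)
  have "open ((\<lambda>q::real \<times> real. ext q 0) -` ran \<Phi>)"
    by (intro open_vimage continuous_intros) (use point_transformation in \<open>simp add: point_transformation_def\<close>)
  moreover have "bmap d (t, x) \<in> (\<lambda>q. ext q 0) -` ran \<Phi>"
  proof -
    have "ext (bmap d (t, x)) 0 = gmap d (t, x, 0)" using gmap_ext[of d "(t, x)" 0] by simp
    moreover have "(t, x, 0) \<in> dom \<Phi>" using assms by (simp add: dom_\<Phi>)
    ultimately show ?thesis unfolding ran_\<Phi> by auto
  qed
  ultimately have "\<forall>\<^sub>F q in nhds (bmap d (t, x)). q \<in> (\<lambda>q. ext q 0) -` ran \<Phi>"
    by (rule eventually_nhds_in_open)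
  then have nr: "\<forall>\<^sub>F q in nhds (bmap d (t, x)). \<exists>s y. s \<in> I \<and> y \<in> dom C \<and> q = bmap d (s, y)"
  proof (rule eventually_mono)
    fix q :: "real \<times> real" assume "q \<in> (\<lambda>q. ext q 0) -` ran \<Phi>"
    then obtain s y u where "s \<in> I" "y \<in> dom C" "ext q 0 = gmap d (s, y, u)"
      unfolding ran_\<Phi> dom_\<Phi> by auto
    then show "\<exists>s y. s \<in> I \<and> y \<in> dom C \<and> q = bmap d (s, y)"
      by (intro exI[of _ s] exI[of _ y]) (auto simp: gmap_def bmap_def prod_eq_iff)
  qed
  have b: "bmap dinv (bmap d (s, y)) = (s, y)" if "s \<in> I" "y \<in> dom C" for s y
    using gmap_dinv[OF that, of 0] by (simp add: gmap_def bmap_def)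
  have gd: "gmap dinv (gmap d (ext q u)) = ext q u" if "q \<in> I \<times> dom C" for q u
    using that gmap_dinv by (cases q) simp
  have g2: "gmap d (gmap dinv (ext (bmap d (s, y)) u)) = ext (bmap d (s, y)) u" if sy: "s \<in> I" "y \<in> dom C" for s y u
  proof -
    have "ext (bmap d (s, y)) u = gmap d (s, y, u / fa d (s, y))"
      using gmap_ext[of d "(s, y)" "u / fa d (s, y)"] fa_nz[OF sy] by simp
    then show ?thesis using gmap_dinv[OF sy] by simp
  qed
  have "germ_near (\<lambda>x. the (C x)) d (\<lambda>x. the (C' x)) (t, x)"
    unfolding germ_near_def using nd
  proof (rule eventually_mono)
    fix q assume "q \<in> I \<times> dom C"
    then have "fst q \<in> I" "snd q \<in> dom C" by (simp_all only: mem_Times_iff)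
    then show "germ_at (\<lambda>x. the (C x)) d (\<lambda>x. the (C' x)) (fst q) (snd q)" by (rule germ)
  qed
  moreover have "germ_near (\<lambda>x. the (C' x)) dinv (\<lambda>x. the (C x)) (bmap d (t, x))"
    unfolding germ_near_def using nr
  proof (rule eventually_mono)
    fix q assume "\<exists>s y. s \<in> I \<and> y \<in> dom C \<and> q = bmap d (s, y)"
    then obtain s y where "s \<in> I" "y \<in> dom C" "q = bmap d (s, y)" by blast
    then show "germ_at (\<lambda>x. the (C' x)) dinv (\<lambda>x. the (C x)) (fst q) (snd q)"
      using germ_dinv by (simp add: bmap_def)
  qed
  moreover have "\<forall>\<^sub>F q in nhds (t, x). \<forall>u. gmap dinv (gmap d (ext q u)) = ext q u"
    using nd by (rule eventually_mono) (intro allI gd)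
  moreover have "\<forall>\<^sub>F q in nhds (bmap d (t, x)). \<forall>u. gmap d (gmap dinv (ext q u)) = ext q u"
    using nr
  proof (rule eventually_mono)
    fix q assume "\<exists>s y. s \<in> I \<and> y \<in> dom C \<and> q = bmap d (s, y)"
    then obtain s y where sy: "s \<in> I" "y \<in> dom C" "q = bmap d (s, y)" by blast
    show "\<forall>u. gmap d (gmap dinv (ext q u)) = ext q u" unfolding sy(3) using g2[OF sy(1,2)] by (intro allI)
  qed
  moreover have "reachable S (\<lambda>x. the (C x)) (gmap d) (\<lambda>x. the (C' x)) (ext (t, x) u)" for u
  proof (rule reachableI[OF assms(1) admissible])
    show "ext (t, x) u \<in> dom (trans_part (C, \<Phi>, C'))" using assms by (simp add: trans_part_def dom_\<Phi>)
    show "r = gmap d q" if "trans_part (C, \<Phi>, C') q = Some r" for q r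
    proof -
      have "\<Phi> q = Some r" using that by (simp add: trans_part_def)
      with \<Phi>_in[OF domI[of \<Phi>, OF this]] show ?thesis by simp
    qed
  qed (simp_all add: source_def target_def)
  moreover have "reachable S (\<lambda>x. the (C' x)) (gmap dinv) (\<lambda>x. the (C x)) (ext (bmap d (t, x)) u)" for u
  proof (rule reachableI[OF assms(2) admissible_inverse[OF admissible]])
    note i = inverse_map_props[OF inj_\<Phi>]
    have "ext (bmap d (t, x)) u = gmap d (t, x, u / fa d (t, x))"
      using gmap_ext[of d "(t, x)" "u / fa d (t, x)"] fa_nz[OF assms(3,4)] by simp
    moreover have "(t, x, u / fa d (t, x)) \<in> dom \<Phi>" using assms by (simp add: dom_\<Phi>)
    ultimately have "ext (bmap d (t, x)) u \<in> ran \<Phi>" unfolding ran_\<Phi> by simp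
    then show "ext (bmap d (t, x)) u \<in> dom (trans_part (inverse_of (C, \<Phi>, C')))"
      by (simp only: inverse_of_def trans_part_def i fst_conv snd_conv)
    show "r = gmap dinv q" if "trans_part (inverse_of (C, \<Phi>, C')) q = Some r" for q r
    proof -
      have e: "inverse_map \<Phi> q = Some r" using that by (simp add: trans_part_def inverse_of_def)
      then have "q \<in> ran \<Phi>" using i(1) domI by metis
      then show ?thesis using inverse_\<Phi> e by simp
    qed
  qed (simp_all add: source_def target_def inverse_of_def)
  ultimately show ?thesis unfolding link_def using b[OF assms(3,4)] by simp
qed

text \<open>All multipliers \<open>fa\<close> of the generators have this shape.\<close>

lemma multiplier_has_derivative:
  fixes F G K :: "real \<Rightarrow> real"
  assumes F: "(F has_real_derivative F t * f) (at t)" and G: "(G has_real_derivative g) (at t)"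
    and K: "(K has_real_derivative k) (at t)"
  shows "((\<lambda>(t, x). F t * exp (G t * x\<^sup>2 + K t * x)) has_derivative
    (\<lambda>(a, b). (F t * exp (G t * x\<^sup>2 + K t * x)) * (a * (f + g * x\<^sup>2 + k * x) + b * (2 * G t * x + K t)))) (at (t, x))"
proof -
  have D: "((\<lambda>p::real \<times> real. h (fst p)) has_derivative (\<lambda>v. h' * fst v)) (at (t, x))"
    if "(h has_real_derivative h') (at t)" for h h'
    by (rule has_derivative_compose[where g = h and f = fst])
      (use that in \<open>auto intro!: derivative_eq_intros simp: has_field_derivative_def\<close>)
  have "((\<lambda>p. F (fst p) * exp (G (fst p) * (snd p)\<^sup>2 + K (fst p) * snd p)) has_derivative
    (\<lambda>(a, b). (F t * exp (G t * x\<^sup>2 + K t * x)) * (a * (f + g * x\<^sup>2 + k * x) + b * (2 * G t * x + K t)))) (at (t, x))"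
    by (rule derivative_eq_intros D[OF F] D[OF G] D[OF K] | simp)+
      (auto simp: fun_eq_iff algebra_simps power2_eq_square)
  moreover have "(\<lambda>(t, x). F t * exp (G t * x\<^sup>2 + K t * x)) = (\<lambda>p. F (fst p) * exp (G (fst p) * (snd p)\<^sup>2 + K (fst p) * snd p))"
    by (auto simp: fun_eq_iff)
  ultimately show ?thesis by (simp only:)
qed

lemma potential_potential_on:
  assumes "open D" "is_interval D" "x \<in> D" "smooth_on c D"
  shows "potential (potential_on D c)"
proof -
  have d: "dom (potential_on D c) = D" by (auto simp: potential_on_def dom_def)
  have "smooth_on (\<lambda>x. the (potential_on D c x)) D"
    by (subst smooth_on_cong[OF assms(1), of _ c]) (simp_all add: potential_on_def assms(4))
  then show ?thesis using assms by (auto simp: potential_def d)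
qed

lemma dom_potential_on: "dom (potential_on D c) = D"
  by (auto simp: potential_on_def dom_def)

lemma germ_at_cong:
  assumes "c x = e x" "c' (sc d t * x + sh d t) = e' (sc d t * x + sh d t)"
  shows "germ_at c d c' t x \<longleftrightarrow> germ_at e d e' t x"
  using assms by (simp add: germ_at_def rate_def)

section \<open>The equivalence group and the superposition of solutions\<close>

lemma is_interval_affine_image:
  fixes S :: "real set"
  assumes "is_interval S"
  shows "is_interval ((\<lambda>x. a * x + b) ` S)"
proof -
  have "convex ((\<lambda>x. b + a *\<^sub>R x) ` S)"
    using assms by (intro convex_affinity) (simp add: is_interval_convex_1)
  then show ?thesis by (simp add: is_interval_convex_1 add.commute)
qed

lemma smooth_on_affine:
  fixes a b :: real
  assumes "open S" "a \<noteq> 0"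
  shows "smooth_on (\<lambda>z. (z - b) / a) S"
  by (intro smooth_on_divide smooth_on_diff smooth_on_id smooth_on_const assms)

definition ggerm :: "real \<Rightarrow> real \<Rightarrow> real \<Rightarrow> real \<Rightarrow> real \<Rightarrow> germ" where
  "ggerm c1 c2 c3 c4 c5 = Germ (\<lambda>t. c1\<^sup>2 * t + c2) (\<lambda>_. c1) (\<lambda>_. 0) (\<lambda>_. c3) (\<lambda>_. 0) (\<lambda>(t, x). c4 * exp (c5 * t))"

lemma gmap_ggerm: "gmap (ggerm c1 c2 c3 c4 c5) = group_trans c1 c2 c3 c4 c5"
  by (auto simp: gmap_def ggerm_def group_trans_def)

lemma germ_at_ggerm:
  assumes "c1 \<noteq> 0" "c4 \<noteq> 0" "c1\<^sup>2 * c' (c1 * x + c3) = c x + c5"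
  shows "germ_at c (ggerm c1 c2 c3 c4 c5) c' t x"
proof -
  have "((\<lambda>(t, x). c4 * exp (c5 * t) * exp ((\<lambda>_. 0) t * x\<^sup>2 + (\<lambda>_. 0) t * x)) has_derivative
    (\<lambda>(a, b). (c4 * exp (c5 * t) * exp (0 * x\<^sup>2 + 0 * x)) * (a * (c5 + 0 * x\<^sup>2 + 0 * x) + b * (2 * 0 * x + 0)))) (at (t, x))"
    by (rule multiplier_has_derivative) (auto intro!: derivative_eq_intros)
  moreover have "slope (ggerm c1 c2 c3 c4 c5) t x = 0" "rate c (ggerm c1 c2 c3 c4 c5) c' t x = c5"
    using assms by (simp_all add: slope_def rate_def ggerm_def)
  ultimately show ?thesis
    using assms unfolding germ_at_def
    by (auto simp: ggerm_def intro!: derivative_eq_intros)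
qed

lemma group_potential_props:
  assumes C: "potential C" and c1: "c1 \<noteq> 0"
  shows "dom (group_potential c1 c3 c5 C) = (\<lambda>x. c1 * x + c3) ` dom C"
    "potential (group_potential c1 c3 c5 C)"
    "\<And>x. x \<in> dom C \<Longrightarrow> c1\<^sup>2 * the (group_potential c1 c3 c5 C (c1 * x + c3)) = the (C x) + c5"
proof -
  let ?G = "group_potential c1 c3 c5 C"
  have dm: "dom ?G = (\<lambda>y. (y - c3) / c1) -` dom C"
    by (auto simp: group_potential_def dom_def)
  show d: "dom ?G = (\<lambda>x. c1 * x + c3) ` dom C"
    unfolding dm
  proof (rule set_eqI)
    fix y
    have "y = c1 * ((y - c3) / c1) + c3" using c1 by simp
    moreover have "(c1 * x + c3 - c3) / c1 = x" for x using c1 by simp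
    ultimately show "y \<in> (\<lambda>y. (y - c3) / c1) -` dom C \<longleftrightarrow> y \<in> (\<lambda>x. c1 * x + c3) ` dom C"
      by (metis (no_types, lifting) imageE image_eqI vimage_eq)
  qed
  have o: "open (dom C)" "is_interval (dom C)" "dom C \<noteq> {}" "smooth_on (\<lambda>x. the (C x)) (dom C)"
    using C by (simp_all add: potential_def)
  have og: "open (dom ?G)" unfolding dm by (intro open_vimage o continuous_intros) (use c1 in simp)
  have ig: "is_interval (dom ?G)" unfolding d by (rule is_interval_affine_image[OF o(2)])
  have "smooth_on (\<lambda>y. the (C ((y - c3) / c1))) (dom ?G)"
    by (rule smooth_on_compose[OF o(4) og o(1) smooth_on_affine[OF og c1]]) (simp only: dm vimage_eq)
  then have "smooth_on (\<lambda>y. (the (C ((y - c3) / c1)) + c5) / c1\<^sup>2) (dom ?G)"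
    by (intro smooth_on_divide smooth_on_add smooth_on_const og) (use c1 in auto)
  moreover have "the (?G y) = (the (C ((y - c3) / c1)) + c5) / c1\<^sup>2" if "y \<in> dom ?G" for y
    using that by (auto simp: group_potential_def)
  ultimately have "smooth_on (\<lambda>y. the (?G y)) (dom ?G)"
    using smooth_on_cong[OF og, of "\<lambda>y. the (?G y)" "\<lambda>y. (the (C ((y - c3) / c1)) + c5) / c1\<^sup>2"] by blast
  then show "potential ?G" using og ig o(3) by (simp add: potential_def d)
  show "c1\<^sup>2 * the (?G (c1 * x + c3)) = the (C x) + c5" if "x \<in> dom C" for x
    using that c1 by (auto simp: group_potential_def)
qed

lemma smooth_germ_group:
  assumes C: "potential C" and c: "c1 \<noteq> 0" "c4 \<noteq> 0"
  shows "smooth_germ UNIV C (group_potential c1 c3 c5 C) (ggerm c1 c2 c3 c4 c5)"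
proof
  note g = group_potential_props[OF C c(1), where ?c3.0 = c3 and ?c5.0 = c5]
  show "germ_at (\<lambda>x. the (C x)) (ggerm c1 c2 c3 c4 c5) (\<lambda>x. the (group_potential c1 c3 c5 C x)) t x"
    if "x \<in> dom C" for t x
    by (rule germ_at_ggerm[OF c]) (rule g(3)[OF that])
  show "sc (ggerm c1 c2 c3 c4 c5) t * x + sh (ggerm c1 c2 c3 c4 c5) t \<in> dom (group_potential c1 c3 c5 C)" if "x \<in> dom C" for t x
    unfolding g(1) using imageI[OF that, of "\<lambda>x. c1 * x + c3"] by (simp only: ggerm_def germ.sel)
  show "smooth_on (fa (ggerm c1 c2 c3 c4 c5)) (UNIV \<times> dom C)"
  proof -
    have o: "open ((UNIV :: real set) \<times> dom C)" by (intro open_Times open_UNIV potential_open C)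
    have "smooth_on (\<lambda>p. c4 * exp (c5 * fst p)) ((UNIV :: real set) \<times> dom C)"
      by (intro smooth_intros o)
    moreover have "fa (ggerm c1 c2 c3 c4 c5) = (\<lambda>p. c4 * exp (c5 * fst p))" by (auto simp: ggerm_def)
    ultimately show ?thesis by (simp only:)
  qed
qed (use C group_potential_props(2)[OF C c(1)] in \<open>auto simp: ggerm_def intro: smooth_on_const\<close>)

lemma action_groupoid_admissible: "action_groupoid \<subseteq> admissible"
proof
  fix T assume "T \<in> action_groupoid"
  then obtain C c1 c2 c3 c4 c5 where C: "potential C" and c: "c1 * c4 \<noteq> 0" and
    T: "T = (C, (\<lambda>(t, x, u). if x \<in> dom C then Some (group_trans c1 c2 c3 c4 c5 (t, x, u)) else None), group_potential c1 c3 c5 C)"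
    unfolding action_groupoid_def by auto
  interpret smooth_germ UNIV C "group_potential c1 c3 c5 C" "ggerm c1 c2 c3 c4 c5"
    by (rule smooth_germ_group[OF C]) (use c in auto)
  have "T = (C, \<Phi>, group_potential c1 c3 c5 C)" unfolding T \<Phi>_def gmap_ggerm by simp
  then show "T \<in> admissible" using admissible by simp
qed

text \<open>The equation is linear: the derivatives of \<open>w\<close> and \<open>f\<close> add up,
  and the contribution of the solution \<open>f\<close> cancels. The inverse \<open>\<Psi>\<close>
  subtracts \<open>f\<close>.\<close>

lemma lin_groupoid_admissible: "lin_groupoid \<subseteq> admissible"
proof
  fix T assume "T \<in> lin_groupoid"
  then obtain C \<Omega> f where C: "potential C" and O: "open \<Omega>" "\<Omega> \<noteq> {}" and f: "solution_on C \<Omega> f"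
    and T: "T = (C, (\<lambda>(t, x, u). if (t, x) \<in> \<Omega> then Some (t, x, u + f (t, x)) else None), C)"
    unfolding lin_groupoid_def by auto
  define \<Phi> where "\<Phi> = (\<lambda>(t, x, u). if (t, x) \<in> \<Omega> then Some (t, x, u + f (t, x)) else None)"
  define \<Psi> where "\<Psi> = (\<lambda>(t, x, u). if (t, x) \<in> \<Omega> then Some (t, x, u - f (t, x)) else None)"
  have sf: "smooth_on f \<Omega>" and sat: "\<And>t x. (t, x) \<in> \<Omega> \<Longrightarrow> satisfies_at C f t x"
    using f by (auto simp: solution_on_def)
  define V where "V = (\<lambda>p::pt. (fst p, xpart p)) -` \<Omega>"
  have oV: "open V" unfolding V_def by (intro open_vimage O continuous_intros)
  have dP: "dom \<Phi> = V" by (auto simp: \<Phi>_def V_def dom_def split: if_splits)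
  have iff: "\<Phi> p = Some q \<longleftrightarrow> \<Psi> q = Some p" for p q
    by (cases p, cases q) (auto simp: \<Phi>_def \<Psi>_def)
  have inj: "inj_on \<Phi> (dom \<Phi>)"
  proof (rule inj_onI)
    fix p q assume "p \<in> dom \<Phi>" "\<Phi> p = \<Phi> q"
    then obtain r where "\<Phi> p = Some r" "\<Phi> q = Some r" by (metis domD)
    then show "p = q" using iff by (metis option.inject)
  qed
  have inv: "inverse_map \<Phi> = \<Psi>"
  proof
    fix q
    show "inverse_map \<Phi> q = \<Psi> q"
    proof (cases "\<Psi> q")
      case (Some p)
      then show ?thesis using inverse_map_apply[OF inj] iff by simp
    next
      case None
      then have "q \<notin> ran \<Phi>" unfolding ran_def using iff by auto
      then show ?thesis using None by (simp add: inverse_map_def)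
    qed
  qed
  have rP: "ran \<Phi> = V"
  proof -
    have "ran \<Phi> = dom \<Psi>" unfolding ran_def dom_def using iff by auto
    also have "\<dots> = V" by (auto simp: \<Psi>_def V_def dom_def split: if_splits)
    finally show ?thesis .
  qed
  have sfV: "smooth_on (\<lambda>p::pt. f (fst p, xpart p)) V"
    by (rule smooth_on_compose[OF sf oV O(1) smooth_on_Pair[OF oV smooth_on_fst[OF oV smooth_on_id[OF oV]]
            smooth_on_fst[OF oV smooth_on_snd[OF oV smooth_on_id[OF oV]]]]]) (simp add: V_def)
  have s1: "smooth_on (\<lambda>p. the (\<Phi> p)) V"
  proof (subst smooth_on_cong[OF oV])
    show "the (\<Phi> p) = (fst p, xpart p, snd (snd p) + f (fst p, xpart p))" if "p \<in> V" for p
      using that by (cases p) (simp add: \<Phi>_def V_def)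
    show "smooth_on (\<lambda>p::pt. (fst p, xpart p, snd (snd p) + f (fst p, xpart p))) V"
      by (intro smooth_intros oV sfV)
  qed
  have s2: "smooth_on (\<lambda>p. the (\<Psi> p)) V"
  proof (subst smooth_on_cong[OF oV])
    show "the (\<Psi> p) = (fst p, xpart p, snd (snd p) - f (fst p, xpart p))" if "p \<in> V" for p
      using that by (cases p) (simp add: \<Psi>_def V_def)
    show "smooth_on (\<lambda>p::pt. (fst p, xpart p, snd (snd p) - f (fst p, xpart p))) V"
      by (intro smooth_intros oV sfV)
  qed
  have Vne: "V \<noteq> {}"
  proof -
    obtain q where "q \<in> \<Omega>" using O(2) by blast
    then have "ext q 0 \<in> V" by (simp add: V_def)
    then show ?thesis by blast
  qed
  have pt: "point_transformation \<Phi>"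
    unfolding point_transformation_def rP inv using inj oV s1 s2 Vne unfolding dP by auto
  have dC: "x \<in> dom C" if "(t, x, u) \<in> V" for t x u
    using sat that by (auto simp: V_def satisfies_at_def)
  have mp: "maps_equation C \<Phi> C"
    unfolding maps_equation_def
  proof (intro allI impI, elim conjE)
    fix \<Omega>1 \<Omega>2 :: "(real \<times> real) set" and w w' :: "real \<times> real \<Rightarrow> real" and t x t' x' :: real
    assume a: "open \<Omega>1" "open \<Omega>2" "smooth_on w \<Omega>1" "smooth_on w' \<Omega>2" "(t, x) \<in> \<Omega>1" "(t', x') \<in> \<Omega>2"
      and gr: "graph_over \<Omega>1 w \<subseteq> dom \<Phi>"
      and img: "(\<lambda>p. the (\<Phi> p)) ` graph_over \<Omega>1 w = graph_over \<Omega>2 w'"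
      and P: "\<Phi> (t, x, w (t, x)) = Some (t', x', w' (t', x'))"
    have q: "q \<in> \<Omega> \<and> w' q = w q + f q" if "q \<in> \<Omega>1" for q
    proof -
      obtain s y where sy: "q = (s, y)" by (cases q)
      have g: "(s, y, w (s, y)) \<in> graph_over \<Omega>1 w" using that by (auto simp: graph_over_def sy)
      then have O': "(s, y) \<in> \<Omega>" using gr unfolding dP V_def by auto
      have "the (\<Phi> (s, y, w (s, y))) \<in> graph_over \<Omega>2 w'" using img g by blast
      then show ?thesis using O' by (auto simp: \<Phi>_def graph_over_def sy)
    qed
    have tx: "t' = t" "x' = x" using P by (auto simp: \<Phi>_def split: if_splits)
    have sub: "\<Omega>1 \<subseteq> \<Omega>" using q by blast
    have O2: "(t, x) \<in> \<Omega>2" using a(6) tx by simp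
    have fO: "(t, x) \<in> \<Omega>" using sub a(5) by blast
    have d1: "dd w' v q = dd w v q + dd f v q" if "q \<in> \<Omega>1" for q v
    proof -
      have "dd w' v q = dd (\<lambda>q. w q + f q) v q" by (rule dd_cong[OF a(1) that]) (use q in blast)
      also have "\<dots> = dd w v q + dd f v q"
        by (rule dd_add) (use smooth_on_differentiable[OF a(3) that] smooth_on_differentiable[OF sf] sub that in blast)+
      finally show ?thesis .
    qed
    have d2: "dd (dd w' (0, 1)) (0, 1) (t, x) = dd (dd w (0, 1)) (0, 1) (t, x) + dd (dd f (0, 1)) (0, 1) (t, x)"
    proof -
      have "dd (dd w' (0, 1)) (0, 1) (t, x) = dd (\<lambda>q. dd w (0, 1) q + dd f (0, 1) q) (0, 1) (t, x)"
        by (rule dd_cong[OF a(1,5) d1])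
      also have "\<dots> = dd (dd w (0, 1)) (0, 1) (t, x) + dd (dd f (0, 1)) (0, 1) (t, x)"
        by (rule dd_add; rule smooth_on_differentiable[OF smooth_on_dd])
          (rule a(3), rule a(5), rule sf, rule fO)
      finally show ?thesis .
    qed
    have fs: "dd f (1, 0) (t, x) = dd (dd f (0, 1)) (0, 1) (t, x) + the (C x) * f (t, x)"
      using sat[OF fO] satisfies_at_dd[OF O(1) sf fO] by blast
    show "satisfies_at C w t x \<longleftrightarrow> satisfies_at C w' t' x'"
      unfolding tx satisfies_at_dd[OF a(1,3,5)] satisfies_at_dd[OF a(2,4) O2] d1[OF a(5)] d2 fs
      using q[OF a(5)] by (auto simp: algebra_simps)
  qed
  show "T \<in> admissible"
    unfolding T \<Phi>_def[symmetric] admissible_def mem_Collect_eq prod.case rP dP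
    using C pt mp dC by auto
qed

lemma action_lin_in_U: "action_groupoid \<union> lin_groupoid \<subseteq> \<U>"
  using action_groupoid_admissible lin_groupoid_admissible compositions.single unfolding \<U>_def by blast

text \<open>Local counterpart of \<open>potential\<close> for total functions: precisely what allows
  \<open>c\<close> to be cut to an interval and used as the source of a triple.\<close>

definition smooth_near :: "(real \<Rightarrow> real) \<Rightarrow> real \<Rightarrow> bool" where
  "smooth_near c x \<longleftrightarrow> (\<exists>D. open D \<and> is_interval D \<and> x \<in> D \<and> smooth_on c D)"

lemma reachable_group:
  assumes S: "\<U> \<subseteq> S" and c: "smooth_near c x" "c1 \<noteq> 0" "c4 \<noteq> 0"
    and eq: "\<forall>\<^sub>F y in nhds x. c1\<^sup>2 * c' (c1 * y + c3) = c y + c5"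
  shows "reachable S c (gmap (ggerm c1 c2 c3 c4 c5)) c' (t, x, u)"
proof -
  obtain D where D: "open D" "is_interval D" "x \<in> D" "smooth_on c D" using c(1) unfolding smooth_near_def by blast
  obtain E where E: "open E" "is_interval E" "x \<in> E" "\<And>y. y \<in> E \<Longrightarrow> c1\<^sup>2 * c' (c1 * y + c3) = c y + c5"
    by (rule open_interval_around[OF eq]) (rule that)
  define C where "C = potential_on (D \<inter> E) c"
  have C: "potential C" unfolding C_def
    using D E by (intro potential_potential_on[of _ x] smooth_on_subset[OF D(4)]) (auto intro: is_interval_Int)
  interpret smooth_germ UNIV C "group_potential c1 c3 c5 C" "ggerm c1 c2 c3 c4 c5"
    by (rule smooth_germ_group[OF C c(2,3)])
  have "(C, \<Phi>, group_potential c1 c3 c5 C) \<in> action_groupoid"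
    unfolding action_groupoid_def mem_Collect_eq prod.case
    using C c by (intro conjI exI[of _ c1] exI[of _ c2] exI[of _ c3] exI[of _ c4] exI[of _ c5]) (auto simp: \<Phi>_def gmap_ggerm)
  then have T: "(C, \<Phi>, group_potential c1 c3 c5 C) \<in> S" using action_lin_in_U S by blast
  show ?thesis
  proof (rule reachableI[OF T admissible])
    have "x \<in> dom C" using D E by (simp add: C_def dom_potential_on)
    then show "(t, x, u) \<in> dom (trans_part (C, \<Phi>, group_potential c1 c3 c5 C))"
      by (simp add: trans_part_def dom_\<Phi>)
    show "r = gmap (ggerm c1 c2 c3 c4 c5) q" if "trans_part (C, \<Phi>, group_potential c1 c3 c5 C) q = Some r" for q r
    proof -
      have "\<Phi> q = Some r" using that by (simp add: trans_part_def)
      with \<Phi>_in[OF domI[of \<Phi>, OF this]] show ?thesis by simp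
    qed
    show "y = c z" if "source (C, \<Phi>, group_potential c1 c3 c5 C) z = Some y" for z y
      using that by (auto simp: source_def C_def potential_on_def split: if_splits)
    show "y = c' z" if "target (C, \<Phi>, group_potential c1 c3 c5 C) z = Some y" for z y
    proof -
      define w where "w = (z - c3) / c1"
      have "z = c1 * w + c3" using c(2) by (simp add: w_def)
      moreover have "w \<in> E \<and> y = (c w + c5) / c1\<^sup>2"
        using that by (auto simp: target_def group_potential_def C_def potential_on_def w_def split: if_splits)
      ultimately have "c1\<^sup>2 * y = c1\<^sup>2 * c' z" using E(4)[of w] c(2) by simp
      then show ?thesis using c(2) by simp
    qed
  qed
qed

lemma eventually_snd:
  assumes "\<forall>\<^sub>F y in nhds (x::real). P y"
  shows "\<forall>\<^sub>F q in nhds (t::real, x). P (snd q)"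
proof -
  obtain D where D: "open D" "x \<in> D" "\<And>y. y \<in> D \<Longrightarrow> P y" using assms unfolding eventually_nhds by blast
  have "\<forall>\<^sub>F q in nhds (t, x). q \<in> UNIV \<times> D"
    by (rule eventually_nhds_in_open) (use D in \<open>auto intro: open_Times\<close>)
  then show ?thesis by (rule eventually_mono) (use D(3) in auto)
qed

lemma link_group:
  assumes S: "\<U> \<subseteq> S" and c: "smooth_near c x" "c1 \<noteq> 0" "c4 \<noteq> 0"
    and eq: "\<forall>\<^sub>F y in nhds x. c1\<^sup>2 * c' (c1 * y + c3) = c y + c5"
  shows "\<exists>e. sc e = (\<lambda>_. 1 / c1) \<and> sc1 e = (\<lambda>_. 0) \<and> sh1 e = (\<lambda>_. 0) \<and> link S c (ggerm c1 c2 c3 c4 c5) e c' (t, x)"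
proof -
  let ?d = "ggerm c1 c2 c3 c4 c5"
  \<comment> \<open>The inverse group element. The exponential in the fourth parameter compensates
    for the time shift \<open>c2\<close> inside \<open>exp (c5 * t)\<close>.\<close>
  define e where "e = ggerm (1 / c1) (- c2 / c1\<^sup>2) (- c3 / c1) (exp (c5 * c2 / c1\<^sup>2) / c4) (- c5 / c1\<^sup>2)"
  have b: "bmap ?d (t, x) = (c1\<^sup>2 * t + c2, c1 * x + c3)" by (simp add: bmap_def ggerm_def)
  have inv1: "gmap e (gmap ?d q) = q" for q
  proof (cases q)
    case (fields t x u)
    have "exp (c5 * c2 / c1\<^sup>2) / c4 * exp (- c5 / c1\<^sup>2 * (c1\<^sup>2 * t + c2)) * (c4 * exp (c5 * t) * u)
        = (exp (c5 * c2 / c1\<^sup>2) * exp (- c5 / c1\<^sup>2 * (c1\<^sup>2 * t + c2)) * exp (c5 * t)) * u" using c(3) by simp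
    also have "exp (c5 * c2 / c1\<^sup>2) * exp (- c5 / c1\<^sup>2 * (c1\<^sup>2 * t + c2)) * exp (c5 * t) = exp 0"
      unfolding exp_add[symmetric] using c(2) by (intro arg_cong[of _ _ exp]) (simp add: field_simps)
    finally show ?thesis using c(2) by (simp add: fields e_def gmap_ggerm group_trans_def power_one_over field_simps)
  qed
  have inv2: "gmap ?d (gmap e q) = q" for q
  proof (cases q)
    case (fields t x u)
    have "c4 * exp (c5 * ((1 / c1)\<^sup>2 * t + - c2 / c1\<^sup>2)) * (exp (c5 * c2 / c1\<^sup>2) / c4 * exp (- c5 / c1\<^sup>2 * t) * u)
        = (exp (c5 * ((1 / c1)\<^sup>2 * t + - c2 / c1\<^sup>2)) * exp (c5 * c2 / c1\<^sup>2) * exp (- c5 / c1\<^sup>2 * t)) * u" using c(3) by simp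
    also have "exp (c5 * ((1 / c1)\<^sup>2 * t + - c2 / c1\<^sup>2)) * exp (c5 * c2 / c1\<^sup>2) * exp (- c5 / c1\<^sup>2 * t) = exp 0"
      unfolding exp_add[symmetric] using c(2) by (intro arg_cong[of _ _ exp]) (simp add: field_simps)
    finally show ?thesis using c(2) by (simp add: fields e_def gmap_ggerm group_trans_def power_one_over field_simps)
  qed
  obtain E where E: "open E" "is_interval E" "x \<in> E" "\<And>y. y \<in> E \<Longrightarrow> c1\<^sup>2 * c' (c1 * y + c3) = c y + c5"
    by (rule open_interval_around[OF eq]) (rule that)
  have eq': "(1 / c1)\<^sup>2 * c (1 / c1 * z + - c3 / c1) = c' z + - c5 / c1\<^sup>2" if "(z - c3) / c1 \<in> E" for z
  proof -
    have "z = c1 * ((z - c3) / c1) + c3" "1 / c1 * z + - c3 / c1 = (z - c3) / c1" using c(2) by (simp_all add: field_simps)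
    then show ?thesis using E(4)[OF that] c(2) by (simp add: power_one_over field_simps)
  qed
  have xb: "(c1 * x + c3 - c3) / c1 = x" using c(2) by simp
  have oE': "open ((\<lambda>z. (z - c3) / c1) -` E)" by (intro open_vimage E continuous_intros) (use c(2) in simp)
  have ev': "\<forall>\<^sub>F z in nhds (c1 * x + c3). (1 / c1)\<^sup>2 * c (1 / c1 * z + - c3 / c1) = c' z + - c5 / c1\<^sup>2"
    by (rule eventually_mono[OF eventually_nhds_in_open[OF oE']]) (use E(3) xb eq' in auto)
  have sm': "smooth_near c' (c1 * x + c3)"
  proof -
    obtain D where D: "open D" "is_interval D" "x \<in> D" "smooth_on c D" using c(1) unfolding smooth_near_def by blast
    define F where "F = (\<lambda>y. c1 * y + c3) ` (D \<inter> E)"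
    have F_eq: "F = (\<lambda>z. (z - c3) / c1) -` (D \<inter> E)"
    proof (rule set_eqI)
      fix y
      have "y = c1 * ((y - c3) / c1) + c3" using c(2) by simp
      moreover have "(c1 * x + c3 - c3) / c1 = x" for x using c(2) by simp
      ultimately show "y \<in> F \<longleftrightarrow> y \<in> (\<lambda>y. (y - c3) / c1) -` (D \<inter> E)"
        unfolding F_def by (metis (no_types, lifting) imageE image_eqI vimage_eq)
    qed
    have oF: "open F" unfolding F_eq by (intro open_vimage open_Int D E continuous_intros) (use c(2) in simp)
    have "smooth_on (\<lambda>z. c ((z - c3) / c1)) F"
      by (rule smooth_on_compose[OF D(4) oF D(1) smooth_on_affine[OF oF c(2)]]) (simp add: F_eq)
    then have "smooth_on (\<lambda>z. (c ((z - c3) / c1) + c5) / c1\<^sup>2) F"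
      by (intro smooth_on_divide smooth_on_add smooth_on_const oF) (use c(2) in auto)
    moreover have "c' z = (c ((z - c3) / c1) + c5) / c1\<^sup>2" if "z \<in> F" for z
      using that E(4) c(2) unfolding F_def by (auto simp: field_simps)
    ultimately have "smooth_on c' F" using smooth_on_cong[OF oF, of c' "\<lambda>z. (c ((z - c3) / c1) + c5) / c1\<^sup>2"] by blast
    moreover have "is_interval F" unfolding F_def
      by (rule is_interval_affine_image[OF is_interval_Int[OF D(2) E(2)]])
    moreover have "c1 * x + c3 \<in> F" unfolding F_def using D(3) E(3) by blast
    ultimately show ?thesis unfolding smooth_near_def using oF by blast
  qed
  have n1: "germ_near c ?d c' (t, x)"
    unfolding germ_near_def using eventually_snd[OF eq, of t]
    by (rule eventually_mono) (rule germ_at_ggerm[OF c(2,3)])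
  have n2: "germ_near c' e c (bmap ?d (t, x))"
    unfolding germ_near_def b e_def using eventually_snd[OF ev', of "c1\<^sup>2 * t + c2"]
    by (rule eventually_mono) (rule germ_at_ggerm, use c in auto)
  have r2: "reachable S c' (gmap e) c (c1\<^sup>2 * t + c2, c1 * x + c3, u)" for u
    unfolding e_def by (rule reachable_group[OF S sm' _ _ ev']) (use c in auto)
  have r1: "reachable S c (gmap ?d) c' (t, x, u)" for u by (rule reachable_group[OF S c eq])
  have "bmap e (bmap ?d (t, x)) = (t, x)"
    using inv1[of "(t, x, 0)"] by (simp add: gmap_def bmap_def)
  then have "link S c ?d e c' (t, x)"
    unfolding link_def using n1 n2 inv1 inv2 r1 r2 b by simp
  moreover have "sc e = (\<lambda>_. 1 / c1)" "sc1 e = (\<lambda>_. 0)" "sh1 e = (\<lambda>_. 0)" by (simp_all add: e_def ggerm_def)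
  ultimately show ?thesis by blast
qed

lemma reachable_lin:
  assumes S: "\<U> \<subseteq> S" and C: "potential C" and W: "open W" "(t, x) \<in> W" and f: "solution_on C W f"
  shows "reachable S (\<lambda>x. the (C x)) (\<lambda>(t, x, u). (t, x, u + f (t, x))) (\<lambda>x. the (C x)) (t, x, u)"
proof -
  define T where "T = (C, (\<lambda>(t, x, u). if (t, x) \<in> W then Some (t, x, u + f (t, x)) else None), C)"
  have lin: "T \<in> lin_groupoid" unfolding T_def lin_groupoid_def using C W f by blast
  show ?thesis
  proof (rule reachableI)
    show "T \<in> S" "T \<in> admissible" using lin action_lin_in_U S lin_groupoid_admissible by blast+
    show "(t, x, u) \<in> dom (trans_part T)" using W by (simp add: T_def trans_part_def domIff)
  qed (auto simp: T_def trans_part_def source_def target_def split: if_splits)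
qed

lemma link_cong:
  assumes L: "link S c d e c' p" and c: "\<forall>\<^sub>F y in nhds (snd p). c y = f y"
    and c': "\<forall>\<^sub>F y in nhds (snd (bmap d p)). c' y = f' y"
  shows "link S f d e f' p"
proof -
  have gn: "germ_near a2 g b2 q" if "germ_near a g b q" "\<forall>\<^sub>F y in nhds (snd q). a y = a2 y"
    "\<forall>\<^sub>F y in nhds (snd (bmap g q)). b y = b2 y" for a b a2 b2 g q
  proof -
    have "\<forall>\<^sub>F z in nhds (bmap g q). b (snd z) = b2 (snd z)"
      using eventually_snd[OF that(3), of "fst (bmap g q)"] by simp
    from eventually_bmap[OF that(1) this] eventually_snd[OF that(2), of "fst q", simplified] that(1)[unfolded germ_near_def]
    show ?thesis unfolding germ_near_def
    proof eventually_elim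
      case (elim z)
      then show ?case using germ_at_cong[of a "snd z" a2 b g "fst z" b2] by (simp add: bmap_def case_prod_beta)
    qed
  qed
  have b: "bmap e (bmap d p) = p" using L by (simp add: link_def)
  have "germ_near f d f' p" by (rule gn[OF _ c c']) (use L in \<open>simp add: link_def\<close>)
  moreover have "germ_near f' e f (bmap d p)"
  proof (rule gn[of c' e c])
    show "\<forall>\<^sub>F y in nhds (snd (bmap e (bmap d p))). c y = f y" unfolding b by (rule c)
  qed (use L c' in \<open>simp_all add: link_def\<close>)
  moreover have "reachable S f (gmap d) f' (ext p u)" for u
    by (rule reachable_cong[of S c "gmap d" c']) (use L c c' in \<open>simp_all add: link_def gmap_ext\<close>)
  moreover have "reachable S f' (gmap e) f (ext (bmap d p) u)" for u
    by (rule reachable_cong[of S c' "gmap e" c]) (use L c c' b in \<open>simp_all add: link_def gmap_ext\<close>)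
  ultimately show ?thesis using L unfolding link_def by blast
qed

text \<open>The values of the inverse germ at the image time are recorded because the loops built
  later start with an inverse generator.\<close>

lemma (in smooth_germ) link_total:
  assumes "(C, \<Phi>, C') \<in> S" "inverse_of (C, \<Phi>, C') \<in> S" "t \<in> I" "x \<in> dom C"
    and c: "\<And>y. y \<in> dom C \<Longrightarrow> the (C y) = c y" and c': "\<And>y. y \<in> dom C' \<Longrightarrow> the (C' y) = c' y"
  shows "link S c d dinv c' (t, x)"
    "sc dinv (tm d t) = 1 / sc d t" "sc1 dinv (tm d t) = - sc1 d t / (sc d t) ^ 4"
    "sh1 dinv (tm d t) = (sh d t * sc1 d t - sh1 d t * sc d t) / (sc d t) ^ 4"
proof -
  have "\<forall>\<^sub>F y in nhds x. y \<in> dom C" by (rule eventually_nhds_in_open[OF potential_open[OF C] assms(4)])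
  then have "\<forall>\<^sub>F y in nhds x. the (C y) = c y" by (rule eventually_mono) (rule c)
  then have 1: "\<forall>\<^sub>F y in nhds (snd (t, x)). the (C y) = c y" by simp
  have "\<forall>\<^sub>F y in nhds (sc d t * x + sh d t). y \<in> dom C'"
    by (rule eventually_nhds_in_open[OF potential_open[OF C'] range[OF assms(3,4)]])
  then have "\<forall>\<^sub>F y in nhds (sc d t * x + sh d t). the (C' y) = c' y" by (rule eventually_mono) (rule c')
  then have 2: "\<forall>\<^sub>F y in nhds (snd (bmap d (t, x))). the (C' y) = c' y" by (simp add: bmap_def)
  show "link S c d dinv c' (t, x)" by (rule link_cong[OF link[OF assms(1-4)] 1 2])
qed (simp_all add: dinv_def germ_inv_def \<sigma>_tm[OF assms(3)])

section \<open>The three families as germs\<close>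

definition d1 :: germ where
  "d1 = Germ (\<lambda>t. tan (2 * t) / 2) (\<lambda>t. 1 / cos (2 * t)) (\<lambda>t. 2 * sin (2 * t) / (cos (2 * t))\<^sup>2) (\<lambda>_. 0) (\<lambda>_. 0)
     (\<lambda>(t, x). sqrt \<bar>cos (2 * t)\<bar> * exp (- (tan (2 * t) * x\<^sup>2 / 2)))"

definition d2 :: germ where
  "d2 = Germ (\<lambda>t. exp (4 * t) / 4) (\<lambda>t. exp (2 * t)) (\<lambda>t. 2 * exp (2 * t)) (\<lambda>_. 0) (\<lambda>_. 0)
     (\<lambda>(t, x). exp (- x\<^sup>2 / 2 - t))"

definition d3 :: germ where
  "d3 = Germ (\<lambda>t. t) (\<lambda>_. 1) (\<lambda>_. 0) (\<lambda>t. t\<^sup>2) (\<lambda>t. 2 * t) (\<lambda>(t, x). exp (- t * x - t ^ 3 / 3))"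

lemma gmap_d: "gmap d1 = \<Phi>1" "gmap d2 = \<Phi>2" "gmap d3 = \<Phi>3"
  by (auto simp: gmap_def d1_def d2_def d3_def \<Phi>1_def \<Phi>2_def \<Phi>3_def)

lemma DERIV_tan2:
  assumes "cos (2 * t) \<noteq> (0 :: real)"
  shows "((\<lambda>t. tan (2 * t)) has_real_derivative 2 / (cos (2 * t))\<^sup>2) (at t)"
  by (rule DERIV_cong[OF DERIV_chain2[where f = tan and g = "\<lambda>t. 2 * t" and Db = 2, OF DERIV_tan[OF assms]]])
    (auto intro!: derivative_eq_intros simp: field_simps)

lemma ln_abs_cos_deriv:
  assumes "cos (2 * t) \<noteq> (0 :: real)"
  shows "((\<lambda>t. ln \<bar>cos (2 * t)\<bar> / 2) has_real_derivative - tan (2 * t)) (at t)"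
proof -
  have "((\<lambda>t. ln \<bar>s\<bar>) has_real_derivative 0) (at t)" for s :: real by simp
  have "((\<lambda>t. ln (k * cos (2 * t)) / 2) has_real_derivative - tan (2 * t)) (at t)" if "k * cos (2 * t) > 0" for k
    using that assms by (auto intro!: derivative_eq_intros simp: tan_def)
  \<comment> \<open>\<open>k\<close> is the sign of the cosine at \<open>t\<close>. On the open set
    where this sign persists, the absolute value is multiplication by \<open>k\<close>.\<close>
  moreover have "\<exists>k. k * cos (2 * t) > 0 \<and> (\<forall>y. k * y > 0 \<longrightarrow> \<bar>y\<bar> = k * y)"
    using assms by (intro exI[of _ "sgn (cos (2 * t))"]) (auto simp: sgn_real_def zero_less_mult_iff split: if_splits)
  then obtain k where k: "k * cos (2 * t) > 0" "\<And>y. k * y > 0 \<Longrightarrow> \<bar>y\<bar> = k * y" by blast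
  have o: "open {s. k * cos (2 * s) > 0}" by (intro open_Collect_less continuous_intros)
  have "((\<lambda>t. ln (k * cos (2 * t)) / 2) has_real_derivative - tan (2 * t)) (at t)"
    using calculation k(1) by blast
  from has_field_derivative_transform_within_open[OF this o, of "\<lambda>t. ln \<bar>cos (2 * t)\<bar> / 2"] k
  show ?thesis by simp
qed

lemma sqrt_abs_cos: "cos (2 * t) \<noteq> (0 :: real) \<Longrightarrow> sqrt \<bar>cos (2 * t)\<bar> = exp (ln \<bar>cos (2 * t)\<bar> / 2)"
  by (simp add: ln_sqrt[symmetric])

lemma sqrt_abs_cos_deriv:
  assumes "cos (2 * t) \<noteq> (0 :: real)"
  shows "((\<lambda>t. sqrt \<bar>cos (2 * t)\<bar>) has_real_derivative sqrt \<bar>cos (2 * t)\<bar> * - tan (2 * t)) (at t)"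
proof -
  have o: "open {s. cos (2 * s) \<noteq> (0 :: real)}" by (intro open_Collect_neq continuous_intros)
  have "((\<lambda>t. exp (ln \<bar>cos (2 * t)\<bar> / 2)) has_real_derivative exp (ln \<bar>cos (2 * t)\<bar> / 2) * - tan (2 * t)) (at t)"
    by (rule DERIV_chain2[OF DERIV_exp ln_abs_cos_deriv[OF assms]])
  from has_field_derivative_transform_within_open[OF this o, of "\<lambda>t. sqrt \<bar>cos (2 * t)\<bar>"] assms
  show ?thesis by (simp add: sqrt_abs_cos)
qed

text \<open>The singular term is invariant under the scaling \<open>1 / cos (2 * t)\<close>, and the
  added \<open>x\<^sup>2\<close> comes from \<open>1 / cos\<^sup>2 = 1 + tan\<^sup>2\<close>. For
  \<open>\<mu> = 0\<close> the point \<open>x = 0\<close> is allowed, as the quotient is then 0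
  there too.\<close>

lemma germ_at_d1:
  assumes t: "cos (2 * t) \<noteq> 0" and x: "\<mu> \<noteq> 0 \<Longrightarrow> x \<noteq> 0"
  shows "germ_at (\<lambda>x. \<mu> / x\<^sup>2 + x\<^sup>2) d1 (\<lambda>x. \<mu> / x\<^sup>2) t x"
proof -
  have sl: "slope d1 t x = - tan (2 * t) * x" using t by (simp add: slope_def d1_def tan_def field_simps power2_eq_square)
  have sct: "1 / (cos (2 * t))\<^sup>2 = 1 + (tan (2 * t))\<^sup>2" using tan_sec[OF t] by (simp only: inverse_eq_divide power_one_over)
  have m: "(1 / cos (2 * t))\<^sup>2 * (\<mu> / (1 / cos (2 * t) * x + 0)\<^sup>2) = \<mu> / x\<^sup>2"
    using t x by (cases "\<mu> = 0") (auto simp: field_simps power2_eq_square)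
  have z: "2 * sin (2 * t) / (cos (2 * t))\<^sup>2 / (2 * (1 / cos (2 * t))) = tan (2 * t)"
    using t by (simp add: tan_def field_simps power2_eq_square)
  have ra: "rate (\<lambda>x. \<mu> / x\<^sup>2 + x\<^sup>2) d1 (\<lambda>x. \<mu> / x\<^sup>2) t x = - tan (2 * t) - 1 / (cos (2 * t))\<^sup>2 * x\<^sup>2"
    unfolding rate_def sl sct using m z by (simp add: d1_def algebra_simps power_mult_distrib)
  have G: "((\<lambda>t. - tan (2 * t) / 2) has_real_derivative - (1 / (cos (2 * t))\<^sup>2)) (at t)"
    by (rule DERIV_cong[OF DERIV_cdivide[OF DERIV_minus[OF DERIV_tan2[OF t]]]]) simp
  have "((\<lambda>(t, x). sqrt \<bar>cos (2 * t)\<bar> * exp ((\<lambda>t. - tan (2 * t) / 2) t * x\<^sup>2 + (\<lambda>_. 0) t * x)) has_derivative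
    (\<lambda>(a, b). (sqrt \<bar>cos (2 * t)\<bar> * exp (- tan (2 * t) / 2 * x\<^sup>2 + 0 * x)) * (a * (- tan (2 * t) + - (1 / (cos (2 * t))\<^sup>2) * x\<^sup>2 + 0 * x) + b * (2 * (- tan (2 * t) / 2) * x + 0)))) (at (t, x))"
    by (rule multiplier_has_derivative[OF sqrt_abs_cos_deriv[OF t] G DERIV_const])
  then have fa: "(fa d1 has_derivative (\<lambda>(a, b). fa d1 (t, x) * (a * rate (\<lambda>x. \<mu> / x\<^sup>2 + x\<^sup>2) d1 (\<lambda>x. \<mu> / x\<^sup>2) t x + b * slope d1 t x))) (at (t, x))"
    unfolding sl ra by (simp add: d1_def)
  show ?thesis unfolding germ_at_def
  proof (intro conjI fa)
    show "(tm d1 has_real_derivative (sc d1 t)\<^sup>2) (at t)"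
      unfolding d1_def germ.sel by (rule DERIV_cong[OF DERIV_cdivide[OF DERIV_tan2[OF t]]]) (simp add: power_one_over)
    show "(sc d1 has_real_derivative sc1 d1 t) (at t)"
      unfolding d1_def germ.sel using t by (auto intro!: derivative_eq_intros simp: power2_eq_square)
    have "((\<lambda>t. 2 * sin (2 * t) / (cos (2 * t))\<^sup>2) has_real_derivative
       (2 * (cos (2 * t) * 2) * (cos (2 * t))\<^sup>2 - 2 * sin (2 * t) * (2 * cos (2 * t) * (- sin (2 * t) * 2))) / ((cos (2 * t))\<^sup>2 * (cos (2 * t))\<^sup>2)) (at t)"
      using t by (auto intro!: derivative_eq_intros)
    then show "sc1 d1 differentiable (at t)" unfolding d1_def germ.sel by (rule DERIV_imp_differentiable)
  qed (use t in \<open>auto simp: d1_def\<close>)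
qed

lemma germ_at_d2:
  assumes x: "\<mu> \<noteq> 0 \<Longrightarrow> x \<noteq> 0"
  shows "germ_at (\<lambda>x. \<mu> / x\<^sup>2 - x\<^sup>2) d2 (\<lambda>x. \<mu> / x\<^sup>2) t x"
proof -
  have sl: "slope d2 t x = - x" by (simp add: slope_def d2_def)
  have m: "(exp (2 * t))\<^sup>2 * (\<mu> / (exp (2 * t) * x + 0)\<^sup>2) = \<mu> / x\<^sup>2"
    using x by (cases "\<mu> = 0") (auto simp: field_simps power2_eq_square)
  have ra: "rate (\<lambda>x. \<mu> / x\<^sup>2 - x\<^sup>2) d2 (\<lambda>x. \<mu> / x\<^sup>2) t x = - 1"
    unfolding rate_def sl using m by (simp add: d2_def)
  have "((\<lambda>(t, x). exp (- t) * exp ((\<lambda>t. - 1 / 2) t * x\<^sup>2 + (\<lambda>_. 0) t * x)) has_derivative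
    (\<lambda>(a, b). (exp (- t) * exp (- 1 / 2 * x\<^sup>2 + 0 * x)) * (a * (- 1 + 0 * x\<^sup>2 + 0 * x) + b * (2 * (- 1 / 2) * x + 0)))) (at (t, x))"
    by (rule multiplier_has_derivative) (auto intro!: derivative_eq_intros)
  moreover have "fa d2 = (\<lambda>(t, x). exp (- t) * exp ((\<lambda>t. - 1 / 2) t * x\<^sup>2 + (\<lambda>_. 0) t * x))"
    by (auto simp: d2_def fun_eq_iff exp_add[symmetric])
  ultimately have fa: "(fa d2 has_derivative (\<lambda>(a, b). fa d2 (t, x) * (a * rate (\<lambda>x. \<mu> / x\<^sup>2 - x\<^sup>2) d2 (\<lambda>x. \<mu> / x\<^sup>2) t x + b * slope d2 t x))) (at (t, x))"
    unfolding sl ra by simp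
  show ?thesis unfolding germ_at_def
  proof (intro conjI fa)
    show "sc1 d2 differentiable (at t)" unfolding d2_def germ.sel
      by (rule DERIV_imp_differentiable[of _ "4 * exp (2 * t)"]) (auto intro!: derivative_eq_intros)
    show "(tm d2 has_real_derivative (sc d2 t)\<^sup>2) (at t)"
      unfolding d2_def germ.sel by (auto intro!: derivative_eq_intros simp: exp_double[symmetric])
  qed (auto simp: d2_def intro!: derivative_eq_intros)
qed

lemma germ_at_d3: "germ_at (\<lambda>x. x) d3 (\<lambda>x. 0) t x"
proof -
  have sl: "slope d3 t x = - t" by (simp add: slope_def d3_def)
  have ra: "rate (\<lambda>x. x) d3 (\<lambda>x. 0) t x = - t\<^sup>2 - x" unfolding rate_def sl by (simp add: d3_def)
  have "((\<lambda>(t, x). exp (- (t ^ 3) / 3) * exp ((\<lambda>t. 0) t * x\<^sup>2 + (\<lambda>t. - t) t * x)) has_derivative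
    (\<lambda>(a, b). (exp (- (t ^ 3) / 3) * exp (0 * x\<^sup>2 + - t * x)) * (a * (- t\<^sup>2 + 0 * x\<^sup>2 + - 1 * x) + b * (2 * 0 * x + - t)))) (at (t, x))"
    by (rule multiplier_has_derivative) (auto intro!: derivative_eq_intros)
  moreover have "fa d3 = (\<lambda>(t, x). exp (- (t ^ 3) / 3) * exp ((\<lambda>t. 0) t * x\<^sup>2 + (\<lambda>t. - t) t * x))"
    by (auto simp: d3_def fun_eq_iff exp_add[symmetric])
  ultimately have fa: "(fa d3 has_derivative (\<lambda>(a, b). fa d3 (t, x) * (a * rate (\<lambda>x. x) d3 (\<lambda>x. 0) t x + b * slope d3 t x))) (at (t, x))"
    unfolding sl ra by simp
  show ?thesis unfolding germ_at_def
  proof (intro conjI fa)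
    show "sh1 d3 differentiable (at t)" unfolding d3_def germ.sel
      by (rule DERIV_imp_differentiable[of _ 2]) (auto intro!: derivative_eq_intros)
  qed (auto simp: d3_def intro!: derivative_eq_intros)
qed

locale families =
  fixes J H :: "real set"
  assumes J: "open J" "is_interval J" "J \<noteq> {}" "\<forall>t\<in>J. cos (2 * t) \<noteq> 0"
    and H: "H = {0<..} \<or> H = {..<0}"
begin

definition gens :: "triple set" where "gens = \<B> J H \<union> inverse_of ` \<B> J H \<union> \<U>"

definition D1 :: "real \<Rightarrow> real set" where "D1 \<mu> = {x. \<forall>t\<in>J. x / cos (2 * t) \<in> axis H \<mu>}"

lemma axis_props: "open (axis H \<mu>)" "is_interval (axis H \<mu>)" "\<exists>x. x \<in> axis H \<mu>" "\<mu> \<noteq> 0 \<Longrightarrow> 0 \<notin> axis H \<mu>"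
proof -
  have "is_interval H" using H by (auto simp: is_interval_1)
  then show "is_interval (axis H \<mu>)" by (simp add: axis_def is_interval_univ)
  show "\<exists>x. x \<in> axis H \<mu>" using H by (cases "H = {0<..}") (auto simp: axis_def intro: exI[of _ 1] exI[of _ "- 1"])
qed (use H in \<open>auto simp: axis_def\<close>)

lemma axis_scale: "k > 0 \<Longrightarrow> k * x \<in> axis H \<mu> \<longleftrightarrow> x \<in> axis H \<mu>"
  using H by (auto simp: axis_def zero_less_mult_iff mult_less_0_iff)

text \<open>The cosine has no zero on the interval \<open>J\<close>, so the intermediate value
  theorem fixes its sign.\<close>

lemma cos_sign: "\<exists>s. (s = 1 \<or> s = - 1) \<and> (\<forall>t\<in>J. s * cos (2 * t) > 0)"
proof -
  have "is_interval ((\<lambda>t. cos (2 * t)) ` J)"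
    unfolding is_interval_connected_1
    by (intro connected_continuous_image continuous_intros) (use J(2) in \<open>simp add: is_interval_connected_1\<close>)
  then have iv: "\<And>a b. a \<in> J \<Longrightarrow> b \<in> J \<Longrightarrow> cos (2 * a) \<le> 0 \<Longrightarrow> 0 \<le> cos (2 * b) \<Longrightarrow> 0 \<in> (\<lambda>t. cos (2 * t)) ` J"
    unfolding is_interval_1 by blast
  obtain a where a: "a \<in> J" using J(3) by blast
  show ?thesis
  proof (cases "cos (2 * a) > 0")
    case True
    have "cos (2 * t) > 0" if "t \<in> J" for t
      using iv[OF that a] J(4) True by (force simp: not_less[symmetric])
    then show ?thesis by (intro exI[of _ 1]) simp
  next
    case False
    have "cos (2 * t) < 0" if "t \<in> J" for t
      using iv[OF a that] J(4) False by (force simp: not_less[symmetric])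
    then show ?thesis by (intro exI[of _ "- 1"]) simp
  qed
qed

text \<open>With \<open>s\<close> the sign of the cosine on \<open>J\<close>: the axis is invariant
  under positive scalings, so the source domain is the axis or its mirror image.\<close>

lemma D1_mem: "\<exists>s. (s = 1 \<or> s = - 1) \<and> (\<forall>x t. t \<in> J \<longrightarrow> (x / cos (2 * t) \<in> axis H \<mu> \<longleftrightarrow> s * x \<in> axis H \<mu>)) \<and> (\<forall>x. x \<in> D1 \<mu> \<longleftrightarrow> s * x \<in> axis H \<mu>)"
proof -
  obtain s where s: "s = 1 \<or> s = - 1" "\<And>t. t \<in> J \<Longrightarrow> s * cos (2 * t) > 0" using cos_sign by blast
  have *: "x / cos (2 * t) \<in> axis H \<mu> \<longleftrightarrow> s * x \<in> axis H \<mu>" if "t \<in> J" for x t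
  proof -
    have "s * s = 1" using s(1) by auto
    then have "x / cos (2 * t) = (1 / (s * cos (2 * t))) * (s * x)" using s(2)[OF that] by (auto simp: field_simps)
    moreover have "1 / (s * cos (2 * t)) > 0" using s(2)[OF that] by simp
    ultimately show ?thesis using axis_scale[of "1 / (s * cos (2 * t))" "s * x" \<mu>] by (simp only:)
  qed
  then show ?thesis using s(1) J(3) unfolding D1_def by blast
qed

lemma D1_props: "open (D1 \<mu>)" "is_interval (D1 \<mu>)" "\<exists>x. x \<in> D1 \<mu>" "\<mu> \<noteq> 0 \<Longrightarrow> 0 \<notin> D1 \<mu>"
proof -
  obtain s where s: "s = 1 \<or> s = - 1" "\<And>x. x \<in> D1 \<mu> \<longleftrightarrow> s * x \<in> axis H \<mu>" using D1_mem by blast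
  have eq: "D1 \<mu> = (\<lambda>x. s * x) -` axis H \<mu>" using s(2) by auto
  show "open (D1 \<mu>)" unfolding eq by (intro open_vimage axis_props continuous_intros)
  have "s * s = 1" using s(1) by auto
  then have e2: "D1 \<mu> = (\<lambda>x. s * x + 0) ` axis H \<mu>"
    unfolding eq by (auto simp: image_iff algebra_simps simp flip: mult.assoc intro!: bexI[of _ "s * _"])
  show "is_interval (D1 \<mu>)" unfolding e2 by (rule is_interval_affine_image[OF axis_props(2)])
  obtain y where "y \<in> axis H \<mu>" using axis_props(3) by blast
  then have "s * y \<in> D1 \<mu>" using s(2) \<open>s * s = 1\<close> by (simp flip: mult.assoc)
  then show "\<exists>x. x \<in> D1 \<mu>" by blast
  show "0 \<notin> D1 \<mu>" if "\<mu> \<noteq> 0" using s(2)[of 0] axis_props(4)[OF that] by simp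
qed

lemma smooth_singular:
  assumes "open D" "\<mu> \<noteq> 0 \<Longrightarrow> 0 \<notin> D"
  shows "smooth_on (\<lambda>x::real. \<mu> / x\<^sup>2) D"
proof (cases "\<mu> = 0")
  case False
  then show ?thesis
    by (intro smooth_on_divide smooth_on_const smooth_on_power smooth_on_id assms(1)) (use assms(2) in auto)
qed (simp add: smooth_on_const)

lemma potential_sing:
  "potential (potential_on (axis H \<mu>) (\<lambda>x. \<mu> / x\<^sup>2))"
  "potential (potential_on (axis H \<mu>) (\<lambda>x. \<mu> / x\<^sup>2 - x\<^sup>2))"
  "potential (potential_on (D1 \<mu>) (\<lambda>x. \<mu> / x\<^sup>2 + x\<^sup>2))"
proof -
  obtain y z where y: "y \<in> axis H \<mu>" and z: "z \<in> D1 \<mu>" using axis_props(3) D1_props(3) by blast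
  show "potential (potential_on (axis H \<mu>) (\<lambda>x. \<mu> / x\<^sup>2))"
    by (rule potential_potential_on[OF axis_props(1,2) y smooth_singular[OF axis_props(1,4)]])
  show "potential (potential_on (axis H \<mu>) (\<lambda>x. \<mu> / x\<^sup>2 - x\<^sup>2))"
    by (rule potential_potential_on[OF axis_props(1,2) y])
      (intro smooth_on_diff smooth_on_power smooth_on_id axis_props(1) smooth_singular[OF axis_props(1,4)])
  show "potential (potential_on (D1 \<mu>) (\<lambda>x. \<mu> / x\<^sup>2 + x\<^sup>2))"
    by (rule potential_potential_on[OF D1_props(1,2) z])
      (intro smooth_on_add smooth_on_power smooth_on_id D1_props(1) smooth_singular[OF D1_props(1,4)])
qed

lemma smooth_germ_1: "smooth_germ J (potential_on (D1 \<mu>) (\<lambda>x. \<mu> / x\<^sup>2 + x\<^sup>2)) (potential_on (axis H \<mu>) (\<lambda>x. \<mu> / x\<^sup>2)) d1"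
proof (unfold_locales, unfold dom_potential_on)
  fix t x assume tx: "t \<in> J" "x \<in> D1 \<mu>"
  have ax: "x / cos (2 * t) \<in> axis H \<mu>" using tx by (simp add: D1_def)
  then show r: "sc d1 t * x + sh d1 t \<in> axis H \<mu>" by (simp add: d1_def)
  have "germ_at (\<lambda>x. \<mu> / x\<^sup>2 + x\<^sup>2) d1 (\<lambda>x. \<mu> / x\<^sup>2) t x"
    by (rule germ_at_d1) (use tx J(4) D1_props(4)[of \<mu>] in auto)
  then show "germ_at (\<lambda>x. the (potential_on (D1 \<mu>) (\<lambda>x. \<mu> / x\<^sup>2 + x\<^sup>2) x)) d1 (\<lambda>x. the (potential_on (axis H \<mu>) (\<lambda>x. \<mu> / x\<^sup>2) x)) t x"
    by (rule germ_at_cong[THEN iffD1, rotated 2]) (use tx r in \<open>simp_all add: potential_on_def\<close>)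
next
  have c2: "smooth_on (\<lambda>t::real. cos (2 * t)) J" "smooth_on (\<lambda>t::real. sin (2 * t)) J"
    by (intro smooth_intros J)+
  show "smooth_on (sc d1) J" unfolding d1_def germ.sel
    by (intro smooth_on_divide smooth_on_const c2 J) (use J in auto)
  show "smooth_on (sh d1) J" unfolding d1_def germ.sel by (rule smooth_on_const)
  have tn: "smooth_on (\<lambda>t::real. tan (2 * t)) J" unfolding tan_def
    by (intro smooth_on_divide c2 J) (use J in auto)
  have "smooth_on (\<lambda>t. ln \<bar>cos (2 * t)\<bar> / 2) J"
    by (rule smooth_on_real_primitive[OF J(1) ln_abs_cos_deriv smooth_on_minus[OF J(1) tn]]) (use J in auto)
  then have "smooth_on (\<lambda>t. exp (ln \<bar>cos (2 * t)\<bar> / 2)) J" by (rule smooth_on_exp[OF J(1)])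
  moreover have "sqrt \<bar>cos (2 * t)\<bar> = exp (ln \<bar>cos (2 * t)\<bar> / 2)" if "t \<in> J" for t
    using sqrt_abs_cos J(4) that by blast
  ultimately have sq: "smooth_on (\<lambda>t. sqrt \<bar>cos (2 * t)\<bar>) J"
    using smooth_on_cong[OF J(1), of "\<lambda>t. sqrt \<bar>cos (2 * t)\<bar>" "\<lambda>t. exp (ln \<bar>cos (2 * t)\<bar> / 2)"] by blast
  have o: "open (J \<times> D1 \<mu>)" by (intro open_Times J D1_props)
  have l: "smooth_on (\<lambda>p::real \<times> real. f (fst p)) (J \<times> D1 \<mu>)" if "smooth_on f J" for f :: "real \<Rightarrow> real"
    by (rule smooth_on_compose[OF that o J(1) smooth_on_fst[OF o smooth_on_id[OF o]]]) auto
  have "smooth_on (\<lambda>p::real \<times> real. sqrt \<bar>cos (2 * fst p)\<bar> * exp (- (tan (2 * fst p) * (snd p)\<^sup>2 / 2))) (J \<times> D1 \<mu>)"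
    by (intro smooth_on_mult smooth_on_exp smooth_on_minus smooth_on_divide smooth_on_power smooth_on_snd smooth_on_id smooth_on_const o
        l[OF sq] l[OF tn]) simp
  moreover have "fa d1 = (\<lambda>p. sqrt \<bar>cos (2 * fst p)\<bar> * exp (- (tan (2 * fst p) * (snd p)\<^sup>2 / 2)))" by (auto simp: d1_def)
  ultimately show "smooth_on (fa d1) (J \<times> D1 \<mu>)" by (simp only:)
qed (rule J potential_sing)+

lemma smooth_germ_2: "smooth_germ UNIV (potential_on (axis H \<mu>) (\<lambda>x. \<mu> / x\<^sup>2 - x\<^sup>2)) (potential_on (axis H \<mu>) (\<lambda>x. \<mu> / x\<^sup>2)) d2"
proof (unfold_locales, unfold dom_potential_on)
  fix t x :: real assume x: "x \<in> axis H \<mu>"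
  show r: "sc d2 t * x + sh d2 t \<in> axis H \<mu>" using axis_scale[of "exp (2 * t)" x \<mu>] x by (simp add: d2_def)
  have "germ_at (\<lambda>x. \<mu> / x\<^sup>2 - x\<^sup>2) d2 (\<lambda>x. \<mu> / x\<^sup>2) t x"
    by (rule germ_at_d2) (use x axis_props(4)[of \<mu>] in auto)
  then show "germ_at (\<lambda>x. the (potential_on (axis H \<mu>) (\<lambda>x. \<mu> / x\<^sup>2 - x\<^sup>2) x)) d2 (\<lambda>x. the (potential_on (axis H \<mu>) (\<lambda>x. \<mu> / x\<^sup>2) x)) t x"
    by (rule germ_at_cong[THEN iffD1, rotated 2]) (use x r in \<open>simp_all add: potential_on_def\<close>)
next
  show "smooth_on (sc d2) UNIV" unfolding d2_def germ.sel by (intro smooth_intros open_UNIV)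
  show "smooth_on (sh d2) UNIV" unfolding d2_def germ.sel by (rule smooth_on_const)
  have o: "open ((UNIV :: real set) \<times> axis H \<mu>)" by (intro open_Times open_UNIV axis_props)
  have "smooth_on (\<lambda>p::real \<times> real. exp (- (snd p)\<^sup>2 / 2 - fst p)) ((UNIV :: real set) \<times> axis H \<mu>)"
    by (intro smooth_on_exp smooth_on_diff smooth_on_minus smooth_on_divide smooth_on_power smooth_on_snd smooth_on_fst smooth_on_id smooth_on_const o) simp
  moreover have "fa d2 = (\<lambda>p. exp (- (snd p)\<^sup>2 / 2 - fst p))" by (auto simp: d2_def)
  ultimately show "smooth_on (fa d2) (UNIV \<times> axis H \<mu>)" by (simp only:)
qed (rule open_UNIV is_interval_univ UNIV_not_empty potential_sing)+

lemma smooth_germ_3: "smooth_germ UNIV (potential_on UNIV (\<lambda>x. x)) (potential_on UNIV (\<lambda>x. 0)) d3"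
proof (unfold_locales, unfold dom_potential_on)
  show "potential (potential_on UNIV (\<lambda>x. x))" "potential (potential_on UNIV (\<lambda>x. 0))"
    by (rule potential_potential_on[OF open_UNIV is_interval_univ UNIV_I]; intro smooth_intros open_UNIV)+
  show "smooth_on (sc d3) UNIV" "smooth_on (sh d3) UNIV" unfolding d3_def germ.sel by (intro smooth_intros open_UNIV)+
  show "germ_at (\<lambda>x. the (potential_on UNIV (\<lambda>x. x) x)) d3 (\<lambda>x. the (potential_on UNIV (\<lambda>x. 0) x)) t x" for t x
    using germ_at_d3 by (simp add: potential_on_def)
  have o: "open ((UNIV :: real set) \<times> (UNIV :: real set))" by (intro open_Times open_UNIV)
  have "smooth_on (\<lambda>p::real \<times> real. exp (- fst p * snd p - fst p ^ 3 / 3)) (UNIV \<times> UNIV)"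
    by (intro smooth_on_exp smooth_on_diff smooth_on_mult smooth_on_minus smooth_on_divide smooth_on_power smooth_on_snd smooth_on_fst smooth_on_id smooth_on_const o) simp
  moreover have "fa d3 = (\<lambda>p. exp (- fst p * snd p - fst p ^ 3 / 3))" by (auto simp: d3_def)
  ultimately show "smooth_on (fa d3) (UNIV \<times> UNIV)" by (simp only:)
qed simp_all

lemma triples:
  "T1 J H \<mu> = (potential_on (D1 \<mu>) (\<lambda>x. \<mu> / x\<^sup>2 + x\<^sup>2), smooth_germ.\<Phi> J (potential_on (D1 \<mu>) (\<lambda>x. \<mu> / x\<^sup>2 + x\<^sup>2)) d1, potential_on (axis H \<mu>) (\<lambda>x. \<mu> / x\<^sup>2))"
  "T2 H \<mu> = (potential_on (axis H \<mu>) (\<lambda>x. \<mu> / x\<^sup>2 - x\<^sup>2), smooth_germ.\<Phi> UNIV (potential_on (axis H \<mu>) (\<lambda>x. \<mu> / x\<^sup>2 - x\<^sup>2)) d2, potential_on (axis H \<mu>) (\<lambda>x. \<mu> / x\<^sup>2))"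
  "T3 = (potential_on UNIV (\<lambda>x. x), smooth_germ.\<Phi> UNIV (potential_on UNIV (\<lambda>x. x)) d3, potential_on UNIV (\<lambda>x. 0))"
  unfolding T1_def T2_def T3_def Let_def smooth_germ.\<Phi>_def[OF smooth_germ_1] smooth_germ.\<Phi>_def[OF smooth_germ_2]
    smooth_germ.\<Phi>_def[OF smooth_germ_3] dom_potential_on gmap_d D1_def[symmetric]
  by auto

lemma in_gens: "T \<in> \<B> J H \<Longrightarrow> T \<in> gens" "T \<in> \<B> J H \<Longrightarrow> inverse_of T \<in> gens"
  "T1 J H \<mu> \<in> \<B> J H" "T2 H \<mu> \<in> \<B> J H" "T3 \<in> \<B> J H" "\<U> \<subseteq> gens"
  by (auto simp: gens_def \<B>_def)

lemma families_admissible: "\<B> J H \<subseteq> admissible"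
  using smooth_germ.admissible[OF smooth_germ_1] smooth_germ.admissible[OF smooth_germ_2] smooth_germ.admissible[OF smooth_germ_3]
  unfolding \<B>_def triples by auto

text \<open>The values of \<open>sc\<close> and \<open>sc1\<close> for the inverse germ are those
  entering the computation of projective loops.\<close>

lemma link_1:
  assumes "t \<in> J" "x \<in> D1 \<mu>"
  shows "\<exists>e. link gens (\<lambda>x. \<mu> / x\<^sup>2 + x\<^sup>2) d1 e (\<lambda>x. \<mu> / x\<^sup>2) (t, x) \<and>
    sc e (tan (2 * t) / 2) = cos (2 * t) \<and> sc1 e (tan (2 * t) / 2) = - 2 * sin (2 * t) * (cos (2 * t))\<^sup>2"
proof -
  interpret smooth_germ J "potential_on (D1 \<mu>) (\<lambda>x. \<mu> / x\<^sup>2 + x\<^sup>2)" "potential_on (axis H \<mu>) (\<lambda>x. \<mu> / x\<^sup>2)" d1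
    by (rule smooth_germ_1)
  note l = link_total[OF in_gens(1)[OF in_gens(3)[of \<mu>], unfolded triples] in_gens(2)[OF in_gens(3)[of \<mu>], unfolded triples] assms(1),
      unfolded dom_potential_on, OF assms(2), where c = "\<lambda>x. \<mu> / x\<^sup>2 + x\<^sup>2" and c' = "\<lambda>x. \<mu> / x\<^sup>2"]
  have t: "tm d1 t = tan (2 * t) / 2" by (simp add: d1_def)
  have nz: "cos (2 * t) \<noteq> 0" using J assms by blast
  have "sc dinv (tm d1 t) = cos (2 * t)" using l(2) by (simp add: potential_on_def d1_def)
  moreover have "sc1 dinv (tm d1 t) = - 2 * sin (2 * t) * (cos (2 * t))\<^sup>2"
    using l(3) nz by (simp add: potential_on_def d1_def field_simps power2_eq_square power4_eq_xxxx)
  moreover have "link gens (\<lambda>x. \<mu> / x\<^sup>2 + x\<^sup>2) d1 dinv (\<lambda>x. \<mu> / x\<^sup>2) (t, x)"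
    by (rule l(1)) (simp_all add: potential_on_def)
  ultimately show ?thesis unfolding t by blast
qed

lemma link_2:
  assumes "x \<in> axis H \<mu>"
  shows "\<exists>e. link gens (\<lambda>x. \<mu> / x\<^sup>2 - x\<^sup>2) d2 e (\<lambda>x. \<mu> / x\<^sup>2) (t, x)"
proof -
  interpret smooth_germ UNIV "potential_on (axis H \<mu>) (\<lambda>x. \<mu> / x\<^sup>2 - x\<^sup>2)" "potential_on (axis H \<mu>) (\<lambda>x. \<mu> / x\<^sup>2)" d2
    by (rule smooth_germ_2)
  note l = link_total(1)[OF in_gens(1)[OF in_gens(4)[of \<mu>], unfolded triples] in_gens(2)[OF in_gens(4)[of \<mu>], unfolded triples] UNIV_I,
      unfolded dom_potential_on, OF assms, where c = "\<lambda>x. \<mu> / x\<^sup>2 - x\<^sup>2" and c' = "\<lambda>x. \<mu> / x\<^sup>2"]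
  show ?thesis by (rule exI, rule l) (simp_all add: potential_on_def)
qed

lemma link_3:
  "\<exists>e. link gens (\<lambda>x. x) d3 e (\<lambda>x. 0) (t, x) \<and> sc e t = 1 \<and> sc1 e t = 0 \<and> sh1 e t = - 2 * t"
proof -
  interpret smooth_germ UNIV "potential_on UNIV (\<lambda>x. x)" "potential_on UNIV (\<lambda>x. 0)" d3
    by (rule smooth_germ_3)
  note l = link_total[OF in_gens(1)[OF in_gens(5), unfolded triples] in_gens(2)[OF in_gens(5), unfolded triples] UNIV_I,
      unfolded dom_potential_on, OF UNIV_I, where c = "\<lambda>x. x" and c' = "\<lambda>x. 0"]
  have t: "tm d3 t = t" by (simp add: d3_def)
  have "sc dinv (tm d3 t) = 1" using l(2) by (simp add: potential_on_def d3_def)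
  moreover have "sc1 dinv (tm d3 t) = 0" using l(3) by (simp add: potential_on_def d3_def)
  moreover have "sh1 dinv (tm d3 t) = - 2 * t" using l(4) by (simp add: potential_on_def d3_def)
  moreover have "link gens (\<lambda>x. x) d3 dinv (\<lambda>x. 0) (t, x)"
    by (rule l(1)) (simp_all add: potential_on_def)
  ultimately show ?thesis unfolding t by blast
qed

end

subsection \<open>Classification of the admissible germs\<close>

lemma eventually_box:
  assumes "\<forall>\<^sub>F q in nhds (t0 :: real, x0 :: real). P (fst q) (snd q)"
  obtains e where "e > 0" "\<And>t x. \<bar>t - t0\<bar> < e \<Longrightarrow> \<bar>x - x0\<bar> < e \<Longrightarrow> P t x"
proof -
  obtain S where S: "open S" "(t0, x0) \<in> S" "\<And>q. q \<in> S \<Longrightarrow> P (fst q) (snd q)"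
    using assms unfolding eventually_nhds by blast
  obtain A B where AB: "open A" "open B" "(t0, x0) \<in> A \<times> B" "A \<times> B \<subseteq> S" by (rule open_prod_elim[OF S(1,2)])
  have A: "t0 \<in> A" and B: "x0 \<in> B" using AB(3) by auto
  obtain e1 where e1: "e1 > 0" "ball t0 e1 \<subseteq> A" by (rule openE[OF AB(1) A])
  obtain e2 where e2: "e2 > 0" "ball x0 e2 \<subseteq> B" by (rule openE[OF AB(2) B])
  show thesis
  proof (rule that[of "min e1 e2"])
    fix t x assume "\<bar>t - t0\<bar> < min e1 e2" "\<bar>x - x0\<bar> < min e1 e2"
    then have "t \<in> ball t0 e1" "x \<in> ball x0 e2" by (auto simp: dist_real_def)
    then have "(t, x) \<in> S" using e1 e2 AB(4) by blast
    from S(3)[OF this] show "P t x" by simp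
  qed (use e1 e2 in simp)
qed

lemma DERIV_zero_const:
  fixes f :: "real \<Rightarrow> real"
  assumes "\<And>s. \<bar>s - a\<bar> < e \<Longrightarrow> (f has_real_derivative 0) (at s)" "\<bar>s - a\<bar> < e"
  shows "f s = f a"
proof -
  have "e > 0" using assms(2) by linarith
  then show ?thesis
    using DERIV_isconst3[of "a - e" "a + e" s a f] assms by (auto simp: abs_less_iff)
qed

lemma fa_deriv:
  assumes "germ_at c m c' t x"
  shows "((\<lambda>s. fa m (s, x)) has_real_derivative fa m (t, x) * rate c m c' t x) (at t)"
    "((\<lambda>y. fa m (t, y)) has_real_derivative fa m (t, x) * slope m t x) (at x)"
proof -
  have D: "(fa m has_derivative (\<lambda>(a, b). fa m (t, x) * (a * rate c m c' t x + b * slope m t x))) (at (t, x))"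
    using assms by (simp add: germ_at_def)
  have df: "fa m differentiable (at (t, x))" using D by (auto simp: differentiable_def)
  note dd = fun_cong[OF frechet_derivative_at[OF D]]
  show "((\<lambda>s. fa m (s, x)) has_real_derivative fa m (t, x) * rate c m c' t x) (at t)"
  proof -
    have v: "((\<lambda>s. (s, x)) has_vector_derivative (1, 0)) (at t)"
      by (auto intro!: derivative_eq_intros simp: zero_prod_def)
    from dd_curve[where \<gamma> = "\<lambda>s. (s, x)", OF df v] dd[of "(1, 0)"] show ?thesis by simp
  qed
  show "((\<lambda>y. fa m (t, y)) has_real_derivative fa m (t, x) * slope m t x) (at x)"
  proof -
    have v: "((\<lambda>y. (t, y)) has_vector_derivative (0, 1)) (at x)"
      by (auto intro!: derivative_eq_intros simp: zero_prod_def)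
    from dd_curve[where \<gamma> = "\<lambda>y. (t, y)", OF df v] dd[of "(0, 1)"] show ?thesis by simp
  qed
qed

text \<open>Scale and shift are locally constant, so \<open>slope\<close> vanishes and the
  multiplier depends on \<open>t\<close> only. Its logarithmic derivative \<open>rate\<close> then
  depends neither on \<open>t\<close> nor on \<open>x\<close>; this constant is the group parameter
  \<open>c5\<close>.\<close>

lemma trivial_germ_reachable:
  assumes S: "\<U> \<subseteq> S" and c: "smooth_near c x0" and m: "germ_near c m c' (t0, x0)"
    and z: "\<forall>\<^sub>F t in nhds t0. sc1 m t = 0 \<and> sh1 m t = 0"
  shows "reachable S c (gmap m) c' (t0, x0, u)"
proof -
  obtain e1 where e1: "e1 > 0" "\<And>t x. \<bar>t - t0\<bar> < e1 \<Longrightarrow> \<bar>x - x0\<bar> < e1 \<Longrightarrow> germ_at c m c' t x"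
    by (rule eventually_box[OF m[unfolded germ_near_def]]) (rule that)
  obtain e2 where e2: "e2 > 0" "\<And>t. \<bar>t - t0\<bar> < e2 \<Longrightarrow> sc1 m t = 0 \<and> sh1 m t = 0"
    using z unfolding eventually_nhds_metric dist_real_def by blast
  define e where "e = min e1 e2"
  have e0: "e > 0" using e1 e2 by (simp add: e_def)
  have g: "germ_at c m c' t x" if "\<bar>t - t0\<bar> < e" "\<bar>x - x0\<bar> < e" for t x using e1(2) that by (simp add: e_def)
  have z: "sc1 m t = 0" "sh1 m t = 0" if "\<bar>t - t0\<bar> < e" for t using e2(2) that by (simp_all add: e_def)
  have gx: "germ_at c m c' t x0" if "\<bar>t - t0\<bar> < e" for t using g[OF that] e0 by simp
  define c1 where "c1 = sc m t0"
  define c3 where "c3 = sh m t0"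
  have sc: "sc m t = c1" if "\<bar>t - t0\<bar> < e" for t
    unfolding c1_def by (rule DERIV_zero_const[OF _ that]) (use gx z in \<open>auto simp: germ_at_def\<close>)
  have sh: "sh m t = c3" if "\<bar>t - t0\<bar> < e" for t
    unfolding c3_def by (rule DERIV_zero_const[OF _ that]) (use gx z in \<open>auto simp: germ_at_def\<close>)
  have c1: "c1 \<noteq> 0" using gx[of t0] e0 by (simp add: germ_at_def c1_def)
  define k where "k x = c1\<^sup>2 * c' (c1 * x + c3) - c x" for x
  have sl: "slope m t x = 0" and ra: "rate c m c' t x = k x" if "\<bar>t - t0\<bar> < e" for t x
    using sc[OF that] sh[OF that] z[OF that] by (simp_all add: slope_def rate_def k_def)
  define g where "g t = fa m (t, x0)" for t
  have fx: "fa m (t, x) = g t" if "\<bar>t - t0\<bar> < e" "\<bar>x - x0\<bar> < e" for t x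
    unfolding g_def by (rule DERIV_zero_const[where f = "\<lambda>x. fa m (t, x)", OF _ that(2)])
      (use fa_deriv(2)[OF \<open>\<And>t x. \<lbrakk>\<bar>t - t0\<bar> < e; \<bar>x - x0\<bar> < e\<rbrakk> \<Longrightarrow> germ_at c m c' t x\<close>[OF that(1)]] sl[OF that(1)] in auto)
  have gnz: "g t0 \<noteq> 0" using gx[of t0] e0 by (simp add: germ_at_def g_def)
  have dg: "(g has_real_derivative g t * k x0) (at t)" if "\<bar>t - t0\<bar> < e" for t
    using fa_deriv(1)[OF gx[OF that]] ra[OF that] unfolding g_def[abs_def] by simp
  \<comment> \<open>The multiplier does not depend on \<open>x\<close>, so its
    \<open>t\<close>-derivative, computed at \<open>x\<close> and at \<open>x0\<close>, is the
    same.\<close>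
  have kx: "k x = k x0" if "\<bar>x - x0\<bar> < e" for x
  proof -
    have o: "open {t. \<bar>t - t0\<bar> < e}" by (intro open_Collect_less continuous_intros)
    have "((\<lambda>s. fa m (s, x)) has_real_derivative fa m (t0, x) * k x) (at t0)"
      using fa_deriv(1)[OF \<open>\<And>t x. \<lbrakk>\<bar>t - t0\<bar> < e; \<bar>x - x0\<bar> < e\<rbrakk> \<Longrightarrow> germ_at c m c' t x\<close>, of t0 x] ra[of t0 x] that e0 by simp
    from has_field_derivative_transform_within_open[OF this o, of g] fx that e0
    have "(g has_real_derivative g t0 * k x) (at t0)" by simp
    from DERIV_unique[OF this dg[of t0]] e0 have "g t0 * k x = g t0 * k x0" by simp
    then show ?thesis using gnz by simp
  qed
  define c5 where "c5 = k x0"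
  define c4 where "c4 = g t0 * exp (- c5 * t0)"
  have gt: "g t = c4 * exp (c5 * t)" if "\<bar>t - t0\<bar> < e" for t
  proof -
    have "g t * exp (- c5 * t) = g t0 * exp (- c5 * t0)"
      by (rule DERIV_zero_const[where f = "\<lambda>t. g t * exp (- c5 * t)", OF _ that])
        (auto intro!: derivative_eq_intros dg simp: c5_def)
    then show ?thesis by (simp add: c4_def exp_minus field_simps)
  qed
  define c2 where "c2 = tm m t0 - c1\<^sup>2 * t0"
  have tm: "tm m t = c1\<^sup>2 * t + c2" if "\<bar>t - t0\<bar> < e" for t
  proof -
    have "tm m t - c1\<^sup>2 * t = tm m t0 - c1\<^sup>2 * t0"
    proof (rule DERIV_zero_const[where f = "\<lambda>t. tm m t - c1\<^sup>2 * t", OF _ that])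
      fix s assume s: "\<bar>s - t0\<bar> < e"
      have "(tm m has_real_derivative c1\<^sup>2) (at s)" using gx[OF s] sc[OF s] by (simp add: germ_at_def)
      then show "((\<lambda>t. tm m t - c1\<^sup>2 * t) has_real_derivative 0) (at s)" by (auto intro!: derivative_eq_intros)
    qed
    then show ?thesis by (simp add: c2_def)
  qed
  have c4: "c4 \<noteq> 0" using gnz by (simp add: c4_def)
  have eq: "\<forall>\<^sub>F y in nhds x0. c1\<^sup>2 * c' (c1 * y + c3) = c y + c5"
  proof -
    have "c1\<^sup>2 * c' (c1 * y + c3) = c y + c5" if "\<bar>y - x0\<bar> < e" for y
      using kx[OF that] unfolding c5_def k_def[of y] by linarith
    then show ?thesis unfolding eventually_nhds_metric dist_real_def using e0 by blast
  qed
  have "\<forall>\<^sub>F q in nhds (t0, x0). \<bar>fst q - t0\<bar> < e \<and> \<bar>snd q - x0\<bar> < e"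
  proof -
    have "open {q::real \<times> real. \<bar>fst q - t0\<bar> < e \<and> \<bar>snd q - x0\<bar> < e}"
      by (intro open_Collect_conj open_Collect_less continuous_intros)
    from eventually_nhds_in_open[OF this, of "(t0, x0)"] e0 show ?thesis by simp
  qed
  from eventually_base[OF this, of u, unfolded fst_conv snd_conv]
  have "\<forall>\<^sub>F z in nhds (t0, x0, u). gmap (ggerm c1 c2 c3 c4 c5) z = gmap m z"
  proof (rule eventually_mono)
    fix z :: pt assume "\<bar>fst z - t0\<bar> < e \<and> \<bar>xpart z - x0\<bar> < e"
    then have a: "\<bar>fst z - t0\<bar> < e" "\<bar>xpart z - x0\<bar> < e" by simp_all
    show "gmap (ggerm c1 c2 c3 c4 c5) z = gmap m z"
      using tm[OF a(1)] sc[OF a(1)] sh[OF a(1)] fx[OF a] gt[OF a(1)]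
      by (cases z) (simp add: gmap_def ggerm_def)
  qed
  then show ?thesis
    by (intro reachable_cong[OF reachable_group[OF S c c1 c4 eq]]) simp_all
qed

text \<open>The compatibility condition of the two logarithmic derivatives of the multiplier. Since
  \<open>slope\<close> is affine in \<open>x\<close>, with coefficients \<open>2 G\<close> and
  \<open>K\<close>, it can be integrated explicitly from \<open>x0\<close>; differentiating the
  result in \<open>t\<close> makes \<open>rate\<close> quadratic in \<open>x\<close>, and its
  definition gives the relation between the potentials.\<close>

lemma master_identity:
  assumes m: "\<And>t x. \<bar>t - t0\<bar> < e \<Longrightarrow> \<bar>x - x0\<bar> < e \<Longrightarrow> germ_at c m c' t x" and t: "\<bar>t - t0\<bar> < e"
  defines "G \<equiv> \<lambda>t. - sc1 m t / (4 * sc m t)" and "K \<equiv> \<lambda>t. - sh1 m t / (2 * sc m t)"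
  shows "\<exists>g k q0. (G has_real_derivative g) (at t) \<and> (K has_real_derivative k) (at t) \<and>
    (\<forall>x. \<bar>x - x0\<bar> < e \<longrightarrow> c x = (sc m t)\<^sup>2 * c' (sc m t * x + sh m t) + (- g - 4 * (G t)\<^sup>2) * x\<^sup>2 + (- k - 4 * G t * K t) * x + q0)"
proof -
  have e0: "e > 0" using t by linarith
  have gx: "germ_at c m c' s x0" if "\<bar>s - t0\<bar> < e" for s using m[OF that] e0 by simp
  have nz: "sc m s \<noteq> 0" if "\<bar>s - t0\<bar> < e" for s using gx[OF that] by (simp add: germ_at_def)
  obtain g where g: "(G has_real_derivative g) (at t)"
  proof -
    have "sc m differentiable (at t)" using gx[OF t] DERIV_imp_differentiable by (auto simp: germ_at_def)
    then have "G differentiable (at t)" unfolding G_def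
      using gx[OF t] nz[OF t] by (intro differentiable_divide differentiable_minus differentiable_mult differentiable_const) (auto simp: germ_at_def)
    then show ?thesis using that unfolding real_differentiable_def by blast
  qed
  obtain k where k: "(K has_real_derivative k) (at t)"
  proof -
    have "sc m differentiable (at t)" using gx[OF t] DERIV_imp_differentiable by (auto simp: germ_at_def)
    then have "K differentiable (at t)" unfolding K_def
      using gx[OF t] nz[OF t] by (intro differentiable_divide differentiable_minus differentiable_mult differentiable_const) (auto simp: germ_at_def)
    then show ?thesis using that unfolding real_differentiable_def by blast
  qed
  have sl: "slope m s x = 2 * G s * x + K s" if "\<bar>s - t0\<bar> < e" for s x
    using nz[OF that] by (simp add: slope_def G_def K_def field_simps)
  \<comment> \<open>The primitive of \<open>slope\<close> in \<open>x\<close> that vanishes at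
    \<open>x0\<close>, so that \<open>exp (E s x)\<close> is the ratio of the multipliers at
    \<open>x\<close> and \<open>x0\<close>.\<close>
  define E where "E s x = G s * (x\<^sup>2 - x0\<^sup>2) + K s * (x - x0)" for s x
  have A: "fa m (s, x) = fa m (s, x0) * exp (E s x)" if "\<bar>s - t0\<bar> < e" "\<bar>x - x0\<bar> < e" for s x
  proof -
    have "fa m (s, x) * exp (- E s x) = fa m (s, x0) * exp (- E s x0)"
    proof (rule DERIV_zero_const[where f = "\<lambda>x. fa m (s, x) * exp (- E s x)", OF _ that(2)])
      fix y assume y: "\<bar>y - x0\<bar> < e"
      have "((\<lambda>y. exp (- E s y)) has_real_derivative exp (- E s y) * - (2 * G s * y + K s)) (at y)"
        unfolding E_def by (auto intro!: derivative_eq_intros)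
      from DERIV_mult[OF fa_deriv(2)[OF m[OF that(1) y]] this] sl[OF that(1)]
      show "((\<lambda>x. fa m (s, x) * exp (- E s x)) has_real_derivative 0) (at y)" by (simp add: algebra_simps)
    qed
    moreover have "E s x0 = 0" by (simp add: E_def)
    ultimately show ?thesis by (simp add: exp_minus field_simps)
  qed
  have ra: "rate c m c' t x = rate c m c' t x0 + (g * (x\<^sup>2 - x0\<^sup>2) + k * (x - x0))" if x: "\<bar>x - x0\<bar> < e" for x
  proof -
    have o: "open {t. \<bar>t - t0\<bar> < e}" by (intro open_Collect_less continuous_intros)
    have "((\<lambda>s. exp (E s x)) has_real_derivative exp (E t x) * (g * (x\<^sup>2 - x0\<^sup>2) + k * (x - x0))) (at t)"
      unfolding E_def by (auto intro!: derivative_eq_intros g k)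
    from DERIV_mult[OF fa_deriv(1)[OF gx[OF t]] this]
    have "((\<lambda>s. fa m (s, x0) * exp (E s x)) has_real_derivative fa m (t, x) * (rate c m c' t x0 + (g * (x\<^sup>2 - x0\<^sup>2) + k * (x - x0)))) (at t)"
      unfolding A[OF t x] by (simp add: algebra_simps)
    from has_field_derivative_transform_within_open[OF this o, of "\<lambda>s. fa m (s, x)"] A[OF _ x] t
    have "((\<lambda>s. fa m (s, x)) has_real_derivative fa m (t, x) * (rate c m c' t x0 + (g * (x\<^sup>2 - x0\<^sup>2) + k * (x - x0)))) (at t)" by simp
    with fa_deriv(1)[OF m[OF t x]]
    have "fa m (t, x) * rate c m c' t x = fa m (t, x) * (rate c m c' t x0 + (g * (x\<^sup>2 - x0\<^sup>2) + k * (x - x0)))"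
      by (rule DERIV_unique)
    moreover have "fa m (t, x) \<noteq> 0" using m[OF t x] by (simp add: germ_at_def)
    ultimately show ?thesis by simp
  qed
  define q0 where "q0 = - (K t)\<^sup>2 + 2 * G t - rate c m c' t x0 + g * x0\<^sup>2 + k * x0"
  have "c x = (sc m t)\<^sup>2 * c' (sc m t * x + sh m t) + (- g - 4 * (G t)\<^sup>2) * x\<^sup>2 + (- k - 4 * G t * K t) * x + q0"
    if x: "\<bar>x - x0\<bar> < e" for x
  proof -
    have "sc1 m t / (2 * sc m t) = - 2 * G t" by (simp add: G_def)
    then have "rate c m c' t x = (sc m t)\<^sup>2 * c' (sc m t * x + sh m t) - c x - (2 * G t * x + K t)\<^sup>2 + 2 * G t"
      unfolding rate_def sl[OF t] by simp
    with ra[OF x] show ?thesis unfolding q0_def by (simp add: algebra_simps power2_eq_square)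
  qed
  then show ?thesis using g k by blast
qed

lemma poly_zero_on_infinite:
  assumes "infinite (S :: real set)" "\<And>x. x \<in> S \<Longrightarrow> poly p x = 0"
  shows "p = 0"
  using assms poly_roots_finite[of p] finite_subset[of S "{x. poly p x = 0}"] by blast

text \<open>After clearing denominators this is the vanishing of a polynomial on an infinite set.
  The points \<open>a\<close> and \<open>a'\<close> are removed first, since division by zero gives
  0 there. For \<open>\<mu> = 0\<close> the position of the pole is meaningless, hence the
  conditional conclusion.\<close>

lemma form_unique:
  fixes \<mu> a k l d \<mu>' a' k' l' d' :: real
  assumes "\<forall>\<^sub>F x in nhds x0. \<mu> / (x - a)\<^sup>2 + k * x\<^sup>2 + l * x + d = \<mu>' / (x - a')\<^sup>2 + k' * x\<^sup>2 + l' * x + d'"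
  shows "\<mu> = \<mu>' \<and> (\<mu> \<noteq> 0 \<longrightarrow> a = a') \<and> k = k' \<and> l = l' \<and> d = d'"
proof -
  obtain D where D: "open D" "x0 \<in> D" "\<And>x. x \<in> D \<Longrightarrow> \<mu> / (x - a)\<^sup>2 + k * x\<^sup>2 + l * x + d = \<mu>' / (x - a')\<^sup>2 + k' * x\<^sup>2 + l' * x + d'"
    using assms unfolding eventually_nhds by blast
  have inf: "infinite (D - {a, a'})"
  proof -
    have "infinite D" using finite_imp_not_open[of D] D(1,2) by blast
    then show ?thesis by simp
  qed
  define q where "q = [:d - d', l - l', k - k':]"
  \<comment> \<open>The difference of the two sides times
    \<open>(x - a)\<^sup>2 * (x - a')\<^sup>2\<close>.\<close>
  define P where "P = [:\<mu>:] * [:- a', 1:]^2 + q * [:- a, 1:]^2 * [:- a', 1:]^2 - [:\<mu>':] * [:- a, 1:]^2"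
  have "poly P x = 0" if "x \<in> D - {a, a'}" for x
  proof -
    have n: "x - a \<noteq> 0" "x - a' \<noteq> 0" using that by auto
    define u v where "u = x - a" and "v = x - a'"
    have "\<mu> / u\<^sup>2 + k * x\<^sup>2 + l * x + d = \<mu>' / v\<^sup>2 + k' * x\<^sup>2 + l' * x + d'" using D(3) that by (simp add: u_def v_def)
    then have "(\<mu> / u\<^sup>2 + k * x\<^sup>2 + l * x + d) * (u\<^sup>2 * v\<^sup>2) = (\<mu>' / v\<^sup>2 + k' * x\<^sup>2 + l' * x + d') * (u\<^sup>2 * v\<^sup>2)" by simp
    moreover have "\<mu> / u\<^sup>2 * (u\<^sup>2 * v\<^sup>2) = \<mu> * v\<^sup>2" "\<mu>' / v\<^sup>2 * (u\<^sup>2 * v\<^sup>2) = \<mu>' * u\<^sup>2"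
      using n by (simp_all add: u_def v_def)
    ultimately have "\<mu> * v\<^sup>2 + (k * x\<^sup>2 + l * x + d) * (u\<^sup>2 * v\<^sup>2) = \<mu>' * u\<^sup>2 + (k' * x\<^sup>2 + l' * x + d') * (u\<^sup>2 * v\<^sup>2)" by algebra
    moreover have "poly P x = \<mu> * v\<^sup>2 + poly q x * u\<^sup>2 * v\<^sup>2 - \<mu>' * u\<^sup>2"
      by (simp add: P_def u_def v_def)
    moreover have "poly q x = d - d' + x * (l - l' + x * (k - k'))" by (simp add: q_def)
    ultimately show ?thesis by algebra
  qed
  from poly_zero_on_infinite[OF inf this] have P0: "P = 0" .
  have ev: "\<mu> * (x - a')\<^sup>2 + poly q x * (x - a)\<^sup>2 * (x - a')\<^sup>2 - \<mu>' * (x - a)\<^sup>2 = 0" for x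
    using arg_cong[OF P0, of "\<lambda>p. poly p x"] by (simp add: P_def)
  have qz: "k = k' \<and> l = l' \<and> d = d'" if "\<And>x. x \<noteq> a \<Longrightarrow> x \<noteq> a' \<Longrightarrow> poly q x = 0"
  proof -
    have "q = 0" by (rule poly_zero_on_infinite[OF inf]) (use that in auto)
    then show ?thesis by (simp add: q_def)
  qed
  show ?thesis
  proof (cases "a = a'")
    case True
    have e: "(\<mu> - \<mu>' + poly q x * (x - a)\<^sup>2) * (x - a)\<^sup>2 = 0" for x using ev[of x] True by (simp add: algebra_simps)
    have "[:\<mu> - \<mu>':] + q * [:- a, 1:]^2 = 0"
      by (rule poly_zero_on_infinite[OF inf]) (use e in auto)
    from arg_cong[OF this, of "\<lambda>p. poly p x" for x] have z: "\<mu> - \<mu>' + poly q x * (x - a)\<^sup>2 = 0" for x by simp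
    have mu: "\<mu> = \<mu>'" using z[of a] by simp
    then have "poly q x = 0" if "x \<noteq> a" for x using z[of x] that by simp
    then show ?thesis using qz mu True by blast
  next
    case False
    \<comment> \<open>At \<open>x = a\<close> every term but \<open>\<mu> * (a - a')\<^sup>2\<close>
      vanishes, and similarly at \<open>a'\<close>; distinct double poles cannot cancel.\<close>
    have "\<mu> = 0" "\<mu>' = 0" using ev[of a] ev[of a'] False by auto
    then have "poly q x = 0" if "x \<noteq> a" "x \<noteq> a'" for x using ev[of x] that by simp
    then show ?thesis using qz \<open>\<mu> = 0\<close> \<open>\<mu>' = 0\<close> by blast
  qed
qed

text \<open>With equal potentials at both ends, uniqueness of the rational form kills the quadratic
  and linear coefficients of the master identity and keeps the pole at 0. The resulting equations
  for \<open>G\<close> and \<open>K\<close> are homogeneous, so vanishing at one instant propagates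
  to a neighbourhood.\<close>

lemma loop_structure:
  assumes m: "germ_near (\<lambda>x. \<mu> / x\<^sup>2) m (\<lambda>x. \<mu> / x\<^sup>2) (t0, x0)"
  shows "\<mu> \<noteq> 0 \<Longrightarrow> sh1 m t0 = 0"
    and "sc1 m t0 = 0 \<Longrightarrow> sh1 m t0 = 0 \<Longrightarrow> \<forall>\<^sub>F t in nhds t0. sc1 m t = 0 \<and> sh1 m t = 0"
proof -
  let ?c = "\<lambda>x. \<mu> / x\<^sup>2"
  obtain e where e: "e > 0" "\<And>t x. \<bar>t - t0\<bar> < e \<Longrightarrow> \<bar>x - x0\<bar> < e \<Longrightarrow> germ_at ?c m ?c t x"
    by (rule eventually_box[OF m[unfolded germ_near_def]]) (rule that)
  have gx: "germ_at ?c m ?c t x0" if "\<bar>t - t0\<bar> < e" for t using e that by simp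
  have nz: "sc m t \<noteq> 0" and dsc: "(sc m has_real_derivative sc1 m t) (at t)" and dsh: "(sh m has_real_derivative sh1 m t) (at t)"
    if "\<bar>t - t0\<bar> < e" for t using gx[OF that] by (simp_all add: germ_at_def)
  define G where "G t = - sc1 m t / (4 * sc m t)" for t
  define K where "K t = - sh1 m t / (2 * sc m t)" for t
  have key: "(\<mu> \<noteq> 0 \<longrightarrow> sh m t = 0) \<and> (G has_real_derivative - 4 * (G t)\<^sup>2) (at t) \<and> (K has_real_derivative - 4 * G t * K t) (at t)"
    if t: "\<bar>t - t0\<bar> < e" for t
  proof -
    obtain g k q0 where *: "(G has_real_derivative g) (at t)" "(K has_real_derivative k) (at t)"
      "\<And>x. \<bar>x - x0\<bar> < e \<Longrightarrow> ?c x = (sc m t)\<^sup>2 * ?c (sc m t * x + sh m t) + (- g - 4 * (G t)\<^sup>2) * x\<^sup>2 + (- k - 4 * G t * K t) * x + q0"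
      using master_identity[OF e(2) t, folded G_def K_def] by blast
    have c2: "(sc m t)\<^sup>2 * ?c (sc m t * x + sh m t) = \<mu> / (x - (- sh m t / sc m t))\<^sup>2" for x
    proof -
      have "sc m t * x + sh m t = sc m t * (x - (- sh m t / sc m t))" using nz[OF t] by (simp add: field_simps)
      then show ?thesis using nz[OF t] by (simp add: power_mult_distrib)
    qed
    have "\<forall>\<^sub>F x in nhds x0. \<mu> / (x - 0)\<^sup>2 + 0 * x\<^sup>2 + 0 * x + 0 = \<mu> / (x - (- sh m t / sc m t))\<^sup>2 + (- g - 4 * (G t)\<^sup>2) * x\<^sup>2 + (- k - 4 * G t * K t) * x + q0"
      unfolding eventually_nhds_metric dist_real_def using e(1) *(3) c2 by (intro exI[of _ e]) auto
    from form_unique[OF this] have "\<mu> \<noteq> 0 \<longrightarrow> 0 = - sh m t / sc m t" "0 = - g - 4 * (G t)\<^sup>2" "0 = - k - 4 * G t * K t" by blast+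
    then have "\<mu> \<noteq> 0 \<longrightarrow> sh m t = 0" "g = - 4 * (G t)\<^sup>2" "k = - 4 * G t * K t" using nz[OF t] by auto
    then show ?thesis using *(1,2) by simp
  qed
  show "sh1 m t0 = 0" if mu: "\<mu> \<noteq> 0"
  proof -
    have o: "open {t. \<bar>t - t0\<bar> < e}" by (intro open_Collect_less continuous_intros)
    have "((\<lambda>_. 0) has_real_derivative sh1 m t0) (at t0)"
      by (rule has_field_derivative_transform_within_open[OF dsh o]) (use key mu e(1) in auto)
    then show ?thesis using DERIV_unique[OF _ DERIV_const] by blast
  qed
  assume z0: "sc1 m t0 = 0" "sh1 m t0 = 0"
  have "sc1 m t = 0 \<and> sh1 m t = 0" if t: "\<bar>t - t0\<bar> < e" for t
  proof -
    have s1: "sc1 m s = - 4 * G s * sc m s" and s2: "sh1 m s = - 2 * K s * sc m s" if "\<bar>s - t0\<bar> < e" for s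
      using nz[OF that] by (simp_all add: G_def K_def)
    \<comment> \<open>A first integral: \<open>G' = - 4 G\<^sup>2\<close> while \<open>sc m\<close>
      has derivative \<open>- 4 G * sc m\<close>. The same holds for
      \<open>K / sc m\<close>.\<close>
    have "G t / sc m t = G t0 / sc m t0"
    proof (rule DERIV_zero_const[where f = "\<lambda>t. G t / sc m t", OF _ t])
      fix s assume s: "\<bar>s - t0\<bar> < e"
      have "((\<lambda>t. G t / sc m t) has_real_derivative (- 4 * (G s)\<^sup>2 * sc m s - G s * sc1 m s) / (sc m s * sc m s)) (at s)"
        by (rule DERIV_divide) (use key[OF s] dsc[OF s] nz[OF s] in auto)
      moreover have "- 4 * (G s)\<^sup>2 * sc m s - G s * sc1 m s = 0" unfolding s1[OF s] by (simp add: power2_eq_square)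
      ultimately show "((\<lambda>t. G t / sc m t) has_real_derivative 0) (at s)" by simp
    qed
    moreover have "G t0 = 0" using z0 by (simp add: G_def)
    ultimately have "G t = 0" using nz[OF t] by simp
    have "K t / sc m t = K t0 / sc m t0"
    proof (rule DERIV_zero_const[where f = "\<lambda>t. K t / sc m t", OF _ t])
      fix s assume s: "\<bar>s - t0\<bar> < e"
      have "((\<lambda>t. K t / sc m t) has_real_derivative (- 4 * G s * K s * sc m s - K s * sc1 m s) / (sc m s * sc m s)) (at s)"
        by (rule DERIV_divide) (use key[OF s] dsc[OF s] nz[OF s] in auto)
      moreover have "- 4 * G s * K s * sc m s - K s * sc1 m s = 0" unfolding s1[OF s] by simp
      ultimately show "((\<lambda>t. K t / sc m t) has_real_derivative 0) (at s)" by simp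
    qed
    moreover have "K t0 = 0" using z0 by (simp add: K_def)
    ultimately have "K t = 0" using nz[OF t] by simp
    then show ?thesis using s1[OF t] s2[OF t] \<open>G t = 0\<close> by simp
  qed
  then show "\<forall>\<^sub>F t in nhds t0. sc1 m t = 0 \<and> sh1 m t = 0"
    unfolding eventually_nhds_metric dist_real_def using e(1) by blast
qed

section \<open>Loops and normal forms provided by the families\<close>

context families
begin

lemma axis_sign:
  assumes "\<mu> \<noteq> 0 \<Longrightarrow> x \<noteq> 0"
  shows "\<exists>s. (s = 1 \<or> s = - 1) \<and> s * x \<in> axis H \<mu>" "\<exists>s. (s = 1 \<or> s = - 1) \<and> s * x \<in> D1 \<mu>"
proof -
  have *: "\<exists>s. (s = 1 \<or> s = - 1) \<and> s * z \<in> axis H \<mu>" if nz: "\<mu> \<noteq> 0 \<Longrightarrow> z \<noteq> 0" for z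
  proof (cases "\<mu> = 0")
    case False
    then consider "z > 0" | "z < 0" using nz[OF False] by linarith
    then show ?thesis
    proof cases
      case 1
      then show ?thesis using H False by (cases "H = {0<..}") (auto simp: axis_def intro: exI[of _ 1] exI[of _ "- 1"])
    next
      case 2
      then show ?thesis using H False by (cases "H = {0<..}") (auto simp: axis_def intro: exI[of _ 1] exI[of _ "- 1"])
    qed
  qed (auto simp: axis_def intro: exI[of _ 1])
  show "\<exists>s. (s = 1 \<or> s = - 1) \<and> s * x \<in> axis H \<mu>" by (rule *[OF assms])
  obtain r where r: "r = 1 \<or> r = - 1" "\<And>x. x \<in> D1 \<mu> \<longleftrightarrow> r * x \<in> axis H \<mu>" using D1_mem by blast
  obtain s where s: "s = 1 \<or> s = - 1" "s * x \<in> axis H \<mu>" using *[OF assms] by blast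
  have "r * (r * s * x) = s * x" using r(1) by auto
  then have "r * s * x \<in> D1 \<mu>" unfolding r(2) using s(2) by (simp only:)
  moreover have "r * s = 1 \<or> r * s = - 1" using r(1) s(1) by auto
  ultimately show "\<exists>s. (s = 1 \<or> s = - 1) \<and> s * x \<in> D1 \<mu>" by blast
qed

lemma smooth_near_singular:
  assumes "\<mu> \<noteq> 0 \<Longrightarrow> x \<noteq> 0"
  shows "smooth_near (\<lambda>x. \<mu> / x\<^sup>2 + k * x\<^sup>2 + l * x) x"
proof -
  define D where "D = (if \<mu> = 0 then UNIV else if x > 0 then {0<..} else {..<0::real})"
  have D: "open D" "is_interval D" "x \<in> D" "\<mu> \<noteq> 0 \<Longrightarrow> 0 \<notin> D"
    using assms by (auto simp: D_def is_interval_univ is_interval_1)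
  have "smooth_on (\<lambda>x. \<mu> / x\<^sup>2 + k * x\<^sup>2 + l * x) D"
    by (intro smooth_on_add smooth_on_mult smooth_on_power smooth_on_const smooth_on_id D(1) smooth_singular D(4))
  then show ?thesis unfolding smooth_near_def using D by blast
qed

lemma smooth_near_simple:
  assumes "\<mu> \<noteq> 0 \<Longrightarrow> x \<noteq> 0"
  shows "smooth_near (\<lambda>x. \<mu> / x\<^sup>2) x" "smooth_near (\<lambda>x. \<mu> / x\<^sup>2 + x\<^sup>2) x" "smooth_near (\<lambda>x. \<mu> / x\<^sup>2 - x\<^sup>2) x"
    "smooth_near (\<lambda>x. x) x"
proof -
  show "smooth_near (\<lambda>x. \<mu> / x\<^sup>2) x" using smooth_near_singular[of \<mu> x 0 0] assms by simp
  show "smooth_near (\<lambda>x. \<mu> / x\<^sup>2 + x\<^sup>2) x" using smooth_near_singular[of \<mu> x 1 0] assms by simp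
  show "smooth_near (\<lambda>x. \<mu> / x\<^sup>2 - x\<^sup>2) x" using smooth_near_singular[of \<mu> x "- 1" 0] assms by simp
  show "smooth_near (\<lambda>x. x) x" using smooth_near_singular[of 0 x 0 1] by simp
qed

lemma link_time_shift:
  assumes "smooth_near c x"
  shows "\<exists>e. link gens c (ggerm 1 s 0 1 0) e c (t, x)"
  using link_group[OF in_gens(6) assms, of 1 1 c 0 0 s t] by auto

text \<open>Conjugating a time shift by \<open>\<Phi>1\<close> gives loops at \<open>\<mu> / x\<^sup>2\<close> whose time part is a non-affine Moebius map.
  They realise all nonzero values of \<open>sc1 / sc ^ 3\<close>, which is the amount needed to make \<open>sc\<close> constant.\<close>

lemma projective_loop:
  assumes k: "\<kappa> \<noteq> 0" and x0: "x0 \<in> axis H \<mu>"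
  shows "\<exists>p d e. link gens (\<lambda>x. \<mu> / x\<^sup>2) d e (\<lambda>x. \<mu> / x\<^sup>2) p \<and> bmap d p = (t0, x0) \<and> snd p \<in> axis H \<mu> \<and>
    sc1 d (fst p) / sc d (fst p) ^ 3 = \<kappa>"
proof -
  obtain j where j: "j \<in> J" using J(3) by blast
  obtain r where r: "r > 0" "ball j r \<subseteq> J" by (rule openE[OF J(1) j])
  \<comment> \<open>Small enough that the shifted time stays in \<open>J\<close> and that
    \<open>sin (2 * \<eta>)\<close> is positive; shifting forward or backward then gives
    \<open>sg\<close> the sign of \<open>\<kappa>\<close>.\<close>
  define \<eta> where "\<eta> = min (r / 2) (pi / 8)"
  have "\<eta> \<le> pi / 8" "\<eta> \<le> r / 2" "\<eta> > 0" using r(1) pi_gt_zero by (auto simp: \<eta>_def)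
  then have eta: "\<eta> > 0" "\<eta> < r" "2 * \<eta> < pi" using r(1) pi_gt_zero by linarith+
  define j1 where "j1 = j"
  define j2 where "j2 = (if \<kappa> > 0 then j + \<eta> else j - \<eta>)"
  have jJ: "j1 \<in> J" "j2 \<in> J"
    using j r(2) eta by (auto simp: j1_def j2_def subset_iff dist_real_def)
  define a b where "a = cos (2 * j1)" and "b = cos (2 * j2)"
  define sg where "sg = sin (2 * (j2 - j1))"
  have sg: "sg * \<kappa> > 0"
  proof (cases "\<kappa> > 0")
    case True
    then have "sg > 0" using eta by (auto simp: sg_def j1_def j2_def intro!: sin_gt_zero)
    then show ?thesis using True by simp
  next
    case False
    then have "sg = - sin (2 * \<eta>)" by (simp add: sg_def j1_def j2_def)
    moreover have "sin (2 * \<eta>) > 0" using eta by (intro sin_gt_zero) auto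
    ultimately show ?thesis using False k by (simp add: mult_less_0_iff mult_neg_neg)
  qed
  have ab: "a \<noteq> 0" "b \<noteq> 0" "b / a > 0"
  proof -
    obtain s where "\<forall>t\<in>J. s * cos (2 * t) > 0" using cos_sign by blast
    then have s: "s * a > 0" "s * b > 0" using jJ by (auto simp: a_def b_def)
    then show "a \<noteq> 0" "b \<noteq> 0" by auto
    have "s \<noteq> 0" using s by auto
    then have "b / a = (s * b) / (s * a)" by simp
    also have "\<dots> > 0" using s by (intro divide_pos_pos)
    finally show "b / a > 0" .
  qed
  have q: "2 * (b / a) * (sg / \<kappa>) > 0"
  proof -
    have "sg / \<kappa> > 0" using sg by (simp add: zero_less_divide_iff zero_less_mult_iff)
    from mult_pos_pos[OF mult_pos_pos[OF zero_less_numeral ab(3)] this] show ?thesis .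
  qed
  \<comment> \<open>The loop without a final scaling has
    \<open>sc1 / sc ^ 3 = 2 * (b / a) * sg\<close>. A scaling by \<open>l\<close> divides this by
    \<open>l\<^sup>2\<close>, and the common sign of \<open>sg\<close> and \<open>\<kappa>\<close>
    makes the root real.\<close>
  define l where "l = sqrt (2 * (b / a) * (sg / \<kappa>))"
  have l: "l > 0" "l\<^sup>2 = 2 * (b / a) * (sg / \<kappa>)" using q by (simp_all add: l_def)
  \<comment> \<open>Chosen backwards, so that the loop ends at \<open>x0\<close> after division by
    \<open>b\<close> and scaling by \<open>l\<close>; likewise \<open>c2\<close> below lets it end
    at time \<open>t0\<close>.\<close>
  define x1 where "x1 = x0 * b / l"
  have x1: "x1 \<in> D1 \<mu>" and x1': "x1 / cos (2 * j1) \<in> axis H \<mu>" "x1 / cos (2 * j2) \<in> axis H \<mu>"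
  proof -
    obtain s where s: "\<And>x t. t \<in> J \<Longrightarrow> x / cos (2 * t) \<in> axis H \<mu> \<longleftrightarrow> s * x \<in> axis H \<mu>" "\<And>x. x \<in> D1 \<mu> \<longleftrightarrow> s * x \<in> axis H \<mu>"
      using D1_mem by blast
    have "x1 / cos (2 * j2) = (1 / l) * x0" using ab by (simp add: x1_def b_def)
    then show x2: "x1 / cos (2 * j2) \<in> axis H \<mu>" using axis_scale[of "1 / l" x0 \<mu>] x0 l by simp
    then show "x1 \<in> D1 \<mu>" "x1 / cos (2 * j1) \<in> axis H \<mu>" using s jJ by blast+
  qed
  have x1nz: "\<mu> \<noteq> 0 \<Longrightarrow> x1 \<noteq> 0" using x1 D1_props(4) by auto
  define y2 where "y2 = x1 / cos (2 * j2)"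
  have y2nz: "\<mu> \<noteq> 0 \<Longrightarrow> y2 \<noteq> 0" using x1'(2) axis_props(4) by (auto simp: y2_def)
  obtain e1 where e1: "link gens (\<lambda>x. \<mu> / x\<^sup>2 + x\<^sup>2) d1 e1 (\<lambda>x. \<mu> / x\<^sup>2) (j1, x1)"
    "sc e1 (tan (2 * j1) / 2) = a" "sc1 e1 (tan (2 * j1) / 2) = - 2 * sin (2 * j1) * a\<^sup>2"
    using link_1[OF jJ(1) x1] by (auto simp: a_def)
  define p where "p = bmap d1 (j1, x1)"
  have p: "p = (tan (2 * j1) / 2, x1 / cos (2 * j1))" by (simp add: p_def bmap_def d1_def)
  have A: "link gens (\<lambda>x. \<mu> / x\<^sup>2) e1 d1 (\<lambda>x. \<mu> / x\<^sup>2 + x\<^sup>2) p" unfolding p_def by (rule link_sym[OF e1(1)])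
  have b1: "bmap e1 p = (j1, x1)" using e1(1) by (simp add: link_def p_def)
  have t1: "tm e1 (tan (2 * j1) / 2) = j1" using b1 by (simp add: p bmap_def)
  obtain g2 where g2: "link gens (\<lambda>x. \<mu> / x\<^sup>2 + x\<^sup>2) (ggerm 1 (j2 - j1) 0 1 0) g2 (\<lambda>x. \<mu> / x\<^sup>2 + x\<^sup>2) (j1, x1)"
    using link_time_shift[OF smooth_near_simple(2)[OF x1nz]] by blast
  have b2: "bmap (ggerm 1 (j2 - j1) 0 1 0) (j1, x1) = (j2, x1)" by (simp add: bmap_def ggerm_def)
  obtain e3 where e3: "link gens (\<lambda>x. \<mu> / x\<^sup>2 + x\<^sup>2) d1 e3 (\<lambda>x. \<mu> / x\<^sup>2) (j2, x1)"
    using link_1[OF jJ(2) x1] by blast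
  have b3: "bmap d1 (j2, x1) = (tan (2 * j2) / 2, y2)" by (simp add: bmap_def d1_def y2_def)
  define c2 where "c2 = t0 - l\<^sup>2 * (tan (2 * j2) / 2)"
  have ev: "\<forall>\<^sub>F y in nhds y2. l\<^sup>2 * (\<mu> / (l * y + 0)\<^sup>2) = \<mu> / y\<^sup>2 + 0"
    using l(1) by (intro always_eventually allI) (simp add: power_mult_distrib)
  obtain e4 where e4: "link gens (\<lambda>x. \<mu> / x\<^sup>2) (ggerm l c2 0 1 0) e4 (\<lambda>x. \<mu> / x\<^sup>2) (tan (2 * j2) / 2, y2)"
    using link_group[OF in_gens(6) smooth_near_simple(1)[OF y2nz] _ _ ev, of 1 c2 "tan (2 * j2) / 2"] l(1) by auto
  have b4: "bmap (ggerm l c2 0 1 0) (tan (2 * j2) / 2, y2) = (t0, x0)"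
    using l(1) ab by (simp add: bmap_def ggerm_def c2_def y2_def x1_def b_def)
  note c12 = link_comp[OF A g2[folded b1]]
  have b12: "bmap (germ_comp (ggerm 1 (j2 - j1) 0 1 0) e1) p = (j2, x1)" by (simp add: bmap_comp b1 b2)
  note c13 = link_comp[OF c12 e3[folded b12]]
  have b13: "bmap (germ_comp d1 (germ_comp (ggerm 1 (j2 - j1) 0 1 0) e1)) p = (tan (2 * j2) / 2, y2)"
    by (simp add: bmap_comp b1 b2 b3)
  note c14 = link_comp[OF c13 e4[folded b13]]
  define d where "d = germ_comp (ggerm l c2 0 1 0) (germ_comp d1 (germ_comp (ggerm 1 (j2 - j1) 0 1 0) e1))"
  have "bmap d p = (t0, x0)" by (simp add: d_def bmap_comp b1 b2 b3 b4)
  moreover have "snd p \<in> axis H \<mu>" using x1'(1) by (simp add: p)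
  moreover have "sc1 d (fst p) / sc d (fst p) ^ 3 = \<kappa>"
  proof -
    define s1 s2 where "s1 = sin (2 * j1)" and "s2 = sin (2 * j2)"
    have sgs: "sg = s2 * a - b * s1" by (simp add: sg_def s1_def s2_def a_def b_def right_diff_distrib sin_diff)
    have scd: "sc d (fst p) = l * (1 / b * a)"
      by (simp add: d_def germ_comp_def ggerm_def d1_def p e1(2) t1 b_def)
    have sc1d: "sc1 d (fst p) = l * (2 * s2 / b\<^sup>2 * a ^ 3 + 1 / b * (- 2 * s1 * a\<^sup>2))"
      by (simp add: d_def germ_comp_def ggerm_def d1_def p e1(2,3) t1 b_def s1_def s2_def)
    have "sc1 d (fst p) / sc d (fst p) ^ 3 = (2 * (b / a) * sg) / l\<^sup>2"
      unfolding scd sc1d sgs using ab l(1) by (simp add: field_simps power2_eq_square power3_eq_cube)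
    also have "\<dots> = \<kappa>" unfolding l(2) using ab k sg by (auto simp: field_simps)
    finally show ?thesis .
  qed
  ultimately show ?thesis using c14[folded d_def] by blast
qed

text \<open>Conjugating a time shift by \<open>\<Phi>3\<close> gives the Galilean boosts of the free equation.\<close>

lemma boost_loop:
  "\<exists>p d e. link gens (\<lambda>x. 0) d e (\<lambda>x. 0) p \<and> bmap d p = (t0, x0) \<and>
    sc d (fst p) = 1 \<and> sc1 d (fst p) = 0 \<and> sh1 d (fst p) = 2 * s"
proof -
  define x1 where "x1 = x0 - t0\<^sup>2"
  \<comment> \<open>The inverse of \<open>d3\<close> contributes velocity \<open>- 2 * t1\<close>
    and \<open>d3\<close> itself, after the shift by \<open>s\<close>, contributes
    \<open>2 * t0\<close>; the difference is \<open>2 * s\<close>.\<close>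
  define t1 where "t1 = t0 - s"
  obtain e1 where e1: "link gens (\<lambda>x. x) d3 e1 (\<lambda>x. 0) (t1, x1)" "sc e1 t1 = 1" "sc1 e1 t1 = 0" "sh1 e1 t1 = - 2 * t1"
    using link_3 by blast
  define p where "p = bmap d3 (t1, x1)"
  have p: "p = (t1, x1 + t1\<^sup>2)" by (simp add: p_def bmap_def d3_def)
  have A: "link gens (\<lambda>x. 0) e1 d3 (\<lambda>x. x) p" unfolding p_def by (rule link_sym[OF e1(1)])
  have b1: "bmap e1 p = (t1, x1)" using e1(1) by (simp add: link_def p_def)
  have tm1: "tm e1 t1 = t1" using b1 by (simp add: p bmap_def)
  obtain g2 where g2: "link gens (\<lambda>x. x) (ggerm 1 s 0 1 0) g2 (\<lambda>x. x) (t1, x1)"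
    using link_time_shift[OF smooth_near_simple(4)[of 0 x1]] by auto
  have b2: "bmap (ggerm 1 s 0 1 0) (t1, x1) = (t0, x1)" by (simp add: bmap_def ggerm_def t1_def)
  obtain e3 where e3: "link gens (\<lambda>x. x) d3 e3 (\<lambda>x. 0) (t0, x1)" using link_3 by blast
  have b3: "bmap d3 (t0, x1) = (t0, x0)" by (simp add: bmap_def d3_def x1_def)
  note c12 = link_comp[OF A g2[folded b1]]
  have b12: "bmap (germ_comp (ggerm 1 s 0 1 0) e1) p = (t0, x1)" by (simp add: bmap_comp b1 b2)
  note c13 = link_comp[OF c12 e3[folded b12]]
  define d where "d = germ_comp d3 (germ_comp (ggerm 1 s 0 1 0) e1)"
  have "bmap d p = (t0, x0)" by (simp add: d_def bmap_comp b1 b2 b3)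
  moreover have "sc d (fst p) = 1" "sc1 d (fst p) = 0"
    by (simp_all add: d_def germ_comp_def ggerm_def d3_def p e1(2,3))
  moreover have "sh1 d (fst p) = 2 * s"
    by (simp add: d_def germ_comp_def ggerm_def d3_def p e1(2,3,4) tm1 t1_def[symmetric] algebra_simps)
  ultimately show ?thesis using c13[folded d_def] by blast
qed

text \<open>Composition with a projective loop makes \<open>sc1\<close> vanish at one instant; for
  \<open>\<mu> = 0\<close> a boost does the same for \<open>sh1\<close>, for
  \<open>\<mu> \<noteq> 0\<close> this is automatic. By \<open>loop_structure\<close> both then
  vanish nearby, and the composed loop comes from the equivalence group.\<close>

lemma loop_reachable:
  assumes m: "germ_near (\<lambda>x. \<mu> / x\<^sup>2) m (\<lambda>x. \<mu> / x\<^sup>2) (t0, x0)" and x0: "x0 \<in> axis H \<mu>"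
  shows "reachable gens (\<lambda>x. \<mu> / x\<^sup>2) (gmap m) (\<lambda>x. \<mu> / x\<^sup>2) (t0, x0, u)"
proof -
  let ?c = "\<lambda>x. \<mu> / x\<^sup>2"
  have nz: "\<mu> \<noteq> 0 \<Longrightarrow> x \<noteq> 0" if "x \<in> axis H \<mu>" for x using that axis_props(4) by auto
  have both_zero: "reachable gens ?c (gmap m) ?c (t, x, u)"
    if m: "germ_near ?c m ?c (t, x)" and x: "x \<in> axis H \<mu>" and z: "sc1 m t = 0" "sh1 m t = 0" for m t x u
    by (rule trivial_germ_reachable[OF in_gens(6) smooth_near_simple(1)[OF nz[OF x]] m loop_structure(2)[OF m z]])
  have sc1_zero: "reachable gens ?c (gmap m) ?c (t, x, u)"
    if m: "germ_near ?c m ?c (t, x)" and x: "x \<in> axis H \<mu>" and z: "sc1 m t = 0" for m t x u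
  proof (cases "\<mu> = 0")
    case False
    show ?thesis by (rule both_zero[OF m x z loop_structure(1)[OF m False]])
  next
    case True
    have sc: "sc m t \<noteq> 0" using germ_nearD[OF m] by (simp add: germ_at_def)
    \<comment> \<open>Since \<open>sc1 m t = 0\<close>, composing with a boost of velocity
      \<open>v\<close> turns \<open>sh1 m t\<close> into \<open>sh1 m t + sc m t * v\<close>; the
      boost is chosen to make this zero.\<close>
    obtain p d e where L: "link gens (\<lambda>x. 0) d e (\<lambda>x. 0) p" and b: "bmap d p = (t, x)"
      and v: "sc d (fst p) = 1" "sc1 d (fst p) = 0" "sh1 d (fst p) = 2 * (- sh1 m t / (2 * sc m t))"
      using boost_loop by blast
    have tmd: "tm d (fst p) = t" using b by (simp add: bmap_def case_prod_beta)
    have L': "link gens ?c e d ?c (t, x)" using link_sym[OF L] b True by simp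
    have gd: "germ_near ?c d ?c p" using L True by (simp add: link_def)
    have gm: "germ_near ?c (germ_comp m d) ?c p" by (rule germ_near_comp[OF gd]) (use m b in simp)
    have "sc1 (germ_comp m d) (fst p) = 0" "sh1 (germ_comp m d) (fst p) = 0"
      using z v sc by (simp_all add: germ_comp_def tmd)
    then have R: "reachable gens ?c (gmap (germ_comp m d)) ?c (fst p, snd p, u)" for u
      using both_zero[of "germ_comp m d" "fst p" "snd p"] gm True by (simp add: axis_def)
    have bp: "bmap e (t, x) = p" using L b by (simp add: link_def)
    have "reachable gens ?c (gmap m) ?c (ext (t, x) u)"
      by (rule link_cancel_source[OF L']) (use R bp in simp)
    then show ?thesis by simp
  qed
  show ?thesis
  proof (cases "sc1 m t0 = 0")
    case True
    then show ?thesis by (rule sc1_zero[OF m x0])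
  next
    case False
    have sc: "sc m t0 \<noteq> 0" using germ_nearD[OF m] by (simp add: germ_at_def)
    \<comment> \<open>The composition has \<open>sc1\<close> equal to
      \<open>sc1 m * sc d ^ 3 + sc m * sc1 d\<close>, which vanishes for this value of
      \<open>sc1 d / sc d ^ 3\<close>.\<close>
    define \<kappa> where "\<kappa> = - sc1 m t0 / sc m t0"
    have k: "\<kappa> \<noteq> 0" using False sc by (simp add: \<kappa>_def)
    obtain p d e where L: "link gens ?c d e ?c p" and b: "bmap d p = (t0, x0)" and px: "snd p \<in> axis H \<mu>"
      and v: "sc1 d (fst p) / sc d (fst p) ^ 3 = \<kappa>"
      using projective_loop[OF k x0] by blast
    have tmd: "tm d (fst p) = t0" using b by (simp add: bmap_def case_prod_beta)
    have L': "link gens ?c e d ?c (t0, x0)" using link_sym[OF L] b by simp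
    have gd: "germ_near ?c d ?c p" using L by (simp add: link_def)
    have scd: "sc d (fst p) \<noteq> 0" using germ_nearD[OF gd] by (simp add: germ_at_def)
    have gm: "germ_near ?c (germ_comp m d) ?c p" by (rule germ_near_comp[OF gd]) (use m b in simp)
    have "sc1 d (fst p) = \<kappa> * sc d (fst p) ^ 3" using v scd by (simp add: field_simps)
    then have "sc1 (germ_comp m d) (fst p) = 0"
      using sc by (simp add: germ_comp_def tmd \<kappa>_def)
    then have R: "reachable gens ?c (gmap (germ_comp m d)) ?c (fst p, snd p, u)" for u
      using sc1_zero[of "germ_comp m d" "fst p" "snd p"] gm px by simp
    have bp: "bmap e (t0, x0) = p" using L b by (simp add: link_def)
    have "reachable gens ?c (gmap m) ?c (ext (t0, x0) u)"
      by (rule link_cancel_source[OF L']) (use R bp in simp)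
    then show ?thesis by simp
  qed
qed

text \<open>For \<open>\<mu> \<noteq> 0\<close> the quadratic part must be centred at the pole,
  because one translation has to normalise both. For \<open>\<mu> = 0\<close> the number
  \<open>s\<close> is merely a centre of expansion and a linear term is allowed.\<close>

definition special :: "real \<Rightarrow> (real \<Rightarrow> real) \<Rightarrow> real \<Rightarrow> bool" where
  "special \<mu> c x0 \<longleftrightarrow> (\<exists>s p2 p1 p0. (\<forall>\<^sub>F y in nhds x0. c y = \<mu> / (y - s)\<^sup>2 + p2 * (y - s)\<^sup>2 + p1 * (y - s) + p0) \<and>
     (\<mu> \<noteq> 0 \<longrightarrow> x0 \<noteq> s \<and> p1 = 0))"

text \<open>The equivalence group brings the potential to the source of one of the families or
  directly to \<open>\<mu> / x\<^sup>2\<close>, according to whether \<open>p2\<close> is positive,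
  negative, or zero with or without a linear term. A reflection puts the point on the prescribed
  half-line.\<close>

lemma normal_form:
  assumes c: "special \<mu> c x0" "smooth_near c x0"
  shows "\<exists>d e. link gens c d e (\<lambda>x. \<mu> / x\<^sup>2) (t0, x0) \<and> snd (bmap d (t0, x0)) \<in> axis H \<mu>"
proof -
  obtain s p2 p1 p0 where f: "\<forall>\<^sub>F y in nhds x0. c y = \<mu> / (y - s)\<^sup>2 + p2 * (y - s)\<^sup>2 + p1 * (y - s) + p0"
    and mu: "\<mu> \<noteq> 0 \<Longrightarrow> x0 \<noteq> s" "\<mu> \<noteq> 0 \<Longrightarrow> p1 = 0" using c(1) unfolding special_def by blast
  show ?thesis
  proof (cases "p2 = 0")
    case False
    \<comment> \<open>Completing the square. For \<open>\<mu> \<noteq> 0\<close> there is no linear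
      term, so the new centre is still the pole.\<close>
    define r where "r = s - p1 / (2 * p2)"
    \<comment> \<open>Under scaling by \<open>k\<close> the coefficient of \<open>x\<^sup>2\<close>
      is divided by \<open>k ^ 4\<close>: two powers from the argument and two from the factor of
      the potential. The fourth root therefore normalises it to its sign.\<close>
    define k where "k = sqrt (sqrt \<bar>p2\<bar>)"
    have k2: "k\<^sup>2 = sqrt \<bar>p2\<bar>" by (simp add: k_def)
    have "k ^ 4 = (k\<^sup>2)\<^sup>2" by simp
    also have "\<dots> = \<bar>p2\<bar>" unfolding k2 by simp
    finally have k: "k > 0" "k ^ 4 = \<bar>p2\<bar>" using False by (simp_all add: k_def)
    have rs: "\<mu> \<noteq> 0 \<Longrightarrow> r = s" using mu(2) by (simp add: r_def)
    define q where "q = p0 - p1\<^sup>2 / (4 * p2)"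
    have f': "\<forall>\<^sub>F y in nhds x0. c y = \<mu> / (y - r)\<^sup>2 + p2 * (y - r)\<^sup>2 + q"
      using f
    proof (rule eventually_mono)
      fix y assume e: "c y = \<mu> / (y - s)\<^sup>2 + p2 * (y - s)\<^sup>2 + p1 * (y - s) + p0"
      have "\<mu> / (y - s)\<^sup>2 = \<mu> / (y - r)\<^sup>2" using rs by (cases "\<mu> = 0") auto
      moreover have "p2 * (y - s)\<^sup>2 + p1 * (y - s) + p0 = p2 * (y - r)\<^sup>2 + q"
        using False by (simp add: r_def q_def field_simps power2_eq_square)
      ultimately show "c y = \<mu> / (y - r)\<^sup>2 + p2 * (y - r)\<^sup>2 + q" using e by linarith
    qed
    have nz: "\<mu> \<noteq> 0 \<Longrightarrow> k * (x0 - r) \<noteq> 0" using mu(1) rs k(1) by auto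
    have step: "\<exists>e. link gens c (ggerm (\<sigma> * k) c2 (- (\<sigma> * k) * r) 1 (- q)) e (\<lambda>x. \<mu> / x\<^sup>2 + sgn p2 * x\<^sup>2) (t0, x0)
        \<and> bmap (ggerm (\<sigma> * k) c2 (- (\<sigma> * k) * r) 1 (- q)) (t0, x0) = (k\<^sup>2 * t0 + c2, \<sigma> * (k * (x0 - r)))"
      if sg: "\<sigma> = 1 \<or> \<sigma> = - 1" for \<sigma> c2
    proof -
      have s2: "\<sigma>\<^sup>2 = 1" using sg by auto
      have "\<forall>\<^sub>F y in nhds x0. (\<sigma> * k)\<^sup>2 * (\<mu> / (\<sigma> * k * y + - (\<sigma> * k) * r)\<^sup>2 + sgn p2 * (\<sigma> * k * y + - (\<sigma> * k) * r)\<^sup>2) = c y + - q"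
        using f'
      proof (rule eventually_mono)
        fix y assume e: "c y = \<mu> / (y - r)\<^sup>2 + p2 * (y - r)\<^sup>2 + q"
        have 1: "\<sigma> * k * y + - (\<sigma> * k) * r = \<sigma> * k * (y - r)" by (simp add: algebra_simps)
        have 2: "(\<sigma> * k * (y - r))\<^sup>2 = k\<^sup>2 * (y - r)\<^sup>2" "(\<sigma> * k)\<^sup>2 = k\<^sup>2" using s2 by (simp_all add: power_mult_distrib)
        have 3: "k\<^sup>2 * (\<mu> / (k\<^sup>2 * (y - r)\<^sup>2)) = \<mu> / (y - r)\<^sup>2" using k(1) by simp
        have 4: "k\<^sup>2 * (sgn p2 * (k\<^sup>2 * (y - r)\<^sup>2)) = p2 * (y - r)\<^sup>2"
        proof -
          have "k\<^sup>2 * (sgn p2 * (k\<^sup>2 * (y - r)\<^sup>2)) = (sgn p2 * k ^ 4) * (y - r)\<^sup>2" by (simp add: power2_eq_square power4_eq_xxxx)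
          also have "sgn p2 * k ^ 4 = p2" unfolding k(2) by (rule sgn_mult_abs)
          finally show ?thesis .
        qed
        show "(\<sigma> * k)\<^sup>2 * (\<mu> / (\<sigma> * k * y + - (\<sigma> * k) * r)\<^sup>2 + sgn p2 * (\<sigma> * k * y + - (\<sigma> * k) * r)\<^sup>2) = c y + - q"
          unfolding 1 2 distrib_left 3 4 e by simp
      qed
      from link_group[OF in_gens(6) c(2) _ _ this, of 1 c2 t0] k(1) sg
      have "\<exists>e. link gens c (ggerm (\<sigma> * k) c2 (- (\<sigma> * k) * r) 1 (- q)) e (\<lambda>x. \<mu> / x\<^sup>2 + sgn p2 * x\<^sup>2) (t0, x0)" by auto
      moreover have "bmap (ggerm (\<sigma> * k) c2 (- (\<sigma> * k) * r) 1 (- q)) (t0, x0) = (k\<^sup>2 * t0 + c2, \<sigma> * (k * (x0 - r)))"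
        using s2 by (simp add: bmap_def ggerm_def power_mult_distrib algebra_simps)
      ultimately show ?thesis by blast
    qed
    show ?thesis
    proof (cases "p2 > 0")
      case True
      obtain \<sigma> where sg: "\<sigma> = 1 \<or> \<sigma> = - 1" "\<sigma> * (k * (x0 - r)) \<in> D1 \<mu>" using axis_sign(2)[OF nz] by blast
      obtain j where j: "j \<in> J" using J(3) by blast
      \<comment> \<open>The time translation moves \<open>t0\<close> to a point of \<open>J\<close>,
        where \<open>\<Phi>1\<close> is defined.\<close>
      define g where "g = ggerm (\<sigma> * k) (j - k\<^sup>2 * t0) (- (\<sigma> * k) * r) 1 (- q)"
      obtain e where e: "link gens c g e (\<lambda>x. \<mu> / x\<^sup>2 + x\<^sup>2) (t0, x0)" and b: "bmap g (t0, x0) = (j, \<sigma> * (k * (x0 - r)))"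
        using step[OF sg(1), of "j - k\<^sup>2 * t0"] True by (auto simp: g_def)
      obtain e' where e': "link gens (\<lambda>x. \<mu> / x\<^sup>2 + x\<^sup>2) d1 e' (\<lambda>x. \<mu> / x\<^sup>2) (j, \<sigma> * (k * (x0 - r)))"
        using link_1[OF j sg(2)] by blast
      have "snd (bmap (germ_comp d1 g) (t0, x0)) \<in> axis H \<mu>"
        unfolding bmap_comp b using sg(2) j by (simp add: bmap_def d1_def D1_def)
      then show ?thesis using link_comp[OF e e'[folded b]] by blast
    next
      case n: False
      obtain \<sigma> where sg: "\<sigma> = 1 \<or> \<sigma> = - 1" "\<sigma> * (k * (x0 - r)) \<in> axis H \<mu>" using axis_sign(1)[OF nz] by blast
      define g where "g = ggerm (\<sigma> * k) 0 (- (\<sigma> * k) * r) 1 (- q)"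
      have "sgn p2 = - 1" using n False by simp
      then obtain e where e: "link gens c g e (\<lambda>x. \<mu> / x\<^sup>2 - x\<^sup>2) (t0, x0)" and b: "bmap g (t0, x0) = (k\<^sup>2 * t0, \<sigma> * (k * (x0 - r)))"
        using step[OF sg(1), of 0] by (auto simp: g_def)
      obtain e' where e': "link gens (\<lambda>x. \<mu> / x\<^sup>2 - x\<^sup>2) d2 e' (\<lambda>x. \<mu> / x\<^sup>2) (k\<^sup>2 * t0, \<sigma> * (k * (x0 - r)))"
        using link_2[OF sg(2)] by blast
      have "snd (bmap (germ_comp d2 g) (t0, x0)) \<in> axis H \<mu>"
        unfolding bmap_comp b using axis_scale[of "exp (2 * (k\<^sup>2 * t0))" "\<sigma> * (k * (x0 - r))" \<mu>] sg(2) by (simp add: bmap_def d2_def)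
      then show ?thesis using link_comp[OF e e'[folded b]] by blast
    qed
  next
    case p2: True
    show ?thesis
    proof (cases "p1 = 0")
      case True
      have nz: "\<mu> \<noteq> 0 \<Longrightarrow> x0 - s \<noteq> 0" using mu(1) by auto
      obtain \<sigma> where sg: "\<sigma> = 1 \<or> \<sigma> = - 1" "\<sigma> * (x0 - s) \<in> axis H \<mu>" using axis_sign(1)[OF nz] by blast
      have s2: "\<sigma>\<^sup>2 = 1" using sg by auto
      have "\<forall>\<^sub>F y in nhds x0. \<sigma>\<^sup>2 * (\<mu> / (\<sigma> * y + - \<sigma> * s)\<^sup>2) = c y + - p0"
        using f
      proof (rule eventually_mono)
        fix y assume e: "c y = \<mu> / (y - s)\<^sup>2 + p2 * (y - s)\<^sup>2 + p1 * (y - s) + p0"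
        have "\<sigma> * y + - \<sigma> * s = \<sigma> * (y - s)" by (simp add: algebra_simps)
        then have "(\<sigma> * y + - \<sigma> * s)\<^sup>2 = (y - s)\<^sup>2" using s2 by (simp add: power_mult_distrib)
        then show "\<sigma>\<^sup>2 * (\<mu> / (\<sigma> * y + - \<sigma> * s)\<^sup>2) = c y + - p0" using e p2 True s2 by simp
      qed
      from link_group[OF in_gens(6) c(2) _ _ this, of 1 0 t0] sg
      obtain e where e: "link gens c (ggerm \<sigma> 0 (- \<sigma> * s) 1 (- p0)) e (\<lambda>x. \<mu> / x\<^sup>2) (t0, x0)" by auto
      have "snd (bmap (ggerm \<sigma> 0 (- \<sigma> * s) 1 (- p0)) (t0, x0)) = \<sigma> * (x0 - s)"
        by (simp add: bmap_def ggerm_def algebra_simps)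
      then show ?thesis using e sg(2) by metis
    next
      case False
      have mu0: "\<mu> = 0" using mu(2) False by blast
      \<comment> \<open>A linear coefficient scales with the third power, and an odd root exists for
        either sign, so the potential becomes \<open>x\<close> rather than \<open>x\<close> up to
        sign.\<close>
      define k where "k = root 3 p1"
      have k: "k \<noteq> 0" "k ^ 3 = p1" using False by (simp_all add: k_def odd_real_root_pow)
      have "\<forall>\<^sub>F y in nhds x0. k\<^sup>2 * (k * y + - k * s) = c y + - p0"
        using f by (rule eventually_mono) (simp add: mu0 p2 k(2)[symmetric] power2_eq_square power3_eq_cube algebra_simps)
      from link_group[OF in_gens(6) c(2) k(1) _ this, of 1 0 t0]
      obtain e where e: "link gens c (ggerm k 0 (- k * s) 1 (- p0)) e (\<lambda>x. x) (t0, x0)" by auto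
      obtain t x where b: "bmap (ggerm k 0 (- k * s) 1 (- p0)) (t0, x0) = (t, x)" by (cases "bmap (ggerm k 0 (- k * s) 1 (- p0)) (t0, x0)")
      obtain e' where "link gens (\<lambda>x. x) d3 e' (\<lambda>x. 0) (t, x)" using link_3 by blast
      from link_comp[OF e this[folded b]] show ?thesis using mu0 by (auto simp: axis_def)
    qed
  qed
qed

end

section \<open>Potentials that admit a nontrivial transformation\<close>

lemma DERIV_eq_on:
  fixes f g :: "real \<Rightarrow> real"
  assumes "\<And>x. \<bar>x - a\<bar> < e \<Longrightarrow> f x = g x" "\<bar>x - a\<bar> < e"
    and "(f has_real_derivative f') (at x)" "(g has_real_derivative g') (at x)"
  shows "f' = g'"
proof -
  have o: "open {x. \<bar>x - a\<bar> < e}" by (intro open_Collect_less continuous_intros)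
  have "(g has_real_derivative f') (at x)"
    by (rule has_field_derivative_transform_within_open[OF assms(3) o]) (use assms(1,2) in auto)
  then show ?thesis using assms(4) by (rule DERIV_unique)
qed

lemma smooth_on_iterated:
  fixes f :: "real \<Rightarrow> real"
  assumes "smooth_on f S" "open S"
  obtains F where "F 0 = f" "\<And>k x. x \<in> S \<Longrightarrow> (F k has_real_derivative F (Suc k) x) (at x)"
proof -
  define F where "F k = ((\<lambda>f. dd f 1) ^^ k) f" for k
  have "smooth_on (F k) S" for k
    by (induction k) (auto simp: F_def assms intro: smooth_on_dd)
  then have "x \<in> S \<Longrightarrow> (F k has_real_derivative F (Suc k) x) (at x)" for k x
    using smooth_on_has_real_derivative by (fastforce simp: F_def)
  then show thesis using that[of F] by (simp add: F_def)
qed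

text \<open>The centre \<open>a\<close> of the quadratic is independent of the base point
  \<open>x0\<close>, because it will be the pole of the potential.\<close>

lemma quadratic_of_DERIV:
  fixes E0 :: "real \<Rightarrow> real"
  assumes E: "\<And>x. \<bar>x - x0\<bar> < e \<Longrightarrow> (E0 has_real_derivative E1 x) (at x)"
    "\<And>x. \<bar>x - x0\<bar> < e \<Longrightarrow> (E1 has_real_derivative E2 x) (at x)"
    "\<And>x. \<bar>x - x0\<bar> < e \<Longrightarrow> (E2 has_real_derivative 0) (at x)"
  shows "\<exists>p0. \<forall>x. \<bar>x - x0\<bar> < e \<longrightarrow> E0 x = E2 x0 / 2 * (x - a)\<^sup>2 + (E1 x0 - (x0 - a) * E2 x0) * (x - a) + p0"
proof -
  have 2: "E2 x = E2 x0" if "\<bar>x - x0\<bar> < e" for x by (rule DERIV_zero_const[OF E(3) that])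
  have 1: "E1 x = E1 x0 - (x0 - a) * E2 x0 + E2 x0 * (x - a)" if x: "\<bar>x - x0\<bar> < e" for x
  proof -
    have "E1 x - E2 x0 * (x - a) = E1 x0 - E2 x0 * (x0 - a)"
    proof (rule DERIV_zero_const[where f = "\<lambda>x. E1 x - E2 x0 * (x - a)", OF _ x])
      fix y assume y: "\<bar>y - x0\<bar> < e"
      show "((\<lambda>x. E1 x - E2 x0 * (x - a)) has_real_derivative 0) (at y)"
        using E(2)[OF y] 2[OF y] by (auto intro!: derivative_eq_intros)
    qed
    then show ?thesis by (simp add: algebra_simps)
  qed
  define B where "B = E1 x0 - (x0 - a) * E2 x0"
  define P where "P x = E2 x0 / 2 * (x - a)\<^sup>2 + B * (x - a)" for x
  have "E0 x - P x = E0 x0 - P x0" if x: "\<bar>x - x0\<bar> < e" for x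
  proof (rule DERIV_zero_const[where f = "\<lambda>x. E0 x - P x", OF _ x])
    fix y assume y: "\<bar>y - x0\<bar> < e"
    have "(P has_real_derivative E1 y) (at y)" unfolding P_def[abs_def] 1[OF y] B_def[symmetric]
      by (auto intro!: derivative_eq_intros)
    from DERIV_diff[OF E(1)[OF y] this] show "((\<lambda>x. E0 x - P x) has_real_derivative 0) (at y)" by simp
  qed
  note * = this
  have "E0 x = E2 x0 / 2 * (x - a)\<^sup>2 + B * (x - a) + (E0 x0 - P x0)" if "\<bar>x - x0\<bar> < e" for x
    unfolding P_def[of x, symmetric] using *[OF that] by linarith
  then show ?thesis unfolding B_def by blast
qed

lemma DERIV_pole:
  fixes x a b :: real
  assumes "x \<noteq> a"
  shows "((\<lambda>x. b / (x - a) ^ n) has_real_derivative - (real n * b / (x - a) ^ Suc n)) (at x)"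
proof (cases n)
  case (Suc k)
  have "((\<lambda>x. (x - a) ^ n) has_real_derivative real n * (x - a) ^ k) (at x)"
    using DERIV_power[OF DERIV_diff[OF DERIV_ident DERIV_const[where k = a]], where n = n] by (simp add: Suc)
  from DERIV_divide[OF DERIV_const this, of b] assms
  have "((\<lambda>x. b / (x - a) ^ n) has_real_derivative - (b * (real n * (x - a) ^ k)) / ((x - a) ^ n * (x - a) ^ n)) (at x)" by simp
  moreover have "- (b * (real n * r ^ k)) / (r ^ n * r ^ n) = - (real n * b / r ^ Suc n)" if "r \<noteq> 0" for r
    using that by (simp add: Suc)
  ultimately show ?thesis using assms by simp
qed simp

text \<open>Differentiating the master identity three times with respect to \<open>x\<close> and once with respect to \<open>t\<close> gives
  the linear equation \<open>5 sc1 c''' + (sc1 x + sh1) c'''' = 0\<close>, whence \<open>c''' = - 24 \<mu> / (x - a)\<^sup>5\<close> unless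
  \<open>c'''\<close> vanishes.\<close>

lemma classification_source:
  assumes m: "\<And>t x. \<bar>t - t0\<bar> < e \<Longrightarrow> \<bar>x - x0\<bar> < e \<Longrightarrow> germ_at (C 0) m (C' 0) t x"
    and C: "\<And>k x. \<bar>x - x0\<bar> < e \<Longrightarrow> (C k has_real_derivative C (Suc k) x) (at x)"
    and C': "\<And>k t x. \<bar>t - t0\<bar> < e \<Longrightarrow> \<bar>x - x0\<bar> < e \<Longrightarrow>
      (C' k has_real_derivative C' (Suc k) (sc m t * x + sh m t)) (at (sc m t * x + sh m t))"
    and t1: "\<bar>t1 - t0\<bar> < e" "sc1 m t1 \<noteq> 0 \<or> sh1 m t1 \<noteq> 0"
  shows "\<exists>\<mu> a p2 p1 p0 q2 q1 q0. (\<forall>x. \<bar>x - x0\<bar> < e \<longrightarrow>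
      C 0 x = \<mu> / (x - a)\<^sup>2 + p2 * (x - a)\<^sup>2 + p1 * (x - a) + p0 \<and>
      C 0 x = (sc m t0)\<^sup>2 * C' 0 (sc m t0 * x + sh m t0) + q2 * x\<^sup>2 + q1 * x + q0) \<and>
      (\<mu> \<noteq> 0 \<longrightarrow> x0 \<noteq> a \<and> p1 = 0 \<and> q1 = - 2 * a * q2)"
proof -
  have e0: "e > 0" using t1 by linarith
  have gx: "germ_at (C 0) m (C' 0) t x0" if "\<bar>t - t0\<bar> < e" for t using m[OF that] e0 by simp
  have nz: "sc m t \<noteq> 0" and ds: "(sc m has_real_derivative sc1 m t) (at t)" and dh: "(sh m has_real_derivative sh1 m t) (at t)"
    if "\<bar>t - t0\<bar> < e" for t using gx[OF that] by (simp_all add: germ_at_def)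
  define X where "X t x = sc m t * x + sh m t" for t x
  have dXx: "(X t has_real_derivative sc m t) (at x)" for t x
    unfolding X_def by (auto intro!: derivative_eq_intros)
  have dXt: "((\<lambda>t. X t x) has_real_derivative sc1 m t * x + sh1 m t) (at t)" if "\<bar>t - t0\<bar> < e" for t x
    unfolding X_def using ds[OF that] dh[OF that] by (auto intro!: derivative_eq_intros)
  have Cx: "((\<lambda>x. C' k (X t x)) has_real_derivative C' (Suc k) (X t x) * sc m t) (at x)"
    if "\<bar>t - t0\<bar> < e" "\<bar>x - x0\<bar> < e" for k t x
    by (rule DERIV_chain2[OF C'[OF that, folded X_def] dXx])
  have Ct: "((\<lambda>t. C' k (X t x)) has_real_derivative C' (Suc k) (X t x) * (sc1 m t * x + sh1 m t)) (at t)"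
    if "\<bar>t - t0\<bar> < e" "\<bar>x - x0\<bar> < e" for k t x
    by (rule DERIV_chain2[where f = "C' k" and g = "\<lambda>t. X t x", OF C'[OF that, folded X_def] dXt[OF that(1)]])
  define G where "G t = - sc1 m t / (4 * sc m t)" for t
  define K where "K t = - sh1 m t / (2 * sc m t)" for t
  define ident where "ident t q2 q1 q0 \<longleftrightarrow> (\<forall>x. \<bar>x - x0\<bar> < e \<longrightarrow> C 0 x = (sc m t)\<^sup>2 * C' 0 (X t x) + q2 * x\<^sup>2 + q1 * x + q0)"
    for t q2 q1 q0
  have master: "\<exists>g k q0. (G has_real_derivative g) (at t) \<and> (K has_real_derivative k) (at t) \<and>
      ident t (- g - 4 * (G t)\<^sup>2) (- k - 4 * G t * K t) q0" if t: "\<bar>t - t0\<bar> < e" for t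
    unfolding ident_def using master_identity[of t0 e x0 "C 0" m "C' 0" t, OF m t, folded G_def K_def X_def] by blast
  have D1: "C 1 x = (sc m t) ^ 3 * C' 1 (X t x) + 2 * q2 * x + q1"
    and D2: "C 2 x = (sc m t) ^ 4 * C' 2 (X t x) + 2 * q2"
    and D3: "C 3 x = (sc m t) ^ 5 * C' 3 (X t x)" if "ident t q2 q1 q0" "\<bar>t - t0\<bar> < e" "\<bar>x - x0\<bar> < e" for t x q2 q1 q0
  proof -
    note I = that(1)[unfolded ident_def, rule_format] and t = that(2)
    have 1: "C 1 x = (sc m t) ^ 3 * C' 1 (X t x) + 2 * q2 * x + q1" if x: "\<bar>x - x0\<bar> < e" for x
    proof (rule DERIV_eq_on[OF I x])
      show "(C 0 has_real_derivative C 1 x) (at x)" using C[OF x, of 0] by simp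
      show "((\<lambda>x. (sc m t)\<^sup>2 * C' 0 (X t x) + q2 * x\<^sup>2 + q1 * x + q0) has_real_derivative
        (sc m t) ^ 3 * C' 1 (X t x) + 2 * q2 * x + q1) (at x)"
        by (rule derivative_eq_intros Cx[OF t x] refl)+ (simp add: power2_eq_square power3_eq_cube)
    qed simp
    have 2: "C 2 x = (sc m t) ^ 4 * C' 2 (X t x) + 2 * q2" if x: "\<bar>x - x0\<bar> < e" for x
    proof (rule DERIV_eq_on[OF 1 x])
      show "(C 1 has_real_derivative C 2 x) (at x)" using C[OF x, of 1] by (simp add: numeral_2_eq_2)
      show "((\<lambda>x. (sc m t) ^ 3 * C' 1 (X t x) + 2 * q2 * x + q1) has_real_derivative
        (sc m t) ^ 4 * C' 2 (X t x) + 2 * q2) (at x)"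
        by (rule derivative_eq_intros Cx[OF t x] refl)+ (simp add: power3_eq_cube power4_eq_xxxx numeral_2_eq_2)
    qed simp
    have 3: "C 3 x = (sc m t) ^ 5 * C' 3 (X t x)" if x: "\<bar>x - x0\<bar> < e" for x
    proof (rule DERIV_eq_on[OF 2 x])
      show "(C 2 has_real_derivative C 3 x) (at x)" using C[OF x, of 2] by (simp add: eval_nat_numeral)
      show "((\<lambda>x. (sc m t) ^ 4 * C' 2 (X t x) + 2 * q2) has_real_derivative (sc m t) ^ 5 * C' 3 (X t x)) (at x)"
        by (rule derivative_eq_intros Cx[OF t x] refl)+ (simp add: eval_nat_numeral)
    qed simp
    show "C 1 x = (sc m t) ^ 3 * C' 1 (X t x) + 2 * q2 * x + q1" "C 2 x = (sc m t) ^ 4 * C' 2 (X t x) + 2 * q2"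
      "C 3 x = (sc m t) ^ 5 * C' 3 (X t x)" using 1[OF that(3)] 2[OF that(3)] 3[OF that(3)] .
  qed
  have E3: "C 3 x = (sc m t) ^ 5 * C' 3 (X t x)" if tx: "\<bar>t - t0\<bar> < e" "\<bar>x - x0\<bar> < e" for t x
    using master[OF tx(1)] D3[OF _ tx] by blast
  have E4: "C 4 x = (sc m t) ^ 6 * C' 4 (X t x)" if t: "\<bar>t - t0\<bar> < e" and x: "\<bar>x - x0\<bar> < e" for t x
  proof (rule DERIV_eq_on[OF E3[OF t] x])
    show "(C 3 has_real_derivative C 4 x) (at x)" using C[OF x, of 3] by (simp add: eval_nat_numeral)
    show "((\<lambda>x. (sc m t) ^ 5 * C' 3 (X t x)) has_real_derivative (sc m t) ^ 6 * C' 4 (X t x)) (at x)"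
      by (rule derivative_eq_intros Cx[OF t x] refl)+ (simp add: eval_nat_numeral)
  qed simp
  \<comment> \<open>The left side of \<open>E3\<close> does not depend on \<open>t\<close>.
    Differentiate it in \<open>t\<close>, multiply by \<open>sc m t\<close>, and rewrite in terms of
    the source potential by \<open>E3\<close> and \<open>E4\<close>.\<close>
  have key: "5 * sc1 m t * C 3 x + (sc1 m t * x + sh1 m t) * C 4 x = 0" if t: "\<bar>t - t0\<bar> < e" and x: "\<bar>x - x0\<bar> < e" for t x
  proof -
    have "0 = 5 * (sc m t) ^ 4 * sc1 m t * C' 3 (X t x) + (sc m t) ^ 5 * (C' 4 (X t x) * (sc1 m t * x + sh1 m t))"
    proof (rule DERIV_eq_on[where f = "\<lambda>_. C 3 x", OF E3[OF _ x] t])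
      show "((\<lambda>t. (sc m t) ^ 5 * C' 3 (X t x)) has_real_derivative
        5 * (sc m t) ^ 4 * sc1 m t * C' 3 (X t x) + (sc m t) ^ 5 * (C' 4 (X t x) * (sc1 m t * x + sh1 m t))) (at t)"
        by (rule derivative_eq_intros Ct[OF t x] ds[OF t] refl)+ (simp add: eval_nat_numeral algebra_simps)
    qed (simp_all)
    then have "0 = sc m t * (5 * (sc m t) ^ 4 * sc1 m t * C' 3 (X t x) + (sc m t) ^ 5 * (C' 4 (X t x) * (sc1 m t * x + sh1 m t)))" by simp
    also have "\<dots> = 5 * sc1 m t * C 3 x + (sc1 m t * x + sh1 m t) * C 4 x"
      unfolding E3[OF t x] E4[OF t x] by (simp add: eval_nat_numeral algebra_simps)
    finally show ?thesis by simp
  qed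
  have d2: "(C 0 has_real_derivative C 1 x) (at x)" "(C 1 has_real_derivative C 2 x) (at x)" "(C 2 has_real_derivative C 3 x) (at x)"
    "(C 3 has_real_derivative C 4 x) (at x)" if x: "\<bar>x - x0\<bar> < e" for x
    using C[OF x, of 0] C[OF x, of 1] C[OF x, of 2] C[OF x, of 3] by (simp_all add: eval_nat_numeral)
  have t0: "\<bar>t0 - t0\<bar> < e" using e0 by simp
  \<comment> \<open>A vanishing third derivative means a quadratic potential, which is the case
    \<open>\<mu> = 0\<close>; the dummy pole is placed at \<open>x0\<close>.\<close>
  have flat: ?thesis if z: "\<And>x. \<bar>x - x0\<bar> < e \<Longrightarrow> C 3 x = 0"
  proof -
    obtain q2 q1 q0 where q: "ident t0 q2 q1 q0" using master[OF t0] by blast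
    obtain p0 where p0: "\<And>x. \<bar>x - x0\<bar> < e \<Longrightarrow> C 0 x = C 2 x0 / 2 * (x - x0)\<^sup>2 + (C 1 x0 - (x0 - x0) * C 2 x0) * (x - x0) + p0"
      using quadratic_of_DERIV[OF d2(1,2), of x0 e x0] d2(3) z by force
    show ?thesis
      by (rule exI[of _ 0], rule exI[of _ x0], rule exI[of _ "C 2 x0 / 2"], rule exI[of _ "C 1 x0 - (x0 - x0) * C 2 x0"],
        rule exI[of _ p0], rule exI[of _ q2], rule exI[of _ q1], rule exI[of _ q0])
        (use p0 q in \<open>simp add: ident_def X_def\<close>)
  qed
  show ?thesis
  proof (cases "\<exists>t. \<bar>t - t0\<bar> < e \<and> sc1 m t \<noteq> 0")
    case False
    then have s1: "sc1 m t = 0" if "\<bar>t - t0\<bar> < e" for t using that by blast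
    \<comment> \<open>If the scale is constant, \<open>G\<close> vanishes and so does the quadratic
      coefficient of the master identity. Then already the second \<open>x\<close>-derivative can be
      differentiated in \<open>t\<close>.\<close>
    have E2: "C 2 x = (sc m t) ^ 4 * C' 2 (X t x)" if t: "\<bar>t - t0\<bar> < e" and x: "\<bar>x - x0\<bar> < e" for t x
    proof -
      obtain g k q0 where g: "(G has_real_derivative g) (at t)" and i: "ident t (- g - 4 * (G t)\<^sup>2) (- k - 4 * G t * K t) q0"
        using master[OF t] by blast
      have "0 = g" by (rule DERIV_eq_on[where f = "\<lambda>_. 0", OF _ t _ g]) (use s1 in \<open>simp_all add: G_def\<close>)
      moreover have "G t = 0" using s1[OF t] by (simp add: G_def)
      ultimately show ?thesis using D2[OF i t x] by simp
    qed
    have h1: "sh1 m t1 \<noteq> 0" using t1 s1 by blast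
    show ?thesis
    proof (rule flat)
      fix x assume x: "\<bar>x - x0\<bar> < e"
      have "0 = 4 * (sc m t1) ^ 3 * sc1 m t1 * C' 2 (X t1 x) + (sc m t1) ^ 4 * (C' 3 (X t1 x) * (sc1 m t1 * x + sh1 m t1))"
      proof (rule DERIV_eq_on[where f = "\<lambda>_. C 2 x", OF E2[OF _ x] t1(1)])
        show "((\<lambda>t. (sc m t) ^ 4 * C' 2 (X t x)) has_real_derivative
          4 * (sc m t1) ^ 3 * sc1 m t1 * C' 2 (X t1 x) + (sc m t1) ^ 4 * (C' 3 (X t1 x) * (sc1 m t1 * x + sh1 m t1))) (at t1)"
          by (rule derivative_eq_intros Ct[OF t1(1) x] ds[OF t1(1)] refl)+ (simp add: eval_nat_numeral algebra_simps)
      qed simp_all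
      then have "C' 3 (X t1 x) = 0" using s1[OF t1(1)] h1 nz[OF t1(1)] by simp
      then show "C 3 x = 0" using E3[OF t1(1) x] by simp
    qed
  next
    case True
    then obtain t2 where t2: "\<bar>t2 - t0\<bar> < e" "sc1 m t2 \<noteq> 0" by blast
    \<comment> \<open>The fixed point of the infinitesimal motion at time \<open>t2\<close>, the
      only possible pole.\<close>
    define a where "a = - sh1 m t2 / sc1 m t2"
    have ode: "5 * C 3 x + (x - a) * C 4 x = 0" if x: "\<bar>x - x0\<bar> < e" for x
    proof -
      have "sc1 m t2 * x + sh1 m t2 = sc1 m t2 * (x - a)" using t2(2) by (simp add: a_def field_simps)
      then have "sc1 m t2 * (5 * C 3 x + (x - a) * C 4 x) = 0" using key[OF t2(1) x] by algebra
      then show ?thesis using t2(2) by simp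
    qed
    define \<kappa> where "\<kappa> = (x0 - a) ^ 5 * C 3 x0"
    \<comment> \<open>The first integral of \<open>ode\<close>.\<close>
    have kap: "(x - a) ^ 5 * C 3 x = \<kappa>" if x: "\<bar>x - x0\<bar> < e" for x
      unfolding \<kappa>_def
    proof (rule DERIV_zero_const[where f = "\<lambda>x. (x - a) ^ 5 * C 3 x", OF _ x])
      fix y assume y: "\<bar>y - x0\<bar> < e"
      have "((\<lambda>x. (x - a) ^ 5 * C 3 x) has_real_derivative (y - a) ^ 4 * (5 * C 3 y + (y - a) * C 4 y)) (at y)"
        by (rule derivative_eq_intros d2(4)[OF y] refl)+ (simp add: eval_nat_numeral algebra_simps)
      then show "((\<lambda>x. (x - a) ^ 5 * C 3 x) has_real_derivative 0) (at y)" unfolding ode[OF y] by simp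
    qed
    show ?thesis
    proof (cases "\<kappa> = 0")
      case True
      show ?thesis
      proof (rule flat)
        fix x assume x: "\<bar>x - x0\<bar> < e"
        show "C 3 x = 0" using kap[OF x] ode[OF x] True by (cases "x = a") auto
      qed
    next
      case False
      have xa: "x - a \<noteq> 0" if x: "\<bar>x - x0\<bar> < e" for x using kap[OF x] False by auto
      have x0: "\<bar>x0 - x0\<bar> < e" using e0 by simp
      have C3nz: "C 3 x0 \<noteq> 0" using kap[OF x0] False by auto
      \<comment> \<open>As \<open>C 3 x0\<close> is nonzero, comparing \<open>key\<close> at time
        \<open>t\<close> with \<open>ode\<close> at \<open>x0\<close> shows that the infinitesimal
        motions at all times fix the same point \<open>a\<close>.\<close>
      have h1: "sh1 m t = - a * sc1 m t" if t: "\<bar>t - t0\<bar> < e" for t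
      proof -
        have "(x0 - a) * (5 * sc1 m t * C 3 x0 + (sc1 m t * x0 + sh1 m t) * C 4 x0) = 0" using key[OF t x0] by simp
        moreover have "(x0 - a) * C 4 x0 = - 5 * C 3 x0" using ode[OF x0] by simp
        ultimately have "5 * C 3 x0 * (sc1 m t * (x0 - a) - (sc1 m t * x0 + sh1 m t)) = 0" by algebra
        then have "sc1 m t * (x0 - a) - (sc1 m t * x0 + sh1 m t) = 0" using C3nz by simp
        then show ?thesis by (simp add: algebra_simps)
      qed
      \<comment> \<open>From \<open>h1\<close> one gets \<open>K = - 2 * a * G\<close>, so the
        quadratic part of the master identity is a multiple of \<open>(x - a)\<^sup>2\<close> up to
        a constant.\<close>
      have idq: "\<exists>q2 q0. ident t q2 (- 2 * a * q2) q0" if t: "\<bar>t - t0\<bar> < e" for t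
      proof -
        obtain g k q0 where g: "(G has_real_derivative g) (at t)" "(K has_real_derivative k) (at t)"
          and i: "ident t (- g - 4 * (G t)\<^sup>2) (- k - 4 * G t * K t) q0" using master[OF t] by blast
        have KG: "K s = - 2 * a * G s" if "\<bar>s - t0\<bar> < e" for s using nz[OF that] by (simp add: K_def G_def h1[OF that] field_simps)
        have "((\<lambda>s. - 2 * a * G s) has_real_derivative - 2 * a * g) (at t)" by (rule DERIV_cmult[OF g(1)])
        from DERIV_eq_on[OF KG t g(2) this] have "k = - 2 * a * g" by simp
        then have "- k - 4 * G t * K t = - 2 * a * (- g - 4 * (G t)\<^sup>2)" using KG[OF t] by (simp add: power2_eq_square algebra_simps)
        with i have "ident t (- g - 4 * (G t)\<^sup>2) (- 2 * a * (- g - 4 * (G t)\<^sup>2)) q0" by (simp only:)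
        then show ?thesis by (intro exI)
      qed
      \<comment> \<open>The operator \<open>f' - (x - a) f''\<close> annihilates constants and
        multiples of \<open>(x - a)\<^sup>2\<close>; this removes the time-dependent coefficient
        \<open>q2\<close> and leaves an identity whose left side is independent of \<open>t\<close>.
        Its \<open>t\<close>-derivative gives \<open>h3\<close>.\<close>
      have hh: "C 1 x0 - (x0 - a) * C 2 x0 = (sc m t) ^ 3 * C' 1 (X t x0) - (x0 - a) * ((sc m t) ^ 4 * C' 2 (X t x0))"
        if t: "\<bar>t - t0\<bar> < e" for t
      proof -
        obtain q2 q0 where i: "ident t q2 (- 2 * a * q2) q0" using idq[OF t] by blast
        show ?thesis unfolding D1[OF i t x0] D2[OF i t x0] by (simp add: algebra_simps)
      qed
      have h3: "3 * (C 1 x0 - (x0 - a) * C 2 x0) = (x0 - a)\<^sup>2 * C 3 x0"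
      proof -
        let ?s = "sc m t2" and ?s1 = "sc1 m t2" and ?r = "x0 - a" and ?X = "X t2 x0"
        have Xt: "?s1 * x0 + sh1 m t2 = ?s1 * ?r" using h1[OF t2(1)] by (simp add: algebra_simps)
        have "0 = 3 * ?s ^ 2 * ?s1 * C' 1 ?X + ?s ^ 3 * (C' 2 ?X * (?s1 * ?r))
            - ?r * (4 * ?s ^ 3 * ?s1 * C' 2 ?X + ?s ^ 4 * (C' 3 ?X * (?s1 * ?r)))"
        proof (rule DERIV_eq_on[where f = "\<lambda>_. C 1 x0 - (x0 - a) * C 2 x0", OF hh t2(1)])
          show "((\<lambda>t. (sc m t) ^ 3 * C' 1 (X t x0) - (x0 - a) * ((sc m t) ^ 4 * C' 2 (X t x0))) has_real_derivative
            3 * ?s ^ 2 * ?s1 * C' 1 ?X + ?s ^ 3 * (C' 2 ?X * (?s1 * ?r))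
            - ?r * (4 * ?s ^ 3 * ?s1 * C' 2 ?X + ?s ^ 4 * (C' 3 ?X * (?s1 * ?r)))) (at t2)"
            by (rule derivative_eq_intros Ct[OF t2(1) x0, unfolded Xt] ds[OF t2(1)] refl)+ (simp add: eval_nat_numeral algebra_simps)
        qed simp_all
        then have "0 = ?s * (3 * ?s ^ 2 * ?s1 * C' 1 ?X + ?s ^ 3 * (C' 2 ?X * (?s1 * ?r))
            - ?r * (4 * ?s ^ 3 * ?s1 * C' 2 ?X + ?s ^ 4 * (C' 3 ?X * (?s1 * ?r))))" by simp
        also have "\<dots> = ?s1 * (3 * (?s ^ 3 * C' 1 ?X - ?r * (?s ^ 4 * C' 2 ?X)) - ?r\<^sup>2 * (?s ^ 5 * C' 3 ?X))"
          by (simp add: eval_nat_numeral algebra_simps)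
        also have "\<dots> = ?s1 * (3 * (C 1 x0 - ?r * C 2 x0) - ?r\<^sup>2 * C 3 x0)" unfolding hh[OF t2(1)] E3[OF t2(1) x0] ..
        finally show ?thesis using t2(2) by simp
      qed
      \<comment> \<open>The third derivative of \<open>\<mu> / (x - a)\<^sup>2\<close> is
        \<open>- 24 * \<mu> / (x - a) ^ 5\<close>.\<close>
      define \<mu> where "\<mu> = - \<kappa> / 24"
      define E0 where "E0 x = C 0 x - \<mu> / (x - a)\<^sup>2" for x
      define E1 where "E1 x = C 1 x + 2 * \<mu> / (x - a) ^ 3" for x
      define E2 where "E2 x = C 2 x - 6 * \<mu> / (x - a) ^ 4" for x
      have dE: "(E0 has_real_derivative E1 x) (at x)" "(E1 has_real_derivative E2 x) (at x)" "(E2 has_real_derivative 0) (at x)"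
        if x: "\<bar>x - x0\<bar> < e" for x
      proof -
        have xa': "x \<noteq> a" using xa[OF x] by simp
        show "(E0 has_real_derivative E1 x) (at x)" unfolding E0_def[abs_def] E1_def
          using DERIV_diff[OF d2(1)[OF x] DERIV_pole[OF xa', of \<mu> 2]] by (simp add: eval_nat_numeral)
        show "(E1 has_real_derivative E2 x) (at x)" unfolding E1_def[abs_def] E2_def
          using DERIV_add[OF d2(2)[OF x] DERIV_pole[OF xa', of "2 * \<mu>" 3]] by (simp add: eval_nat_numeral)
        have "C 3 x = - 24 * \<mu> / (x - a) ^ 5" using kap[OF x] xa[OF x] by (simp add: \<mu>_def field_simps)
        then have c3: "C 3 x + real 4 * (6 * \<mu>) / (x - a) ^ Suc 4 = 0" by simp
        have "(E2 has_real_derivative C 3 x + real 4 * (6 * \<mu>) / (x - a) ^ Suc 4) (at x)" unfolding E2_def[abs_def]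
          using DERIV_diff[OF d2(3)[OF x] DERIV_pole[OF xa', of "6 * \<mu>" 4]] by simp
        then show "(E2 has_real_derivative 0) (at x)" unfolding c3 .
      qed
      obtain p0 where p0: "\<And>x. \<bar>x - x0\<bar> < e \<Longrightarrow> E0 x = E2 x0 / 2 * (x - a)\<^sup>2 + (E1 x0 - (x0 - a) * E2 x0) * (x - a) + p0"
        using quadratic_of_DERIV[OF dE, of x0 e a] by blast
      \<comment> \<open>The linear coefficient about the pole is the same combination of first and
        second derivatives as in \<open>hh\<close>; \<open>h3\<close> says that it is due to the
        singular term alone.\<close>
      have p1: "E1 x0 - (x0 - a) * E2 x0 = 0"
      proof -
        define r where "r = x0 - a"
        have r: "r \<noteq> 0" using xa[OF x0] by (simp add: r_def)
        have c3: "r\<^sup>2 * C 3 x0 = - 24 * \<mu> / r ^ 3" using kap[OF x0] r by (simp add: \<mu>_def r_def[symmetric] field_simps eval_nat_numeral)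
        have "E1 x0 - r * E2 x0 = (C 1 x0 - r * C 2 x0) + (2 * \<mu> / r ^ 3 + r * (6 * \<mu> / r ^ 4))"
          by (simp add: E1_def E2_def r_def[symmetric] algebra_simps)
        also have "r * (6 * \<mu> / r ^ 4) = 6 * \<mu> / r ^ 3" using r by (simp add: field_simps eval_nat_numeral)
        also have "C 1 x0 - r * C 2 x0 = - 8 * \<mu> / r ^ 3" using h3[folded r_def] c3 by simp
        finally show ?thesis by (simp add: r_def[symmetric] add_divide_distrib[symmetric])
      qed
      obtain q2 q0 where q: "ident t0 q2 (- 2 * a * q2) q0" using idq[OF t0] by blast
      show ?thesis
        by (rule exI[of _ \<mu>], rule exI[of _ a], rule exI[of _ "E2 x0 / 2"], rule exI[of _ 0],
          rule exI[of _ p0], rule exI[of _ q2], rule exI[of _ "- 2 * a * q2"], rule exI[of _ q0])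
          (use p0[unfolded p1] q xa[OF x0] in \<open>simp add: ident_def X_def E0_def algebra_simps\<close>)
    qed
  qed
qed

context families
begin

text \<open>The form of the target potential is obtained by solving the master identity at
  \<open>t0\<close> for it and substituting the affine change of \<open>x\<close>. The scaling
  leaves the coefficient of the inverse square unchanged, so both ends share
  \<open>\<mu>\<close>.\<close>

lemma classification:
  assumes m: "germ_near c m c' (t0, x0)" and c: "smooth_near c x0" and c': "smooth_near c' (snd (bmap m (t0, x0)))"
    and nt: "\<not> (\<forall>\<^sub>F t in nhds t0. sc1 m t = 0 \<and> sh1 m t = 0)"
  shows "\<exists>\<mu>. special \<mu> c x0 \<and> special \<mu> c' (snd (bmap m (t0, x0)))"
proof -
  obtain D where D: "open D" "x0 \<in> D" "smooth_on c D" using c unfolding smooth_near_def by blast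
  obtain D' where D': "open D'" "snd (bmap m (t0, x0)) \<in> D'" "smooth_on c' D'" using c' unfolding smooth_near_def by blast
  obtain C where C: "C 0 = c" "\<And>k x. x \<in> D \<Longrightarrow> (C k has_real_derivative C (Suc k) x) (at x)"
    by (rule smooth_on_iterated[OF D(3,1)]) (rule that)
  obtain C' where C': "C' 0 = c'" "\<And>k x. x \<in> D' \<Longrightarrow> (C' k has_real_derivative C' (Suc k) x) (at x)"
    by (rule smooth_on_iterated[OF D'(3,1)]) (rule that)
  have ev1: "\<forall>\<^sub>F q in nhds (t0, x0). snd q \<in> D"
    by (rule eventually_snd[OF eventually_nhds_in_open[OF D(1,2)]])
  have "\<forall>\<^sub>F q in nhds (bmap m (t0, x0)). snd q \<in> D'"
    using eventually_snd[OF eventually_nhds_in_open[OF D'(1,2)], of "fst (bmap m (t0, x0))"] by simp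
  from eventually_bmap[OF m this] have ev2: "\<forall>\<^sub>F q in nhds (t0, x0). snd (bmap m q) \<in> D'" .
  have "\<forall>\<^sub>F q in nhds (t0, x0). germ_at c m c' (fst q) (snd q) \<and> snd q \<in> D \<and> sc m (fst q) * snd q + sh m (fst q) \<in> D'"
    using m[unfolded germ_near_def] ev1 ev2 by eventually_elim (simp add: bmap_def case_prod_beta)
  then obtain e where e: "e > 0" and box: "\<And>t x. \<bar>t - t0\<bar> < e \<Longrightarrow> \<bar>x - x0\<bar> < e \<Longrightarrow>
      germ_at c m c' t x \<and> x \<in> D \<and> sc m t * x + sh m t \<in> D'"
    by (rule eventually_box) (rule that)
  obtain t1 where t1: "\<bar>t1 - t0\<bar> < e" "sc1 m t1 \<noteq> 0 \<or> sh1 m t1 \<noteq> 0"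
    using nt e unfolding eventually_nhds_metric dist_real_def by blast
  have t0: "\<bar>t0 - t0\<bar> < e" using e by simp
  have "\<exists>\<mu> a p2 p1 p0 q2 q1 q0. (\<forall>x. \<bar>x - x0\<bar> < e \<longrightarrow>
      C 0 x = \<mu> / (x - a)\<^sup>2 + p2 * (x - a)\<^sup>2 + p1 * (x - a) + p0 \<and>
      C 0 x = (sc m t0)\<^sup>2 * C' 0 (sc m t0 * x + sh m t0) + q2 * x\<^sup>2 + q1 * x + q0) \<and>
      (\<mu> \<noteq> 0 \<longrightarrow> x0 \<noteq> a \<and> p1 = 0 \<and> q1 = - 2 * a * q2)"
  proof (rule classification_source[OF _ _ _ t1])
    show "germ_at (C 0) m (C' 0) t x" if "\<bar>t - t0\<bar> < e" "\<bar>x - x0\<bar> < e" for t x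
      using box[OF that] unfolding C(1) C'(1) by simp
    show "(C k has_real_derivative C (Suc k) x) (at x)" if "\<bar>x - x0\<bar> < e" for k x
      using box[OF t0 that] by (intro C(2)) simp
    show "(C' k has_real_derivative C' (Suc k) (sc m t * x + sh m t)) (at (sc m t * x + sh m t))"
      if "\<bar>t - t0\<bar> < e" "\<bar>x - x0\<bar> < e" for k t x
      using box[OF that] by (intro C'(2)) simp
  qed
  then obtain \<mu> a p2 p1 p0 q2 q1 q0 where f: "\<And>x. \<bar>x - x0\<bar> < e \<Longrightarrow> c x = \<mu> / (x - a)\<^sup>2 + p2 * (x - a)\<^sup>2 + p1 * (x - a) + p0"
    and i: "\<And>x. \<bar>x - x0\<bar> < e \<Longrightarrow> c x = (sc m t0)\<^sup>2 * c' (sc m t0 * x + sh m t0) + q2 * x\<^sup>2 + q1 * x + q0"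
    and mu: "\<mu> \<noteq> 0 \<longrightarrow> x0 \<noteq> a \<and> p1 = 0 \<and> q1 = - 2 * a * q2" unfolding C(1) C'(1) by blast
  have "special \<mu> c x0" unfolding special_def
    by (rule exI[of _ a], rule exI[of _ p2], rule exI[of _ p1], rule exI[of _ p0])
      (use f mu e in \<open>auto simp: eventually_nhds_metric dist_real_def\<close>)
  moreover have "special \<mu> c' (snd (bmap m (t0, x0)))"
  proof -
    define s where "s = sc m t0"
    define h where "h = sh m t0"
    have s: "s \<noteq> 0" using germ_nearD[OF m] by (simp add: germ_at_def s_def)
    define y0 where "y0 = s * x0 + h"
    have y0: "snd (bmap m (t0, x0)) = y0" by (simp add: bmap_def y0_def s_def h_def)
    define b where "b = s * a + h"
    define r2 where "r2 = (p2 - q2) / s ^ 4"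
    define r1 where "r1 = (p1 - q1 - 2 * a * q2) / s ^ 3"
    define r0 where "r0 = (p0 - q2 * a\<^sup>2 - q1 * a - q0) / s\<^sup>2"
    define g where "g y = (y - h) / s" for y
    have "isCont g y0" unfolding g_def using s by (intro continuous_intros) auto
    then have "(g \<longlongrightarrow> g y0) (nhds y0)" unfolding isCont_def tendsto_at_iff_tendsto_nhds .
    moreover have "g y0 = x0" using s by (simp add: g_def y0_def)
    ultimately have "(g \<longlongrightarrow> x0) (nhds y0)" by (simp only:)
    from tendstoD[OF this e] have "\<forall>\<^sub>F y in nhds y0. \<bar>(y - h) / s - x0\<bar> < e" by (simp add: dist_real_def g_def)
    then have "\<forall>\<^sub>F y in nhds y0. c' y = \<mu> / (y - b)\<^sup>2 + r2 * (y - b)\<^sup>2 + r1 * (y - b) + r0"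
    proof (rule eventually_mono)
      fix y assume y: "\<bar>(y - h) / s - x0\<bar> < e"
      define x where "x = (y - h) / s"
      have yx: "s * x + h = y" "y - b = s * (x - a)"
      proof -
        show "s * x + h = y" using s by (simp add: x_def)
        then show "y - b = s * (x - a)" by (simp add: b_def right_diff_distrib)
      qed
      have "s\<^sup>2 * c' y = \<mu> / (x - a)\<^sup>2 + p2 * (x - a)\<^sup>2 + p1 * (x - a) + p0 - (q2 * x\<^sup>2 + q1 * x + q0)"
        using f[OF y] i[OF y] unfolding x_def[symmetric] s_def[symmetric] h_def[symmetric] yx(1) by simp
      also have "\<dots> = \<mu> / (x - a)\<^sup>2 + (p2 - q2) * (x - a)\<^sup>2 + (p1 - q1 - 2 * a * q2) * (x - a) + (p0 - q2 * a\<^sup>2 - q1 * a - q0)"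
        by (simp add: algebra_simps power2_eq_square)
      also have "\<dots> = s\<^sup>2 * (\<mu> / (y - b)\<^sup>2 + r2 * (y - b)\<^sup>2 + r1 * (y - b) + r0)"
      proof -
        have "s\<^sup>2 * (\<mu> / (y - b)\<^sup>2) = \<mu> / (x - a)\<^sup>2" "s\<^sup>2 * (r2 * (y - b)\<^sup>2) = (p2 - q2) * (x - a)\<^sup>2"
          "s\<^sup>2 * (r1 * (y - b)) = (p1 - q1 - 2 * a * q2) * (x - a)" "s\<^sup>2 * r0 = p0 - q2 * a\<^sup>2 - q1 * a - q0"
          using s unfolding yx(2) r2_def r1_def r0_def by (simp_all add: power_mult_distrib eval_nat_numeral)
        then show ?thesis by (simp only: distrib_left)
      qed
      finally show "c' y = \<mu> / (y - b)\<^sup>2 + r2 * (y - b)\<^sup>2 + r1 * (y - b) + r0" using s by simp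
    qed
    moreover have "\<mu> \<noteq> 0 \<longrightarrow> y0 \<noteq> b \<and> r1 = 0" using mu s by (auto simp: y0_def b_def r1_def)
    ultimately show ?thesis unfolding y0 special_def by blast
  qed
  ultimately show ?thesis by blast
qed

text \<open>Both ends are carried to \<open>\<mu> / x\<^sup>2\<close> with the same
  \<open>\<mu>\<close>, so the conjugated germ is a loop there.\<close>

lemma germ_reachable:
  assumes m: "germ_near c m c' (t0, x0)" and c: "smooth_near c x0" and c': "smooth_near c' (snd (bmap m (t0, x0)))"
  shows "reachable gens c (gmap m) c' (t0, x0, u)"
proof (cases "\<forall>\<^sub>F t in nhds t0. sc1 m t = 0 \<and> sh1 m t = 0")
  case True
  show ?thesis by (rule trivial_germ_reachable[OF in_gens(6) c m True])
next
  case False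
  obtain \<mu> where mu: "special \<mu> c x0" "special \<mu> c' (snd (bmap m (t0, x0)))"
    using classification[OF m c c' False] by blast
  obtain d e where L: "link gens c d e (\<lambda>x. \<mu> / x\<^sup>2) (t0, x0)" "snd (bmap d (t0, x0)) \<in> axis H \<mu>"
    using normal_form[OF mu(1) c] by blast
  obtain t2 x2 where b: "bmap m (t0, x0) = (t2, x2)" by (cases "bmap m (t0, x0)")
  have x2: "snd (bmap m (t0, x0)) = x2" by (simp add: b)
  obtain d' e' where L': "link gens c' d' e' (\<lambda>x. \<mu> / x\<^sup>2) (t2, x2)"
    using normal_form[OF mu(2) c', unfolded x2] by blast
  obtain t1 x1 where b1: "bmap d (t0, x0) = (t1, x1)" by (cases "bmap d (t0, x0)")
  have be: "bmap e (t1, x1) = (t0, x0)" using L(1) unfolding link_def b1 by blast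
  have ge: "germ_near (\<lambda>x. \<mu> / x\<^sup>2) e c (t1, x1)" using L(1) unfolding link_def b1 by blast
  have gd': "germ_near c' d' (\<lambda>x. \<mu> / x\<^sup>2) (t2, x2)" using L' unfolding link_def by blast
  have g1: "germ_near c (germ_comp d' m) (\<lambda>x. \<mu> / x\<^sup>2) (t0, x0)"
    by (rule germ_near_comp[OF m gd'[folded b]])
  have g2: "germ_near (\<lambda>x. \<mu> / x\<^sup>2) (germ_comp (germ_comp d' m) e) (\<lambda>x. \<mu> / x\<^sup>2) (t1, x1)"
    by (rule germ_near_comp[OF ge]) (simp only: be g1)
  have x1: "x1 \<in> axis H \<mu>" using L(2) by (simp add: b1)
  have "reachable gens c (gmap (germ_comp d' m)) (\<lambda>x. \<mu> / x\<^sup>2) (ext (t0, x0) u)" for u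
  proof (rule link_cancel_source[OF L(1)])
    show "reachable gens (\<lambda>x. \<mu> / x\<^sup>2) (gmap (germ_comp (germ_comp d' m) e)) (\<lambda>x. \<mu> / x\<^sup>2) (ext (bmap d (t0, x0)) u)" for u
      unfolding b1 fst_conv snd_conv by (rule loop_reachable[OF g2 x1])
  qed
  from link_cancel_target[OF m L'[folded b] this] show ?thesis by simp
qed

text \<open>Near a point, \<open>local_form\<close> factors the transformation into a superposition
  followed by a linear germ, and both factors are reachable.\<close>

lemma families_generating: "generating (\<B> J H)"
proof (rule generating_if_reachable[OF families_admissible])
  fix C \<Phi> C' p assume T: "(C, \<Phi>, C') \<in> admissible" and p: "p \<in> dom \<Phi>"
  interpret admissible_transformation C \<Phi> C' by unfold_locales (rule T)
  obtain t0 x0 u0 where pp: "p = (t0, x0, u0)" by (cases p)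
  note P0 = p[unfolded pp]
  obtain d f W e where W: "open W" "(t0, x0) \<in> W" "e > 0"
    "\<And>t x. (t, x) \<in> W \<Longrightarrow> germ_at (\<lambda>x. the (C x)) d (\<lambda>x. the (C' x)) t x"
    "solution_on C W f"
    "\<And>t x u. (t, x) \<in> W \<Longrightarrow> \<bar>u - u0\<bar> < e \<Longrightarrow> \<Phi> (t, x, u) = Some (gmap d (t, x, u + f (t, x)))"
    by (rule local_form[OF P0]) (rule that)
  have pC: "potential C" "potential C'" using potentials by blast+
  have x0: "x0 \<in> dom C" by (rule source_dom[OF P0])
  have q: "\<Phi> (t0, x0, u0) = Some (gmap d (t0, x0, u0 + f (t0, x0)))" by (rule W(6)) (use W in simp_all)
  have y0: "snd (bmap d (t0, x0)) \<in> dom C'"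
  proof -
    have "gmap d (t0, x0, u0 + f (t0, x0)) \<in> ran \<Phi>" using q by (rule ranI)
    then show ?thesis using T by (auto simp: admissible_def gmap_def bmap_def)
  qed
  have sm: "smooth_near (\<lambda>x. the (K x)) x" if "potential K" "x \<in> dom K" for K x
    using that unfolding potential_def smooth_near_def by blast
  have m: "germ_near (\<lambda>x. the (C x)) d (\<lambda>x. the (C' x)) (t0, x0)"
    unfolding germ_near_def
    by (rule eventually_mono[OF eventually_nhds_in_open[OF W(1,2)]]) (use W(4) in \<open>metis prod.collapse\<close>)
  have L: "reachable gens (\<lambda>x. the (C x)) (\<lambda>(t, x, u). (t, x, u + f (t, x))) (\<lambda>x. the (C x)) (t0, x0, u0)"
    by (rule reachable_lin[OF in_gens(6) pC(1) W(1,2,5)])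
  have "reachable gens (\<lambda>x. the (C x)) (\<lambda>z. gmap d ((\<lambda>(t, x, u). (t, x, u + f (t, x))) z)) (\<lambda>x. the (C' x)) (t0, x0, u0)"
    by (rule reachable_comp[OF L]) (simp add: germ_reachable[OF m sm[OF pC(1) x0] sm[OF pC(2) y0]])
  moreover have "\<forall>\<^sub>F z in nhds (t0, x0, u0). gmap d ((\<lambda>(t, x, u). (t, x, u + f (t, x))) z) = the (\<Phi> z)"
  proof -
    have "open (W \<times> ball u0 e)" by (intro open_Times W(1) open_ball)
    then have "open ((\<lambda>z::pt. ((fst z, fst (snd z)), snd (snd z))) -` (W \<times> ball u0 e))"
      by (intro open_vimage continuous_intros)
    moreover have "(t0, x0, u0) \<in> (\<lambda>z::pt. ((fst z, fst (snd z)), snd (snd z))) -` (W \<times> ball u0 e)" using W by simp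
    ultimately have "\<forall>\<^sub>F z in nhds (t0, x0, u0). z \<in> (\<lambda>z::pt. ((fst z, fst (snd z)), snd (snd z))) -` (W \<times> ball u0 e)"
      by (rule eventually_nhds_in_open)
    then show ?thesis
    proof (rule eventually_mono)
      fix z :: pt assume z: "z \<in> (\<lambda>z::pt. ((fst z, fst (snd z)), snd (snd z))) -` (W \<times> ball u0 e)"
      obtain t x u where zz: "z = (t, x, u)" by (cases z)
      have "(t, x) \<in> W" "\<bar>u - u0\<bar> < e" using z by (simp_all add: zz dist_real_def abs_minus_commute)
      from W(6)[OF this] show "gmap d ((\<lambda>(t, x, u). (t, x, u + f (t, x))) z) = the (\<Phi> z)" by (simp add: zz)
    qed
  qed
  ultimately show "reachable (\<B> J H \<union> inverse_of ` \<B> J H \<union> \<U>) (\<lambda>x. the (C x)) (\<lambda>p. the (\<Phi> p)) (\<lambda>x. the (C' x)) p"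
    unfolding pp gens_def[symmetric] by (rule reachable_cong) simp_all
qed

end

subsection \<open>Types of potentials\<close>

text \<open>The type \<open>(\<mu>, sgn k, k = 0 \<and> l \<noteq> 0)\<close> of the germ \<open>\<mu> / (x - a)\<^sup>2 + k x\<^sup>2 + l x + d\<close> is invariant under \<open>\<U>\<close> and
  separates the sources and targets of the families.\<close>

definition has_type :: "real \<times> real \<times> bool \<Rightarrow> potential \<Rightarrow> real \<Rightarrow> bool" where
  "has_type \<kappa> C x \<longleftrightarrow> (\<exists>\<mu> a k l d. \<kappa> = (\<mu>, sgn k, k = 0 \<and> l \<noteq> 0) \<and>
     (\<forall>\<^sub>F y in nhds x. the (C y) = \<mu> / (y - a)\<^sup>2 + k * y\<^sup>2 + l * y + d))"

lemma has_type_unique: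
  assumes "has_type \<kappa> C x" "has_type \<kappa>' C x"
  shows "\<kappa> = \<kappa>'"
proof -
  obtain \<mu> a k l d where 1: "\<kappa> = (\<mu>, sgn k, k = 0 \<and> l \<noteq> 0)"
    "\<forall>\<^sub>F y in nhds x. the (C y) = \<mu> / (y - a)\<^sup>2 + k * y\<^sup>2 + l * y + d" using assms(1) unfolding has_type_def by blast
  obtain \<mu>' a' k' l' d' where 2: "\<kappa>' = (\<mu>', sgn k', k' = 0 \<and> l' \<noteq> 0)"
    "\<forall>\<^sub>F y in nhds x. the (C y) = \<mu>' / (y - a')\<^sup>2 + k' * y\<^sup>2 + l' * y + d'" using assms(2) unfolding has_type_def by blast
  have "\<forall>\<^sub>F y in nhds x. \<mu> / (y - a)\<^sup>2 + k * y\<^sup>2 + l * y + d = \<mu>' / (y - a')\<^sup>2 + k' * y\<^sup>2 + l' * y + d'"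
    using 1(2) 2(2) by eventually_elim simp
  from form_unique[OF this] show ?thesis unfolding 1(1) 2(1) by simp
qed

lemma has_type_cong:
  assumes "has_type \<kappa> C x" "\<forall>\<^sub>F y in nhds x. the (C y) = the (C' y)"
  shows "has_type \<kappa> C' x"
proof -
  obtain \<mu> a k l d where 1: "\<kappa> = (\<mu>, sgn k, k = 0 \<and> l \<noteq> 0)"
    "\<forall>\<^sub>F y in nhds x. the (C y) = \<mu> / (y - a)\<^sup>2 + k * y\<^sup>2 + l * y + d" using assms(1) unfolding has_type_def by blast
  have "\<forall>\<^sub>F y in nhds x. the (C' y) = \<mu> / (y - a)\<^sup>2 + k * y\<^sup>2 + l * y + d"
    using 1(2) assms(2) by eventually_elim simp
  with 1(1) show ?thesis unfolding has_type_def by blast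
qed

lemma potential_le_eventually:
  assumes "potential C0" "C0 \<subseteq>\<^sub>m C" "x \<in> dom C0"
  shows "\<forall>\<^sub>F y in nhds x. the (C0 y) = the (C y)"
proof (rule eventually_mono[OF eventually_nhds_in_open[OF potential_open[OF assms(1)] assms(3)]])
  fix y assume "y \<in> dom C0"
  then show "the (C0 y) = the (C y)" using assms(2) by (simp add: map_le_def)
qed

lemma has_type_restrict:
  assumes "potential C0" "C0 \<subseteq>\<^sub>m C" "x \<in> dom C0"
  shows "has_type \<kappa> C0 x \<longleftrightarrow> has_type \<kappa> C x"
proof
  note e = potential_le_eventually[OF assms]
  then show "has_type \<kappa> C0 x \<Longrightarrow> has_type \<kappa> C x" by (rule has_type_cong[rotated])
  have "\<forall>\<^sub>F y in nhds x. the (C y) = the (C0 y)" using e by eventually_elim simp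
  then show "has_type \<kappa> C x \<Longrightarrow> has_type \<kappa> C0 x" by (rule has_type_cong[rotated])
qed

text \<open>Substituting \<open>(z - c3) / c1\<close> keeps \<open>\<mu>\<close>, divides
  \<open>k\<close> by the positive number \<open>c1 ^ 4\<close>, and for \<open>k = 0\<close>
  divides \<open>l\<close> by \<open>c1 ^ 3\<close>; \<open>c5\<close> affects only the constant
  term.\<close>

lemma has_type_group:
  assumes C: "potential C" "x \<in> dom C" and c1: "c1 \<noteq> 0" and h: "has_type \<kappa> C x"
  shows "has_type \<kappa> (group_potential c1 c3 c5 C) (c1 * x + c3)"
proof -
  obtain \<mu> a k l d where 1: "\<kappa> = (\<mu>, sgn k, k = 0 \<and> l \<noteq> 0)"
    "\<forall>\<^sub>F y in nhds x. the (C y) = \<mu> / (y - a)\<^sup>2 + k * y\<^sup>2 + l * y + d" using h unfolding has_type_def by blast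
  define k' where "k' = k / c1 ^ 4"
  define l' where "l' = l / c1 ^ 3 - 2 * k * c3 / c1 ^ 4"
  define d' where "d' = k * c3\<^sup>2 / c1 ^ 4 - l * c3 / c1 ^ 3 + (d + c5) / c1\<^sup>2"
  define a' where "a' = c1 * a + c3"
  define g where "g z = (z - c3) / c1" for z
  have "isCont g (c1 * x + c3)" unfolding g_def using c1 by (intro continuous_intros) auto
  then have "(g \<longlongrightarrow> g (c1 * x + c3)) (nhds (c1 * x + c3))" unfolding isCont_def tendsto_at_iff_tendsto_nhds .
  moreover have "g (c1 * x + c3) = x" using c1 by (simp add: g_def)
  ultimately have lim: "(g \<longlongrightarrow> x) (nhds (c1 * x + c3))" by (simp only:)
  have "\<forall>\<^sub>F y in nhds x. y \<in> dom C" by (rule eventually_nhds_in_open[OF potential_open[OF C(1)] C(2)])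
  with 1(2) have "\<forall>\<^sub>F y in nhds x. y \<in> dom C \<and> the (C y) = \<mu> / (y - a)\<^sup>2 + k * y\<^sup>2 + l * y + d"
    by eventually_elim simp
  with lim have "\<forall>\<^sub>F z in nhds (c1 * x + c3). g z \<in> dom C \<and> the (C (g z)) = \<mu> / (g z - a)\<^sup>2 + k * (g z)\<^sup>2 + l * g z + d"
    unfolding filterlim_iff by blast
  then have "\<forall>\<^sub>F z in nhds (c1 * x + c3). the (group_potential c1 c3 c5 C z) = \<mu> / (z - a')\<^sup>2 + k' * z\<^sup>2 + l' * z + d'"
  proof (rule eventually_mono)
    fix z assume z: "g z \<in> dom C \<and> the (C (g z)) = \<mu> / (g z - a)\<^sup>2 + k * (g z)\<^sup>2 + l * g z + d"
    define y where "y = g z"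
    have zy: "c1 * y + c3 = z" using c1 by (simp add: y_def g_def)
    have "z - a' = c1 * (y - a)" unfolding zy[symmetric] a'_def by (simp add: algebra_simps)
    then have e1: "c1\<^sup>2 * (\<mu> / (z - a')\<^sup>2) = \<mu> / (y - a)\<^sup>2" using c1 by (simp add: power_mult_distrib)
    have e2: "c1\<^sup>2 * (k' * z\<^sup>2 + l' * z + d') = k * y\<^sup>2 + l * y + d + c5"
      unfolding zy[symmetric] k'_def l'_def d'_def using c1 by (simp add: field_simps eval_nat_numeral)
    have "c1\<^sup>2 * the (group_potential c1 c3 c5 C z) = the (C y) + c5"
      using group_potential_props(3)[OF C(1) c1, of y c3 c5] z unfolding zy by (simp add: y_def)
    also have "\<dots> = c1\<^sup>2 * (\<mu> / (z - a')\<^sup>2) + c1\<^sup>2 * (k' * z\<^sup>2 + l' * z + d')" unfolding e1 e2 using z by (simp add: y_def)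
    finally have "c1\<^sup>2 * the (group_potential c1 c3 c5 C z) = c1\<^sup>2 * (\<mu> / (z - a')\<^sup>2 + k' * z\<^sup>2 + l' * z + d')"
      by (simp only: distrib_left add.assoc)
    then show "the (group_potential c1 c3 c5 C z) = \<mu> / (z - a')\<^sup>2 + k' * z\<^sup>2 + l' * z + d'" using c1 by simp
  qed
  moreover have "sgn k' = sgn k"
  proof -
    have "c1 ^ 4 > 0" using c1 by simp
    then show ?thesis by (simp only: k'_def sgn_divide sgn_pos div_by_1)
  qed
  moreover have "k' = 0 \<and> l' \<noteq> 0 \<longleftrightarrow> k = 0 \<and> l \<noteq> 0" using c1 by (auto simp: k'_def l'_def)
  ultimately show ?thesis unfolding has_type_def 1(1)
    by (intro exI[of _ \<mu>] exI[of _ a'] exI[of _ k'] exI[of _ l'] exI[of _ d']) simp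
qed

lemma has_type_action_lin:
  assumes "T \<in> action_groupoid \<union> lin_groupoid" "trans_part T p = Some q" "has_type \<kappa> (source T) (xpart p)"
  shows "has_type \<kappa> (target T) (xpart q)"
proof -
  obtain t x u where p: "p = (t, x, u)" by (cases p)
  from assms(1) show ?thesis
  proof
    assume "T \<in> action_groupoid"
    then obtain C c1 c2 c3 c4 c5 where C: "potential C" "c1 * c4 \<noteq> 0" and
      T: "T = (C, (\<lambda>(t, x, u). if x \<in> dom C then Some (group_trans c1 c2 c3 c4 c5 (t, x, u)) else None), group_potential c1 c3 c5 C)"
      unfolding action_groupoid_def by auto
    have x: "x \<in> dom C" and q: "q = group_trans c1 c2 c3 c4 c5 (t, x, u)"
      using assms(2) by (simp_all add: T p trans_part_def split: if_splits)
    have "has_type \<kappa> C x" using assms(3) by (simp add: T p source_def)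
    from has_type_group[OF C(1) x _ this, of c1 c3 c5] C(2)
    show ?thesis by (simp add: T q target_def group_trans_def)
  next
    assume "T \<in> lin_groupoid"
    then obtain C W f where T: "T = (C, (\<lambda>(t, x, u). if (t, x) \<in> W then Some (t, x, u + f (t, x)) else None), C)"
      unfolding lin_groupoid_def by auto
    have "xpart q = x" using assms(2) by (auto simp: T p trans_part_def split: if_splits)
    then show ?thesis using assms(3) by (simp add: T p source_def target_def)
  qed
qed

lemma has_type_U:
  assumes "T \<in> \<U>" "trans_part T p = Some q" "has_type \<kappa> (source T) (xpart p)"
  shows "has_type \<kappa> (target T) (xpart q)"
proof -
  have "T \<in> compositions (action_groupoid \<union> lin_groupoid)" using assms(1) by (simp add: \<U>_def)
  then show ?thesis using assms(2,3)
  proof (induction arbitrary: p rule: compositions.induct)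
    case (single T)
    then show ?case using has_type_action_lin by blast
  next
    case (step T T')
    from step.prems(1) obtain r where r: "trans_part T p = Some r" "trans_part T' r = Some q"
      unfolding compose_apply by blast
    have "has_type \<kappa> (source T) (xpart p)" using step.prems(2) by (simp add: compose_def source_def)
    from has_type_action_lin[OF step.hyps(1) r(1) this]
    have "has_type \<kappa> (source T') (xpart r)" using step.hyps(3) by (simp add: composable_def)
    from step.IH[OF r(2) this] show ?case by (simp add: compose_def target_def)
  qed
qed

lemma admissible_point:
  assumes "T \<in> admissible"
  obtains p q where "trans_part T p = Some q"
  using assms by (auto simp: admissible_def point_transformation_def trans_part_def dom_def)

lemma restrictionsD:
  assumes "T0 \<in> restrictions S"
  obtains T where "T0 \<in> admissible" "T \<in> S" "source T0 \<subseteq>\<^sub>m source T" "trans_part T0 \<subseteq>\<^sub>m trans_part T" "target T0 \<subseteq>\<^sub>m target T"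
  using assms unfolding restrictions_def restriction_of_def by blast

section \<open>Self-consistency and minimality of the families\<close>

context families
begin

text \<open>The second component is the sign in front of \<open>x\<^sup>2\<close>, and the third
  marks the linear potential. No two members of the families share a label.\<close>

definition source_type :: "triple \<Rightarrow> real \<times> real \<times> bool \<Rightarrow> bool" where
  "source_type T \<kappa> \<longleftrightarrow> (\<exists>\<mu>. T = T1 J H \<mu> \<and> \<kappa> = (\<mu>, 1, False) \<or> T = T2 H \<mu> \<and> \<kappa> = (\<mu>, - 1, False)) \<or>
     T = T3 \<and> \<kappa> = (0, 0, True)"

lemma source_type_inj: "source_type T \<kappa> \<Longrightarrow> source_type T' \<kappa> \<Longrightarrow> T = T'"
  unfolding source_type_def by auto

lemma source_type_neq: "source_type T \<kappa> \<Longrightarrow> \<kappa> \<noteq> (\<mu>, 0, False)"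
  unfolding source_type_def by auto

lemma source_type_ex: "T \<in> \<B> J H \<Longrightarrow> \<exists>\<kappa>. source_type T \<kappa>"
  unfolding source_type_def \<B>_def by blast

lemma target_family: "T \<in> \<B> J H \<Longrightarrow> \<exists>\<mu>. target T = potential_on (axis H \<mu>) (\<lambda>x. \<mu> / x\<^sup>2)"
proof -
  have "target T3 = potential_on (axis H 0) (\<lambda>x. 0 / x\<^sup>2)" by (simp add: T3_def target_def axis_def)
  moreover have "target (T1 J H \<mu>) = potential_on (axis H \<mu>) (\<lambda>x. \<mu> / x\<^sup>2)" for \<mu> by (simp add: T1_def target_def Let_def)
  moreover have "target (T2 H \<mu>) = potential_on (axis H \<mu>) (\<lambda>x. \<mu> / x\<^sup>2)" for \<mu> by (simp add: T2_def target_def)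
  moreover assume "T \<in> \<B> J H"
  ultimately show ?thesis unfolding \<B>_def by blast
qed

lemma has_type_potential_on:
  assumes "open D" "x \<in> D" "\<And>y. y \<in> D \<Longrightarrow> c y = \<mu> / y\<^sup>2 + k * y\<^sup>2 + l * y"
  shows "has_type (\<mu>, sgn k, k = 0 \<and> l \<noteq> 0) (potential_on D c) x"
proof -
  have "\<forall>\<^sub>F y in nhds x. the (potential_on D c y) = \<mu> / (y - 0)\<^sup>2 + k * y\<^sup>2 + l * y + 0"
    by (rule eventually_mono[OF eventually_nhds_in_open[OF assms(1,2)]]) (simp add: potential_on_def assms(3))
  then show ?thesis unfolding has_type_def by blast
qed

lemma has_type_source:
  assumes "source_type T \<kappa>" "x \<in> dom (source T)"
  shows "has_type \<kappa> (source T) x"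
  using assms(1) unfolding source_type_def
proof (elim disjE exE conjE)
  fix \<mu> assume T: "T = T1 J H \<mu>" and k: "\<kappa> = (\<mu>, 1, False)"
  have "x \<in> D1 \<mu>" using assms(2) by (simp add: T triples source_def dom_potential_on)
  from has_type_potential_on[OF D1_props(1) this, of "\<lambda>x. \<mu> / x\<^sup>2 + x\<^sup>2" \<mu> 1 0]
  show ?thesis by (simp add: T k triples source_def)
next
  fix \<mu> assume T: "T = T2 H \<mu>" and k: "\<kappa> = (\<mu>, - 1, False)"
  have "x \<in> axis H \<mu>" using assms(2) by (simp add: T triples source_def dom_potential_on)
  from has_type_potential_on[OF axis_props(1) this, of "\<lambda>x. \<mu> / x\<^sup>2 - x\<^sup>2" \<mu> "- 1" 0]
  show ?thesis by (simp add: T k triples source_def)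
next
  assume T: "T = T3" and k: "\<kappa> = (0, 0, True)"
  from has_type_potential_on[OF open_UNIV UNIV_I, of "\<lambda>x. x" 0 0 1 x]
  show ?thesis by (simp add: T k triples source_def)
qed

lemma has_type_target:
  assumes "x \<in> axis H \<mu>"
  shows "has_type (\<mu>, 0, False) (potential_on (axis H \<mu>) (\<lambda>x. \<mu> / x\<^sup>2)) x"
  using has_type_potential_on[OF axis_props(1) assms, of "\<lambda>x. \<mu> / x\<^sup>2" \<mu> 0 0] by simp

text \<open>Labels every potential at which a member of the families or its inverse can begin or
  end.\<close>

definition end_type :: "potential \<Rightarrow> real \<times> real \<times> bool \<Rightarrow> bool" where
  "end_type C \<kappa> \<longleftrightarrow> (\<exists>T. source_type T \<kappa> \<and> source T = C) \<or>
     (\<exists>\<mu>. \<kappa> = (\<mu>, 0, False) \<and> C = potential_on (axis H \<mu>) (\<lambda>x. \<mu> / x\<^sup>2))"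

text \<open>The label determines the potential together with its domain; this is what upgrades a
  coincidence of types to composability in the literal sense.\<close>

lemma end_type_inj: "end_type C \<kappa> \<Longrightarrow> end_type C' \<kappa> \<Longrightarrow> C = C'"
  unfolding end_type_def using source_type_inj source_type_neq by blast

lemma end_type_ex:
  assumes "T \<in> \<B> J H \<union> inverse_of ` \<B> J H"
  shows "\<exists>\<kappa>. end_type (source T) \<kappa>" "\<exists>\<kappa>. end_type (target T) \<kappa>"
proof -
  have *: "\<exists>\<kappa>. end_type (source T) \<kappa>" "\<exists>\<kappa>. end_type (target T) \<kappa>" if "T \<in> \<B> J H" for T
    using source_type_ex[OF that] target_family[OF that] unfolding end_type_def by blast+
  from assms have "(\<exists>\<kappa>. end_type (source T) \<kappa>) \<and> (\<exists>\<kappa>. end_type (target T) \<kappa>)"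
  proof
    assume "T \<in> inverse_of ` \<B> J H"
    then obtain R where R: "R \<in> \<B> J H" "T = inverse_of R" by blast
    then have "source T = target R" "target T = source R" by (simp_all add: inverse_of_def source_def target_def)
    then show ?thesis using *[OF R(1)] by (simp only: simp_thms)
  qed (intro conjI *)
  then show "\<exists>\<kappa>. end_type (source T) \<kappa>" "\<exists>\<kappa>. end_type (target T) \<kappa>" by blast+
qed

lemma has_type_end:
  assumes "end_type C \<kappa>" "x \<in> dom C"
  shows "has_type \<kappa> C x"
  using assms(1) unfolding end_type_def
proof (elim disjE exE conjE)
  fix T assume "source_type T \<kappa>" "source T = C"
  then show ?thesis using has_type_source assms(2) by blast
next
  fix \<mu> assume *: "\<kappa> = (\<mu>, 0, False)" "C = potential_on (axis H \<mu>) (\<lambda>x. \<mu> / x\<^sup>2)"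
  then have "x \<in> axis H \<mu>" using assms(2) by (simp add: dom_potential_on)
  from has_type_target[OF this] show ?thesis unfolding * .
qed

text \<open>The left factor from \<open>\<U>\<close> does not affect the target. The right factor
  carries the type of \<open>target T\<close> to a point of \<open>source T'\<close>, and uniqueness
  of types identifies the two labels.\<close>

lemma families_self_consistent: "self_consistent (\<B> J H)"
  unfolding self_consistent_def
proof (intro ballI impI)
  fix T T' assume T: "T \<in> \<B> J H \<union> inverse_of ` \<B> J H" and T': "T' \<in> \<B> J H \<union> inverse_of ` \<B> J H"
    and "composable_up_to_U T T'"
  then obtain T0 T0' T1 where T0: "T0 \<in> restrictions {T}" and T0': "T0' \<in> restrictions {T'}"
    and U: "U_equivalent T0 T1" and c: "composable T1 T0'" unfolding composable_up_to_U_def by blast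
  from U obtain A B where adm: "T0 \<in> admissible" "T1 \<in> admissible" and B: "B \<in> \<U>" "composable T0 B" "T1 = A \<star> T0 \<star> B"
    unfolding U_equivalent_def by blast
  obtain p s where ps: "trans_part T1 p = Some s" by (rule admissible_point[OF adm(2)])
  from ps[unfolded B(3) compose_apply] obtain q r where q: "trans_part T0 q = Some r" "trans_part B r = Some s" by blast
  obtain \<kappa> where k: "end_type (target T) \<kappa>" using end_type_ex[OF T] by blast
  obtain \<kappa>' where k': "end_type (source T') \<kappa>'" using end_type_ex[OF T'] by blast
  have le: "target T0 \<subseteq>\<^sub>m target T" by (rule restrictionsD[OF T0]) simp
  have le': "source T0' \<subseteq>\<^sub>m source T'" and adm': "T0' \<in> admissible" by (rule restrictionsD[OF T0'], simp)+
  have r: "xpart r \<in> dom (target T0)" "potential (target T0)" using admissible_points[OF adm(1) q(1)] by blast+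
  then have "xpart r \<in> dom (target T)" using map_le_implies_dom_le[OF le] by blast
  from has_type_end[OF k this] have "has_type \<kappa> (source B) (xpart r)"
    using has_type_restrict[OF r(2) le r(1)] B(2) by (simp add: composable_def)
  from has_type_U[OF B(1) q(2) this] have "has_type \<kappa> (source T0') (xpart s)"
    using c by (simp add: composable_def B(3) compose_def target_def)
  moreover have s: "xpart s \<in> dom (source T0')" "potential (source T0')"
    using admissible_points[OF adm(2) ps] c by (simp_all add: composable_def)
  ultimately have "has_type \<kappa> (source T') (xpart s)" using has_type_restrict[OF s(2) le' s(1)] by blast
  moreover have "has_type \<kappa>' (source T') (xpart s)"
    by (rule has_type_end[OF k']) (use s(1) map_le_implies_dom_le[OF le'] in blast)
  ultimately have "\<kappa> = \<kappa>'" by (rule has_type_unique)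
  then show "composable T T'" using end_type_inj[OF k] k' unfolding composable_def by blast
qed

text \<open>A step starting at the type of \<open>source T\<close> and not belonging to \<open>\<U>\<close> must be \<open>T\<close> itself.\<close>

lemma has_type_generated:
  assumes B': "B' \<subseteq> \<B> J H" "T \<notin> B'" and k: "source_type T \<kappa>"
    and T0: "T0 \<in> compositions (restrictions (B' \<union> inverse_of ` B' \<union> \<U>))" "trans_part T0 p = Some q"
    and h: "has_type \<kappa> (source T0) (xpart p)"
  shows "has_type \<kappa> (target T0) (xpart q)"
proof -
  have one: "has_type \<kappa> (target T0) (xpart q)"
    if R: "T0 \<in> restrictions (B' \<union> inverse_of ` B' \<union> \<U>)" and q: "trans_part T0 p = Some q" and h: "has_type \<kappa> (source T0) (xpart p)"
    for T0 p q
  proof -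
    obtain S where S: "T0 \<in> admissible" "S \<in> B' \<union> inverse_of ` B' \<union> \<U>" "source T0 \<subseteq>\<^sub>m source S"
      "trans_part T0 \<subseteq>\<^sub>m trans_part S" "target T0 \<subseteq>\<^sub>m target S" by (rule restrictionsD[OF R]) (rule that)
    note a = admissible_points[OF S(1) q]
    have hS: "has_type \<kappa> (source S) (xpart p)" using h has_type_restrict[OF a(1) S(3) a(3)] by blast
    have dS: "xpart p \<in> dom (source S)" using map_le_implies_dom_le[OF S(3)] a(3) by blast
    from S(2) consider "S \<in> B'" | R where "R \<in> B'" "S = inverse_of R" | "S \<in> \<U>" by blast
    then show ?thesis
    proof cases
      case 1
      then obtain \<kappa>' where k': "source_type S \<kappa>'" using source_type_ex B'(1) by blast
      have "\<kappa> = \<kappa>'" by (rule has_type_unique[OF hS has_type_source[OF k' dS]])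
      then have "S = T" using source_type_inj k k' by blast
      then show ?thesis using 1 B'(2) by blast
    next
      case 2
      \<comment> \<open>An inverse starts at a potential \<open>\<mu> / x\<^sup>2\<close>, whose
        type is not the source type of any member of the families.\<close>
      then obtain \<mu> where "target R = potential_on (axis H \<mu>) (\<lambda>x. \<mu> / x\<^sup>2)" using target_family B'(1) by blast
      then have s: "source S = potential_on (axis H \<mu>) (\<lambda>x. \<mu> / x\<^sup>2)" by (simp add: 2 inverse_of_def source_def)
      have "xpart p \<in> axis H \<mu>" using dS by (simp add: s dom_potential_on)
      from has_type_unique[OF hS[unfolded s] has_type_target[OF this]] source_type_neq[OF k] show ?thesis by blast
    next
      case 3
      have "trans_part S p = Some q" by (rule map_leD[OF S(4) q])
      from has_type_U[OF 3 this hS] show ?thesis using has_type_restrict[OF a(2) S(5) a(4)] by blast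
    qed
  qed
  show ?thesis using T0 h
  proof (induction arbitrary: p rule: compositions.induct)
    case (single T)
    then show ?case using one by blast
  next
    case (step T T')
    from step.prems(1) obtain r where r: "trans_part T p = Some r" "trans_part T' r = Some q"
      unfolding compose_apply by blast
    have "has_type \<kappa> (source T) (xpart p)" using step.prems(2) by (simp add: compose_def source_def)
    from one[OF step.hyps(1) r(1) this]
    have "has_type \<kappa> (source T') (xpart r)" using step.hyps(3) by (simp add: composable_def)
    from step.IH[OF r(2) this] show ?case by (simp add: compose_def target_def)
  qed
qed

text \<open>A decomposition of a restriction of an omitted \<open>T\<close> would preserve the type
  of its source, but the target of \<open>T\<close> has the different type
  \<open>(\<mu>, 0, False)\<close>.\<close>

lemma families_minimal:
  assumes "B' \<subset> \<B> J H"
  shows "\<not> generating B'"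
proof
  assume g: "generating B'"
  obtain T where T: "T \<in> \<B> J H" "T \<notin> B'" using assms by blast
  have adm: "T \<in> admissible" using T(1) families_admissible by blast
  obtain \<kappa> where k: "source_type T \<kappa>" using source_type_ex[OF T(1)] by blast
  obtain p q where pq: "trans_part T p = Some q" by (rule admissible_point[OF adm])
  obtain T0 where T0: "T0 \<in> compositions (restrictions (B' \<union> inverse_of ` B' \<union> \<U>))" "T0 \<sqsubseteq>\<^sub>r T" "p \<in> dom (trans_part T0)"
    using g adm domI[of "trans_part T", OF pq] unfolding generating_def by blast
  have le: "source T0 \<subseteq>\<^sub>m source T" "trans_part T0 \<subseteq>\<^sub>m trans_part T" "target T0 \<subseteq>\<^sub>m target T"
    using T0(2) unfolding restriction_of_def by blast+
  obtain q' where q: "trans_part T0 p = Some q'" using T0(3) by blast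
  note a = compositions_points[OF T0(1) q]
  have p: "xpart p \<in> dom (source T)" and q': "xpart q' \<in> dom (target T)"
    using a map_le_implies_dom_le[OF le(1)] map_le_implies_dom_le[OF le(3)] by blast+
  have "has_type \<kappa> (source T0) (xpart p)"
    using has_type_source[OF k p] has_type_restrict[OF _ le(1)] a by blast
  from has_type_generated[OF psubset_imp_subset[OF assms] T(2) k T0(1) q this]
  have "has_type \<kappa> (target T) (xpart q')" using has_type_restrict[OF _ le(3)] a by blast
  moreover obtain \<mu> where m: "target T = potential_on (axis H \<mu>) (\<lambda>x. \<mu> / x\<^sup>2)" using target_family[OF T(1)] by blast
  moreover have "has_type (\<mu>, 0, False) (target T) (xpart q')"
    unfolding m by (rule has_type_target) (use q' in \<open>simp add: m dom_potential_on\<close>)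
  ultimately have "\<kappa> = (\<mu>, 0, False)" using has_type_unique by blast
  then show False using source_type_neq[OF k] by blast
qed

end

theorem theorem18:
  fixes J H :: "real set"
  assumes J: "open J" "is_interval J" "J \<noteq> {}" "\<forall>t\<in>J. cos (2 * t) \<noteq> 0"
    and H: "H = {0<..} \<or> H = {..<0}"
  shows "minimal_generating (\<B> J H) \<and> self_consistent (\<B> J H)"
proof -
  interpret families J H by unfold_locales (fact J H)+
  show ?thesis
    unfolding minimal_generating_def using families_generating families_minimal families_self_consistent by blast
qed

end
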